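(* Let $G$ be a finite group and let $\mathcal{O}$ be a $G$-transfer system. There is an equivalence of categories $$\mathcal{O}\text{-}\mathrm{Mackey}^G_{\mathbb{Q}}\cong\prod_{[H]^{\mathcal{O}}}[H]^{\mathcal{O}}\text{-}\mathrm{Mackey}^G_{\mathbb{Q}},$$ where the product runs over the inseparability classes $[H]^{\mathcal{O}}$ for $\mathcal{O}$, each represented by an $H$ with $H\to G$ in $\mathcal{O}$.
   Context: A $G$-transfer system $\mathcal{O}$ is a partial order on the set $\mathrm{Sub}(G)$ of subgroups of $G$, written $K\to H$, which refines inclusion and satisfies: $K\to H$ implies $gKg^{-1}\to gHg^{-1}$ for all $g\in G$; and $K\to H$, $L\subseteq H$ imply $K\cap L\to L$. $\mathrm{Sub}^{\mathcal{O}}(G)$ is the set of subgroups $H$ with $H\to G$ in $\mathcal{O}$. For every subgroup $J$ there is a unique smallest element $H_{\mathcal{O}}(J)$ of $\mathrm{Sub}^{\mathcal{O}}(G)$ containing $J$. Subgroups $J,K$ are inseparable if $H_{\mathcal{O}}(J)$ and $H_{\mathcal{O}}(K)$ are conjugate in $G$; $[H]^{\mathcal{O}}$ is the inseparability (equivalence) class of $H$. Each class contains exactly one conjugacy class of subgroups lying in $\mathrm{Sub}^{\mathcal{O}}(G)$, and representatives $H$ are always chosen with $H\to G$ in $\mathcal{O}$. $\mathrm{Fin}^G_{\mathcal{O}}$ is the wide subcategory of finite $G$-sets consisting of equivariant maps $f\colon S\to T$ with $\mathrm{Stab}(s)\to\mathrm{Stab}(f(s))$ in $\mathcal{O}$ for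 all $s$. The Lindner category $\mathcal{A}^{\mathcal{O}}$ has objects the finite $G$-sets and morphisms from $S$ to $T$ the isomorphism classes of spans $S\leftarrow U\xrightarrow{h}T$ with $h\in\mathrm{Fin}^G_{\mathcal{O}}$, composed by pullback; disjoint union is the biproduct. $\mathcal{O}\text{-}\mathrm{Mackey}^G_{\mathbb{Q}}$ is the category of product preserving functors from $\mathcal{A}^{\mathcal{O}}$ to $\mathbb{Q}$-vector spaces. $\mathcal{A}^{\mathcal{O}}_{(H)}$ is the full subcategory of $\mathcal{A}^{\mathcal{O}}$ spanned by the finite $G$-sets all of whose stabilizers are subconjugate to $H$. $[H]^{\mathcal{O}}\text{-}\mathrm{Mackey}^G_{\mathbb{Q}}$ is the full subcategory of the category of product preserving functors $\underline{M}$ from $\mathcal{A}^{\mathcal{O}}_{(H)}$ to $\mathbb{Q}$-vector spaces spanned by those with $\underline{M}(G/K)=0$ whenever $K$ is subconjugate to $H$ and $K\notin[H]^{\mathcal{O}}$. *)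

theory Defs
  imports Complex_Main "HOL-Algebra.Group_Action" "HOL-Algebra.Left_Coset" "HOL-Algebra.Module"
begin

section \<open>Categories\<close>

text \<open>
  Categories are given by a set of objects and hom-sets.  Hom-sets for different pairs of objects
  need not be disjoint, so composition and functors take the objects concerned as arguments:
  \<open>Comp C X Y Z g f\<close> is the composite of \<open>f\<close> from \<open>X\<close> to \<open>Y\<close> and \<open>g\<close> from \<open>Y\<close> to \<open>Z\<close>.
  The fields are meaningful only on \<open>Obj C\<close> and the respective hom-sets.
\<close>

record ('o, 'm) cat =
  Obj :: "'o set"
  Hom :: "'o \<Rightarrow> 'o \<Rightarrow> 'm set"
  Ident :: "'o \<Rightarrow> 'm"
  Comp :: "'o \<Rightarrow> 'o \<Rightarrow> 'o \<Rightarrow> 'm \<Rightarrow> 'm \<Rightarrow> 'm"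

locale category =
  fixes C :: "('o, 'm) cat"
  assumes Ident_in_Hom: "X \<in> Obj C \<Longrightarrow> Ident C X \<in> Hom C X X"
    and Comp_in_Hom: "\<lbrakk>X \<in> Obj C; Y \<in> Obj C; Z \<in> Obj C; f \<in> Hom C X Y; g \<in> Hom C Y Z\<rbrakk>
      \<Longrightarrow> Comp C X Y Z g f \<in> Hom C X Z"
    and Comp_Ident_left: "\<lbrakk>X \<in> Obj C; Y \<in> Obj C; f \<in> Hom C X Y\<rbrakk>
      \<Longrightarrow> Comp C X Y Y (Ident C Y) f = f"
    and Comp_Ident_right: "\<lbrakk>X \<in> Obj C; Y \<in> Obj C; f \<in> Hom C X Y\<rbrakk>
      \<Longrightarrow> Comp C X X Y f (Ident C X) = f"
    and Comp_assoc: "\<lbrakk>W \<in> Obj C; X \<in> Obj C; Y \<in> Obj C; Z \<in> Obj C;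
        f \<in> Hom C W X; g \<in> Hom C X Y; h \<in> Hom C Y Z\<rbrakk>
      \<Longrightarrow> Comp C W Y Z h (Comp C W X Y g f) = Comp C W X Z (Comp C X Y Z h g) f"

definition full_subcategory :: "('o, 'm) cat \<Rightarrow> ('o \<Rightarrow> bool) \<Rightarrow> ('o, 'm) cat" where
  "full_subcategory C P = C\<lparr>Obj := {X \<in> Obj C. P X}\<rparr>"

definition product_category :: "'i set \<Rightarrow> ('i \<Rightarrow> ('o, 'm) cat) \<Rightarrow> ('i \<Rightarrow> 'o, 'i \<Rightarrow> 'm) cat" where
  "product_category I C =
    \<lparr>Obj = (\<Pi>\<^sub>E i\<in>I. Obj (C i)),
     Hom = (\<lambda>X Y. \<Pi>\<^sub>E i\<in>I. Hom (C i) (X i) (Y i)),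
     Ident = (\<lambda>X. \<lambda>i\<in>I. Ident (C i) (X i)),
     Comp = (\<lambda>X Y Z g f. \<lambda>i\<in>I. Comp (C i) (X i) (Y i) (Z i) (g i) (f i))\<rparr>"

definition iso_in :: "('o, 'm) cat \<Rightarrow> 'o \<Rightarrow> 'o \<Rightarrow> 'm \<Rightarrow> bool" where
  "iso_in C X Y f \<longleftrightarrow> f \<in> Hom C X Y \<and>
    (\<exists>g \<in> Hom C Y X. Comp C X Y X g f = Ident C X \<and> Comp C Y X Y f g = Ident C Y)"

record ('o1, 'm1, 'o2, 'm2) cfunctor =
  FObj :: "'o1 \<Rightarrow> 'o2"
  FMap :: "'o1 \<Rightarrow> 'o1 \<Rightarrow> 'm1 \<Rightarrow> 'm2"

definition is_functor ::
  "('o1, 'm1) cat \<Rightarrow> ('o2, 'm2) cat \<Rightarrow> ('o1, 'm1, 'o2, 'm2) cfunctor \<Rightarrow> bool" where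
  "is_functor C D F \<longleftrightarrow>
    (\<forall>X \<in> Obj C. FObj F X \<in> Obj D) \<and>
    (\<forall>X \<in> Obj C. \<forall>Y \<in> Obj C. \<forall>f \<in> Hom C X Y. FMap F X Y f \<in> Hom D (FObj F X) (FObj F Y)) \<and>
    (\<forall>X \<in> Obj C. FMap F X X (Ident C X) = Ident D (FObj F X)) \<and>
    (\<forall>X \<in> Obj C. \<forall>Y \<in> Obj C. \<forall>Z \<in> Obj C. \<forall>f \<in> Hom C X Y. \<forall>g \<in> Hom C Y Z.
      FMap F X Z (Comp C X Y Z g f) =
        Comp D (FObj F X) (FObj F Y) (FObj F Z) (FMap F Y Z g) (FMap F X Y f))"

definition extensional_functor ::
  "('o1, 'm1) cat \<Rightarrow> ('o1, 'm1, 'o2, 'm2) cfunctor \<Rightarrow> bool" where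
  "extensional_functor C F \<longleftrightarrow>
    (\<forall>X. X \<notin> Obj C \<longrightarrow> FObj F X = undefined) \<and>
    (\<forall>X Y f. \<not> (X \<in> Obj C \<and> Y \<in> Obj C \<and> f \<in> Hom C X Y) \<longrightarrow> FMap F X Y f = undefined)"

definition id_functor :: "('o, 'm, 'o, 'm) cfunctor" where
  "id_functor = \<lparr>FObj = (\<lambda>X. X), FMap = (\<lambda>X Y f. f)\<rparr>"

definition comp_functor ::
  "('o2, 'm2, 'o3, 'm3) cfunctor \<Rightarrow> ('o1, 'm1, 'o2, 'm2) cfunctor \<Rightarrow> ('o1, 'm1, 'o3, 'm3) cfunctor"
  where
  "comp_functor K F =
    \<lparr>FObj = (\<lambda>X. FObj K (FObj F X)),
     FMap = (\<lambda>X Y f. FMap K (FObj F X) (FObj F Y) (FMap F X Y f))\<rparr>"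

definition nat_trans ::
  "('o1, 'm1) cat \<Rightarrow> ('o2, 'm2) cat \<Rightarrow> ('o1, 'm1, 'o2, 'm2) cfunctor \<Rightarrow>
    ('o1, 'm1, 'o2, 'm2) cfunctor \<Rightarrow> ('o1 \<Rightarrow> 'm2) \<Rightarrow> bool" where
  "nat_trans C D F K \<alpha> \<longleftrightarrow>
    (\<forall>X \<in> Obj C. \<alpha> X \<in> Hom D (FObj F X) (FObj K X)) \<and>
    (\<forall>X \<in> Obj C. \<forall>Y \<in> Obj C. \<forall>f \<in> Hom C X Y.
      Comp D (FObj F X) (FObj F Y) (FObj K Y) (\<alpha> Y) (FMap F X Y f) =
      Comp D (FObj F X) (FObj K X) (FObj K Y) (FMap K X Y f) (\<alpha> X))"

definition naturally_isomorphic ::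
  "('o1, 'm1) cat \<Rightarrow> ('o2, 'm2) cat \<Rightarrow> ('o1, 'm1, 'o2, 'm2) cfunctor \<Rightarrow>
    ('o1, 'm1, 'o2, 'm2) cfunctor \<Rightarrow> bool" where
  "naturally_isomorphic C D F K \<longleftrightarrow>
    (\<exists>\<alpha>. nat_trans C D F K \<alpha> \<and> (\<forall>X \<in> Obj C. iso_in D (FObj F X) (FObj K X) (\<alpha> X)))"

definition equivalent_categories :: "('o1, 'm1) cat \<Rightarrow> ('o2, 'm2) cat \<Rightarrow> bool" where
  "equivalent_categories C D \<longleftrightarrow> category C \<and> category D \<and>
    (\<exists>F K. is_functor C D F \<and> is_functor D C K \<and>
      naturally_isomorphic C C (comp_functor K F) id_functor \<and>
      naturally_isomorphic D D (comp_functor F K) id_functor)"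

text \<open>
  Functors and natural transformations are required to be undefined off their domain here, so that
  HOL equality of objects and morphisms is equality of functors and of natural transformations.
\<close>

definition functor_category ::
  "('o1, 'm1) cat \<Rightarrow> ('o2, 'm2) cat \<Rightarrow> (('o1, 'm1, 'o2, 'm2) cfunctor, 'o1 \<Rightarrow> 'm2) cat" where
  "functor_category C D =
    \<lparr>Obj = {F. is_functor C D F \<and> extensional_functor C F},
     Hom = (\<lambda>F K. {\<alpha> \<in> extensional (Obj C). nat_trans C D F K \<alpha>}),
     Ident = (\<lambda>F. \<lambda>X\<in>Obj C. Ident D (FObj F X)),
     Comp = (\<lambda>F K L \<beta> \<alpha>. \<lambda>X\<in>Obj C. Comp D (FObj F X) (FObj K X) (FObj L X) (\<beta> X) (\<alpha> X))\<rparr>"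

definition is_terminal :: "('o, 'm) cat \<Rightarrow> 'o \<Rightarrow> bool" where
  "is_terminal C P \<longleftrightarrow> P \<in> Obj C \<and> (\<forall>X \<in> Obj C. \<exists>!f. f \<in> Hom C X P)"

definition is_binary_product ::
  "('o, 'm) cat \<Rightarrow> 'o \<Rightarrow> 'o \<Rightarrow> 'o \<Rightarrow> 'm \<Rightarrow> 'm \<Rightarrow> bool" where
  "is_binary_product C X Y P p q \<longleftrightarrow>
    X \<in> Obj C \<and> Y \<in> Obj C \<and> P \<in> Obj C \<and> p \<in> Hom C P X \<and> q \<in> Hom C P Y \<and>
    (\<forall>Z \<in> Obj C. \<forall>f \<in> Hom C Z X. \<forall>g \<in> Hom C Z Y.
      \<exists>!u. u \<in> Hom C Z P \<and> Comp C Z P X p u = f \<and> Comp C Z P Y q u = g)"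

definition product_preserving ::
  "('o1, 'm1) cat \<Rightarrow> ('o2, 'm2) cat \<Rightarrow> ('o1, 'm1, 'o2, 'm2) cfunctor \<Rightarrow> bool" where
  "product_preserving C D F \<longleftrightarrow>
    (\<forall>P. is_terminal C P \<longrightarrow> is_terminal D (FObj F P)) \<and>
    (\<forall>X Y P p q. is_binary_product C X Y P p q \<longrightarrow>
      is_binary_product D (FObj F X) (FObj F Y) (FObj F P) (FMap F P X p) (FMap F P Y q))"


section \<open>Rational vector spaces\<close>

definition rat_field :: "rat ring" where
  "rat_field = \<lparr>carrier = UNIV, mult = (*), one = 1, zero = 0, add = (+)\<rparr>"

definition linear_maps :: "(rat, 'v) module \<Rightarrow> (rat, 'v) module \<Rightarrow> ('v \<Rightarrow> 'v) set" where
  "linear_maps V W = {f \<in> carrier V \<rightarrow>\<^sub>E carrier W.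
    (\<forall>x \<in> carrier V. \<forall>y \<in> carrier V. f (x \<oplus>\<^bsub>V\<^esub> y) = f x \<oplus>\<^bsub>W\<^esub> f y) \<and>
    (\<forall>c. \<forall>x \<in> carrier V. f (c \<odot>\<^bsub>V\<^esub> x) = c \<odot>\<^bsub>W\<^esub> f x)}"

text \<open>
  The type \<open>'v\<close> is the universe: the objects are all rational vector spaces whose underlying set is
  a set of elements of \<open>'v\<close>.
\<close>

definition rat_vect :: "((rat, 'v) module, 'v \<Rightarrow> 'v) cat" where
  "rat_vect =
    \<lparr>Obj = {V. module rat_field V},
     Hom = linear_maps,
     Ident = (\<lambda>V. \<lambda>x\<in>carrier V. x),
     Comp = (\<lambda>U V W g f. compose (carrier U) g f)\<rparr>"


section \<open>Transfer systems and inseparability\<close>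

definition conjugate_set :: "('a, 'b) monoid_scheme \<Rightarrow> 'a \<Rightarrow> 'a set \<Rightarrow> 'a set" where
  "conjugate_set G g H = g <#\<^bsub>G\<^esub> H #>\<^bsub>G\<^esub> (inv\<^bsub>G\<^esub> g)"

definition transfer_system :: "('a, 'b) monoid_scheme \<Rightarrow> ('a set \<times> 'a set) set \<Rightarrow> bool" where
  "transfer_system G \<O> \<longleftrightarrow>
    partial_order_on {H. subgroup H G} \<O> \<and>
    (\<forall>(K, H) \<in> \<O>. K \<subseteq> H) \<and>
    (\<forall>(K, H) \<in> \<O>. \<forall>g \<in> carrier G. (conjugate_set G g K, conjugate_set G g H) \<in> \<O>) \<and>
    (\<forall>(K, H) \<in> \<O>. \<forall>L. subgroup L G \<and> L \<subseteq> H \<longrightarrow> (K \<inter> L, L) \<in> \<O>)"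

definition Sub_O :: "('a, 'b) monoid_scheme \<Rightarrow> ('a set \<times> 'a set) set \<Rightarrow> 'a set set" where
  "Sub_O G \<O> = {H. subgroup H G \<and> (H, carrier G) \<in> \<O>}"

definition H_O :: "('a, 'b) monoid_scheme \<Rightarrow> ('a set \<times> 'a set) set \<Rightarrow> 'a set \<Rightarrow> 'a set" where
  "H_O G \<O> J = (THE H. H \<in> Sub_O G \<O> \<and> J \<subseteq> H \<and> (\<forall>K \<in> Sub_O G \<O>. J \<subseteq> K \<longrightarrow> H \<subseteq> K))"

definition inseparable :: "('a, 'b) monoid_scheme \<Rightarrow> ('a set \<times> 'a set) set \<Rightarrow> ('a set \<times> 'a set) set"
  where
  "inseparable G \<O> = {(J, K). subgroup J G \<and> subgroup K G \<and>
    (\<exists>g \<in> carrier G. conjugate_set G g (H_O G \<O> J) = H_O G \<O> K)}"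

definition insep_class :: "('a, 'b) monoid_scheme \<Rightarrow> ('a set \<times> 'a set) set \<Rightarrow> 'a set \<Rightarrow> 'a set set"
  where "insep_class G \<O> H = inseparable G \<O> `` {H}"

definition insep_classes :: "('a, 'b) monoid_scheme \<Rightarrow> ('a set \<times> 'a set) set \<Rightarrow> 'a set set set"
  where "insep_classes G \<O> = {H. subgroup H G} // inseparable G \<O>"

definition subconjugate :: "('a, 'b) monoid_scheme \<Rightarrow> 'a set \<Rightarrow> 'a set \<Rightarrow> bool" where
  "subconjugate G K H \<longleftrightarrow> (\<exists>g \<in> carrier G. conjugate_set G g K \<subseteq> H)"


section \<open>Finite \<open>G\<close>-sets and spans\<close>

record ('a, 's) gset =
  pts :: "'s set"
  act :: "'a \<Rightarrow> 's \<Rightarrow> 's"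

definition finite_gset :: "('a, 'b) monoid_scheme \<Rightarrow> ('a, 's) gset \<Rightarrow> bool" where
  "finite_gset G X \<longleftrightarrow> group_action G (pts X) (act X) \<and> finite (pts X)"

definition coset_gset :: "('a, 'b) monoid_scheme \<Rightarrow> 'a set \<Rightarrow> ('a, 'a set) gset" where
  "coset_gset G H =
    \<lparr>pts = lcosets\<^bsub>G\<^esub> H, act = (\<lambda>g. \<lambda>C \<in> lcosets\<^bsub>G\<^esub> H. g <#\<^bsub>G\<^esub> C)\<rparr>"

definition gmaps :: "('a, 'b) monoid_scheme \<Rightarrow> ('a, 's) gset \<Rightarrow> ('a, 't) gset \<Rightarrow> ('s \<Rightarrow> 't) set" where
  "gmaps G X Y = {f \<in> pts X \<rightarrow>\<^sub>E pts Y.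
    \<forall>g \<in> carrier G. \<forall>x \<in> pts X. f (act X g x) = act Y g (f x)}"

definition gset_iso :: "('a, 'b) monoid_scheme \<Rightarrow> ('a, 's) gset \<Rightarrow> ('a, 't) gset \<Rightarrow> bool" where
  "gset_iso G X Y \<longleftrightarrow> (\<exists>f \<in> gmaps G X Y. bij_betw f (pts X) (pts Y))"

text \<open>The morphisms of $\mathrm{Fin}^G_{\mathcal O}$.\<close>

definition Fin_O_maps ::
  "('a, 'b) monoid_scheme \<Rightarrow> ('a set \<times> 'a set) set \<Rightarrow> ('a, 's) gset \<Rightarrow> ('a, 't) gset \<Rightarrow> ('s \<Rightarrow> 't) set"
  where
  "Fin_O_maps G \<O> X Y = {f \<in> gmaps G X Y.
    \<forall>x \<in> pts X. (stabilizer G (act X) x, stabilizer G (act Y) (f x)) \<in> \<O>}"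

record ('a, 'u, 's, 't) gspan =
  apex :: "('a, 'u) gset"
  lleg :: "'u \<Rightarrow> 's"
  rleg :: "'u \<Rightarrow> 't"

definition spans ::
  "('a, 'b) monoid_scheme \<Rightarrow> ('a set \<times> 'a set) set \<Rightarrow> ('a, 's) gset \<Rightarrow> ('a, 't) gset \<Rightarrow>
    ('a, 'u, 's, 't) gspan set" where
  "spans G \<O> S T = {w. finite_gset G (apex w) \<and>
    lleg w \<in> gmaps G (apex w) S \<and> rleg w \<in> Fin_O_maps G \<O> (apex w) T}"

definition span_iso ::
  "('a, 'b) monoid_scheme \<Rightarrow> ('a, 'u, 's, 't) gspan \<Rightarrow> ('a, 'w, 's, 't) gspan \<Rightarrow> bool" where
  "span_iso G v w \<longleftrightarrow>
    (\<exists>\<theta> \<in> gmaps G (apex v) (apex w). bij_betw \<theta> (pts (apex v)) (pts (apex w)) \<and>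
      (\<forall>x \<in> pts (apex v). lleg w (\<theta> x) = lleg v x \<and> rleg w (\<theta> x) = rleg v x))"

text \<open>The composite of \<open>S \<leftarrow> U \<rightarrow> T\<close> and \<open>T \<leftarrow> V \<rightarrow> R\<close>; its apex is the pullback of \<open>U\<close> and \<open>V\<close> over \<open>T\<close>.\<close>

definition comp_span ::
  "('a, 'v, 't, 'r) gspan \<Rightarrow> ('a, 'u, 's, 't) gspan \<Rightarrow> ('a, 'u \<times> 'v, 's, 'r) gspan" where
  "comp_span w v =
    (let P = {(x, y). x \<in> pts (apex v) \<and> y \<in> pts (apex w) \<and> rleg v x = lleg w y} in
     \<lparr>apex = \<lparr>pts = P, act = (\<lambda>g. \<lambda>z\<in>P. (act (apex v) g (fst z), act (apex w) g (snd z)))\<rparr>,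
      lleg = (\<lambda>z\<in>P. lleg v (fst z)),
      rleg = (\<lambda>z\<in>P. rleg w (snd z))\<rparr>)"

text \<open>
  The Lindner category.  Every finite \<open>G\<close>-set is isomorphic to one on a set of natural numbers, so
  only those are used, both as objects and as apices of spans.  As the pullback of two such apices
  consists of pairs, the composite of two isomorphism classes is described as the set of those spans
  with apex in \<open>nat\<close> that are isomorphic to a pullback of representatives.
\<close>

type_synonym 'a lindner_obj = "('a, nat) gset"
type_synonym 'a lindner_mor = "('a, nat, nat, nat) gspan set"
type_synonym 'a lindner_cat = "('a lindner_obj, 'a lindner_mor) cat"

definition lindner :: "('a, 'b) monoid_scheme \<Rightarrow> ('a set \<times> 'a set) set \<Rightarrow> 'a lindner_cat" where
  "lindner G \<O> =
    \<lparr>Obj = {X. finite_gset G X},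
     Hom = (\<lambda>S T. spans G \<O> S T // {(v, w). v \<in> spans G \<O> S T \<and> w \<in> spans G \<O> S T \<and> span_iso G v w}),
     Ident = (\<lambda>S. {w \<in> spans G \<O> S S.
       span_iso G w \<lparr>apex = S, lleg = (\<lambda>x\<in>pts S. x), rleg = (\<lambda>x\<in>pts S. x)\<rparr>}),
     Comp = (\<lambda>S T R b a. {w \<in> spans G \<O> S R.
       \<exists>u \<in> a. \<exists>v \<in> b. span_iso G w (comp_span v u)})\<rparr>"

definition lindner_sub ::
  "('a, 'b) monoid_scheme \<Rightarrow> ('a set \<times> 'a set) set \<Rightarrow> 'a set \<Rightarrow> 'a lindner_cat" where
  "lindner_sub G \<O> H = full_subcategory (lindner G \<O>)
    (\<lambda>X. \<forall>x \<in> pts X. subconjugate G (stabilizer G (act X) x) H)"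


section \<open>Incomplete Mackey functors\<close>

type_synonym ('a, 'v) mackey_obj =
  "('a lindner_obj, 'a lindner_mor, (rat, 'v) module, 'v \<Rightarrow> 'v) cfunctor"
type_synonym ('a, 'v) mackey_mor = "'a lindner_obj \<Rightarrow> 'v \<Rightarrow> 'v"
type_synonym ('a, 'v) mackey_cat = "(('a, 'v) mackey_obj, ('a, 'v) mackey_mor) cat"

definition O_Mackey ::
  "('a, 'b) monoid_scheme \<Rightarrow> ('a set \<times> 'a set) set \<Rightarrow> ('a, 'v) mackey_cat" where
  "O_Mackey G \<O> = full_subcategory (functor_category (lindner G \<O>) rat_vect)
    (product_preserving (lindner G \<O>) rat_vect)"

definition class_Mackey ::
  "('a, 'b) monoid_scheme \<Rightarrow> ('a set \<times> 'a set) set \<Rightarrow> 'a set \<Rightarrow> ('a, 'v) mackey_cat" where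
  "class_Mackey G \<O> H = full_subcategory (functor_category (lindner_sub G \<O> H) rat_vect)
    (\<lambda>M. product_preserving (lindner_sub G \<O> H) rat_vect M \<and>
      (\<forall>K. subgroup K G \<and> subconjugate G K H \<and> K \<notin> insep_class G \<O> H \<longrightarrow>
        (\<forall>X \<in> Obj (lindner_sub G \<O> H). gset_iso G X (coset_gset G K) \<longrightarrow>
          carrier (FObj M X) = {\<zero>\<^bsub>FObj M X\<^esub>})))"

end

theory Submission
  imports Defs "HOL-Library.Nat_Bijection"
begin

text \<open>
  A finite \<open>G\<close>-set \<open>Z\<close> with all stabilizers in \<open>Sub\<^sup>\<O>\<close> acts on every Mackey functor \<open>M\<close>, through the
  span \<open>T \<leftarrow> T \<times> Z \<rightarrow> T\<close>, by an endomorphism that is natural in \<open>T\<close>.  On an orbit \<open>G/K\<close> this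
  endomorphism is multiplication by the mark \<open>|Z\<^sup>K|\<close> plus a sum of composites \<open>tr \<circ> res\<close> through orbits
  \<open>G/J\<close> with \<open>J = K \<inter> Stab z\<close>, and for these \<open>H\<^sub>\<O>(J)\<close> is properly smaller than \<open>H\<^sub>\<O>(K)\<close>.  Marks
  depend only on the inseparability class of \<open>K\<close>, and some \<open>X\<close> has different marks on different
  classes.  By induction on \<open>K\<close>, \<open>M\<close> is the direct sum of the eigenspaces of \<open>X\<close> for the marks of the
  classes, and the eigenspace of a class vanishes on \<open>G/K\<close> if no subgroup of \<open>K\<close> is in the class.

  The equivalence sends \<open>M\<close> to its eigenspaces, each restricted to the subcategory of its class.
  Nothing is lost by restricting to the subcategory of \<open>[H]\<close>: with \<open>Y = G/H\<close>, the set \<open>T \<times> Y\<close> belongs to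
  it for every \<open>T\<close>, and on the eigenspace of \<open>[H]\<close> the composite \<open>tr \<circ> res\<close> along \<open>T \<times> Y \<rightarrow> T\<close> is the
  nonzero scalar \<open>|Y\<^sup>H|\<close>.  So morphisms extend from the subcategory, and a functor \<open>N\<close> on it extends as a
  retract of \<open>T \<mapsto> N (T \<times> Y)\<close>.
\<close>

section \<open>Categories\<close>

text \<open>The usual route to such splittings is through idempotents of a rational Burnside ring.
  Spans can be added by disjoint union but neither subtracted nor divided, so no such idempotent is
  a morphism of the Lindner category, and all linear algebra must take place in the values of M.
  Hence a single G-set X for all classes: it acts through a genuine morphism, and diagonalizing one
  operator replaces a family of idempotents. The restriction axiom is used twice. Restricting Stab z
  -> G to Stab t makes T x Z -> T a morphism of Fin_O. It also closes Sub_O under intersection, so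
  that H_O exists and a stabilizer of Z contains J exactly when it contains H_O(J); this is why
  marks see only the class. That H_O shrinks in the correction term does more than start an
  induction. The class of K does not occur again below K, so its eigenvalue is not repeated there,
  and the operator is diagonalizable instead of merely triangular. The set Y = G/H can be used
  because Stab(t,y) lies in a conjugate of H, and the scalar is nonzero because H fixes the coset
  H.\<close>

lemma full_subcategory_simps [simp]:
  "Obj (full_subcategory C P) = {X \<in> Obj C. P X}"
  "Hom (full_subcategory C P) = Hom C"
  "Ident (full_subcategory C P) = Ident C"
  "Comp (full_subcategory C P) = Comp C"
  by (simp_all add: full_subcategory_def)

lemma category_full_subcategory: "category C \<Longrightarrow> category (full_subcategory C P)"
  by (auto simp: category_def)

lemma category_product_category:
  assumes "\<And>i. i \<in> I \<Longrightarrow> category (C i)"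
  shows "category (product_category I C)"
proof (unfold_locales, goal_cases)
  case (1 X)
  then show ?case
    using assms by (auto simp: product_category_def intro!: category.Ident_in_Hom dest: PiE_mem)
next
  case (2 X Y Z f g)
  then show ?case
    using assms by (auto simp: product_category_def intro!: category.Comp_in_Hom dest: PiE_mem)
next
  case (3 X Y f)
  show ?case
  proof (rule PiE_ext)
    show "f \<in> (\<Pi>\<^sub>E i\<in>I. Hom (C i) (X i) (Y i))"
      using 3 by (simp add: product_category_def)
    show "Comp (product_category I C) X Y Y (Ident (product_category I C) Y) f
        \<in> (\<Pi>\<^sub>E i\<in>I. Hom (C i) (X i) (Y i))"
      using 3 assms
      by (auto simp: product_category_def intro!: category.Comp_in_Hom category.Ident_in_Hom dest: PiE_mem)
    show "Comp (product_category I C) X Y Y (Ident (product_category I C) Y) f i = f i" if "i \<in> I" for i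
      using 3 assms that by (auto simp: product_category_def intro!: category.Comp_Ident_left dest: PiE_mem)
  qed
next
  case (4 X Y f)
  show ?case
  proof (rule PiE_ext)
    show "f \<in> (\<Pi>\<^sub>E i\<in>I. Hom (C i) (X i) (Y i))"
      using 4 by (simp add: product_category_def)
    show "Comp (product_category I C) X X Y f (Ident (product_category I C) X)
        \<in> (\<Pi>\<^sub>E i\<in>I. Hom (C i) (X i) (Y i))"
      using 4 assms
      by (auto simp: product_category_def intro!: category.Comp_in_Hom category.Ident_in_Hom dest: PiE_mem)
    show "Comp (product_category I C) X X Y f (Ident (product_category I C) X) i = f i" if "i \<in> I" for i
      using 4 assms that by (auto simp: product_category_def intro!: category.Comp_Ident_right dest: PiE_mem)
  qed
next
  case (5 W X Y Z f g h)
  then show ?case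
    using assms by (auto simp: product_category_def intro!: restrict_ext category.Comp_assoc dest: PiE_mem)
qed

lemma functor_category_simps [simp]:
  "Obj (functor_category C D) = {F. is_functor C D F \<and> extensional_functor C F}"
  "Hom (functor_category C D) F K = {\<alpha> \<in> extensional (Obj C). nat_trans C D F K \<alpha>}"
  "Ident (functor_category C D) F = (\<lambda>X\<in>Obj C. Ident D (FObj F X))"
  "Comp (functor_category C D) F K L \<beta> \<alpha> =
    (\<lambda>X\<in>Obj C. Comp D (FObj F X) (FObj K X) (FObj L X) (\<beta> X) (\<alpha> X))"
  by (simp_all add: functor_category_def)

lemma is_functorD:
  assumes "is_functor C D F"
  shows is_functor_obj: "X \<in> Obj C \<Longrightarrow> FObj F X \<in> Obj D"
    and is_functor_map: "\<lbrakk>X \<in> Obj C; Y \<in> Obj C; f \<in> Hom C X Y\<rbrakk>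
      \<Longrightarrow> FMap F X Y f \<in> Hom D (FObj F X) (FObj F Y)"
    and is_functor_Ident: "X \<in> Obj C \<Longrightarrow> FMap F X X (Ident C X) = Ident D (FObj F X)"
    and is_functor_Comp: "\<lbrakk>X \<in> Obj C; Y \<in> Obj C; Z \<in> Obj C; f \<in> Hom C X Y; g \<in> Hom C Y Z\<rbrakk>
      \<Longrightarrow> FMap F X Z (Comp C X Y Z g f) =
        Comp D (FObj F X) (FObj F Y) (FObj F Z) (FMap F Y Z g) (FMap F X Y f)"
  using assms unfolding is_functor_def by blast+

lemma nat_transD:
  assumes "nat_trans C D F K \<alpha>"
  shows nat_trans_in: "X \<in> Obj C \<Longrightarrow> \<alpha> X \<in> Hom D (FObj F X) (FObj K X)"
    and nat_trans_nat: "\<lbrakk>X \<in> Obj C; Y \<in> Obj C; f \<in> Hom C X Y\<rbrakk> \<Longrightarrow>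
      Comp D (FObj F X) (FObj F Y) (FObj K Y) (\<alpha> Y) (FMap F X Y f) =
      Comp D (FObj F X) (FObj K X) (FObj K Y) (FMap K X Y f) (\<alpha> X)"
  using assms unfolding nat_trans_def by blast+

text \<open>Morphisms of the functor category are undefined off the objects. Components can thus be
  built as plain functions and cut down at the end.\<close>

lemma nat_trans_restrict [simp]:
  "nat_trans C D F K (restrict \<alpha> (Obj C)) \<longleftrightarrow> nat_trans C D F K \<alpha>"
  unfolding nat_trans_def by simp

lemma nat_trans_Ident:
  assumes "category D" and "is_functor C D F"
  shows "nat_trans C D F F (\<lambda>X. Ident D (FObj F X))"
  unfolding nat_trans_def
  using is_functorD[OF assms(2)] category.Ident_in_Hom[OF assms(1)]
    category.Comp_Ident_left[OF assms(1)] category.Comp_Ident_right[OF assms(1)] by simp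

lemma nat_trans_Comp:
  assumes D: "category D" and F: "is_functor C D F" "is_functor C D K" "is_functor C D L"
    and \<alpha>: "nat_trans C D F K \<alpha>" and \<beta>: "nat_trans C D K L \<beta>"
  shows "nat_trans C D F L (\<lambda>X. Comp D (FObj F X) (FObj K X) (FObj L X) (\<beta> X) (\<alpha> X))"
  unfolding nat_trans_def
proof (intro conjI ballI)
  show "Comp D (FObj F X) (FObj K X) (FObj L X) (\<beta> X) (\<alpha> X) \<in> Hom D (FObj F X) (FObj L X)"
    if "X \<in> Obj C" for X
    using that nat_transD[OF \<alpha>] nat_transD[OF \<beta>] is_functorD[OF F(1)] is_functorD[OF F(2)]
      is_functorD[OF F(3)] category.Comp_in_Hom[OF D] by simp
next
  fix X Y f assume X: "X \<in> Obj C" and Y: "Y \<in> Obj C" and f: "f \<in> Hom C X Y"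
  let ?F = "FObj F" and ?K = "FObj K" and ?L = "FObj L"
  note o = is_functor_obj[OF F(1) X] is_functor_obj[OF F(1) Y] is_functor_obj[OF F(2) X]
    is_functor_obj[OF F(2) Y] is_functor_obj[OF F(3) X] is_functor_obj[OF F(3) Y]
  note m = is_functor_map[OF F(1) X Y f] is_functor_map[OF F(2) X Y f] is_functor_map[OF F(3) X Y f]
  note ab = nat_trans_in[OF \<alpha> X] nat_trans_in[OF \<alpha> Y] nat_trans_in[OF \<beta> X] nat_trans_in[OF \<beta> Y]
  show "Comp D (?F X) (?F Y) (?L Y) (Comp D (?F Y) (?K Y) (?L Y) (\<beta> Y) (\<alpha> Y)) (FMap F X Y f) =
     Comp D (?F X) (?L X) (?L Y) (FMap L X Y f) (Comp D (?F X) (?K X) (?L X) (\<beta> X) (\<alpha> X))"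
    using o m ab
    by (simp add: category.Comp_assoc[OF D, symmetric] nat_trans_nat[OF \<alpha> X Y f])
      (simp add: category.Comp_assoc[OF D] nat_trans_nat[OF \<beta> X Y f])
qed

lemma category_functor_category:
  assumes D: "category D"
  shows "category (functor_category C D)"
proof (unfold_locales, goal_cases)
  case (1 X)
  then have "is_functor C D X" by simp
  then show ?case using nat_trans_Ident[OF D] by simp
next
  case (2 X Y Z f g)
  then show ?case using nat_trans_Comp[OF D, of C X Y Z f g] by simp
next
  case (3 X Y f)
  then show ?case
    by (auto intro!: extensionalityI[where A = "Obj C"] category.Comp_Ident_left[OF D]
        is_functor_obj nat_trans_in)
next
  case (4 X Y f)
  then show ?case
    by (auto intro!: extensionalityI[where A = "Obj C"] category.Comp_Ident_right[OF D]
        is_functor_obj nat_trans_in)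
next
  case (5 W X Y Z f g h)
  then show ?case
    by (auto intro!: restrict_ext category.Comp_assoc[OF D] is_functor_obj nat_trans_in)
qed

section \<open>Isomorphisms and equivalences of categories\<close>

lemma iso_inE:
  assumes "iso_in C X Y f"
  obtains g where "f \<in> Hom C X Y" "g \<in> Hom C Y X" "Comp C X Y X g f = Ident C X"
    "Comp C Y X Y f g = Ident C Y"
  using assms unfolding iso_in_def by blast

lemma iso_in_product_category:
  assumes "\<And>i. i \<in> I \<Longrightarrow> iso_in (C i) (X i) (Y i) (f i)"
  shows "iso_in (product_category I C) X Y (restrict f I)"
proof -
  obtain g where g: "\<And>i. i \<in> I \<Longrightarrow> g i \<in> Hom (C i) (Y i) (X i) \<and>
    Comp (C i) (X i) (Y i) (X i) (g i) (f i) = Ident (C i) (X i) \<and>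
    Comp (C i) (Y i) (X i) (Y i) (f i) (g i) = Ident (C i) (Y i)"
    using assms unfolding iso_in_def by metis
  show ?thesis
    unfolding iso_in_def
  proof (intro conjI bexI[of _ "restrict g I"])
    show "restrict f I \<in> Hom (product_category I C) X Y"
      using assms by (auto simp: product_category_def iso_in_def)
  qed (use g in \<open>auto simp: product_category_def intro!: restrict_ext\<close>)
qed

text \<open>Naturality of the inverses is automatic: insert the identity \<open>\<alpha> X\<close>
  after \<open>\<beta> X\<close> on the right, exchange by the square of \<open>\<alpha>\<close>,
  and cancel \<open>\<beta> Y\<close> against \<open>\<alpha> Y\<close> on the left.\<close>

lemma iso_in_functor_category:
  assumes D: "category D" and F: "is_functor C D F" and K: "is_functor C D K"
    and \<alpha>: "nat_trans C D F K \<alpha>" and iso: "\<And>X. X \<in> Obj C \<Longrightarrow> iso_in D (FObj F X) (FObj K X) (\<alpha> X)"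
  shows "iso_in (functor_category C D) F K (restrict \<alpha> (Obj C))"
proof -
  obtain \<beta> where \<beta>: "\<And>X. X \<in> Obj C \<Longrightarrow> \<beta> X \<in> Hom D (FObj K X) (FObj F X) \<and>
    Comp D (FObj F X) (FObj K X) (FObj F X) (\<beta> X) (\<alpha> X) = Ident D (FObj F X) \<and>
    Comp D (FObj K X) (FObj F X) (FObj K X) (\<alpha> X) (\<beta> X) = Ident D (FObj K X)"
    using iso unfolding iso_in_def by metis
  have "nat_trans C D K F \<beta>"
    unfolding nat_trans_def
  proof (intro conjI ballI)
    fix X Y f assume X: "X \<in> Obj C" and Y: "Y \<in> Obj C" and f: "f \<in> Hom C X Y"
    let ?F = "FObj F" and ?K = "FObj K"
    note o = is_functor_obj[OF F X] is_functor_obj[OF F Y] is_functor_obj[OF K X]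
      is_functor_obj[OF K Y]
    note m = is_functor_map[OF F X Y f] is_functor_map[OF K X Y f]
    note ab = nat_trans_in[OF \<alpha> X] nat_trans_in[OF \<alpha> Y] \<beta>[OF X] \<beta>[OF Y]
    note b = \<beta>[OF X, THEN conjunct1] \<beta>[OF Y, THEN conjunct1]
    have "Comp D (?K X) (?K Y) (?F Y) (\<beta> Y) (FMap K X Y f) =
      Comp D (?K X) (?K Y) (?F Y) (\<beta> Y)
        (Comp D (?K X) (?K X) (?K Y) (FMap K X Y f) (Comp D (?K X) (?F X) (?K X) (\<alpha> X) (\<beta> X)))"
      using o m ab by (simp add: category.Comp_Ident_right[OF D])
    also have "\<dots> = Comp D (?K X) (?K Y) (?F Y) (\<beta> Y) (Comp D (?K X) (?F X) (?K Y)
        (Comp D (?F X) (?K X) (?K Y) (FMap K X Y f) (\<alpha> X)) (\<beta> X))"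
      using o m ab(1,2) b by (simp only: category.Comp_assoc[OF D])
    also have "\<dots> = Comp D (?K X) (?K Y) (?F Y) (\<beta> Y) (Comp D (?K X) (?F X) (?K Y)
        (Comp D (?F X) (?F Y) (?K Y) (\<alpha> Y) (FMap F X Y f)) (\<beta> X))"
      using nat_trans_nat[OF \<alpha> X Y f] by simp
    also have "\<dots> = Comp D (?K X) (?K Y) (?F Y) (\<beta> Y) (Comp D (?K X) (?F Y) (?K Y)
        (\<alpha> Y) (Comp D (?K X) (?F X) (?F Y) (FMap F X Y f) (\<beta> X)))"
      using o m ab by (simp add: category.Comp_assoc[OF D, symmetric])
    also have "\<dots> = Comp D (?K X) (?F Y) (?F Y) (Comp D (?F Y) (?K Y) (?F Y) (\<beta> Y) (\<alpha> Y))
        (Comp D (?K X) (?F X) (?F Y) (FMap F X Y f) (\<beta> X))"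
      using o m ab(1,2) b by (simp only: category.Comp_assoc[OF D] category.Comp_in_Hom[OF D])
    also have "\<dots> = Comp D (?K X) (?F X) (?F Y) (FMap F X Y f) (\<beta> X)"
      using o m ab by (simp add: category.Comp_Ident_left[OF D] category.Comp_in_Hom[OF D])
    finally show "Comp D (?K X) (?K Y) (?F Y) (\<beta> Y) (FMap K X Y f) =
      Comp D (?K X) (?F X) (?F Y) (FMap F X Y f) (\<beta> X)" .
  qed (simp add: \<beta>)
  then show ?thesis
    unfolding iso_in_def using \<alpha> \<beta>
    by (auto intro!: restrict_ext bexI[of _ "restrict \<beta> (Obj C)"])
qed

text \<open>
  The inverse functor picks a preimage for every object and every morphism; all coherence
  conditions are then checked after applying the faithful functor.
\<close>

lemma equivalent_categoriesI:
  assumes C: "category C" and D: "category D" and F: "is_functor C D F"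
    and ff: "\<And>X Y. \<lbrakk>X \<in> Obj C; Y \<in> Obj C\<rbrakk>
      \<Longrightarrow> bij_betw (FMap F X Y) (Hom C X Y) (Hom D (FObj F X) (FObj F Y))"
    and es: "\<And>Z. Z \<in> Obj D \<Longrightarrow> \<exists>X \<in> Obj C. \<exists>f. iso_in D (FObj F X) Z f"
  shows "equivalent_categories C D"
proof -
  interpret C: category C by fact
  interpret D: category D by fact
  let ?F = "FObj F"
  obtain k e where k: "\<And>Z. Z \<in> Obj D \<Longrightarrow> k Z \<in> Obj C"
    and e: "\<And>Z. Z \<in> Obj D \<Longrightarrow> iso_in D (?F (k Z)) Z (e Z)"
    using es by metis
  then obtain i where e: "\<And>Z. Z \<in> Obj D \<Longrightarrow> e Z \<in> Hom D (?F (k Z)) Z"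
    and i: "\<And>Z. Z \<in> Obj D \<Longrightarrow> i Z \<in> Hom D Z (?F (k Z))"
    and ie: "\<And>Z. Z \<in> Obj D \<Longrightarrow> Comp D (?F (k Z)) Z (?F (k Z)) (i Z) (e Z) = Ident D (?F (k Z))"
    and ei: "\<And>Z. Z \<in> Obj D \<Longrightarrow> Comp D Z (?F (k Z)) Z (e Z) (i Z) = Ident D Z"
    unfolding iso_in_def by metis
  note Fo [simp] = is_functor_obj[OF F] and Fm [simp] = is_functor_map[OF F]
  note [simp] = k e i C.Ident_in_Hom D.Ident_in_Hom C.Comp_in_Hom D.Comp_in_Hom
    C.Comp_Ident_left D.Comp_Ident_left C.Comp_Ident_right D.Comp_Ident_right ie ei
    is_functor_Ident[OF F] is_functor_Comp[OF F]
  define preim where "preim X Y = the_inv_into (Hom C X Y) (FMap F X Y)" for X Y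
  have preim_in [simp]: "preim X Y h \<in> Hom C X Y"
    if "X \<in> Obj C" "Y \<in> Obj C" "h \<in> Hom D (?F X) (?F Y)" for X Y h
    using ff[OF that(1,2)] that(3) the_inv_into_into[of "FMap F X Y" "Hom C X Y" h]
    by (auto simp: preim_def bij_betw_def)
  have F_preim [simp]: "FMap F X Y (preim X Y h) = h"
    if "X \<in> Obj C" "Y \<in> Obj C" "h \<in> Hom D (?F X) (?F Y)" for X Y h
    using ff[OF that(1,2)] that(3) by (auto simp: preim_def bij_betw_def f_the_inv_into_f)
  have faithful: "f = g" if "FMap F X Y f = FMap F X Y g"
    "X \<in> Obj C" "Y \<in> Obj C" "f \<in> Hom C X Y" "g \<in> Hom C X Y" for X Y f g
    using ff[of X Y] that by (auto simp: bij_betw_def inj_on_def)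
  \<comment> \<open>The morphism h conjugated by the chosen isomorphisms \<open>e\<close>; its
    preimage under F will be the value of the inverse functor at h.\<close>
  define tr where "tr Z W h = Comp D (?F (k Z)) W (?F (k W)) (i W) (Comp D (?F (k Z)) Z W h (e Z))"
    for Z W h
  have tr_in [simp]: "tr Z W h \<in> Hom D (?F (k Z)) (?F (k W))"
    if "Z \<in> Obj D" "W \<in> Obj D" "h \<in> Hom D Z W" for Z W h
    using that by (simp add: tr_def)
  have e_tr: "Comp D (?F (k Z)) (?F (k W)) W (e W) (tr Z W h) = Comp D (?F (k Z)) Z W h (e Z)"
    if "Z \<in> Obj D" "W \<in> Obj D" "h \<in> Hom D Z W" for Z W h
    using that by (simp add: tr_def D.Comp_assoc)
  \<comment> \<open>Since \<open>i W\<close> is a left inverse of \<open>e W\<close>, equations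
    between transported morphisms may be checked after composing with \<open>e W\<close>, where
    \<open>e_tr\<close> makes them trivial.\<close>
  have mono: "f = g" if "Comp D X (?F (k W)) W (e W) f = Comp D X (?F (k W)) W (e W) g"
    "X \<in> Obj D" "W \<in> Obj D" "f \<in> Hom D X (?F (k W))" "g \<in> Hom D X (?F (k W))" for X W f g
  proof -
    have "Comp D X W (?F (k W)) (i W) (Comp D X (?F (k W)) W (e W) f) =
      Comp D X W (?F (k W)) (i W) (Comp D X (?F (k W)) W (e W) g)"
      using that by simp
    then show ?thesis
      using that(2-5) by (simp add: D.Comp_assoc)
  qed
  define K where "K = \<lparr>FObj = k, FMap = (\<lambda>Z W h. preim (k Z) (k W) (tr Z W h))\<rparr>"
  have K: "is_functor D C K"
    unfolding is_functor_def
  proof (intro conjI ballI)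
    fix Z assume *: "Z \<in> Obj D"
    show "FMap K Z Z (Ident D Z) = Ident C (FObj K Z)"
      by (rule faithful[of "k Z" "k Z"]) (use * in \<open>simp_all add: K_def tr_def\<close>)
  next
    fix X Y Z f g
    assume *: "X \<in> Obj D" "Y \<in> Obj D" "Z \<in> Obj D" "f \<in> Hom D X Y" "g \<in> Hom D Y Z"
    have "Comp D (?F (k X)) (?F (k Z)) Z (e Z)
        (Comp D (?F (k X)) (?F (k Y)) (?F (k Z)) (tr Y Z g) (tr X Y f)) =
      Comp D (?F (k X)) (?F (k Y)) Z (Comp D (?F (k Y)) Y Z g (e Y)) (tr X Y f)"
      using * by (simp add: D.Comp_assoc e_tr)
    also have "\<dots> = Comp D (?F (k X)) Y Z g (Comp D (?F (k X)) (?F (k Y)) Y (e Y) (tr X Y f))"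
      using * by (simp only: D.Comp_assoc Fo k e tr_in)
    also have "\<dots> = Comp D (?F (k X)) (?F (k Z)) Z (e Z) (tr X Z (Comp D X Y Z g f))"
      using * by (simp add: e_tr D.Comp_assoc)
    finally have eq: "Comp D (?F (k X)) (?F (k Z)) Z (e Z)
        (Comp D (?F (k X)) (?F (k Y)) (?F (k Z)) (tr Y Z g) (tr X Y f)) =
      Comp D (?F (k X)) (?F (k Z)) Z (e Z) (tr X Z (Comp D X Y Z g f))" .
    have eq: "tr X Z (Comp D X Y Z g f) =
      Comp D (?F (k X)) (?F (k Y)) (?F (k Z)) (tr Y Z g) (tr X Y f)"
      by (rule mono[OF eq[symmetric]]) (use * in \<open>simp_all\<close>)
    show "FMap K X Z (Comp D X Y Z g f) =
      Comp C (FObj K X) (FObj K Y) (FObj K Z) (FMap K Y Z g) (FMap K X Y f)"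
      by (rule faithful[of "k X" "k Z"]) (use * eq in \<open>simp_all add: K_def\<close>)
  qed (simp_all add: K_def)
  \<comment> \<open>The preimage of the known isomorphism from F(k(F X)) to F X. Its inverse is the
    preimage of \<open>i\<close>, again by faithfulness.\<close>
  define \<eta> where "\<eta> X = preim (k (?F X)) X (e (?F X))" for X
  have "naturally_isomorphic C C (comp_functor K F) id_functor"
    unfolding naturally_isomorphic_def nat_trans_def
  proof (intro exI[of _ \<eta>] conjI ballI)
    fix X Y f assume *: "X \<in> Obj C" "Y \<in> Obj C" "f \<in> Hom C X Y"
    show "Comp C (FObj (comp_functor K F) X) (FObj (comp_functor K F) Y) (FObj id_functor Y) (\<eta> Y)
        (FMap (comp_functor K F) X Y f) =
      Comp C (FObj (comp_functor K F) X) (FObj id_functor X) (FObj id_functor Y)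
        (FMap id_functor X Y f) (\<eta> X)"
      by (rule faithful[of "k (?F X)" Y]) (use * in \<open>simp_all add: comp_functor_def id_functor_def K_def \<eta>_def e_tr\<close>)
  next
    fix X assume X: "X \<in> Obj C"
    have "Comp C (k (?F X)) X (k (?F X)) (preim X (k (?F X)) (i (?F X))) (\<eta> X) = Ident C (k (?F X))"
      by (rule faithful[of "k (?F X)" "k (?F X)"]) (use X in \<open>simp_all add: \<eta>_def\<close>)
    moreover have "Comp C X (k (?F X)) X (\<eta> X) (preim X (k (?F X)) (i (?F X))) = Ident C X"
      by (rule faithful[of X X]) (use X in \<open>simp_all add: \<eta>_def\<close>)
    ultimately show "iso_in C (FObj (comp_functor K F) X) (FObj id_functor X) (\<eta> X)"
      unfolding iso_in_def using X
      by (auto simp: comp_functor_def id_functor_def K_def \<eta>_def intro!: bexI[of _ "preim X (k (?F X)) (i (?F X))"])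
  qed (simp add: comp_functor_def id_functor_def K_def \<eta>_def)
  moreover have "naturally_isomorphic D D (comp_functor F K) id_functor"
    unfolding naturally_isomorphic_def nat_trans_def
  proof (intro exI[of _ e] conjI ballI)
    fix Z assume "Z \<in> Obj D"
    then show "iso_in D (FObj (comp_functor F K) Z) (FObj id_functor Z) (e Z)"
      unfolding iso_in_def by (auto simp: comp_functor_def id_functor_def K_def intro!: bexI[of _ "i Z"])
  qed (simp_all add: comp_functor_def id_functor_def K_def e_tr)
  ultimately show ?thesis
    unfolding equivalent_categories_def using C D F K by blast
qed

section \<open>Terminal objects and binary products up to isomorphism\<close>

lemma is_terminal_unique_iso:
  assumes C: "category C" and P: "is_terminal C P" and Q: "is_terminal C Q"
  shows "\<exists>f. iso_in C P Q f"
proof -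
  interpret C: category C by fact
  obtain f g where "f \<in> Hom C P Q" "g \<in> Hom C Q P"
    using P Q unfolding is_terminal_def by blast
  moreover have "h = h'" if "h \<in> Hom C X X" "h' \<in> Hom C X X" "is_terminal C X" for X h h'
    using that unfolding is_terminal_def by blast
  ultimately show ?thesis
    using P Q unfolding iso_in_def
    by (metis C.Comp_in_Hom C.Ident_in_Hom is_terminal_def)
qed

lemma iso_in_functor:
  assumes F: "is_functor C D F" and "iso_in C X Y f" "X \<in> Obj C" "Y \<in> Obj C"
  shows "iso_in D (FObj F X) (FObj F Y) (FMap F X Y f)"
proof -
  obtain g where "f \<in> Hom C X Y" "g \<in> Hom C Y X" "Comp C X Y X g f = Ident C X"
    "Comp C Y X Y f g = Ident C Y"
    using assms(2) by (rule iso_inE)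
  then show ?thesis
    unfolding iso_in_def using assms(3,4) is_functorD[OF F]
    by (metis (no_types, lifting))
qed

lemma is_terminal_iso:
  assumes C: "category C" and P: "is_terminal C P" and Q: "Q \<in> Obj C" and f: "iso_in C P Q f"
  shows "is_terminal C Q"
proof -
  interpret C: category C by fact
  have Po: "P \<in> Obj C" using P by (simp add: is_terminal_def)
  obtain g where g: "f \<in> Hom C P Q" "g \<in> Hom C Q P" "Comp C P Q P g f = Ident C P"
    "Comp C Q P Q f g = Ident C Q"
    using f by (rule iso_inE)
  have "h = Comp C X P Q f u"
    if X: "X \<in> Obj C" "h \<in> Hom C X Q" and u: "u \<in> Hom C X P" for X h u
  proof -
    have "Comp C X Q P g h = u"
      using P X u g Q Po C.Comp_in_Hom unfolding is_terminal_def by blast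
    then show ?thesis
      using C.Comp_assoc[of X Q P Q h g f] g Q Po X C.Comp_Ident_left by simp
  qed
  moreover have "\<exists>u. u \<in> Hom C X P" if "X \<in> Obj C" for X
    using P that unfolding is_terminal_def by blast
  ultimately show ?thesis
    unfolding is_terminal_def using Q Po g C.Comp_in_Hom by metis
qed

lemma is_binary_productD:
  assumes "is_binary_product C X Y P p q"
  shows "X \<in> Obj C" "Y \<in> Obj C" "P \<in> Obj C" "p \<in> Hom C P X" "q \<in> Hom C P Y"
  using assms unfolding is_binary_product_def by auto

lemma is_binary_product_ex:
  assumes "is_binary_product C X Y P p q" "Z \<in> Obj C" "f \<in> Hom C Z X" "g \<in> Hom C Z Y"
  obtains u where "u \<in> Hom C Z P" "Comp C Z P X p u = f" "Comp C Z P Y q u = g"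
  using assms unfolding is_binary_product_def by blast

lemma is_binary_product_eq:
  assumes "is_binary_product C X Y P p q" "Z \<in> Obj C" "u \<in> Hom C Z P" "v \<in> Hom C Z P"
    "Comp C Z P X p u = Comp C Z P X p v" "Comp C Z P Y q u = Comp C Z P Y q v" "category C"
  shows "u = v"
proof -
  have "Comp C Z P X p v \<in> Hom C Z X" "Comp C Z P Y q v \<in> Hom C Z Y"
    using assms is_binary_productD[OF assms(1)] category.Comp_in_Hom[OF assms(7)] by auto
  then show ?thesis
    using assms unfolding is_binary_product_def by blast
qed

text \<open>The mediating map into Q is the one into P followed by the inverse \<open>g\<close>; any
  other candidate has the same composite with \<open>f\<close> and is recovered by applying
  \<open>g\<close>.\<close>

lemma is_binary_product_iso:
  assumes C: "category C" and P: "is_binary_product C X Y P p q"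
    and Q: "Q \<in> Obj C" and f: "iso_in C Q P f"
  shows "is_binary_product C X Y Q (Comp C Q P X p f) (Comp C Q P Y q f)"
proof -
  interpret C: category C by fact
  note [simp] = is_binary_productD[OF P] Q C.Comp_in_Hom
  obtain g where g [simp]: "f \<in> Hom C Q P" "g \<in> Hom C P Q" "Comp C Q P Q g f = Ident C Q"
    "Comp C P Q P f g = Ident C P"
    using f by (rule iso_inE)
  show ?thesis
    unfolding is_binary_product_def
  proof (intro conjI ballI)
    fix Z h k assume Z [simp]: "Z \<in> Obj C" "h \<in> Hom C Z X" "k \<in> Hom C Z Y"
    obtain u where u [simp]: "u \<in> Hom C Z P" and pu: "Comp C Z P X p u = h" "Comp C Z P Y q u = k"
      using is_binary_product_ex[OF P Z] .
    have fgu: "Comp C Z Q P f (Comp C Z P Q g u) = u"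
      by (simp add: C.Comp_assoc C.Comp_Ident_left)
    show "\<exists>!u. u \<in> Hom C Z Q \<and> Comp C Z Q X (Comp C Q P X p f) u = h \<and>
        Comp C Z Q Y (Comp C Q P Y q f) u = k"
    proof (rule ex1I[of _ "Comp C Z P Q g u"], intro conjI)
      show "Comp C Z Q X (Comp C Q P X p f) (Comp C Z P Q g u) = h"
        "Comp C Z Q Y (Comp C Q P Y q f) (Comp C Z P Q g u) = k"
        using fgu pu by (simp_all add: C.Comp_assoc[symmetric])
    next
      fix v assume v: "v \<in> Hom C Z Q \<and> Comp C Z Q X (Comp C Q P X p f) v = h \<and>
        Comp C Z Q Y (Comp C Q P Y q f) v = k"
      then have v' [simp]: "v \<in> Hom C Z Q" by blast
      have fv: "Comp C Z P X p (Comp C Z Q P f v) = h" "Comp C Z P Y q (Comp C Z Q P f v) = k"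
        using v by (simp_all add: C.Comp_assoc)
      have "Comp C Z Q P f v = u"
        by (rule is_binary_product_eq[OF P, of Z, OF _ _ _ _ _ C]) (simp_all only: fv pu, simp_all)
      then have "Comp C Z P Q g u = Comp C Z Q Q (Comp C Q P Q g f) v"
        using C.Comp_assoc[of Z Q P Q v f g] by simp
      then show "v = Comp C Z P Q g u"
        by (simp add: C.Comp_Ident_left)
    qed simp
  qed simp_all
qed

text \<open>Products are unique up to isomorphism, so one product per pair of objects suffices.\<close>

lemma product_preservingI:
  assumes C: "category C" and D: "category D" and F: "is_functor C D F"
    and t: "\<exists>P. is_terminal C P \<and> is_terminal D (FObj F P)"
    and p: "\<And>X Y. \<lbrakk>X \<in> Obj C; Y \<in> Obj C\<rbrakk> \<Longrightarrow> \<exists>P p q. is_binary_product C X Y P p q \<and>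
      is_binary_product D (FObj F X) (FObj F Y) (FObj F P) (FMap F P X p) (FMap F P Y q)"
  shows "product_preserving C D F"
  unfolding product_preserving_def
proof (intro conjI allI impI)
  interpret C: category C by fact
  fix Q assume Q: "is_terminal C Q"
  obtain P where P: "is_terminal C P" "is_terminal D (FObj F P)"
    using t by blast
  obtain f where "iso_in C P Q f"
    using is_terminal_unique_iso[OF C P(1) Q] by blast
  moreover have "P \<in> Obj C" "Q \<in> Obj C"
    using P(1) Q by (simp_all add: is_terminal_def)
  ultimately have "iso_in D (FObj F P) (FObj F Q) (FMap F P Q f)" "FObj F Q \<in> Obj D"
    by (simp_all add: iso_in_functor[OF F] is_functor_obj[OF F])
  then show "is_terminal D (FObj F Q)"
    by (intro is_terminal_iso[OF D P(2)])
next
  interpret C: category C by fact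
  fix X Y Q p' q' assume Q: "is_binary_product C X Y Q p' q'"
  note [simp] = is_binary_productD[OF Q]
  obtain P p q where P: "is_binary_product C X Y P p q"
    "is_binary_product D (FObj F X) (FObj F Y) (FObj F P) (FMap F P X p) (FMap F P Y q)"
    using p[of X Y] by auto
  note [simp] = is_binary_productD[OF P(1)]
  \<comment> \<open>The mediating maps in both directions are mutually inverse, by uniqueness; the
    image of \<open>u\<close> under F is the isomorphism along which the product in D is
    moved.\<close>
  obtain u where u [simp]: "u \<in> Hom C Q P" and pu: "Comp C Q P X p u = p'" "Comp C Q P Y q u = q'"
    using is_binary_product_ex[OF P(1), of Q p' q'] by auto
  obtain v where v [simp]: "v \<in> Hom C P Q" and pv: "Comp C P Q X p' v = p" "Comp C P Q Y q' v = q"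
    using is_binary_product_ex[OF Q, of P p q] by auto
  have "Comp C Q P Q v u = Ident C Q"
    by (rule is_binary_product_eq[OF Q, of Q])
      (simp_all add: C.Comp_in_Hom C.Ident_in_Hom C.Comp_assoc pv pu C.Comp_Ident_right C)
  moreover have "Comp C P Q P u v = Ident C P"
    by (rule is_binary_product_eq[OF P(1), of P])
      (simp_all add: C.Comp_in_Hom C.Ident_in_Hom C.Comp_assoc pv pu C.Comp_Ident_right C)
  ultimately have "iso_in C Q P u"
    unfolding iso_in_def using u v by blast
  then have "iso_in D (FObj F Q) (FObj F P) (FMap F Q P u)"
    by (intro iso_in_functor[OF F]) simp_all
  from is_binary_product_iso[OF D P(2) _ this]
  have "is_binary_product D (FObj F X) (FObj F Y) (FObj F Q)
     (FMap F Q X (Comp C Q P X p u)) (FMap F Q Y (Comp C Q P Y q u))"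
    by (simp add: is_functor_obj[OF F] is_functor_Comp[OF F])
  then show "is_binary_product D (FObj F X) (FObj F Y) (FObj F Q) (FMap F Q X p') (FMap F Q Y q')"
    by (simp add: pu)
qed

section \<open>Rational vector spaces\<close>

abbreviation ratmod :: "(rat, 'v) module \<Rightarrow> bool" where
  "ratmod V \<equiv> module rat_field V"

lemma cring_rat_field: "cring rat_field"
proof (rule cringI)
  show "abelian_group rat_field"
    by (rule abelian_groupI) (auto simp: rat_field_def intro: exI[of _ "- x" for x])
  show "comm_monoid rat_field"
    by (rule comm_monoidI) (auto simp: rat_field_def)
qed (auto simp: rat_field_def algebra_simps)

lemma rat_field_simps [simp]:
  "carrier rat_field = UNIV" "add rat_field = (+)" "mult rat_field = (*)" "one rat_field = 1"
  "zero rat_field = 0"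
  by (simp_all add: rat_field_def)

lemma ratmodI:
  assumes "abelian_group V"
    and "\<And>a x. x \<in> carrier V \<Longrightarrow> a \<odot>\<^bsub>V\<^esub> x \<in> carrier V"
    and "\<And>a b x. x \<in> carrier V \<Longrightarrow> (a + b) \<odot>\<^bsub>V\<^esub> x = (a \<odot>\<^bsub>V\<^esub> x) \<oplus>\<^bsub>V\<^esub> (b \<odot>\<^bsub>V\<^esub> x)"
    and "\<And>a x y. \<lbrakk>x \<in> carrier V; y \<in> carrier V\<rbrakk> \<Longrightarrow> a \<odot>\<^bsub>V\<^esub> (x \<oplus>\<^bsub>V\<^esub> y) = (a \<odot>\<^bsub>V\<^esub> x) \<oplus>\<^bsub>V\<^esub> (a \<odot>\<^bsub>V\<^esub> y)"
    and "\<And>a b x. x \<in> carrier V \<Longrightarrow> (a * b) \<odot>\<^bsub>V\<^esub> x = a \<odot>\<^bsub>V\<^esub> (b \<odot>\<^bsub>V\<^esub> x)"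
    and "\<And>x. x \<in> carrier V \<Longrightarrow> 1 \<odot>\<^bsub>V\<^esub> x = x"
  shows "ratmod V"
  by (rule moduleI[OF cring_rat_field]) (simp_all add: assms)

lemma ratmod_abelian_monoid: "ratmod V \<Longrightarrow> abelian_monoid V"
  by (simp add: module_def abelian_group_def)

lemma ratmod_simps [simp]:
  assumes "ratmod V"
  shows rm_zero: "\<zero>\<^bsub>V\<^esub> \<in> carrier V"
    and rm_add: "x \<in> carrier V \<Longrightarrow> y \<in> carrier V \<Longrightarrow> x \<oplus>\<^bsub>V\<^esub> y \<in> carrier V"
    and rm_smult: "x \<in> carrier V \<Longrightarrow> c \<odot>\<^bsub>V\<^esub> x \<in> carrier V"
    and rm_l_zero: "x \<in> carrier V \<Longrightarrow> \<zero>\<^bsub>V\<^esub> \<oplus>\<^bsub>V\<^esub> x = x"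
    and rm_r_zero: "x \<in> carrier V \<Longrightarrow> x \<oplus>\<^bsub>V\<^esub> \<zero>\<^bsub>V\<^esub> = x"
    and rm_smult_one: "x \<in> carrier V \<Longrightarrow> 1 \<odot>\<^bsub>V\<^esub> x = x"
    and rm_smult_0: "x \<in> carrier V \<Longrightarrow> 0 \<odot>\<^bsub>V\<^esub> x = \<zero>\<^bsub>V\<^esub>"
    and rm_smult_zero: "c \<odot>\<^bsub>V\<^esub> \<zero>\<^bsub>V\<^esub> = \<zero>\<^bsub>V\<^esub>"
    and rm_smult_smult: "x \<in> carrier V \<Longrightarrow> c \<odot>\<^bsub>V\<^esub> (d \<odot>\<^bsub>V\<^esub> x) = (c * d) \<odot>\<^bsub>V\<^esub> x"
proof -
  interpret module rat_field V by fact
  show "\<zero>\<^bsub>V\<^esub> \<in> carrier V" by simp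
  show "x \<in> carrier V \<Longrightarrow> y \<in> carrier V \<Longrightarrow> x \<oplus>\<^bsub>V\<^esub> y \<in> carrier V" by simp
  show "x \<in> carrier V \<Longrightarrow> c \<odot>\<^bsub>V\<^esub> x \<in> carrier V" by simp
  show "x \<in> carrier V \<Longrightarrow> \<zero>\<^bsub>V\<^esub> \<oplus>\<^bsub>V\<^esub> x = x" by simp
  show "x \<in> carrier V \<Longrightarrow> x \<oplus>\<^bsub>V\<^esub> \<zero>\<^bsub>V\<^esub> = x" by simp
  show "x \<in> carrier V \<Longrightarrow> 1 \<odot>\<^bsub>V\<^esub> x = x" using smult_one by simp
  show "x \<in> carrier V \<Longrightarrow> 0 \<odot>\<^bsub>V\<^esub> x = \<zero>\<^bsub>V\<^esub>" using smult_l_null by simp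
  show "c \<odot>\<^bsub>V\<^esub> \<zero>\<^bsub>V\<^esub> = \<zero>\<^bsub>V\<^esub>" by simp
  show "x \<in> carrier V \<Longrightarrow> c \<odot>\<^bsub>V\<^esub> (d \<odot>\<^bsub>V\<^esub> x) = (c * d) \<odot>\<^bsub>V\<^esub> x" using smult_assoc1 by simp
qed

lemma ratmod_laws:
  assumes "ratmod V"
  shows rm_assoc: "\<lbrakk>x \<in> carrier V; y \<in> carrier V; z \<in> carrier V\<rbrakk>
      \<Longrightarrow> (x \<oplus>\<^bsub>V\<^esub> y) \<oplus>\<^bsub>V\<^esub> z = x \<oplus>\<^bsub>V\<^esub> (y \<oplus>\<^bsub>V\<^esub> z)"
    and rm_comm: "\<lbrakk>x \<in> carrier V; y \<in> carrier V\<rbrakk> \<Longrightarrow> x \<oplus>\<^bsub>V\<^esub> y = y \<oplus>\<^bsub>V\<^esub> x"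
    and rm_smult_add: "\<lbrakk>x \<in> carrier V; y \<in> carrier V\<rbrakk>
      \<Longrightarrow> c \<odot>\<^bsub>V\<^esub> (x \<oplus>\<^bsub>V\<^esub> y) = c \<odot>\<^bsub>V\<^esub> x \<oplus>\<^bsub>V\<^esub> c \<odot>\<^bsub>V\<^esub> y"
    and rm_add_smult: "x \<in> carrier V \<Longrightarrow> (c + d) \<odot>\<^bsub>V\<^esub> x = c \<odot>\<^bsub>V\<^esub> x \<oplus>\<^bsub>V\<^esub> d \<odot>\<^bsub>V\<^esub> x"
proof -
  interpret module rat_field V by fact
  show "\<lbrakk>x \<in> carrier V; y \<in> carrier V; z \<in> carrier V\<rbrakk>
      \<Longrightarrow> (x \<oplus>\<^bsub>V\<^esub> y) \<oplus>\<^bsub>V\<^esub> z = x \<oplus>\<^bsub>V\<^esub> (y \<oplus>\<^bsub>V\<^esub> z)" by (rule a_assoc)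
  show "\<lbrakk>x \<in> carrier V; y \<in> carrier V\<rbrakk> \<Longrightarrow> x \<oplus>\<^bsub>V\<^esub> y = y \<oplus>\<^bsub>V\<^esub> x" by (rule a_comm)
  show "\<lbrakk>x \<in> carrier V; y \<in> carrier V\<rbrakk>
      \<Longrightarrow> c \<odot>\<^bsub>V\<^esub> (x \<oplus>\<^bsub>V\<^esub> y) = c \<odot>\<^bsub>V\<^esub> x \<oplus>\<^bsub>V\<^esub> c \<odot>\<^bsub>V\<^esub> y" by (simp add: smult_r_distr)
  show "x \<in> carrier V \<Longrightarrow> (c + d) \<odot>\<^bsub>V\<^esub> x = c \<odot>\<^bsub>V\<^esub> x \<oplus>\<^bsub>V\<^esub> d \<odot>\<^bsub>V\<^esub> x"
    using smult_l_distr by simp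
qed

lemma rm_neg:
  assumes "ratmod V" "x \<in> carrier V"
  shows "x \<oplus>\<^bsub>V\<^esub> (-1) \<odot>\<^bsub>V\<^esub> x = \<zero>\<^bsub>V\<^esub>"
proof -
  have "x \<oplus>\<^bsub>V\<^esub> (-1) \<odot>\<^bsub>V\<^esub> x = (1 + (-1)) \<odot>\<^bsub>V\<^esub> x"
    using assms by (simp only: rm_add_smult rm_smult_one)
  then show ?thesis using assms by simp
qed

lemma rm_cancel:
  assumes "ratmod V" "x \<in> carrier V" "y \<in> carrier V"
  shows "y \<oplus>\<^bsub>V\<^esub> x \<oplus>\<^bsub>V\<^esub> (-1) \<odot>\<^bsub>V\<^esub> x = y"
  using assms by (simp add: rm_assoc rm_neg)

lemma rm_left_cancel:
  assumes "ratmod V" "x \<in> carrier V" "y \<in> carrier V" "z \<in> carrier V" "x \<oplus>\<^bsub>V\<^esub> y = x \<oplus>\<^bsub>V\<^esub> z"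
  shows "y = z"
  using rm_cancel[OF assms(1,2,3)] rm_cancel[OF assms(1,2,4)] assms
  by (simp add: rm_comm[OF assms(1), of y x] rm_comm[OF assms(1), of z x])

lemma rm_diff_eq_zero:
  assumes V: "ratmod V" and x: "x \<in> carrier V" and y: "y \<in> carrier V"
    and "x \<oplus>\<^bsub>V\<^esub> (-1) \<odot>\<^bsub>V\<^esub> y = \<zero>\<^bsub>V\<^esub>"
  shows "x = y"
proof -
  have "x = x \<oplus>\<^bsub>V\<^esub> (-1) \<odot>\<^bsub>V\<^esub> y \<oplus>\<^bsub>V\<^esub> y"
    using V x y by (simp add: rm_assoc rm_comm[of V _ y] rm_neg)
  then show ?thesis
    using assms by simp
qed

text \<open>The difference \<open>c - d\<close> kills x and is invertible in the rationals. With c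
  and d eigenvalues this is how vectors belonging to two classes are seen to vanish.\<close>

lemma rm_smult_cancel:
  assumes "ratmod V" "x \<in> carrier V" "c \<odot>\<^bsub>V\<^esub> x = d \<odot>\<^bsub>V\<^esub> x" "c \<noteq> d"
  shows "x = \<zero>\<^bsub>V\<^esub>"
proof -
  have "(c + - d) \<odot>\<^bsub>V\<^esub> x = d \<odot>\<^bsub>V\<^esub> x \<oplus>\<^bsub>V\<^esub> (- d) \<odot>\<^bsub>V\<^esub> x"
    using assms by (simp only: rm_add_smult)
  also have "\<dots> = (d + - d) \<odot>\<^bsub>V\<^esub> x"
    using assms by (simp only: rm_add_smult)
  finally have "(c - d) \<odot>\<^bsub>V\<^esub> x = \<zero>\<^bsub>V\<^esub>"
    using assms by simp
  then have "(1 / (c - d)) \<odot>\<^bsub>V\<^esub> ((c - d) \<odot>\<^bsub>V\<^esub> x) = \<zero>\<^bsub>V\<^esub>"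
    using assms by (simp del: rm_smult_smult)
  then show ?thesis
    using assms by simp
qed

text \<open>Lets a multiplicity be counted one orbit at a time in
  \<open>map_covering\<close>.\<close>

lemma rm_smult_nat:
  assumes "ratmod V" "x \<in> carrier V"
  shows "of_nat (Suc n) \<odot>\<^bsub>V\<^esub> x = x \<oplus>\<^bsub>V\<^esub> of_nat n \<odot>\<^bsub>V\<^esub> x"
proof -
  have "(1 + of_nat n) \<odot>\<^bsub>V\<^esub> x = 1 \<odot>\<^bsub>V\<^esub> x \<oplus>\<^bsub>V\<^esub> of_nat n \<odot>\<^bsub>V\<^esub> x"
    using assms by (simp only: rm_add_smult)
  then show ?thesis using assms by simp
qed

lemma finsum_ratmod_simps:
  assumes "ratmod V"
  shows rm_finsum_closed: "z \<in> I \<rightarrow> carrier V \<Longrightarrow> (\<Oplus>\<^bsub>V\<^esub>i\<in>I. z i) \<in> carrier V"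
    and rm_finsum_insert: "\<lbrakk>finite I; i \<notin> I; z \<in> insert i I \<rightarrow> carrier V\<rbrakk>
      \<Longrightarrow> (\<Oplus>\<^bsub>V\<^esub>i\<in>insert i I. z i) = z i \<oplus>\<^bsub>V\<^esub> (\<Oplus>\<^bsub>V\<^esub>i\<in>I. z i)"
    and rm_finsum_empty: "(\<Oplus>\<^bsub>V\<^esub>i\<in>{}. z i) = \<zero>\<^bsub>V\<^esub>"
    and rm_finsum_add: "\<lbrakk>z \<in> I \<rightarrow> carrier V; w \<in> I \<rightarrow> carrier V\<rbrakk>
      \<Longrightarrow> (\<Oplus>\<^bsub>V\<^esub>i\<in>I. z i \<oplus>\<^bsub>V\<^esub> w i) = (\<Oplus>\<^bsub>V\<^esub>i\<in>I. z i) \<oplus>\<^bsub>V\<^esub> (\<Oplus>\<^bsub>V\<^esub>i\<in>I. w i)"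
    and rm_finsum_smult: "\<lbrakk>finite I; z \<in> I \<rightarrow> carrier V\<rbrakk>
      \<Longrightarrow> c \<odot>\<^bsub>V\<^esub> (\<Oplus>\<^bsub>V\<^esub>i\<in>I. z i) = (\<Oplus>\<^bsub>V\<^esub>i\<in>I. c \<odot>\<^bsub>V\<^esub> z i)"
proof -
  interpret module rat_field V by fact
  show "z \<in> I \<rightarrow> carrier V \<Longrightarrow> (\<Oplus>\<^bsub>V\<^esub>i\<in>I. z i) \<in> carrier V" by simp
  show "\<lbrakk>finite I; i \<notin> I; z \<in> insert i I \<rightarrow> carrier V\<rbrakk>
      \<Longrightarrow> (\<Oplus>\<^bsub>V\<^esub>i\<in>insert i I. z i) = z i \<oplus>\<^bsub>V\<^esub> (\<Oplus>\<^bsub>V\<^esub>i\<in>I. z i)"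
    by (rule finsum_insert) auto
  show "(\<Oplus>\<^bsub>V\<^esub>i\<in>{}. z i) = \<zero>\<^bsub>V\<^esub>" by simp
  show "\<lbrakk>z \<in> I \<rightarrow> carrier V; w \<in> I \<rightarrow> carrier V\<rbrakk>
      \<Longrightarrow> (\<Oplus>\<^bsub>V\<^esub>i\<in>I. z i \<oplus>\<^bsub>V\<^esub> w i) = (\<Oplus>\<^bsub>V\<^esub>i\<in>I. z i) \<oplus>\<^bsub>V\<^esub> (\<Oplus>\<^bsub>V\<^esub>i\<in>I. w i)"
    by (rule finsum_addf)
  show "\<lbrakk>finite I; z \<in> I \<rightarrow> carrier V\<rbrakk>
      \<Longrightarrow> c \<odot>\<^bsub>V\<^esub> (\<Oplus>\<^bsub>V\<^esub>i\<in>I. z i) = (\<Oplus>\<^bsub>V\<^esub>i\<in>I. c \<odot>\<^bsub>V\<^esub> z i)"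
    by (rule finsum_smult_ldistr) auto
qed

lemma rm_finsum_cong:
  assumes "ratmod V" "\<And>i. i \<in> I \<Longrightarrow> z i = w i" "w \<in> I \<rightarrow> carrier V"
  shows "(\<Oplus>\<^bsub>V\<^esub>i\<in>I. z i) = (\<Oplus>\<^bsub>V\<^esub>i\<in>I. w i)"
  using assms by (intro abelian_monoid.finsum_cong' ratmod_abelian_monoid) auto

lemma rm_finsum_zero:
  assumes "ratmod V"
  shows "(\<Oplus>\<^bsub>V\<^esub>i\<in>I. \<zero>\<^bsub>V\<^esub>) = \<zero>\<^bsub>V\<^esub>"
  using assms by (intro abelian_monoid.finsum_zero ratmod_abelian_monoid) auto

lemma rm_finsum_mono:
  assumes V: "ratmod V" and "finite J" "I \<subseteq> J" and z: "z \<in> I \<rightarrow> carrier V"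
  shows "(\<Oplus>\<^bsub>V\<^esub>i\<in>J. if i \<in> I then z i else \<zero>\<^bsub>V\<^esub>) = (\<Oplus>\<^bsub>V\<^esub>i\<in>I. z i)"
proof -
  interpret abelian_monoid V using V by (rule ratmod_abelian_monoid)
  show ?thesis
    using assms by (intro add.finprod_mono_neutral_cong_right) auto
qed

lemma rm_finsum_single:
  assumes V: "ratmod V" and "finite J" "d \<in> J" and z: "z \<in> carrier V"
  shows "(\<Oplus>\<^bsub>V\<^esub>i\<in>J. if i = d then z else \<zero>\<^bsub>V\<^esub>) = z"
  using rm_finsum_mono[OF V \<open>finite J\<close>, of "{d}" "\<lambda>_. z"] assms
  by (simp add: rm_finsum_insert rm_finsum_empty)

section \<open>Linear maps and the category of rational vector spaces\<close>

lemma linear_mapsD: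
  assumes "f \<in> linear_maps V W"
  shows lm_closed: "x \<in> carrier V \<Longrightarrow> f x \<in> carrier W"
    and lm_add: "\<lbrakk>x \<in> carrier V; y \<in> carrier V\<rbrakk> \<Longrightarrow> f (x \<oplus>\<^bsub>V\<^esub> y) = f x \<oplus>\<^bsub>W\<^esub> f y"
    and lm_smult: "x \<in> carrier V \<Longrightarrow> f (c \<odot>\<^bsub>V\<^esub> x) = c \<odot>\<^bsub>W\<^esub> f x"
    and lm_ext: "f \<in> extensional (carrier V)"
  using assms by (auto simp: linear_maps_def PiE_def)

lemma linear_mapsI:
  assumes "\<And>x. x \<in> carrier V \<Longrightarrow> f x \<in> carrier W"
    and "\<And>x y. \<lbrakk>x \<in> carrier V; y \<in> carrier V\<rbrakk> \<Longrightarrow> f (x \<oplus>\<^bsub>V\<^esub> y) = f x \<oplus>\<^bsub>W\<^esub> f y"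
    and "\<And>x c. x \<in> carrier V \<Longrightarrow> f (c \<odot>\<^bsub>V\<^esub> x) = c \<odot>\<^bsub>W\<^esub> f x" and "ratmod V"
  shows "restrict f (carrier V) \<in> linear_maps V W"
  using assms by (auto simp: linear_maps_def)

lemma lm_zero:
  assumes "f \<in> linear_maps V W" "ratmod V" "ratmod W"
  shows "f \<zero>\<^bsub>V\<^esub> = \<zero>\<^bsub>W\<^esub>"
  using lm_smult[OF assms(1), of "\<zero>\<^bsub>V\<^esub>" 0] assms lm_closed[OF assms(1)] by simp

lemma lm_finsum:
  assumes f: "f \<in> linear_maps V W" and V: "ratmod V" and W: "ratmod W" and "finite I"
    and z: "z \<in> I \<rightarrow> carrier V"
  shows "f (\<Oplus>\<^bsub>V\<^esub>i\<in>I. z i) = (\<Oplus>\<^bsub>W\<^esub>i\<in>I. f (z i))"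
  using \<open>finite I\<close> z
proof (induction I)
  case empty
  then show ?case
    using lm_zero[OF f V W] by (simp add: rm_finsum_empty V W)
next
  case (insert i I)
  then have "f (\<Oplus>\<^bsub>V\<^esub>i\<in>insert i I. z i) = f (z i) \<oplus>\<^bsub>W\<^esub> f (\<Oplus>\<^bsub>V\<^esub>i\<in>I. z i)"
    using V by (simp add: rm_finsum_insert lm_add[OF f] rm_finsum_closed)
  also have "\<dots> = (\<Oplus>\<^bsub>W\<^esub>i\<in>insert i I. f (z i))"
    using insert W lm_closed[OF f] by (subst rm_finsum_insert) auto
  finally show ?case .
qed

lemma rat_vect_simps [simp]:
  "V \<in> Obj rat_vect \<longleftrightarrow> ratmod V"
  "Hom rat_vect = linear_maps"
  "Ident rat_vect V = (\<lambda>x\<in>carrier V. x)"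
  "Comp rat_vect U V W g f = compose (carrier U) g f"
  by (simp_all add: rat_vect_def)

lemma iso_in_rat_vect:
  assumes V: "ratmod V" and W: "ratmod W" and f: "f \<in> linear_maps V W"
    and b: "bij_betw f (carrier V) (carrier W)"
  shows "iso_in rat_vect V W f"
proof -
  define g where "g = the_inv_into (carrier V) f"
  have g: "g y \<in> carrier V" "f (g y) = y" if "y \<in> carrier W" for y
    using b that by (auto simp: g_def bij_betw_def the_inv_into_into f_the_inv_into_f)
  have gf: "g (f x) = x" if "x \<in> carrier V" for x
    using b that by (auto simp: g_def bij_betw_def the_inv_into_f_f)
  have "restrict g (carrier W) \<in> linear_maps W V"
  proof (rule linear_mapsI)
    show "g (x \<oplus>\<^bsub>W\<^esub> y) = g x \<oplus>\<^bsub>V\<^esub> g y" if "x \<in> carrier W" "y \<in> carrier W" for x y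
      using that g V gf[of "g x \<oplus>\<^bsub>V\<^esub> g y"] by (simp add: lm_add[OF f])
    show "g (c \<odot>\<^bsub>W\<^esub> x) = c \<odot>\<^bsub>V\<^esub> g x" if "x \<in> carrier W" for x c
      using that g V gf[of "c \<odot>\<^bsub>V\<^esub> g x"] by (simp add: lm_smult[OF f])
  qed (use W g in auto)
  then show ?thesis
    unfolding iso_in_def using f g gf lm_closed[OF f]
    by (auto simp: compose_def intro!: bexI[of _ "restrict g (carrier W)"] restrict_ext)
qed

lemma zero_linear_map:
  "\<lbrakk>ratmod V; ratmod W\<rbrakk> \<Longrightarrow> (\<lambda>x\<in>carrier V. \<zero>\<^bsub>W\<^esub>) \<in> linear_maps V W"
  by (rule linear_mapsI) auto

lemma id_linear_map: "ratmod V \<Longrightarrow> (\<lambda>x\<in>carrier V. x) \<in> linear_maps V V"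
  by (rule linear_mapsI) auto

lemma comp_linear_map:
  assumes "f \<in> linear_maps U V" "g \<in> linear_maps V W" "ratmod U"
  shows "(\<lambda>x\<in>carrier U. g (f x)) \<in> linear_maps U W"
  using assms by (auto intro!: linear_mapsI simp: linear_mapsD)

lemma category_rat_vect: "category rat_vect"
proof (unfold_locales, goal_cases)
  case (1 X)
  then show ?case by (simp add: id_linear_map)
next
  case (2 X Y Z f g)
  then show ?case
    by (simp add: compose_def comp_linear_map)
next
  case (3 X Y f)
  then show ?case
    by (auto intro!: extensionalityI[where A = "carrier X"] simp: compose_def lm_ext lm_closed)
next
  case (4 X Y f)
  then show ?case
    by (auto intro!: extensionalityI[where A = "carrier X"] simp: compose_def lm_ext lm_closed)
next
  case (5 W X Y Z f g h)
  then show ?case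
    by (auto simp: compose_def lm_closed intro!: restrict_ext)
qed

text \<open>The identity and the zero endomorphism of a terminal space are both maps into it, hence
  equal, which forces every vector to be zero.\<close>

lemma is_terminal_rat_vect:
  "is_terminal rat_vect V \<longleftrightarrow> ratmod V \<and> carrier V = {\<zero>\<^bsub>V\<^esub>}"
proof
  assume V: "is_terminal rat_vect V"
  then have "ratmod V" by (simp add: is_terminal_def)
  moreover have "x = \<zero>\<^bsub>V\<^esub>" if "x \<in> carrier V" for x
  proof -
    have "\<exists>!f. f \<in> linear_maps V V"
      using V unfolding is_terminal_def rat_vect_simps(2) by blast
    then have "(\<lambda>x\<in>carrier V. x) = (\<lambda>x\<in>carrier V. \<zero>\<^bsub>V\<^esub>)"
      using zero_linear_map[of V V] id_linear_map[of V] \<open>ratmod V\<close> by blast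
    then show ?thesis using that by (metis restrict_apply')
  qed
  ultimately show "ratmod V \<and> carrier V = {\<zero>\<^bsub>V\<^esub>}" by auto
next
  assume V: "ratmod V \<and> carrier V = {\<zero>\<^bsub>V\<^esub>}"
  have "\<exists>!f. f \<in> linear_maps X V" if "ratmod X" for X :: "(rat, 'a) module"
  proof (rule ex1I)
    show "(\<lambda>x\<in>carrier X. \<zero>\<^bsub>V\<^esub>) \<in> linear_maps X V"
      using V that by (intro zero_linear_map) auto
    show "f = (\<lambda>x\<in>carrier X. \<zero>\<^bsub>V\<^esub>)" if "f \<in> linear_maps X V" for f
      using lm_ext[OF that] lm_closed[OF that] V by (auto intro: extensionalityI)
  qed
  then show "is_terminal rat_vect V"
    using V by (simp add: is_terminal_def)
qed

definition eigenspace :: "(rat, 'v) module \<Rightarrow> ('v \<Rightarrow> 'v) \<Rightarrow> rat \<Rightarrow> 'v set" where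
  "eigenspace V a l = {x \<in> carrier V. a x = l \<odot>\<^bsub>V\<^esub> x}"

lemma eigenspaceD: "x \<in> eigenspace V a l \<Longrightarrow> x \<in> carrier V \<and> a x = l \<odot>\<^bsub>V\<^esub> x"
  by (simp add: eigenspace_def)

lemma ratmod_submodule:
  assumes V: "ratmod V" and "S \<subseteq> carrier V" "\<zero>\<^bsub>V\<^esub> \<in> S"
    and add: "\<And>x y. \<lbrakk>x \<in> S; y \<in> S\<rbrakk> \<Longrightarrow> x \<oplus>\<^bsub>V\<^esub> y \<in> S"
    and smult: "\<And>c x. x \<in> S \<Longrightarrow> c \<odot>\<^bsub>V\<^esub> x \<in> S"
  shows "ratmod (V\<lparr>carrier := S\<rparr>)"
proof (rule ratmodI)
  have "\<exists>y\<in>S. y \<oplus>\<^bsub>V\<^esub> x = \<zero>\<^bsub>V\<^esub>" if "x \<in> S" for x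
    using assms that rm_neg[OF V, of x] by (intro bexI[of _ "(-1) \<odot>\<^bsub>V\<^esub> x"]) (auto simp: rm_comm)
  then show "abelian_group (V\<lparr>carrier := S\<rparr>)"
    using assms by (intro abelian_groupI) (auto simp: subset_iff rm_assoc intro: rm_comm)
qed (use assms in \<open>auto simp: subset_iff rm_smult_add rm_add_smult\<close>)

lemma ratmod_eigenspace:
  assumes V: "ratmod V" and a: "a \<in> linear_maps V V"
  shows "ratmod (V\<lparr>carrier := eigenspace V a l\<rparr>)"
  by (rule ratmod_submodule[OF V])
    (auto simp: eigenspace_def V lm_zero[OF a] lm_add[OF a] lm_smult[OF a] rm_smult_add mult.commute)

text \<open>
  Elements of a product of vector spaces are tested with the kernel of both projections instead of
  the one-dimensional space, which need not exist in the universe.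
\<close>

lemma is_binary_product_rat_vect:
  assumes X: "ratmod X" and Y: "ratmod Y" and P: "ratmod P"
    and p: "p \<in> linear_maps P X" and q: "q \<in> linear_maps P Y"
  shows "is_binary_product rat_vect X Y P p q \<longleftrightarrow>
    (\<forall>x \<in> carrier X. \<forall>y \<in> carrier Y. \<exists>z \<in> carrier P. p z = x \<and> q z = y) \<and>
    (\<forall>z \<in> carrier P. p z = \<zero>\<^bsub>X\<^esub> \<and> q z = \<zero>\<^bsub>Y\<^esub> \<longrightarrow> z = \<zero>\<^bsub>P\<^esub>)" (is "_ \<longleftrightarrow> ?surj \<and> ?inj")
proof
  assume prod: "is_binary_product rat_vect X Y P p q"
  have ex: "\<exists>u. u \<in> linear_maps Z P \<and> compose (carrier Z) p u = f \<and> compose (carrier Z) q u = g"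
    and un: "\<And>u v. \<lbrakk>u \<in> linear_maps Z P; v \<in> linear_maps Z P;
      compose (carrier Z) p u = f \<and> compose (carrier Z) q u = g;
      compose (carrier Z) p v = f \<and> compose (carrier Z) q v = g\<rbrakk> \<Longrightarrow> u = v"
    if "ratmod Z" "f \<in> linear_maps Z X" "g \<in> linear_maps Z Y" for Z f g
  proof -
    have "Z \<in> Obj rat_vect" using that by simp
    then have *: "\<exists>!u. u \<in> linear_maps Z P \<and> compose (carrier Z) p u = f \<and> compose (carrier Z) q u = g"
      using prod that unfolding is_binary_product_def rat_vect_simps(2,4) by blast
    then show "\<exists>u. u \<in> linear_maps Z P \<and> compose (carrier Z) p u = f \<and> compose (carrier Z) q u = g"
      by blast
    show "u = v" if "u \<in> linear_maps Z P" "v \<in> linear_maps Z P"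
      "compose (carrier Z) p u = f \<and> compose (carrier Z) q u = g"
      "compose (carrier Z) p v = f \<and> compose (carrier Z) q v = g" for u v
      using * that by blast
  qed
  \<comment> \<open>\<open>u\<close> and \<open>v\<close> are the two injections of the summands,
    produced by testing the universal property on X and on Y themselves.\<close>
  obtain u where u: "u \<in> linear_maps X P" "compose (carrier X) p u = (\<lambda>x\<in>carrier X. x)"
    "compose (carrier X) q u = (\<lambda>x\<in>carrier X. \<zero>\<^bsub>Y\<^esub>)"
    using ex[OF X id_linear_map[OF X] zero_linear_map[OF X Y]] by auto
  obtain v where v: "v \<in> linear_maps Y P" "compose (carrier Y) p v = (\<lambda>x\<in>carrier Y. \<zero>\<^bsub>X\<^esub>)"
    "compose (carrier Y) q v = (\<lambda>x\<in>carrier Y. x)"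
    using ex[OF Y zero_linear_map[OF Y X] id_linear_map[OF Y]] by auto
  have pu: "p (u x) = x" "q (u x) = \<zero>\<^bsub>Y\<^esub>" if "x \<in> carrier X" for x
    using fun_cong[OF u(2), of x] fun_cong[OF u(3), of x] that by (auto simp: compose_def)
  have pv: "p (v x) = \<zero>\<^bsub>X\<^esub>" "q (v x) = x" if "x \<in> carrier Y" for x
    using fun_cong[OF v(2), of x] fun_cong[OF v(3), of x] that by (auto simp: compose_def)
  have ?surj
  proof (intro ballI)
    fix x y assume "x \<in> carrier X" "y \<in> carrier Y"
    then show "\<exists>z\<in>carrier P. p z = x \<and> q z = y"
      using pu pv lm_closed[OF u(1)] lm_closed[OF v(1)] P X Y
      by (intro bexI[of _ "u x \<oplus>\<^bsub>P\<^esub> v y"]) (simp_all add: lm_add[OF p] lm_add[OF q])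
  qed
  moreover have ?inj
  proof (intro ballI impI)
    fix z assume z: "z \<in> carrier P" "p z = \<zero>\<^bsub>X\<^esub> \<and> q z = \<zero>\<^bsub>Y\<^esub>"
    define S where "S = {z \<in> carrier P. p z = \<zero>\<^bsub>X\<^esub> \<and> q z = \<zero>\<^bsub>Y\<^esub>}"
    have Z: "ratmod (P\<lparr>carrier := S\<rparr>)"
      by (rule ratmod_submodule[OF P]) (auto simp: S_def P X Y lm_add[OF p] lm_add[OF q]
          lm_smult[OF p] lm_smult[OF q] lm_zero[OF p P X] lm_zero[OF q P Y])
    have "restrict (\<lambda>x. x) (carrier (P\<lparr>carrier := S\<rparr>)) \<in> linear_maps (P\<lparr>carrier := S\<rparr>) P"
      "restrict (\<lambda>x. \<zero>\<^bsub>P\<^esub>) (carrier (P\<lparr>carrier := S\<rparr>)) \<in> linear_maps (P\<lparr>carrier := S\<rparr>) P"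
      by (rule linear_mapsI; use P Z in \<open>auto simp: S_def\<close>)+
    then have "restrict (\<lambda>x. x) (carrier (P\<lparr>carrier := S\<rparr>)) =
        restrict (\<lambda>x. \<zero>\<^bsub>P\<^esub>) (carrier (P\<lparr>carrier := S\<rparr>))"
      by (intro un[OF Z zero_linear_map[OF Z X] zero_linear_map[OF Z Y]])
        (auto simp: compose_def S_def lm_zero[OF p P X] lm_zero[OF q P Y])
    moreover have "z \<in> carrier (P\<lparr>carrier := S\<rparr>)"
      using z by (simp add: S_def)
    ultimately show "z = \<zero>\<^bsub>P\<^esub>"
      by (metis restrict_apply')
  qed
  ultimately show "?surj \<and> ?inj" ..
next
  assume *: "?surj \<and> ?inj"
  have uniq: "z = w" if "z \<in> carrier P" "w \<in> carrier P" "p z = p w" "q z = q w" for z w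
  proof (rule rm_diff_eq_zero[OF P that(1,2)])
    have "p (z \<oplus>\<^bsub>P\<^esub> (-1) \<odot>\<^bsub>P\<^esub> w) = \<zero>\<^bsub>X\<^esub>" "q (z \<oplus>\<^bsub>P\<^esub> (-1) \<odot>\<^bsub>P\<^esub> w) = \<zero>\<^bsub>Y\<^esub>"
      using that P X Y lm_closed[OF p] lm_closed[OF q]
      by (simp_all add: lm_add[OF p] lm_add[OF q] lm_smult[OF p] lm_smult[OF q] rm_neg)
    then show "z \<oplus>\<^bsub>P\<^esub> (-1) \<odot>\<^bsub>P\<^esub> w = \<zero>\<^bsub>P\<^esub>"
      using * that P by simp
  qed
  obtain s where s: "\<And>x y. \<lbrakk>x \<in> carrier X; y \<in> carrier Y\<rbrakk> \<Longrightarrow>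
      s x y \<in> carrier P \<and> p (s x y) = x \<and> q (s x y) = y"
    using * by metis
  have "\<exists>!u. u \<in> linear_maps Z P \<and> compose (carrier Z) p u = f \<and> compose (carrier Z) q u = g"
    if Z: "ratmod Z" and f: "f \<in> linear_maps Z X" and g: "g \<in> linear_maps Z Y" for Z f g
  proof (rule ex1I, intro conjI)
    \<comment> \<open>The joint preimage \<open>s\<close> is merely chosen; it becomes linear
      because a vector of P is determined by its two projections.\<close>
    show "(\<lambda>z\<in>carrier Z. s (f z) (g z)) \<in> linear_maps Z P"
    proof (rule linear_mapsI)
      fix x y c assume "x \<in> carrier Z" "y \<in> carrier Z"
      note [simp] = this s Z P X Y lm_closed[OF f] lm_closed[OF g] lm_add[OF f] lm_add[OF g]
        lm_smult[OF f] lm_smult[OF g] lm_add[OF p] lm_add[OF q] lm_smult[OF p] lm_smult[OF q]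
      show "s (f (x \<oplus>\<^bsub>Z\<^esub> y)) (g (x \<oplus>\<^bsub>Z\<^esub> y)) = s (f x) (g x) \<oplus>\<^bsub>P\<^esub> s (f y) (g y)"
        by (rule uniq) simp_all
    next
      fix x c assume "x \<in> carrier Z"
      note [simp] = this s Z P X Y lm_closed[OF f] lm_closed[OF g]
        lm_smult[OF f] lm_smult[OF g] lm_smult[OF p] lm_smult[OF q]
      show "s (f (c \<odot>\<^bsub>Z\<^esub> x)) (g (c \<odot>\<^bsub>Z\<^esub> x)) = c \<odot>\<^bsub>P\<^esub> s (f x) (g x)"
        by (rule uniq) simp_all
    qed (use s Z lm_closed[OF f] lm_closed[OF g] in auto)
    show "compose (carrier Z) p (\<lambda>z\<in>carrier Z. s (f z) (g z)) = f"
      "compose (carrier Z) q (\<lambda>z\<in>carrier Z. s (f z) (g z)) = g"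
      using s lm_closed[OF f] lm_closed[OF g] lm_ext[OF f] lm_ext[OF g]
      by (auto simp: compose_def intro!: extensionalityI[where A = "carrier Z"])
  next
    fix u assume u: "u \<in> linear_maps Z P \<and> compose (carrier Z) p u = f \<and> compose (carrier Z) q u = g"
    then have u1: "u \<in> linear_maps Z P" by simp
    have pu: "p (u z) = f z" "q (u z) = g z" if "z \<in> carrier Z" for z
      using u that by (auto simp: compose_def)
    show "u = (\<lambda>z\<in>carrier Z. s (f z) (g z))"
    proof (rule extensionalityI[OF lm_ext[OF u1]])
      fix z assume z: "z \<in> carrier Z"
      have "u z = s (f z) (g z)"
        by (rule uniq) (use s lm_closed[OF f z] lm_closed[OF g z] lm_closed[OF u1 z] pu[OF z] in auto)
      then show "u z = (\<lambda>z\<in>carrier Z. s (f z) (g z)) z"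
        using z by simp
    qed simp
  qed
  then show "is_binary_product rat_vect X Y P p q"
    using X Y P p q by (simp add: is_binary_product_def)
qed

subsection \<open>Decomposition into eigenspaces\<close>

lemma rm_add_eq_zero:
  assumes V: "ratmod V" and x: "x \<in> carrier V" and y: "y \<in> carrier V" and "x \<oplus>\<^bsub>V\<^esub> y = \<zero>\<^bsub>V\<^esub>"
  shows "y = (-1) \<odot>\<^bsub>V\<^esub> x"
proof (rule rm_diff_eq_zero[OF V])
  show "y \<oplus>\<^bsub>V\<^esub> (-1) \<odot>\<^bsub>V\<^esub> ((-1) \<odot>\<^bsub>V\<^esub> x) = \<zero>\<^bsub>V\<^esub>"
    using assms by (simp add: rm_comm)
qed (use assms in auto)

lemma zero_in_eigenspace:
  assumes "ratmod V" "a \<in> linear_maps V V"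
  shows "\<zero>\<^bsub>V\<^esub> \<in> eigenspace V a l"
  using assms by (simp add: eigenspace_def lm_zero)

lemma smult_in_eigenspace:
  assumes "ratmod V" "a \<in> linear_maps V V" "x \<in> eigenspace V a l"
  shows "c \<odot>\<^bsub>V\<^esub> x \<in> eigenspace V a l"
  using assms by (simp add: eigenspace_def lm_smult mult.commute)

lemma add_in_eigenspace:
  assumes "ratmod V" "a \<in> linear_maps V V" "x \<in> eigenspace V a l" "y \<in> eigenspace V a l"
  shows "x \<oplus>\<^bsub>V\<^esub> y \<in> eigenspace V a l"
  using assms by (simp add: eigenspace_def lm_add rm_smult_add)

lemma map_in_eigenspace:
  assumes "f \<in> linear_maps V W" "x \<in> eigenspace V a l"
    and "\<And>x. x \<in> carrier V \<Longrightarrow> b (f x) = f (a x)"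
  shows "f x \<in> eigenspace W b l"
  using assms by (simp add: eigenspace_def lm_smult lm_closed)

text \<open>Apply \<open>a - l d\<close> to the vanishing sum: the summand at d disappears, the
  others are multiplied by the nonzero factors \<open>l i - l d\<close>, and the induction
  hypothesis applies to these multiples.\<close>

lemma eigen_independent:
  assumes V: "ratmod V" and a: "a \<in> linear_maps V V" and "finite I" "inj_on l I"
    and "\<And>i. i \<in> I \<Longrightarrow> z i \<in> eigenspace V a (l i)" "(\<Oplus>\<^bsub>V\<^esub>i\<in>I. z i) = \<zero>\<^bsub>V\<^esub>" "i \<in> I"
  shows "z i = \<zero>\<^bsub>V\<^esub>"
  using assms(3-)
proof (induction I arbitrary: z i)
  case (insert d I)
  have z: "z i \<in> carrier V" "a (z i) = l i \<odot>\<^bsub>V\<^esub> z i" if "i \<in> insert d I" for i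
    using insert.prems(2)[OF that] by (auto dest: eigenspaceD)
  define S where "S = (\<Oplus>\<^bsub>V\<^esub>i\<in>I. z i)"
  have S: "S \<in> carrier V"
    unfolding S_def using z by (intro rm_finsum_closed[OF V]) auto
  have sum: "z d \<oplus>\<^bsub>V\<^esub> S = \<zero>\<^bsub>V\<^esub>"
    using insert.hyps insert.prems z by (simp add: S_def rm_finsum_insert[OF V])
  have S': "S = (-1) \<odot>\<^bsub>V\<^esub> z d"
    using sum z S by (intro rm_add_eq_zero[OF V]) auto
  have "(\<Oplus>\<^bsub>V\<^esub>i\<in>I. (l i - l d) \<odot>\<^bsub>V\<^esub> z i) = (\<Oplus>\<^bsub>V\<^esub>i\<in>I. a (z i) \<oplus>\<^bsub>V\<^esub> (- l d) \<odot>\<^bsub>V\<^esub> z i)"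
    using V z by (intro rm_finsum_cong[OF V]) (auto simp: rm_add_smult[symmetric])
  also have "\<dots> = a S \<oplus>\<^bsub>V\<^esub> (- l d) \<odot>\<^bsub>V\<^esub> S"
    unfolding S_def using V z insert.hyps
    by (subst rm_finsum_add) (auto simp: lm_finsum[OF a V V] rm_finsum_smult)
  also have "a S = (- l d) \<odot>\<^bsub>V\<^esub> z d"
    using V z[of d] by (simp add: S' lm_smult[OF a])
  also have "(- l d) \<odot>\<^bsub>V\<^esub> z d \<oplus>\<^bsub>V\<^esub> (- l d) \<odot>\<^bsub>V\<^esub> S = \<zero>\<^bsub>V\<^esub>"
    using V z[of d] S sum by (simp add: rm_smult_add[symmetric])
  finally have "(\<Oplus>\<^bsub>V\<^esub>i\<in>I. (l i - l d) \<odot>\<^bsub>V\<^esub> z i) = \<zero>\<^bsub>V\<^esub>" .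
  note sum' = this
  have *: "(l i - l d) \<odot>\<^bsub>V\<^esub> z i = \<zero>\<^bsub>V\<^esub>" if "i \<in> I" for i
    by (rule insert.IH[of "\<lambda>i. (l i - l d) \<odot>\<^bsub>V\<^esub> z i" i])
      (use insert.prems sum' that in \<open>auto intro!: smult_in_eigenspace[OF V a] intro: inj_on_subset\<close>)
  have zI: "z i = \<zero>\<^bsub>V\<^esub>" if "i \<in> I" for i
  proof (rule rm_smult_cancel[OF V])
    show "(l i - l d) \<odot>\<^bsub>V\<^esub> z i = 0 \<odot>\<^bsub>V\<^esub> z i"
      using *[OF that] z that V by simp
    show "l i - l d \<noteq> 0"
      using insert.hyps(2) insert.prems(1) that by (metis inj_onD insertI1 insertI2 right_minus_eq)
  qed (use z that in auto)
  then have "S = (\<Oplus>\<^bsub>V\<^esub>i\<in>I. \<zero>\<^bsub>V\<^esub>)"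
    unfolding S_def using V by (intro rm_finsum_cong[OF V]) auto
  then have "z d = \<zero>\<^bsub>V\<^esub>"
    using sum V z[of d] by (simp add: rm_finsum_zero)
  then show ?case
    using zI insert.prems by auto
qed simp

text \<open>A condition on single vectors instead of a direct sum of subspaces. It is stable under
  addition, under maps commuting with the operators and under enlarging I, which are the closure
  properties that the induction over G-sets needs.\<close>

definition eigen_sum :: "(rat, 'v) module \<Rightarrow> ('v \<Rightarrow> 'v) \<Rightarrow> 'i set \<Rightarrow> ('i \<Rightarrow> rat) \<Rightarrow> 'v \<Rightarrow> bool" where
  "eigen_sum V a I l x \<longleftrightarrow> (\<exists>z. (\<forall>i\<in>I. z i \<in> eigenspace V a (l i)) \<and> x = (\<Oplus>\<^bsub>V\<^esub>i\<in>I. z i))"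

lemma eigen_sum_add:
  assumes V: "ratmod V" and a: "a \<in> linear_maps V V"
    and "eigen_sum V a I l x" "eigen_sum V a I l y"
  shows "eigen_sum V a I l (x \<oplus>\<^bsub>V\<^esub> y)"
proof -
  obtain z w where *: "\<forall>i\<in>I. z i \<in> eigenspace V a (l i)" "x = (\<Oplus>\<^bsub>V\<^esub>i\<in>I. z i)"
    "\<forall>i\<in>I. w i \<in> eigenspace V a (l i)" "y = (\<Oplus>\<^bsub>V\<^esub>i\<in>I. w i)"
    using assms by (auto simp: eigen_sum_def)
  then have "z \<in> I \<rightarrow> carrier V" "w \<in> I \<rightarrow> carrier V"
    by (auto dest: eigenspaceD)
  with * show ?thesis
    unfolding eigen_sum_def using V a
    by (intro exI[of _ "\<lambda>i. z i \<oplus>\<^bsub>V\<^esub> w i"]) (simp add: rm_finsum_add add_in_eigenspace)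
qed

lemma eigen_sum_map:
  assumes V: "ratmod V" and W: "ratmod W" and f: "f \<in> linear_maps V W" and "finite I"
    and "\<And>x. x \<in> carrier V \<Longrightarrow> b (f x) = f (a x)" and "eigen_sum V a I l x"
  shows "eigen_sum W b I l (f x)"
proof -
  obtain z where *: "\<forall>i\<in>I. z i \<in> eigenspace V a (l i)" "x = (\<Oplus>\<^bsub>V\<^esub>i\<in>I. z i)"
    using assms by (auto simp: eigen_sum_def)
  then have "f x = (\<Oplus>\<^bsub>W\<^esub>i\<in>I. f (z i))"
    using assms by (auto intro!: lm_finsum dest: eigenspaceD)
  moreover have "f (z i) \<in> eigenspace W b (l i)" if "i \<in> I" for i
    by (rule map_in_eigenspace[OF f]) (use assms(5) * that in auto)
  ultimately show ?thesis
    unfolding eigen_sum_def by (intro exI[of _ "\<lambda>i. f (z i)"]) auto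
qed

lemma eigen_sum_mono:
  assumes V: "ratmod V" and a: "a \<in> linear_maps V V" and J: "finite J" "I \<subseteq> J"
    and "eigen_sum V a I l x"
  shows "eigen_sum V a J l x"
proof -
  obtain z where *: "\<forall>i\<in>I. z i \<in> eigenspace V a (l i)" "x = (\<Oplus>\<^bsub>V\<^esub>i\<in>I. z i)"
    using assms by (auto simp: eigen_sum_def)
  then have "x = (\<Oplus>\<^bsub>V\<^esub>i\<in>J. if i \<in> I then z i else \<zero>\<^bsub>V\<^esub>)"
    by (subst rm_finsum_mono[OF V J]) (auto dest: eigenspaceD)
  with * show ?thesis
    unfolding eigen_sum_def
    by (intro exI[of _ "\<lambda>i. if i \<in> I then z i else \<zero>\<^bsub>V\<^esub>"]) (auto intro: zero_in_eigenspace[OF V a])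
qed

text \<open>If \<open>(a - l d) x\<close> is a sum of eigenvectors with other eigenvalues, divide by \<open>l i - l d\<close>.\<close>

lemma eigen_sum_step:
  assumes V: "ratmod V" and a: "a \<in> linear_maps V V" and I: "finite I" "d \<notin> I" "l d \<notin> l ` I"
    and x: "x \<in> carrier V" and ax: "a x = l d \<odot>\<^bsub>V\<^esub> x \<oplus>\<^bsub>V\<^esub> y" and "eigen_sum V a I l y"
  shows "eigen_sum V a (insert d I) l x"
proof -
  obtain z where z: "\<forall>i\<in>I. z i \<in> eigenspace V a (l i)" "y = (\<Oplus>\<^bsub>V\<^esub>i\<in>I. z i)"
    using assms by (auto simp: eigen_sum_def)
  have zc: "z i \<in> carrier V" "a (z i) = l i \<odot>\<^bsub>V\<^esub> z i" if "i \<in> I" for i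
    using z(1) that by (auto dest: eigenspaceD)
  define w where "w i = (1 / (l i - l d)) \<odot>\<^bsub>V\<^esub> z i" for i
  have w: "w i \<in> eigenspace V a (l i)" "w i \<in> carrier V" if "i \<in> I" for i
    using z(1) zc that V by (auto simp: w_def intro: smult_in_eigenspace[OF V a])
  define u where "u = (\<Oplus>\<^bsub>V\<^esub>i\<in>I. w i)"
  have u: "u \<in> carrier V"
    unfolding u_def using w by (intro rm_finsum_closed[OF V]) auto
  have y: "y \<in> carrier V"
    unfolding z(2) using zc by (intro rm_finsum_closed[OF V]) auto
  have "a (w i) \<oplus>\<^bsub>V\<^esub> (- l d) \<odot>\<^bsub>V\<^esub> w i = z i" if "i \<in> I" for i
  proof -
    have "l i - l d \<noteq> 0" using I(3) that by (metis imageI right_minus_eq)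
    have "a (w i) \<oplus>\<^bsub>V\<^esub> (- l d) \<odot>\<^bsub>V\<^esub> w i = l i \<odot>\<^bsub>V\<^esub> w i \<oplus>\<^bsub>V\<^esub> (- l d) \<odot>\<^bsub>V\<^esub> w i"
      using w[OF that] by (auto dest: eigenspaceD)
    also have "\<dots> = (l i - l d) \<odot>\<^bsub>V\<^esub> w i"
      using w[OF that] V by (simp add: rm_add_smult[symmetric])
    also have "\<dots> = z i"
      using \<open>l i - l d \<noteq> 0\<close> V zc that by (simp add: w_def)
    finally show ?thesis .
  qed
  then have "y = (\<Oplus>\<^bsub>V\<^esub>i\<in>I. a (w i) \<oplus>\<^bsub>V\<^esub> (- l d) \<odot>\<^bsub>V\<^esub> w i)"
    unfolding z(2) using V zc by (intro rm_finsum_cong) auto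
  also have "\<dots> = a u \<oplus>\<^bsub>V\<^esub> (- l d) \<odot>\<^bsub>V\<^esub> u"
    unfolding u_def using V w I lm_closed[OF a]
    by (subst rm_finsum_add) (auto simp: lm_finsum[OF a V V] rm_finsum_smult)
  finally have y_eq: "y = a u \<oplus>\<^bsub>V\<^esub> (- l d) \<odot>\<^bsub>V\<^esub> u" .
  \<comment> \<open>By the preceding equation \<open>u\<close> solves
    \<open>(a - l d) u = y\<close>, and so does x by assumption; their difference is therefore an
    eigenvector for \<open>l d\<close>.\<close>
  define v where "v = x \<oplus>\<^bsub>V\<^esub> (-1) \<odot>\<^bsub>V\<^esub> u"
  have "a v = l d \<odot>\<^bsub>V\<^esub> x \<oplus>\<^bsub>V\<^esub> (a u \<oplus>\<^bsub>V\<^esub> (- l d) \<odot>\<^bsub>V\<^esub> u) \<oplus>\<^bsub>V\<^esub> (-1) \<odot>\<^bsub>V\<^esub> a u"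
    using V x u ax y_eq by (simp add: v_def lm_add[OF a] lm_smult[OF a])
  also have "\<dots> = l d \<odot>\<^bsub>V\<^esub> x \<oplus>\<^bsub>V\<^esub> ((- l d) \<odot>\<^bsub>V\<^esub> u \<oplus>\<^bsub>V\<^esub> a u \<oplus>\<^bsub>V\<^esub> (-1) \<odot>\<^bsub>V\<^esub> a u)"
    using V x u lm_closed[OF a u] by (simp add: rm_assoc rm_comm[OF V, of "a u"])
  also have "\<dots> = l d \<odot>\<^bsub>V\<^esub> x \<oplus>\<^bsub>V\<^esub> (- l d) \<odot>\<^bsub>V\<^esub> u"
    using V u lm_closed[OF a u] by (simp add: rm_cancel)
  also have "\<dots> = l d \<odot>\<^bsub>V\<^esub> v"
    using V x u by (simp add: v_def rm_smult_add)
  finally have v: "v \<in> eigenspace V a (l d)"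
    using V x u by (simp add: eigenspace_def v_def)
  have "x = v \<oplus>\<^bsub>V\<^esub> u"
    using V x u rm_neg[OF V u] by (simp add: v_def rm_assoc rm_comm[OF V, of _ u])
  also have "\<dots> = (\<Oplus>\<^bsub>V\<^esub>i\<in>insert d I. if i = d then v else w i)"
  proof -
    have "(\<Oplus>\<^bsub>V\<^esub>i\<in>I. if i = d then v else w i) = u"
      unfolding u_def using V I w by (intro rm_finsum_cong) auto
    then show ?thesis
      using V I w v by (subst rm_finsum_insert) (auto dest: eigenspaceD)
  qed
  finally show ?thesis
    unfolding eigen_sum_def using w v I(2)
    by (intro exI[of _ "\<lambda>i. if i = d then v else w i"]) auto
qed

locale eigen_decomposition =
  fixes V :: "(rat, 'v) module" and a :: "'v \<Rightarrow> 'v" and I :: "'i set" and l :: "'i \<Rightarrow> rat"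
  assumes V: "ratmod V" and a: "a \<in> linear_maps V V" and fin: "finite I" and inj: "inj_on l I"
    and sums: "x \<in> carrier V \<Longrightarrow> eigen_sum V a I l x"
begin

definition eproj :: "'v \<Rightarrow> 'i \<Rightarrow> 'v" where
  "eproj x = (SOME z. (\<forall>i\<in>I. z i \<in> eigenspace V a (l i)) \<and> x = (\<Oplus>\<^bsub>V\<^esub>i\<in>I. z i))"

lemma eproj:
  assumes "x \<in> carrier V"
  shows eproj_in: "i \<in> I \<Longrightarrow> eproj x i \<in> eigenspace V a (l i)"
    and eproj_sum: "(\<Oplus>\<^bsub>V\<^esub>i\<in>I. eproj x i) = x"
  using someI_ex[OF sums[OF assms, unfolded eigen_sum_def]] unfolding eproj_def by auto

lemma eproj_carrier: "x \<in> carrier V \<Longrightarrow> eproj x \<in> I \<rightarrow> carrier V"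
  using eproj_in by (auto dest: eigenspaceD)

text \<open>Two decompositions of x differ by eigenvectors with sum zero, which vanish by
  independence. Hence the choice in \<open>eproj\<close> is harmless, and each property below is
  proved by exhibiting a decomposition.\<close>

lemma eproj_unique:
  assumes x: "x \<in> carrier V" and z: "\<And>i. i \<in> I \<Longrightarrow> z i \<in> eigenspace V a (l i)"
    and sum: "(\<Oplus>\<^bsub>V\<^esub>i\<in>I. z i) = x" and i: "i \<in> I"
  shows "eproj x i = z i"
proof (rule rm_diff_eq_zero[OF V])
  have zc: "z \<in> I \<rightarrow> carrier V" and pc: "eproj x \<in> I \<rightarrow> carrier V"
    using z x by (auto dest: eigenspaceD eproj_in)
  then show "eproj x i \<in> carrier V" "z i \<in> carrier V"
    using i by auto
  have "(\<Oplus>\<^bsub>V\<^esub>i\<in>I. eproj x i \<oplus>\<^bsub>V\<^esub> (-1) \<odot>\<^bsub>V\<^esub> z i) = x \<oplus>\<^bsub>V\<^esub> (-1) \<odot>\<^bsub>V\<^esub> x"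
    using zc pc x V fin
    by (subst rm_finsum_add) (auto simp: rm_finsum_smult[symmetric] eproj_sum sum Pi_def)
  then have "(\<Oplus>\<^bsub>V\<^esub>i\<in>I. eproj x i \<oplus>\<^bsub>V\<^esub> (-1) \<odot>\<^bsub>V\<^esub> z i) = \<zero>\<^bsub>V\<^esub>"
    using V x by (simp add: rm_neg)
  then show "eproj x i \<oplus>\<^bsub>V\<^esub> (-1) \<odot>\<^bsub>V\<^esub> z i = \<zero>\<^bsub>V\<^esub>"
    by (rule eigen_independent[OF V a fin inj _ _ i, rotated])
      (use z x in \<open>auto intro!: add_in_eigenspace[OF V a] smult_in_eigenspace[OF V a] eproj_in\<close>)
qed

lemma eproj_add:
  assumes "x \<in> carrier V" "y \<in> carrier V" "i \<in> I"
  shows "eproj (x \<oplus>\<^bsub>V\<^esub> y) i = eproj x i \<oplus>\<^bsub>V\<^esub> eproj y i"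
  using assms V eproj_carrier
  by (intro eproj_unique) (auto simp: rm_finsum_add eproj_sum intro!: add_in_eigenspace[OF V a] eproj_in)

lemma eproj_smult:
  assumes "x \<in> carrier V" "i \<in> I"
  shows "eproj (c \<odot>\<^bsub>V\<^esub> x) i = c \<odot>\<^bsub>V\<^esub> eproj x i"
  using assms V fin eproj_carrier
  by (intro eproj_unique) (auto simp: rm_finsum_smult[symmetric] eproj_sum
      intro!: smult_in_eigenspace[OF V a] eproj_in)

lemma eproj_eigen:
  assumes "x \<in> eigenspace V a (l d)" "d \<in> I" "i \<in> I"
  shows "eproj x i = (if i = d then x else \<zero>\<^bsub>V\<^esub>)"
proof -
  have "x \<in> carrier V" using assms(1) by (auto dest: eigenspaceD)
  then show ?thesis
    using assms V fin
    by (intro eproj_unique) (auto simp: rm_finsum_single intro!: zero_in_eigenspace[OF V a])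
qed

end

text \<open>A map commuting with the operators sends the decomposition of x to a decomposition of
  its image, which is the only one. This makes the projections natural in the G-set.\<close>

lemma eproj_map:
  assumes "eigen_decomposition V a I l" "eigen_decomposition W b I l" and f: "f \<in> linear_maps V W"
    and ab: "\<And>x. x \<in> carrier V \<Longrightarrow> b (f x) = f (a x)" and x: "x \<in> carrier V" and i: "i \<in> I"
  shows "eigen_decomposition.eproj W b I l (f x) i = f (eigen_decomposition.eproj V a I l x i)"
proof -
  interpret V: eigen_decomposition V a I l by fact
  interpret W: eigen_decomposition W b I l by fact
  show ?thesis
  proof (rule W.eproj_unique[OF lm_closed[OF f x] _ _ i])
    show "f (V.eproj x i) \<in> eigenspace W b (l i)" if "i \<in> I" for i
      using map_in_eigenspace[OF f V.eproj_in[OF x that] ab] .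
    show "(\<Oplus>\<^bsub>W\<^esub>i\<in>I. f (V.eproj x i)) = f x"
      using lm_finsum[OF f V.V W.V V.fin V.eproj_carrier[OF x]] V.eproj_sum[OF x] by simp
  qed
qed

subsection \<open>Functors to vector spaces\<close>

lemma functor_rat_vectD:
  assumes "is_functor C rat_vect F"
  shows fv_ratmod: "X \<in> Obj C \<Longrightarrow> ratmod (FObj F X)"
    and fv_lm: "\<lbrakk>X \<in> Obj C; Y \<in> Obj C; f \<in> Hom C X Y\<rbrakk>
      \<Longrightarrow> FMap F X Y f \<in> linear_maps (FObj F X) (FObj F Y)"
    and fv_Ident: "\<lbrakk>X \<in> Obj C; x \<in> carrier (FObj F X)\<rbrakk> \<Longrightarrow> FMap F X X (Ident C X) x = x"
    and fv_Comp: "\<lbrakk>X \<in> Obj C; Y \<in> Obj C; Z \<in> Obj C; f \<in> Hom C X Y; g \<in> Hom C Y Z;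
      x \<in> carrier (FObj F X)\<rbrakk> \<Longrightarrow> FMap F X Z (Comp C X Y Z g f) x = FMap F Y Z g (FMap F X Y f x)"
  using is_functorD[OF assms] by (auto simp: compose_def)

lemma functor_rat_vectI:
  assumes "\<And>X. X \<in> Obj C \<Longrightarrow> ratmod (FObj F X)"
    and lm: "\<And>X Y f. \<lbrakk>X \<in> Obj C; Y \<in> Obj C; f \<in> Hom C X Y\<rbrakk>
      \<Longrightarrow> FMap F X Y f \<in> linear_maps (FObj F X) (FObj F Y)"
    and "\<And>X x. \<lbrakk>X \<in> Obj C; x \<in> carrier (FObj F X)\<rbrakk> \<Longrightarrow> FMap F X X (Ident C X) x = x"
    and "\<And>X Y Z f g x. \<lbrakk>X \<in> Obj C; Y \<in> Obj C; Z \<in> Obj C; f \<in> Hom C X Y; g \<in> Hom C Y Z;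
      x \<in> carrier (FObj F X)\<rbrakk> \<Longrightarrow> FMap F X Z (Comp C X Y Z g f) x = FMap F Y Z g (FMap F X Y f x)"
    and "category C"
  shows "is_functor C rat_vect F"
  unfolding is_functor_def
proof (intro conjI ballI)
  show "FMap F X X (Ident C X) = Ident rat_vect (FObj F X)" if "X \<in> Obj C" for X
    using that assms(3) lm_ext[OF lm, of X X] category.Ident_in_Hom[OF assms(5)]
    by (auto intro!: extensionalityI[where A = "carrier (FObj F X)"])
  show "FMap F X Z (Comp C X Y Z g f) =
      Comp rat_vect (FObj F X) (FObj F Y) (FObj F Z) (FMap F Y Z g) (FMap F X Y f)"
    if "X \<in> Obj C" "Y \<in> Obj C" "Z \<in> Obj C" "f \<in> Hom C X Y" "g \<in> Hom C Y Z" for X Y Z f g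
    using that assms(4) lm_ext[OF lm, of X Z] category.Comp_in_Hom[OF assms(5)]
    by (auto intro!: extensionalityI[where A = "carrier (FObj F X)"] simp: compose_def)
qed (use assms in auto)

lemma nat_rat_vectD:
  assumes "nat_trans C rat_vect F K \<alpha>"
  shows nv_lm: "X \<in> Obj C \<Longrightarrow> \<alpha> X \<in> linear_maps (FObj F X) (FObj K X)"
    and nv_nat: "\<lbrakk>X \<in> Obj C; Y \<in> Obj C; f \<in> Hom C X Y; x \<in> carrier (FObj F X)\<rbrakk>
      \<Longrightarrow> \<alpha> Y (FMap F X Y f x) = FMap K X Y f (\<alpha> X x)"
proof -
  show "X \<in> Obj C \<Longrightarrow> \<alpha> X \<in> linear_maps (FObj F X) (FObj K X)"
    using nat_trans_in[OF assms] by simp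
  show "\<alpha> Y (FMap F X Y f x) = FMap K X Y f (\<alpha> X x)"
    if "X \<in> Obj C" "Y \<in> Obj C" "f \<in> Hom C X Y" "x \<in> carrier (FObj F X)"
    using fun_cong[OF nat_trans_nat[OF assms that(1-3)], of x] that(4) by (simp add: compose_def)
qed

lemma nat_rat_vectI:
  assumes "\<And>X. X \<in> Obj C \<Longrightarrow> \<alpha> X \<in> linear_maps (FObj F X) (FObj K X)"
    and "\<And>X Y f x. \<lbrakk>X \<in> Obj C; Y \<in> Obj C; f \<in> Hom C X Y; x \<in> carrier (FObj F X)\<rbrakk>
      \<Longrightarrow> \<alpha> Y (FMap F X Y f x) = FMap K X Y f (\<alpha> X x)"
  shows "nat_trans C rat_vect F K \<alpha>"
  unfolding nat_trans_def using assms by (auto simp: compose_def intro!: restrict_ext)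

section \<open>Eigenspaces of a natural endomorphism as a subfunctor\<close>

definition eigen_functor ::
  "('o, 'm) cat \<Rightarrow> ('o, 'm, (rat, 'v) module, 'v \<Rightarrow> 'v) cfunctor \<Rightarrow> ('o \<Rightarrow> 'v \<Rightarrow> 'v) \<Rightarrow> rat \<Rightarrow>
    ('o, 'm, (rat, 'v) module, 'v \<Rightarrow> 'v) cfunctor" where
  "eigen_functor C F a l =
    \<lparr>FObj = (\<lambda>X. if X \<in> Obj C then (FObj F X)\<lparr>carrier := eigenspace (FObj F X) (a X) l\<rparr> else undefined),
     FMap = (\<lambda>X Y f. if X \<in> Obj C \<and> Y \<in> Obj C \<and> f \<in> Hom C X Y
       then restrict (FMap F X Y f) (eigenspace (FObj F X) (a X) l) else undefined)\<rparr>"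

lemma eigen_functor_simps [simp]:
  "X \<in> Obj C \<Longrightarrow>
    FObj (eigen_functor C F a l) X = (FObj F X)\<lparr>carrier := eigenspace (FObj F X) (a X) l\<rparr>"
  "\<lbrakk>X \<in> Obj C; Y \<in> Obj C; f \<in> Hom C X Y\<rbrakk> \<Longrightarrow>
    FMap (eigen_functor C F a l) X Y f = restrict (FMap F X Y f) (eigenspace (FObj F X) (a X) l)"
  by (simp_all add: eigen_functor_def)

lemma extensional_eigen_functor: "extensional_functor C (eigen_functor C F a l)"
  by (auto simp: extensional_functor_def eigen_functor_def)

locale eigen_endo =
  fixes C :: "('o, 'm) cat" and F :: "('o, 'm, (rat, 'v) module, 'v \<Rightarrow> 'v) cfunctor"
    and a :: "'o \<Rightarrow> 'v \<Rightarrow> 'v"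
  assumes C: "category C" and F: "is_functor C rat_vect F" and a: "nat_trans C rat_vect F F a"
begin

lemma map_eigenspace:
  assumes "X \<in> Obj C" "Y \<in> Obj C" "f \<in> Hom C X Y" "x \<in> eigenspace (FObj F X) (a X) l"
  shows "FMap F X Y f x \<in> eigenspace (FObj F Y) (a Y) l"
  using assms nv_nat[OF a] by (intro map_in_eigenspace[OF fv_lm[OF F]]) auto

lemma is_functor_eigen: "is_functor C rat_vect (eigen_functor C F a l)"
proof (rule functor_rat_vectI[OF _ _ _ _ C])
  show "FMap (eigen_functor C F a l) X Y f
      \<in> linear_maps (FObj (eigen_functor C F a l) X) (FObj (eigen_functor C F a l) Y)"
    if X: "X \<in> Obj C" "Y \<in> Obj C" "f \<in> Hom C X Y" for X Y f
  proof -
    let ?E = "(FObj F X)\<lparr>carrier := eigenspace (FObj F X) (a X) l\<rparr>"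
    have "restrict (FMap F X Y f) (carrier ?E) \<in> linear_maps ?E (FObj (eigen_functor C F a l) Y)"
      using that map_eigenspace lm_add[OF fv_lm[OF F X]] lm_smult[OF fv_lm[OF F X]]
        ratmod_eigenspace[OF fv_ratmod[OF F] nv_lm[OF a]]
      by (intro linear_mapsI) (simp_all add: eigenspaceD)
    then show ?thesis
      using that by simp
  qed
qed (use category.Ident_in_Hom[OF C] category.Comp_in_Hom[OF C] map_eigenspace in
    \<open>auto simp: ratmod_eigenspace[OF fv_ratmod[OF F] nv_lm[OF a]] fv_Ident[OF F] fv_Comp[OF F]
      dest: eigenspaceD\<close>)

text \<open>The endomorphism commutes with both projections, and a vector of the product is
  determined by them; so it is an eigenvector as soon as its two projections are.\<close>

lemma eigen_preserves_product:
  assumes X: "X \<in> Obj C" and Y: "Y \<in> Obj C" and P: "P \<in> Obj C"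
    and p: "p \<in> Hom C P X" and q: "q \<in> Hom C P Y"
    and prod: "is_binary_product rat_vect (FObj F X) (FObj F Y) (FObj F P) (FMap F P X p) (FMap F P Y q)"
  shows "is_binary_product rat_vect (FObj (eigen_functor C F a l) X) (FObj (eigen_functor C F a l) Y)
    (FObj (eigen_functor C F a l) P) (FMap (eigen_functor C F a l) P X p)
    (FMap (eigen_functor C F a l) P Y q)"
proof -
  note E = is_functor_eigen[of l]
  let ?p = "FMap F P X p" and ?q = "FMap F P Y q"
  note V = fv_ratmod[OF F X] fv_ratmod[OF F Y] fv_ratmod[OF F P]
  note lm = fv_lm[OF F P X p] fv_lm[OF F P Y q]
  note [simp] = X Y P p q
  have *: "\<forall>x \<in> carrier (FObj F X). \<forall>y \<in> carrier (FObj F Y). \<exists>z \<in> carrier (FObj F P). ?p z = x \<and> ?q z = y"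
    "\<forall>z \<in> carrier (FObj F P). ?p z = \<zero>\<^bsub>FObj F X\<^esub> \<and> ?q z = \<zero>\<^bsub>FObj F Y\<^esub> \<longrightarrow> z = \<zero>\<^bsub>FObj F P\<^esub>"
    using prod unfolding is_binary_product_rat_vect[OF V lm] by blast+
  have eig: "z \<in> eigenspace (FObj F P) (a P) l" if z: "z \<in> carrier (FObj F P)"
    and pz: "?p z \<in> eigenspace (FObj F X) (a X) l" and qz: "?q z \<in> eigenspace (FObj F Y) (a Y) l" for z
  proof -
    have az: "a P z \<in> carrier (FObj F P)"
      using lm_closed[OF nv_lm[OF a P] z] .
    have "?p (a P z \<oplus>\<^bsub>FObj F P\<^esub> (-1) \<odot>\<^bsub>FObj F P\<^esub> (l \<odot>\<^bsub>FObj F P\<^esub> z)) = \<zero>\<^bsub>FObj F X\<^esub>"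
      using z az pz V nv_nat[OF a P X p z] lm_closed[OF lm(1) z] rm_neg[OF V(1), of "l \<odot>\<^bsub>FObj F X\<^esub> ?p z"]
      by (simp add: lm_add[OF lm(1)] lm_smult[OF lm(1)] eigenspace_def)
    moreover have "?q (a P z \<oplus>\<^bsub>FObj F P\<^esub> (-1) \<odot>\<^bsub>FObj F P\<^esub> (l \<odot>\<^bsub>FObj F P\<^esub> z)) = \<zero>\<^bsub>FObj F Y\<^esub>"
      using z az qz V nv_nat[OF a P Y q z] lm_closed[OF lm(2) z] rm_neg[OF V(2), of "l \<odot>\<^bsub>FObj F Y\<^esub> ?q z"]
      by (simp add: lm_add[OF lm(2)] lm_smult[OF lm(2)] eigenspace_def)
    ultimately have "a P z \<oplus>\<^bsub>FObj F P\<^esub> (-1) \<odot>\<^bsub>FObj F P\<^esub> (l \<odot>\<^bsub>FObj F P\<^esub> z) = \<zero>\<^bsub>FObj F P\<^esub>"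
      using * z az V by simp
    from this have "a P z = l \<odot>\<^bsub>FObj F P\<^esub> z"
      by (rule rm_diff_eq_zero[OF V(3), rotated 2]) (use z az V(3) in auto)
    then show ?thesis
      using z by (simp add: eigenspace_def)
  qed
  show ?thesis
    unfolding is_binary_product_rat_vect[OF fv_ratmod[OF E X] fv_ratmod[OF E Y] fv_ratmod[OF E P]
        fv_lm[OF E P X p] fv_lm[OF E P Y q]]
  proof (intro conjI ballI impI)
    fix x y assume "x \<in> carrier (FObj (eigen_functor C F a l) X)"
      "y \<in> carrier (FObj (eigen_functor C F a l) Y)"
    then have xy: "x \<in> eigenspace (FObj F X) (a X) l" "y \<in> eigenspace (FObj F Y) (a Y) l"
      by simp_all
    then obtain z where "z \<in> carrier (FObj F P)" "?p z = x" "?q z = y"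
      using *(1) eigenspaceD[OF xy(1)] eigenspaceD[OF xy(2)] by blast
    with xy eig[of z] show "\<exists>z\<in>carrier (FObj (eigen_functor C F a l) P).
        FMap (eigen_functor C F a l) P X p z = x \<and> FMap (eigen_functor C F a l) P Y q z = y"
      by auto
  next
    fix z assume "z \<in> carrier (FObj (eigen_functor C F a l) P)"
      "FMap (eigen_functor C F a l) P X p z = \<zero>\<^bsub>FObj (eigen_functor C F a l) X\<^esub> \<and>
        FMap (eigen_functor C F a l) P Y q z = \<zero>\<^bsub>FObj (eigen_functor C F a l) Y\<^esub>"
    then show "z = \<zero>\<^bsub>FObj (eigen_functor C F a l) P\<^esub>"
      using *(2) by (auto dest: eigenspaceD)
  qed
qed

lemma eigen_preserves_terminal:
  assumes "P \<in> Obj C" "is_terminal rat_vect (FObj F P)"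
  shows "is_terminal rat_vect (FObj (eigen_functor C F a l) P)"
  using assms fv_ratmod[OF is_functor_eigen assms(1)] zero_in_eigenspace[OF fv_ratmod[OF F] nv_lm[OF a]]
  by (auto simp: is_terminal_rat_vect dest: eigenspaceD)

end

subsection \<open>Finite direct sums inside the universe\<close>

text \<open>
  Either all spaces are zero, or the universe contains a copy of the rationals and hence its own
  finite powers.
\<close>

lemma inj_on_PiE_infinite:
  assumes "finite I" and inf: "infinite (UNIV :: 'v set)"
  shows "\<exists>j :: ('i \<Rightarrow> 'v) \<Rightarrow> 'v. inj_on j (\<Pi>\<^sub>E i\<in>I. UNIV)"
  using \<open>finite I\<close>
proof induction
  case empty
  show ?case by (simp add: PiE_empty_domain)
next
  case (insert d I)
  then obtain j :: "('i \<Rightarrow> 'v) \<Rightarrow> 'v" where j: "inj_on j (\<Pi>\<^sub>E i\<in>I. UNIV)" by blast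
  \<comment> \<open>An infinite set is in bijection with its square; iterating this pairing encodes
    one coordinate after another.\<close>
  obtain h :: "'v \<times> 'v \<Rightarrow> 'v" where h: "inj h"
    using card_of_Times_same_infinite[OF inf] card_of_ordIso[symmetric]
    by (metis UNIV_Times_UNIV bij_betw_imp_inj_on)
  have "inj_on (\<lambda>f. h (f d, j (restrict f I))) (\<Pi>\<^sub>E i\<in>insert d I. UNIV)"
  proof (rule inj_onI)
    fix f g assume f: "f \<in> (\<Pi>\<^sub>E i\<in>insert d I. UNIV :: 'v set)" and g: "g \<in> (\<Pi>\<^sub>E i\<in>insert d I. UNIV :: 'v set)"
      and "h (f d, j (restrict f I)) = h (g d, j (restrict g I))"
    then have fg: "f d = g d" "j (restrict f I) = j (restrict g I)"
      using h by (auto dest: injD)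
    then have "restrict f I = restrict g I"
      using inj_onD[OF j, of "restrict f I" "restrict g I"] by auto
    then have "f i = g i" if "i \<in> insert d I" for i
      using that fg(1) by (metis insertE restrict_apply')
    then show "f = g"
      using f g by (rule_tac PiE_ext) auto
  qed
  then show ?case by blast
qed

lemma inj_on_PiE_ratmod:
  fixes V :: "'i \<Rightarrow> (rat, 'v) module"
  assumes "finite I" and V: "\<And>i. i \<in> I \<Longrightarrow> ratmod (V i)"
  shows "\<exists>j :: ('i \<Rightarrow> 'v) \<Rightarrow> 'v. inj_on j (\<Pi>\<^sub>E i\<in>I. carrier (V i))"
proof (cases "\<forall>i\<in>I. carrier (V i) \<subseteq> {\<zero>\<^bsub>V i\<^esub>}")
  case True
  then have "inj_on j (\<Pi>\<^sub>E i\<in>I. carrier (V i))" for j :: "('i \<Rightarrow> 'v) \<Rightarrow> 'v"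
    by (intro inj_onI PiE_ext) (assumption+, metis PiE_mem True singletonD subsetD)
  then show ?thesis by blast
next
  case False
  then obtain i x where i: "i \<in> I" "x \<in> carrier (V i)" "x \<noteq> \<zero>\<^bsub>V i\<^esub>" by blast
  \<comment> \<open>The rational multiples of a nonzero vector are pairwise different, so that its
    universe is infinite.\<close>
  then have "inj (\<lambda>c::rat. c \<odot>\<^bsub>V i\<^esub> x)"
    using rm_smult_cancel[OF V[OF i(1)] i(2)] by (auto intro: injI)
  then have "infinite (UNIV :: 'v set)"
    using infinite_UNIV_char_0 finite_imageD[of "\<lambda>c::rat. c \<odot>\<^bsub>V i\<^esub> x" UNIV] finite_subset subset_UNIV by metis
  then obtain j :: "('i \<Rightarrow> 'v) \<Rightarrow> 'v" where "inj_on j (\<Pi>\<^sub>E i\<in>I. UNIV)"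
    using inj_on_PiE_infinite[OF \<open>finite I\<close>] by blast
  then have "inj_on j (\<Pi>\<^sub>E i\<in>I. carrier (V i))"
    by (rule inj_on_subset) (auto intro!: PiE_mono)
  then show ?thesis by blast
qed

text \<open>The product module on families, transported along an encoding \<open>j\<close> of
  families as elements of \<open>'v\<close>, since the underlying sets of objects must lie in the
  fixed universe.\<close>

definition dsum :: "'i set \<Rightarrow> ('i \<Rightarrow> (rat, 'v) module) \<Rightarrow> (('i \<Rightarrow> 'v) \<Rightarrow> 'v) \<Rightarrow> (rat, 'v) module" where
  "dsum I V j = (let P = \<Pi>\<^sub>E i\<in>I. carrier (V i); k = the_inv_into P j in
    \<lparr>carrier = j ` P, mult = undefined, one = undefined, zero = j (\<lambda>i\<in>I. \<zero>\<^bsub>V i\<^esub>),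
     add = (\<lambda>x y. j (\<lambda>i\<in>I. k x i \<oplus>\<^bsub>V i\<^esub> k y i)), smult = (\<lambda>c x. j (\<lambda>i\<in>I. c \<odot>\<^bsub>V i\<^esub> k x i))\<rparr>)"

definition dcomp :: "'i set \<Rightarrow> ('i \<Rightarrow> (rat, 'v) module) \<Rightarrow> (('i \<Rightarrow> 'v) \<Rightarrow> 'v) \<Rightarrow> 'v \<Rightarrow> 'i \<Rightarrow> 'v" where
  "dcomp I V j = the_inv_into (\<Pi>\<^sub>E i\<in>I. carrier (V i)) j"

locale direct_sum =
  fixes I :: "'i set" and V :: "'i \<Rightarrow> (rat, 'v) module" and j :: "('i \<Rightarrow> 'v) \<Rightarrow> 'v"
  assumes V: "i \<in> I \<Longrightarrow> ratmod (V i)" and j: "inj_on j (\<Pi>\<^sub>E i\<in>I. carrier (V i))"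
begin

abbreviation "D \<equiv> dsum I V j"
abbreviation "k \<equiv> dcomp I V j"

lemma k_j [simp]: "f \<in> (\<Pi>\<^sub>E i\<in>I. carrier (V i)) \<Longrightarrow> k (j f) = f"
  unfolding dcomp_def by (rule the_inv_into_f_f[OF j])

lemma carrier_dsum: "x \<in> carrier D \<longleftrightarrow> (\<exists>f \<in> (\<Pi>\<^sub>E i\<in>I. carrier (V i)). x = j f)"
  by (auto simp: dsum_def Let_def)

lemma j_carrier: "(\<And>i. i \<in> I \<Longrightarrow> f i \<in> carrier (V i)) \<Longrightarrow> j (restrict f I) \<in> carrier D"
  unfolding carrier_dsum by (rule bexI[of _ "restrict f I"]) auto

lemma k_carrier [simp]: "\<lbrakk>x \<in> carrier D; i \<in> I\<rbrakk> \<Longrightarrow> k x i \<in> carrier (V i)"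
  by (auto simp: carrier_dsum)

lemma k_restrict [simp]: "\<lbrakk>\<And>i. i \<in> I \<Longrightarrow> f i \<in> carrier (V i); i \<in> I\<rbrakk> \<Longrightarrow> k (j (restrict f I)) i = f i"
  by (subst k_j) auto

lemma j_k: "x \<in> carrier D \<Longrightarrow> j (restrict (k x) I) = x"
  by (auto simp: carrier_dsum)

text \<open>Encoded families are compared by decoding them, which reduces all module laws to the
  components.\<close>

lemma dsum_eqI:
  assumes "x \<in> carrier D" "y \<in> carrier D" "\<And>i. i \<in> I \<Longrightarrow> k x i = k y i"
  shows "x = y"
  using j_k[OF assms(1)] j_k[OF assms(2)] assms(3) by (metis restrict_ext)

lemma dsum_simps:
  "\<zero>\<^bsub>D\<^esub> = j (\<lambda>i\<in>I. \<zero>\<^bsub>V i\<^esub>)" "x \<oplus>\<^bsub>D\<^esub> y = j (\<lambda>i\<in>I. k x i \<oplus>\<^bsub>V i\<^esub> k y i)"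
  "c \<odot>\<^bsub>D\<^esub> x = j (\<lambda>i\<in>I. c \<odot>\<^bsub>V i\<^esub> k x i)"
  by (simp_all add: dsum_def Let_def dcomp_def)

lemma dsum_closed [simp]:
  "\<zero>\<^bsub>D\<^esub> \<in> carrier D" "\<lbrakk>x \<in> carrier D; y \<in> carrier D\<rbrakk> \<Longrightarrow> x \<oplus>\<^bsub>D\<^esub> y \<in> carrier D"
  "x \<in> carrier D \<Longrightarrow> c \<odot>\<^bsub>D\<^esub> x \<in> carrier D"
  unfolding dsum_simps using V by (auto intro!: j_carrier)

lemma k_simps [simp]:
  assumes "i \<in> I"
  shows "k \<zero>\<^bsub>D\<^esub> i = \<zero>\<^bsub>V i\<^esub>"
    "\<lbrakk>x \<in> carrier D; y \<in> carrier D\<rbrakk> \<Longrightarrow> k (x \<oplus>\<^bsub>D\<^esub> y) i = k x i \<oplus>\<^bsub>V i\<^esub> k y i"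
    "x \<in> carrier D \<Longrightarrow> k (c \<odot>\<^bsub>D\<^esub> x) i = c \<odot>\<^bsub>V i\<^esub> k x i"
  unfolding dsum_simps using assms V by (auto intro!: k_restrict)

lemma ratmod_dsum: "ratmod D"
proof (rule ratmodI)
  show "abelian_group D"
  proof (rule abelian_groupI)
    show "\<exists>y\<in>carrier D. y \<oplus>\<^bsub>D\<^esub> x = \<zero>\<^bsub>D\<^esub>" if "x \<in> carrier D" for x
    proof (rule bexI[of _ "(-1) \<odot>\<^bsub>D\<^esub> x"])
      show "(-1) \<odot>\<^bsub>D\<^esub> x \<oplus>\<^bsub>D\<^esub> x = \<zero>\<^bsub>D\<^esub>"
        by (rule dsum_eqI) (use that V in \<open>auto simp: rm_comm[of "V _" "(-1) \<odot>\<^bsub>V _\<^esub> _"] rm_neg\<close>)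
    qed (use that in simp)
    show "x \<oplus>\<^bsub>D\<^esub> y \<oplus>\<^bsub>D\<^esub> z = x \<oplus>\<^bsub>D\<^esub> (y \<oplus>\<^bsub>D\<^esub> z)" if "x \<in> carrier D" "y \<in> carrier D" "z \<in> carrier D" for x y z
      by (rule dsum_eqI) (use that V in \<open>auto simp: rm_assoc\<close>)
    show "x \<oplus>\<^bsub>D\<^esub> y = y \<oplus>\<^bsub>D\<^esub> x" if "x \<in> carrier D" "y \<in> carrier D" for x y
      by (rule dsum_eqI) (use that V in \<open>auto intro: rm_comm\<close>)
    show "\<zero>\<^bsub>D\<^esub> \<oplus>\<^bsub>D\<^esub> x = x" if "x \<in> carrier D" for x
      by (rule dsum_eqI) (use that V in auto)
  qed auto
  show "(a + b) \<odot>\<^bsub>D\<^esub> x = (a \<odot>\<^bsub>D\<^esub> x) \<oplus>\<^bsub>D\<^esub> (b \<odot>\<^bsub>D\<^esub> x)" if "x \<in> carrier D" for a b x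
    by (rule dsum_eqI) (use that V in \<open>auto simp: rm_add_smult\<close>)
  show "a \<odot>\<^bsub>D\<^esub> (x \<oplus>\<^bsub>D\<^esub> y) = (a \<odot>\<^bsub>D\<^esub> x) \<oplus>\<^bsub>D\<^esub> (a \<odot>\<^bsub>D\<^esub> y)" if "x \<in> carrier D" "y \<in> carrier D" for a x y
    by (rule dsum_eqI) (use that V in \<open>auto simp: rm_smult_add\<close>)
  show "(a * b) \<odot>\<^bsub>D\<^esub> x = a \<odot>\<^bsub>D\<^esub> (b \<odot>\<^bsub>D\<^esub> x)" if "x \<in> carrier D" for a b x
    by (rule dsum_eqI) (use that V in auto)
  show "1 \<odot>\<^bsub>D\<^esub> x = x" if "x \<in> carrier D" for x
    by (rule dsum_eqI) (use that V in auto)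
qed auto

end

section \<open>Direct sums of linear maps and of functors\<close>

definition dsum_map ::
  "'i set \<Rightarrow> ('i \<Rightarrow> (rat, 'v) module) \<Rightarrow> (('i \<Rightarrow> 'v) \<Rightarrow> 'v) \<Rightarrow> (('i \<Rightarrow> 'v) \<Rightarrow> 'v) \<Rightarrow>
    ('i \<Rightarrow> 'v \<Rightarrow> 'v) \<Rightarrow> 'v \<Rightarrow> 'v" where
  "dsum_map I V j j' f = (\<lambda>x\<in>carrier (dsum I V j). j' (\<lambda>i\<in>I. f i (dcomp I V j x i)))"

lemma dsum_map:
  assumes V: "direct_sum I V j" and W: "direct_sum I W j'"
    and f: "\<And>i. i \<in> I \<Longrightarrow> f i \<in> linear_maps (V i) (W i)"
  shows dsum_map_comp: "\<lbrakk>x \<in> carrier (dsum I V j); i \<in> I\<rbrakk>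
      \<Longrightarrow> dcomp I W j' (dsum_map I V j j' f x) i = f i (dcomp I V j x i)"
    and dsum_map_linear: "dsum_map I V j j' f \<in> linear_maps (dsum I V j) (dsum I W j')"
proof -
  interpret V: direct_sum I V j by fact
  interpret W: direct_sum I W j' by fact
  have fk: "f i (dcomp I V j x i) \<in> carrier (W i)" if "x \<in> carrier (dsum I V j)" "i \<in> I" for x i
    using that lm_closed[OF f] by simp
  show comp: "dcomp I W j' (dsum_map I V j j' f x) i = f i (dcomp I V j x i)"
    if "x \<in> carrier (dsum I V j)" "i \<in> I" for x i
    using that fk by (simp add: dsum_map_def)
  have cl: "dsum_map I V j j' f x \<in> carrier (dsum I W j')" if "x \<in> carrier (dsum I V j)" for x
    using that fk by (simp add: dsum_map_def W.j_carrier)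
  have "restrict (dsum_map I V j j' f) (carrier (dsum I V j)) \<in> linear_maps (dsum I V j) (dsum I W j')"
  proof (rule linear_mapsI)
    show "dsum_map I V j j' f (x \<oplus>\<^bsub>dsum I V j\<^esub> y) =
        dsum_map I V j j' f x \<oplus>\<^bsub>dsum I W j'\<^esub> dsum_map I V j j' f y"
      if "x \<in> carrier (dsum I V j)" "y \<in> carrier (dsum I V j)" for x y
      by (rule W.dsum_eqI) (use that in \<open>simp_all add: cl comp lm_add[OF f]\<close>)
    show "dsum_map I V j j' f (c \<odot>\<^bsub>dsum I V j\<^esub> x) = c \<odot>\<^bsub>dsum I W j'\<^esub> dsum_map I V j j' f x"
      if "x \<in> carrier (dsum I V j)" for x c
      by (rule W.dsum_eqI) (use that in \<open>simp_all add: cl comp lm_smult[OF f]\<close>)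
  qed (use cl V.ratmod_dsum in auto)
  then show "dsum_map I V j j' f \<in> linear_maps (dsum I V j) (dsum I W j')"
    by (simp add: dsum_map_def)
qed

definition dsum_functor ::
  "('o, 'm) cat \<Rightarrow> 'i set \<Rightarrow> ('i \<Rightarrow> ('o, 'm, (rat, 'v) module, 'v \<Rightarrow> 'v) cfunctor) \<Rightarrow>
    ('o \<Rightarrow> ('i \<Rightarrow> 'v) \<Rightarrow> 'v) \<Rightarrow> ('o, 'm, (rat, 'v) module, 'v \<Rightarrow> 'v) cfunctor" where
  "dsum_functor C I E j =
    \<lparr>FObj = (\<lambda>X. if X \<in> Obj C then dsum I (\<lambda>i. FObj (E i) X) (j X) else undefined),
     FMap = (\<lambda>X Y f. if X \<in> Obj C \<and> Y \<in> Obj C \<and> f \<in> Hom C X Y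
       then dsum_map I (\<lambda>i. FObj (E i) X) (j X) (j Y) (\<lambda>i. FMap (E i) X Y f) else undefined)\<rparr>"

lemma dsum_functor_simps [simp]:
  "X \<in> Obj C \<Longrightarrow> FObj (dsum_functor C I E j) X = dsum I (\<lambda>i. FObj (E i) X) (j X)"
  "\<lbrakk>X \<in> Obj C; Y \<in> Obj C; f \<in> Hom C X Y\<rbrakk> \<Longrightarrow> FMap (dsum_functor C I E j) X Y f =
    dsum_map I (\<lambda>i. FObj (E i) X) (j X) (j Y) (\<lambda>i. FMap (E i) X Y f)"
  by (simp_all add: dsum_functor_def)

lemma extensional_dsum_functor: "extensional_functor C (dsum_functor C I E j)"
  by (auto simp: extensional_functor_def dsum_functor_def)

locale functor_sum =
  fixes C :: "('o, 'm) cat" and I :: "'i set"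
    and E :: "'i \<Rightarrow> ('o, 'm, (rat, 'v) module, 'v \<Rightarrow> 'v) cfunctor" and j :: "'o \<Rightarrow> ('i \<Rightarrow> 'v) \<Rightarrow> 'v"
  assumes C: "category C" and E: "i \<in> I \<Longrightarrow> is_functor C rat_vect (E i)"
    and j: "X \<in> Obj C \<Longrightarrow> inj_on (j X) (\<Pi>\<^sub>E i\<in>I. carrier (FObj (E i) X))"
begin

lemma direct_sum_at: "X \<in> Obj C \<Longrightarrow> direct_sum I (\<lambda>i. FObj (E i) X) (j X)"
  using j by (simp add: direct_sum_def fv_ratmod[OF E])

lemma comp_map:
  assumes "X \<in> Obj C" "Y \<in> Obj C" "f \<in> Hom C X Y" "x \<in> carrier (FObj (dsum_functor C I E j) X)" "i \<in> I"
  shows "dcomp I (\<lambda>i. FObj (E i) Y) (j Y) (FMap (dsum_functor C I E j) X Y f x) i =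
    FMap (E i) X Y f (dcomp I (\<lambda>i. FObj (E i) X) (j X) x i)"
  using assms by (simp add: dsum_map_comp[OF direct_sum_at direct_sum_at fv_lm[OF E]])

lemma linear_map:
  assumes "X \<in> Obj C" "Y \<in> Obj C" "f \<in> Hom C X Y"
  shows "FMap (dsum_functor C I E j) X Y f
    \<in> linear_maps (FObj (dsum_functor C I E j) X) (FObj (dsum_functor C I E j) Y)"
  using assms by (simp add: dsum_map_linear[OF direct_sum_at direct_sum_at fv_lm[OF E]])

lemma eqI:
  assumes X: "X \<in> Obj C" and "x \<in> carrier (FObj (dsum_functor C I E j) X)"
    "y \<in> carrier (FObj (dsum_functor C I E j) X)"
    "\<And>i. i \<in> I \<Longrightarrow> dcomp I (\<lambda>i. FObj (E i) X) (j X) x i = dcomp I (\<lambda>i. FObj (E i) X) (j X) y i"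
  shows "x = y"
  by (rule direct_sum.dsum_eqI[OF direct_sum_at[OF X]]) (use assms in simp_all)

lemma is_functor_dsum: "is_functor C rat_vect (dsum_functor C I E j)"
proof (rule functor_rat_vectI[OF _ _ _ _ C])
  interpret C: category C by (rule C)
  show "ratmod (FObj (dsum_functor C I E j) X)" if "X \<in> Obj C" for X
    using direct_sum.ratmod_dsum[OF direct_sum_at[OF that]] that by simp
  show "FMap (dsum_functor C I E j) X Y f
    \<in> linear_maps (FObj (dsum_functor C I E j) X) (FObj (dsum_functor C I E j) Y)"
    if "X \<in> Obj C" "Y \<in> Obj C" "f \<in> Hom C X Y" for X Y f
    by (rule linear_map[OF that])
  show "FMap (dsum_functor C I E j) X X (Ident C X) x = x"
    if X: "X \<in> Obj C" and x: "x \<in> carrier (FObj (dsum_functor C I E j) X)" for X x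
  proof (rule eqI[OF X])
    interpret direct_sum I "\<lambda>i. FObj (E i) X" "j X" by (rule direct_sum_at[OF X])
    show "dcomp I (\<lambda>i. FObj (E i) X) (j X) (FMap (dsum_functor C I E j) X X (Ident C X) x) i =
      dcomp I (\<lambda>i. FObj (E i) X) (j X) x i" if "i \<in> I" for i
      using comp_map[OF X X C.Ident_in_Hom[OF X] x that] fv_Ident[OF E X] that x X by simp
  qed (rule lm_closed[OF linear_map[OF X X C.Ident_in_Hom[OF X]] x], rule x)
  show "FMap (dsum_functor C I E j) X Z (Comp C X Y Z g f) x =
      FMap (dsum_functor C I E j) Y Z g (FMap (dsum_functor C I E j) X Y f x)"
    if X: "X \<in> Obj C" and Y: "Y \<in> Obj C" and Z: "Z \<in> Obj C" and f: "f \<in> Hom C X Y" and g: "g \<in> Hom C Y Z"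
      and x: "x \<in> carrier (FObj (dsum_functor C I E j) X)" for X Y Z f g x
  proof (rule eqI[OF Z])
    interpret direct_sum I "\<lambda>i. FObj (E i) X" "j X" by (rule direct_sum_at[OF X])
    have gf: "Comp C X Y Z g f \<in> Hom C X Z" using C.Comp_in_Hom X Y Z f g by blast
    have fx: "FMap (dsum_functor C I E j) X Y f x \<in> carrier (FObj (dsum_functor C I E j) Y)"
      by (rule lm_closed[OF linear_map[OF X Y f] x])
    show "FMap (dsum_functor C I E j) X Z (Comp C X Y Z g f) x \<in> carrier (FObj (dsum_functor C I E j) Z)"
      by (rule lm_closed[OF linear_map[OF X Z gf] x])
    show "FMap (dsum_functor C I E j) Y Z g (FMap (dsum_functor C I E j) X Y f x)
        \<in> carrier (FObj (dsum_functor C I E j) Z)"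
      by (rule lm_closed[OF linear_map[OF Y Z g] fx])
    show "dcomp I (\<lambda>i. FObj (E i) Z) (j Z) (FMap (dsum_functor C I E j) X Z (Comp C X Y Z g f) x) i =
      dcomp I (\<lambda>i. FObj (E i) Z) (j Z)
        (FMap (dsum_functor C I E j) Y Z g (FMap (dsum_functor C I E j) X Y f x)) i" if i: "i \<in> I" for i
      unfolding comp_map[OF X Z gf x i] comp_map[OF Y Z g fx i] comp_map[OF X Y f x i]
      by (rule fv_Comp[OF E[OF i] X Y Z f g]) (use x X i in simp)
  qed
qed

lemma dsum_preserves_product:
  assumes X: "X \<in> Obj C" and Y: "Y \<in> Obj C" and P: "P \<in> Obj C"
    and p: "p \<in> Hom C P X" and q: "q \<in> Hom C P Y"
    and prod: "\<And>i. i \<in> I \<Longrightarrow>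
      is_binary_product rat_vect (FObj (E i) X) (FObj (E i) Y) (FObj (E i) P) (FMap (E i) P X p) (FMap (E i) P Y q)"
  shows "is_binary_product rat_vect (FObj (dsum_functor C I E j) X) (FObj (dsum_functor C I E j) Y)
    (FObj (dsum_functor C I E j) P) (FMap (dsum_functor C I E j) P X p) (FMap (dsum_functor C I E j) P Y q)"
proof -
  let ?D = "dsum_functor C I E j"
  interpret X: direct_sum I "\<lambda>i. FObj (E i) X" "j X" by (rule direct_sum_at[OF X])
  interpret Y: direct_sum I "\<lambda>i. FObj (E i) Y" "j Y" by (rule direct_sum_at[OF Y])
  interpret P: direct_sum I "\<lambda>i. FObj (E i) P" "j P" by (rule direct_sum_at[OF P])
  note D = is_functor_dsum
  have *: "\<forall>x \<in> carrier (FObj (E i) X). \<forall>y \<in> carrier (FObj (E i) Y). \<exists>z \<in> carrier (FObj (E i) P).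
      FMap (E i) P X p z = x \<and> FMap (E i) P Y q z = y"
    "\<forall>z \<in> carrier (FObj (E i) P). FMap (E i) P X p z = \<zero>\<^bsub>FObj (E i) X\<^esub> \<and>
      FMap (E i) P Y q z = \<zero>\<^bsub>FObj (E i) Y\<^esub> \<longrightarrow> z = \<zero>\<^bsub>FObj (E i) P\<^esub>" if i: "i \<in> I" for i
    using prod[OF i] unfolding is_binary_product_rat_vect[OF fv_ratmod[OF E[OF i] X]
        fv_ratmod[OF E[OF i] Y] fv_ratmod[OF E[OF i] P] fv_lm[OF E[OF i] P X p] fv_lm[OF E[OF i] P Y q]]
    by blast+
  show ?thesis
    unfolding is_binary_product_rat_vect[OF fv_ratmod[OF D X] fv_ratmod[OF D Y] fv_ratmod[OF D P]
        fv_lm[OF D P X p] fv_lm[OF D P Y q]]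
  proof (intro conjI ballI impI)
    fix x y assume x: "x \<in> carrier (FObj ?D X)" and y: "y \<in> carrier (FObj ?D Y)"
    have x': "x \<in> carrier X.D" and y': "y \<in> carrier Y.D"
      using x y X Y by simp_all
    have "\<exists>z. z \<in> carrier (FObj (E i) P) \<and> FMap (E i) P X p z = X.k x i \<and> FMap (E i) P Y q z = Y.k y i"
      if "i \<in> I" for i
      using *(1)[OF that] X.k_carrier[OF x' that] Y.k_carrier[OF y' that] by blast
    then obtain z where z: "\<And>i. i \<in> I \<Longrightarrow> z i \<in> carrier (FObj (E i) P) \<and>
        FMap (E i) P X p (z i) = X.k x i \<and> FMap (E i) P Y q (z i) = Y.k y i"
      by metis
    define w where "w = j P (restrict z I)"
    have w: "w \<in> carrier (FObj ?D P)"
      unfolding w_def using P.j_carrier[of z] z P by simp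
    have kw: "P.k w i = z i" if "i \<in> I" for i
      unfolding w_def using P.k_restrict[of z i] z that by simp
    have "FMap ?D P X p w = x"
      by (rule eqI[OF X])
        (use x z kw comp_map[OF P X p w] lm_closed[OF linear_map[OF P X p] w] in auto)
    moreover have "FMap ?D P Y q w = y"
      by (rule eqI[OF Y])
        (use y z kw comp_map[OF P Y q w] lm_closed[OF linear_map[OF P Y q] w] in auto)
    ultimately show "\<exists>z\<in>carrier (FObj ?D P). FMap ?D P X p z = x \<and> FMap ?D P Y q z = y"
      using w by blast
  next
    fix z assume z: "z \<in> carrier (FObj ?D P)"
      "FMap ?D P X p z = \<zero>\<^bsub>FObj ?D X\<^esub> \<and> FMap ?D P Y q z = \<zero>\<^bsub>FObj ?D Y\<^esub>"
    have kz: "P.k z i = \<zero>\<^bsub>FObj (E i) P\<^esub>" if i: "i \<in> I" for i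
    proof -
      have "FMap (E i) P X p (P.k z i) = \<zero>\<^bsub>FObj (E i) X\<^esub>" "FMap (E i) P Y q (P.k z i) = \<zero>\<^bsub>FObj (E i) Y\<^esub>"
        using comp_map[OF P X p z(1) i] comp_map[OF P Y q z(1) i] z(2) X Y i by auto
      then show ?thesis
        using *(2)[OF i] P.k_carrier[of z i] z(1) P i by auto
    qed
    show "z = \<zero>\<^bsub>FObj ?D P\<^esub>"
      by (rule eqI[OF P]) (use z(1) P kz in simp_all)
  qed
qed

lemma dsum_preserves_terminal:
  assumes P: "P \<in> Obj C" and t: "\<And>i. i \<in> I \<Longrightarrow> is_terminal rat_vect (FObj (E i) P)"
  shows "is_terminal rat_vect (FObj (dsum_functor C I E j) P)"
proof -
  interpret P: direct_sum I "\<lambda>i. FObj (E i) P" "j P" by (rule direct_sum_at[OF P])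
  have "x = \<zero>\<^bsub>P.D\<^esub>" if "x \<in> carrier P.D" for x
    by (rule P.dsum_eqI) (use that t P.k_carrier[OF that] in \<open>auto simp: is_terminal_rat_vect\<close>)
  then show ?thesis
    using P P.ratmod_dsum by (auto simp: is_terminal_rat_vect)
qed

end

section \<open>Finite \<open>G\<close>-sets\<close>

text \<open>
  The objects of the Lindner category live on natural numbers, so pullbacks, products and disjoint
  unions are formed there, through a pairing function.
\<close>

definition pr :: "nat \<Rightarrow> nat \<Rightarrow> nat" where "pr x y = prod_encode (x, y)"
definition pr1 :: "nat \<Rightarrow> nat" where "pr1 z = fst (prod_decode z)"
definition pr2 :: "nat \<Rightarrow> nat" where "pr2 z = snd (prod_decode z)"

lemma pr_simps [simp]: "pr1 (pr x y) = x" "pr2 (pr x y) = y" "pr (pr1 z) (pr2 z) = z"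
  by (simp_all add: pr_def pr1_def pr2_def)

lemma pr_eqI: "pr1 z = pr1 w \<Longrightarrow> pr2 z = pr2 w \<Longrightarrow> z = w"
  by (metis pr_simps(3))

lemma pr_eq [simp]: "pr x y = pr x' y' \<longleftrightarrow> x = x' \<and> y = y'"
  by (metis pr_simps(1,2))

section \<open>Equivariant maps, invariant subsets, pullbacks, products and disjoint unions\<close>

definition equivariant ::
  "('a, 'b) monoid_scheme \<Rightarrow> ('a, 's) gset \<Rightarrow> ('a, 't) gset \<Rightarrow> ('s \<Rightarrow> 't) \<Rightarrow> bool" where
  "equivariant G A B f \<longleftrightarrow> (\<forall>x\<in>pts A. f x \<in> pts B) \<and>
    (\<forall>g\<in>carrier G. \<forall>x\<in>pts A. f (act A g x) = act B g (f x))"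

lemma equivariantD:
  assumes "equivariant G A B f"
  shows equivariant_pts: "x \<in> pts A \<Longrightarrow> f x \<in> pts B"
    and equivariant_act: "\<lbrakk>g \<in> carrier G; x \<in> pts A\<rbrakk> \<Longrightarrow> f (act A g x) = act B g (f x)"
  using assms by (auto simp: equivariant_def)

lemma equivariant_comp:
  "\<lbrakk>equivariant G A B f; equivariant G B C h\<rbrakk> \<Longrightarrow> equivariant G A C (\<lambda>x. h (f x))"
  by (auto simp: equivariant_def)

lemma equivariant_id: "equivariant G A A (\<lambda>x. x)"
  by (auto simp: equivariant_def)

definition subg :: "('a, 's) gset \<Rightarrow> 's set \<Rightarrow> ('a, 's) gset" where
  "subg T A = \<lparr>pts = A, act = (\<lambda>g. restrict (act T g) A)\<rparr>"

lemma subg_simps [simp]: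
  "pts (subg T A) = A" "x \<in> A \<Longrightarrow> act (subg T A) g x = act T g x"
  by (simp_all add: subg_def)

text \<open>The target of \<open>r\<close> and \<open>l\<close> has an arbitrary type: natural
  numbers when spans are composed, the unit type when \<open>ten\<close> obtains the product as a
  pullback over a point.\<close>

definition pbk :: "('a, nat) gset \<Rightarrow> ('a, nat) gset \<Rightarrow> (nat \<Rightarrow> 't) \<Rightarrow> (nat \<Rightarrow> 't) \<Rightarrow> ('a, nat) gset" where
  "pbk A B r l = (let P = {z. pr1 z \<in> pts A \<and> pr2 z \<in> pts B \<and> r (pr1 z) = l (pr2 z)} in
    \<lparr>pts = P, act = (\<lambda>g. \<lambda>z\<in>P. pr (act A g (pr1 z)) (act B g (pr2 z)))\<rparr>)"

lemma pbk_simps [simp]: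
  "z \<in> pts (pbk A B r l) \<longleftrightarrow> pr1 z \<in> pts A \<and> pr2 z \<in> pts B \<and> r (pr1 z) = l (pr2 z)"
  "\<lbrakk>pr1 z \<in> pts A; pr2 z \<in> pts B; r (pr1 z) = l (pr2 z)\<rbrakk> \<Longrightarrow>
    act (pbk A B r l) g z = pr (act A g (pr1 z)) (act B g (pr2 z))"
  by (simp_all add: pbk_def Let_def)

definition ten :: "('a, nat) gset \<Rightarrow> ('a, nat) gset \<Rightarrow> ('a, nat) gset" where
  "ten A B = pbk A B (\<lambda>_. ()) (\<lambda>_. ())"

lemma ten_simps [simp]:
  "z \<in> pts (ten A B) \<longleftrightarrow> pr1 z \<in> pts A \<and> pr2 z \<in> pts B"
  "\<lbrakk>pr1 z \<in> pts A; pr2 z \<in> pts B\<rbrakk> \<Longrightarrow> act (ten A B) g z = pr (act A g (pr1 z)) (act B g (pr2 z))"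
  by (simp_all add: ten_def)

definition sumg :: "('a, nat) gset \<Rightarrow> ('a, nat) gset \<Rightarrow> ('a, nat) gset" where
  "sumg A B = (let P = {z. (pr1 z = 0 \<and> pr2 z \<in> pts A) \<or> (pr1 z = 1 \<and> pr2 z \<in> pts B)} in
    \<lparr>pts = P, act = (\<lambda>g. \<lambda>z\<in>P. pr (pr1 z) ((if pr1 z = 0 then act A g else act B g) (pr2 z)))\<rparr>)"

lemma sumg_simps [simp]:
  "z \<in> pts (sumg A B) \<longleftrightarrow> (pr1 z = 0 \<and> pr2 z \<in> pts A) \<or> (pr1 z = 1 \<and> pr2 z \<in> pts B)"
  "\<lbrakk>pr1 z = 0; pr2 z \<in> pts A\<rbrakk> \<Longrightarrow> act (sumg A B) g z = pr 0 (act A g (pr2 z))"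
  "\<lbrakk>pr1 z = 1; pr2 z \<in> pts B\<rbrakk> \<Longrightarrow> act (sumg A B) g z = pr 1 (act B g (pr2 z))"
  by (simp_all add: sumg_def Let_def)

definition emptyg :: "('a, 's) gset" where
  "emptyg = \<lparr>pts = {}, act = (\<lambda>g x. undefined)\<rparr>"

lemma emptyg_simps [simp]: "pts emptyg = {}"
  by (simp add: emptyg_def)

text \<open>Formulated for arbitrary injections so that it covers both the external union
  \<open>sumg\<close> and a G-set cut into an invariant subset and its complement, where both
  injections are the identity function.\<close>

definition coprod_gset ::
  "('a, 'b) monoid_scheme \<Rightarrow> ('a, nat) gset \<Rightarrow> ('a, nat) gset \<Rightarrow> ('a, nat) gset \<Rightarrow>
    (nat \<Rightarrow> nat) \<Rightarrow> (nat \<Rightarrow> nat) \<Rightarrow> bool" where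
  "coprod_gset G X Y D i j \<longleftrightarrow> finite_gset G X \<and> finite_gset G Y \<and> finite_gset G D \<and>
    equivariant G X D i \<and> equivariant G Y D j \<and> inj_on i (pts X) \<and> inj_on j (pts Y) \<and>
    pts D = i ` pts X \<union> j ` pts Y \<and> i ` pts X \<inter> j ` pts Y = {}"

definition invariant_subset :: "('a, 'b) monoid_scheme \<Rightarrow> ('a, 's) gset \<Rightarrow> 's set \<Rightarrow> bool" where
  "invariant_subset G T A \<longleftrightarrow> A \<subseteq> pts T \<and> (\<forall>g\<in>carrier G. \<forall>x\<in>A. act T g x \<in> A)"

section \<open>Stabilizers and closure properties of finite G-sets\<close>

context group
begin

abbreviation "stab X x \<equiv> stabilizer G (act X) x"

lemma finite_gsetD:
  assumes "finite_gset G X"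
  shows gs_finite: "finite (pts X)"
    and gs_act [simp]: "\<lbrakk>g \<in> carrier G; x \<in> pts X\<rbrakk> \<Longrightarrow> act X g x \<in> pts X"
    and gs_one: "x \<in> pts X \<Longrightarrow> act X \<one> x = x"
    and gs_mult: "\<lbrakk>g \<in> carrier G; h \<in> carrier G; x \<in> pts X\<rbrakk> \<Longrightarrow> act X (g \<otimes> h) x = act X g (act X h x)"
    and subgroup_stab: "x \<in> pts X \<Longrightarrow> subgroup (stab X x) G"
proof -
  interpret group_action G "pts X" "act X" using assms by (simp add: finite_gset_def)
  show "finite (pts X)" using assms by (simp add: finite_gset_def)
  show "\<lbrakk>g \<in> carrier G; x \<in> pts X\<rbrakk> \<Longrightarrow> act X g x \<in> pts X" using element_image by blast
  show "x \<in> pts X \<Longrightarrow> act X \<one> x = x" using id_eq_one by (metis restrict_apply')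
  show "\<lbrakk>g \<in> carrier G; h \<in> carrier G; x \<in> pts X\<rbrakk> \<Longrightarrow> act X (g \<otimes> h) x = act X g (act X h x)"
    using composition_rule by blast
  show "x \<in> pts X \<Longrightarrow> subgroup (stab X x) G" by (rule stabilizer_subgroup)
qed

lemma gs_inv:
  assumes "finite_gset G X" "g \<in> carrier G" "x \<in> pts X"
  shows "act X (inv g) (act X g x) = x" "act X g (act X (inv g) x) = x"
  using assms by (simp_all add: gs_mult[symmetric] gs_one)

lemma finite_gsetI:
  assumes fin: "finite (pts X)" and cl: "\<And>g x. \<lbrakk>g \<in> carrier G; x \<in> pts X\<rbrakk> \<Longrightarrow> act X g x \<in> pts X"
    and one: "\<And>x. x \<in> pts X \<Longrightarrow> act X \<one> x = x"
    and mult: "\<And>g h x. \<lbrakk>g \<in> carrier G; h \<in> carrier G; x \<in> pts X\<rbrakk> \<Longrightarrow> act X (g \<otimes> h) x = act X g (act X h x)"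
    and ext: "\<And>g. g \<in> carrier G \<Longrightarrow> act X g \<in> extensional (pts X)"
  shows "finite_gset G X"
proof -
  have bij: "act X g \<in> Bij (pts X)" if g: "g \<in> carrier G" for g
  proof -
    have "act X (inv g) (act X g x) = x" "act X g (act X (inv g) x) = x" if "x \<in> pts X" for x
      using g that by (simp_all add: mult[symmetric] one)
    then have "bij_betw (act X g) (pts X) (pts X)"
      using g cl by (intro bij_betw_byWitness[where f' = "act X (inv g)"]) auto
    then show ?thesis using ext[OF g] by (simp add: Bij_def)
  qed
  have "act X \<in> hom G (BijGroup (pts X))"
  proof (rule homI)
    fix g h assume gh: "g \<in> carrier G" "h \<in> carrier G"
    have "act X (g \<otimes> h) = compose (pts X) (act X g) (act X h)"
      using ext[of "g \<otimes> h"] gh mult by (intro extensionalityI[where A = "pts X"]) (auto simp: compose_def)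
    then show "act X (g \<otimes> h) = act X g \<otimes>\<^bsub>BijGroup (pts X)\<^esub> act X h"
      using bij gh by (simp add: BijGroup_def)
  qed (use bij in \<open>simp add: BijGroup_def\<close>)
  then show ?thesis
    unfolding finite_gset_def group_action_def group_hom_def group_hom_axioms_def
    using fin group_BijGroup is_group by blast
qed

lemma stab_iff: "g \<in> stab X x \<longleftrightarrow> g \<in> carrier G \<and> act X g x = x"
  by (simp add: stabilizer_def)

lemma stab_mono:
  assumes "equivariant G A B f" "x \<in> pts A"
  shows "stab A x \<subseteq> stab B (f x)"
proof
  fix g assume "g \<in> stab A x"
  then show "g \<in> stab B (f x)"
    using equivariant_act[OF assms(1), of g x] assms(2) by (simp add: stab_iff)
qed

lemma stab_inj:
  assumes "equivariant G A B f" "inj_on f (pts A)" "x \<in> pts A" "finite_gset G A"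
  shows "stab B (f x) = stab A x"
proof
  show "stab B (f x) \<subseteq> stab A x"
  proof
    fix g assume g: "g \<in> stab B (f x)"
    then have "f (act A g x) = f x"
      using equivariant_act[OF assms(1), of g x] assms(3) by (simp add: stab_iff)
    then show "g \<in> stab A x"
      using g assms by (auto simp: stab_iff dest: inj_onD)
  qed
qed (rule stab_mono[OF assms(1,3)])

lemma stab_subg [simp]: "x \<in> A \<Longrightarrow> stab (subg T A) x = stab T x"
  by (auto simp: stab_iff)

lemma stab_pbk:
  "z \<in> pts (pbk A B r l) \<Longrightarrow> stab (pbk A B r l) z = stab A (pr1 z) \<inter> stab B (pr2 z)"
  by (auto simp: stab_iff) (metis pr_simps)+

lemma stab_ten: "z \<in> pts (ten A B) \<Longrightarrow> stab (ten A B) z = stab A (pr1 z) \<inter> stab B (pr2 z)"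
  unfolding ten_def by (rule stab_pbk)

lemma finite_gset_subg:
  assumes "finite_gset G T" "invariant_subset G T A"
  shows "finite_gset G (subg T A)"
proof (rule finite_gsetI)
  have A: "A \<subseteq> pts T" "\<And>g x. \<lbrakk>g \<in> carrier G; x \<in> A\<rbrakk> \<Longrightarrow> act T g x \<in> A"
    using assms(2) by (auto simp: invariant_subset_def)
  show "finite (pts (subg T A))" using A(1) gs_finite[OF assms(1)] by (auto intro: finite_subset)
  show "act (subg T A) (g \<otimes> h) x = act (subg T A) g (act (subg T A) h x)"
    if "g \<in> carrier G" "h \<in> carrier G" "x \<in> pts (subg T A)" for g h x
    using that A gs_mult[OF assms(1), of g h x] by auto
qed (use assms gs_one[OF assms(1)] in \<open>auto simp: invariant_subset_def subg_def\<close>)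

lemma equivariant_subg: "invariant_subset G T A \<Longrightarrow> equivariant G (subg T A) T (\<lambda>x. x)"
  by (auto simp: equivariant_def invariant_subset_def)

lemma finite_pairs:
  assumes "finite A" "finite B"
  shows "finite {z. pr1 z \<in> A \<and> pr2 z \<in> B}"
proof (rule finite_subset)
  show "{z. pr1 z \<in> A \<and> pr2 z \<in> B} \<subseteq> (\<lambda>(x, y). pr x y) ` (A \<times> B)"
    by (auto intro!: image_eqI[where x = "(pr1 z, pr2 z)" for z])
qed (use assms in simp)

lemma finite_gset_pbk:
  assumes A: "finite_gset G A" and B: "finite_gset G B" and r: "equivariant G A T r" and l: "equivariant G B T l"
  shows "finite_gset G (pbk A B r l)"
proof (rule finite_gsetI)
  show "finite (pts (pbk A B r l))"
    by (rule finite_subset[OF _ finite_pairs[OF gs_finite[OF A] gs_finite[OF B]]]) auto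
  show "act (pbk A B r l) g \<in> extensional (pts (pbk A B r l))" for g
    by (simp add: pbk_def Let_def)
qed (auto simp: gs_act[OF A] gs_act[OF B] gs_one[OF A] gs_one[OF B] gs_mult[OF A] gs_mult[OF B]
    equivariant_act[OF r] equivariant_act[OF l])

lemma finite_gset_ten:
  assumes "finite_gset G A" "finite_gset G B"
  shows "finite_gset G (ten A B)"
  unfolding ten_def using assms
  by (rule finite_gset_pbk[where T = "\<lparr>pts = {()}, act = (\<lambda>_ _. ())\<rparr>"]) (auto simp: equivariant_def)

lemma equivariant_pbk:
  "equivariant G (pbk A B r l) A pr1" "equivariant G (pbk A B r l) B pr2"
  by (auto simp: equivariant_def)

lemma equivariant_ten: "equivariant G (ten A B) A pr1" "equivariant G (ten A B) B pr2"
  by (auto simp: equivariant_def)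

lemma finite_gset_sumg:
  assumes A: "finite_gset G A" and B: "finite_gset G B"
  shows "finite_gset G (sumg A B)"
proof (rule finite_gsetI)
  show "finite (pts (sumg A B))"
    by (rule finite_subset[OF _ finite_pairs[of "{0, 1}" "pts A \<union> pts B"]])
      (auto simp: gs_finite[OF A] gs_finite[OF B])
  show "act (sumg A B) g \<in> extensional (pts (sumg A B))" for g
    by (simp add: sumg_def Let_def)
qed (auto simp: gs_act[OF A] gs_act[OF B] gs_one[OF A] gs_one[OF B] gs_mult[OF A] gs_mult[OF B]
    intro: pr_eqI)

lemma coprod_sumg:
  assumes A: "finite_gset G A" and B: "finite_gset G B"
  shows "coprod_gset G A B (sumg A B) (pr 0) (pr 1)"
proof -
  have "pts (sumg A B) = pr 0 ` pts A \<union> pr 1 ` pts B"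
  proof (intro Set.set_eqI iffI)
    fix z assume "z \<in> pts (sumg A B)"
    then consider "z = pr 0 (pr2 z)" "pr2 z \<in> pts A" | "z = pr 1 (pr2 z)" "pr2 z \<in> pts B"
      unfolding sumg_simps by (metis pr_simps(3))
    then show "z \<in> pr 0 ` pts A \<union> pr 1 ` pts B"
      by cases blast+
  qed auto
  then show ?thesis
    using A B finite_gset_sumg[OF A B]
    by (auto simp: coprod_gset_def equivariant_def inj_on_def)
qed

lemma invariant_Diff:
  assumes T: "finite_gset G T" and A: "invariant_subset G T A"
  shows "invariant_subset G T (pts T - A)"
  unfolding invariant_subset_def
proof (intro conjI ballI)
  fix g x assume g: "g \<in> carrier G" and x: "x \<in> pts T - A"
  have "act T (inv g) (act T g x) \<in> A" if "act T g x \<in> A"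
    using that A g by (auto simp: invariant_subset_def)
  then show "act T g x \<in> pts T - A"
    using x g gs_inv[OF T g] gs_act[OF T g] by auto
qed auto

lemma coprod_subset:
  assumes T: "finite_gset G T" and A: "invariant_subset G T A"
  shows "coprod_gset G (subg T A) (subg T (pts T - A)) T (\<lambda>x. x) (\<lambda>x. x)"
  using T A finite_gset_subg[OF T A] finite_gset_subg[OF T invariant_Diff[OF T A]]
    equivariant_subg[OF A] equivariant_subg[OF invariant_Diff[OF T A]]
  unfolding coprod_gset_def invariant_subset_def by simp blast

lemma finite_gset_emptyg: "finite_gset G emptyg"
  by (rule finite_gsetI) (auto simp: emptyg_def)

lemma coprodD:
  assumes "coprod_gset G X Y D i j"
  shows "finite_gset G X" "finite_gset G Y" "finite_gset G D" "equivariant G X D i" "equivariant G Y D j"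
    "inj_on i (pts X)" "inj_on j (pts Y)" "pts D = i ` pts X \<union> j ` pts Y" "i ` pts X \<inter> j ` pts Y = {}"
  using assms by (auto simp: coprod_gset_def)

lemma conjugate_set_eq: "conjugate_set G g K = (\<lambda>k. g \<otimes> k \<otimes> inv g) ` K"
  by (auto simp: conjugate_set_def l_coset_def r_coset_def)

lemma stab_act:
  assumes T: "finite_gset G T" and g: "g \<in> carrier G" and x: "x \<in> pts T"
  shows "stab T (act T g x) = conjugate_set G g (stab T x)"
proof (intro Set.set_eqI iffI)
  fix h assume "h \<in> stab T (act T g x)"
  then have h: "h \<in> carrier G" "act T h (act T g x) = act T g x" by (auto simp: stab_iff)
  have "act T (inv g \<otimes> h \<otimes> g) x = x"
    using g x h T by (simp add: gs_mult gs_inv m_assoc)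
  then have "inv g \<otimes> h \<otimes> g \<in> stab T x" using g h by (simp add: stab_iff)
  moreover have "h = g \<otimes> (inv g \<otimes> h \<otimes> g) \<otimes> inv g"
    using g h by (metis inv_closed inv_solve_left m_assoc m_closed r_inv r_one)
  ultimately show "h \<in> conjugate_set G g (stab T x)"
    unfolding conjugate_set_eq by blast
next
  fix h assume "h \<in> conjugate_set G g (stab T x)"
  then obtain k where "k \<in> carrier G" "act T k x = x" "h = g \<otimes> k \<otimes> inv g"
    by (auto simp: conjugate_set_eq stab_iff)
  then show "h \<in> stab T (act T g x)"
    using g x T by (simp add: stab_iff gs_mult gs_inv)
qed

lemma subconjugate_mono: "\<lbrakk>K \<subseteq> K'; subconjugate G K' H\<rbrakk> \<Longrightarrow> subconjugate G K H"
  unfolding subconjugate_def conjugate_set_eq by blast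

end

section \<open>The Lindner category\<close>

lemma partial_order_onD:
  assumes "partial_order_on A r"
  shows "r \<subseteq> A \<times> A" "\<And>x. x \<in> A \<Longrightarrow> (x, x) \<in> r" "trans r"
  using assms by (auto simp: partial_order_on_def preorder_on_def refl_on_def)

text \<open>Legs of spans are undefined off the apex. Restricting here allows legs to be arbitrary
  functions everywhere else, so that compositions can be written as lambda terms.\<close>

definition mkspan :: "('a, 'u) gset \<Rightarrow> ('u \<Rightarrow> 's) \<Rightarrow> ('u \<Rightarrow> 't) \<Rightarrow> ('a, 'u, 's, 't) gspan" where
  "mkspan A l r = \<lparr>apex = A, lleg = restrict l (pts A), rleg = restrict r (pts A)\<rparr>"

lemma mkspan_simps [simp]:
  "apex (mkspan A l r) = A" "lleg (mkspan A l r) = restrict l (pts A)" "rleg (mkspan A l r) = restrict r (pts A)"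
  by (simp_all add: mkspan_def)

section \<open>Transfer systems and admissible maps\<close>

locale transfer = group G for G :: "('a, 'b) monoid_scheme" (structure) +
  fixes \<O> :: "('a set \<times> 'a set) set"
  assumes fin: "finite (carrier G)" and ts: "transfer_system G \<O>"
begin

lemma O_order: "partial_order_on {H. subgroup H G} \<O>"
  using ts by (simp add: transfer_system_def)

lemma O_subgroup: "(K, H) \<in> \<O> \<Longrightarrow> subgroup K G \<and> subgroup H G"
  using partial_order_onD(1)[OF O_order] by blast

lemma O_refl: "subgroup H G \<Longrightarrow> (H, H) \<in> \<O>"
  using partial_order_onD(2)[OF O_order] by blast

lemma O_trans: "(K, H) \<in> \<O> \<Longrightarrow> (H, L) \<in> \<O> \<Longrightarrow> (K, L) \<in> \<O>"
  using transD[OF partial_order_onD(3)[OF O_order]] .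

lemma O_restrict: "\<lbrakk>(K, H) \<in> \<O>; subgroup L G; L \<subseteq> H\<rbrakk> \<Longrightarrow> (K \<inter> L, L) \<in> \<O>"
  using ts unfolding transfer_system_def by blast

lemma O_conj: "\<lbrakk>(K, H) \<in> \<O>; g \<in> carrier G\<rbrakk> \<Longrightarrow> (conjugate_set G g K, conjugate_set G g H) \<in> \<O>"
  using ts unfolding transfer_system_def by blast

definition admissible :: "('a, nat) gset \<Rightarrow> ('a, nat) gset \<Rightarrow> (nat \<Rightarrow> nat) \<Rightarrow> bool" where
  "admissible A T r \<longleftrightarrow> equivariant G A T r \<and> (\<forall>x\<in>pts A. (stab A x, stab T (r x)) \<in> \<O>)"

lemma admissibleD:
  assumes "admissible A T r"
  shows adm_equivariant: "equivariant G A T r"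
    and adm_O: "x \<in> pts A \<Longrightarrow> (stab A x, stab T (r x)) \<in> \<O>"
  using assms by (auto simp: admissible_def)

lemma admissible_comp: "\<lbrakk>admissible A B f; admissible B C h\<rbrakk> \<Longrightarrow> admissible A C (\<lambda>x. h (f x))"
  by (auto simp: admissible_def equivariant_comp equivariant_pts intro: O_trans)

text \<open>Stabilizers do not change along an injection, so reflexivity of \<open>\<O>\<close> is
  enough. In particular inclusions of invariant subsets may be transferred along.\<close>

lemma admissible_inj:
  assumes "finite_gset G A" "equivariant G A B f" "inj_on f (pts A)"
  shows "admissible A B f"
  using assms stab_inj[OF assms(2,3)] subgroup_stab[OF assms(1)] by (auto simp: admissible_def O_refl)

definition span_data :: "('a, nat) gset \<Rightarrow> ('a, nat) gset \<Rightarrow> ('a, nat) gset \<Rightarrow> (nat \<Rightarrow> nat) \<Rightarrow> (nat \<Rightarrow> nat) \<Rightarrow> bool" where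
  "span_data S T A l r \<longleftrightarrow> finite_gset G A \<and> equivariant G A S l \<and> admissible A T r"

lemma span_dataD:
  assumes "span_data S T A l r"
  shows sd_gset: "finite_gset G A" and sd_l: "equivariant G A S l" and sd_adm: "admissible A T r"
    and sd_r: "equivariant G A T r"
  using assms by (auto simp: span_data_def admissible_def)

lemma mkspan_in_spans: "span_data S T A l r \<Longrightarrow> mkspan A l r \<in> spans G \<O> S T"
  by (auto simp: span_data_def admissible_def spans_def gmaps_def Fin_O_maps_def equivariant_def)

lemma spans_mkspan:
  assumes "w \<in> spans G \<O> S T"
  shows "span_data S T (apex w) (lleg w) (rleg w)" "w = mkspan (apex w) (lleg w) (rleg w)"
proof -
  show "span_data S T (apex w) (lleg w) (rleg w)"
    using assms by (auto simp: span_data_def admissible_def spans_def gmaps_def Fin_O_maps_def equivariant_def)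
  have "restrict (lleg w) (pts (apex w)) = lleg w" "restrict (rleg w) (pts (apex w)) = rleg w"
    using assms by (auto simp: spans_def gmaps_def Fin_O_maps_def PiE_def extensional_restrict)
  then show "w = mkspan (apex w) (lleg w) (rleg w)"
    by (simp add: mkspan_def)
qed

section \<open>Isomorphism classes of spans\<close>

definition isomorphic_spans ::
  "('a, 'u) gset \<Rightarrow> ('u \<Rightarrow> nat) \<Rightarrow> ('u \<Rightarrow> nat) \<Rightarrow> ('a, 'w) gset \<Rightarrow> ('w \<Rightarrow> nat) \<Rightarrow> ('w \<Rightarrow> nat) \<Rightarrow> ('u \<Rightarrow> 'w) \<Rightarrow> bool"
  where "isomorphic_spans A l r B l' r' \<theta> \<longleftrightarrow> equivariant G A B \<theta> \<and> bij_betw \<theta> (pts A) (pts B) \<and>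
    (\<forall>x\<in>pts A. l' (\<theta> x) = l x \<and> r' (\<theta> x) = r x)"

lemma isomorphic_spansD:
  assumes "isomorphic_spans A l r B l' r' \<theta>"
  shows "equivariant G A B \<theta>" "bij_betw \<theta> (pts A) (pts B)" "\<And>x. x \<in> pts A \<Longrightarrow> \<theta> x \<in> pts B"
    "\<And>x. x \<in> pts A \<Longrightarrow> l' (\<theta> x) = l x" "\<And>x. x \<in> pts A \<Longrightarrow> r' (\<theta> x) = r x"
  using assms by (auto simp: isomorphic_spans_def equivariant_def)

lemma span_iso_iff:
  assumes act: "\<And>g x. \<lbrakk>g \<in> carrier G; x \<in> pts (apex v)\<rbrakk> \<Longrightarrow> act (apex v) g x \<in> pts (apex v)"
  shows "span_iso G v w \<longleftrightarrow>
    (\<exists>\<theta>. isomorphic_spans (apex v) (lleg v) (rleg v) (apex w) (lleg w) (rleg w) \<theta>)"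
proof
  assume "span_iso G v w"
  then show "\<exists>\<theta>. isomorphic_spans (apex v) (lleg v) (rleg v) (apex w) (lleg w) (rleg w) \<theta>"
    unfolding span_iso_def isomorphic_spans_def gmaps_def equivariant_def by blast
next
  assume "\<exists>\<theta>. isomorphic_spans (apex v) (lleg v) (rleg v) (apex w) (lleg w) (rleg w) \<theta>"
  then obtain \<theta> where \<theta>: "isomorphic_spans (apex v) (lleg v) (rleg v) (apex w) (lleg w) (rleg w) \<theta>" by blast
  have "restrict \<theta> (pts (apex v)) \<in> gmaps G (apex v) (apex w)"
    using \<theta> act by (auto simp: isomorphic_spans_def equivariant_def gmaps_def)
  moreover have "bij_betw (restrict \<theta> (pts (apex v))) (pts (apex v)) (pts (apex w))"
    using isomorphic_spansD(2)[OF \<theta>] by (simp cong: bij_betw_cong)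
  ultimately show "span_iso G v w"
    unfolding span_iso_def using isomorphic_spansD[OF \<theta>] by (intro bexI) auto
qed

lemma isomorphic_spans_sym:
  assumes \<theta>: "isomorphic_spans A l r B l' r' \<theta>"
    and act: "\<And>g x. \<lbrakk>g \<in> carrier G; x \<in> pts A\<rbrakk> \<Longrightarrow> act A g x \<in> pts A"
  shows "isomorphic_spans B l' r' A l r (the_inv_into (pts A) \<theta>)"
proof -
  let ?k = "the_inv_into (pts A) \<theta>"
  note D = isomorphic_spansD[OF \<theta>]
  have k1: "?k (\<theta> x) = x" if "x \<in> pts A" for x
    using D(2) that by (simp add: bij_betw_def the_inv_into_f_f)
  have ex: "\<exists>x\<in>pts A. y = \<theta> x" if "y \<in> pts B" for y
    using D(2) that by (auto simp: bij_betw_def)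
  have "?k (act B g (\<theta> x)) = act A g x" if "g \<in> carrier G" "x \<in> pts A" for g x
    using equivariant_act[OF D(1) that] k1[OF act[OF that]] by simp
  then show ?thesis
    unfolding isomorphic_spans_def equivariant_def
    using D(4,5) k1 by (auto dest!: ex intro!: bij_betw_the_inv_into D(2))
qed

lemma isomorphic_spans_commute:
  assumes "\<And>g x. \<lbrakk>g \<in> carrier G; x \<in> pts A\<rbrakk> \<Longrightarrow> act A g x \<in> pts A"
    and "\<And>g x. \<lbrakk>g \<in> carrier G; x \<in> pts B\<rbrakk> \<Longrightarrow> act B g x \<in> pts B"
  shows "(\<exists>\<theta>. isomorphic_spans A l r B l' r' \<theta>) \<longleftrightarrow> (\<exists>\<theta>. isomorphic_spans B l' r' A l r \<theta>)"
proof
  assume "\<exists>\<theta>. isomorphic_spans A l r B l' r' \<theta>"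
  then obtain \<theta> where "isomorphic_spans A l r B l' r' \<theta>" ..
  from isomorphic_spans_sym[OF this] assms(1) show "\<exists>\<theta>. isomorphic_spans B l' r' A l r \<theta>" by blast
next
  assume "\<exists>\<theta>. isomorphic_spans B l' r' A l r \<theta>"
  then obtain \<theta> where "isomorphic_spans B l' r' A l r \<theta>" ..
  from isomorphic_spans_sym[OF this] assms(2) show "\<exists>\<theta>. isomorphic_spans A l r B l' r' \<theta>" by blast
qed

lemma isomorphic_spans_trans:
  assumes "isomorphic_spans A l r B l' r' \<theta>" "isomorphic_spans B l' r' C l'' r'' \<theta>'"
  shows "isomorphic_spans A l r C l'' r'' (\<lambda>x. \<theta>' (\<theta> x))"
  using assms bij_betw_trans[of \<theta> "pts A" "pts B" \<theta>' "pts C"]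
  by (auto simp: isomorphic_spans_def equivariant_def o_def)

lemma isomorphic_spans_cong:
  assumes "\<And>x. x \<in> pts A \<Longrightarrow> l x = l2 x" "\<And>x. x \<in> pts A \<Longrightarrow> r x = r2 x"
    "\<And>x. x \<in> pts B \<Longrightarrow> l' x = l2' x" "\<And>x. x \<in> pts B \<Longrightarrow> r' x = r2' x"
  shows "isomorphic_spans A l r B l' r' \<theta> = isomorphic_spans A l2 r2 B l2' r2' \<theta>"
  using assms by (auto simp: isomorphic_spans_def equivariant_def)

text \<open>The morphism of the Lindner category represented by a span. By \<open>Hom_mor\<close>
  every morphism has this form, and \<open>mor_eqI\<close> and \<open>mor_eqD\<close> translate
  equality of morphisms into isomorphism of spans.\<close>

definition mor :: "('a, nat) gset \<Rightarrow> ('a, nat) gset \<Rightarrow> ('a, nat) gset \<Rightarrow> (nat \<Rightarrow> nat) \<Rightarrow> (nat \<Rightarrow> nat) \<Rightarrow> 'a lindner_mor" where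
  "mor S T A l r = {w \<in> spans G \<O> S T.
    \<exists>\<theta>. isomorphic_spans A l r (apex w) (lleg w) (rleg w) \<theta>}"

lemma span_rel_Image:
  assumes "v \<in> spans G \<O> S T"
  shows "{(v, w). v \<in> spans G \<O> S T \<and> w \<in> spans G \<O> S T \<and> span_iso G v w} `` {v} =
    mor S T (apex v) (lleg v) (rleg v)"
proof -
  have "finite_gset G (apex v)" using assms by (simp add: spans_def)
  then show ?thesis
    using assms span_iso_iff[of v] unfolding mor_def by (auto simp: gs_act)
qed

lemma mor_cong:
  assumes "\<And>x. x \<in> pts A \<Longrightarrow> l x = l' x" "\<And>x. x \<in> pts A \<Longrightarrow> r x = r' x"
  shows "mor S T A l r = mor S T A l' r'"
proof -
  have "isomorphic_spans A l r B k s = isomorphic_spans A l' r' B k s" for B :: "('a, nat) gset" and k s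
    by (intro ext isomorphic_spans_cong) (use assms in auto)
  then show ?thesis by (simp add: mor_def)
qed

lemma mor_in_Hom:
  assumes "span_data S T A l r"
  shows "mor S T A l r \<in> Hom (lindner G \<O>) S T"
proof -
  have "mor S T A l r = mor S T A (restrict l (pts A)) (restrict r (pts A))"
    by (rule mor_cong) auto
  also have "\<dots> = {(v, w). v \<in> spans G \<O> S T \<and> w \<in> spans G \<O> S T \<and> span_iso G v w} `` {mkspan A l r}"
    by (subst span_rel_Image[OF mkspan_in_spans[OF assms]]) simp
  finally show ?thesis
    unfolding lindner_def quotient_def using mkspan_in_spans[OF assms] by auto
qed

lemma Hom_mor:
  assumes "f \<in> Hom (lindner G \<O>) S T"
  obtains A l r where "span_data S T A l r" "f = mor S T A l r"
proof -
  have "f \<in> spans G \<O> S T // {(v, w). v \<in> spans G \<O> S T \<and> w \<in> spans G \<O> S T \<and> span_iso G v w}"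
    using assms by (simp add: lindner_def)
  then obtain v :: "('a, nat, nat, nat) gspan" where v: "f = {(v, w). v \<in> spans G \<O> S T \<and> w \<in> spans G \<O> S T \<and> span_iso G v w} `` {v}"
    "v \<in> spans G \<O> S T"
    by (rule quotientE) blast
  have "f = mor S T (apex v) (lleg v) (rleg v)"
    unfolding v(1) by (rule span_rel_Image[OF v(2)])
  with spans_mkspan(1)[OF v(2)] show ?thesis by (rule that)
qed

lemma mor_eqI:
  assumes A: "span_data S T A l r" and \<theta>: "isomorphic_spans A l r B l' r' \<theta>"
  shows "mor S T A l r = mor S T B l' r'"
proof -
  have "isomorphic_spans B l' r' A l r (the_inv_into (pts A) \<theta>)"
    using isomorphic_spans_sym[OF \<theta>] gs_act[OF sd_gset[OF A]] by blast
  then show ?thesis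
    unfolding mor_def using isomorphic_spans_trans \<theta> by blast
qed

lemma mor_eqD:
  assumes A: "span_data S T A l r" and B: "span_data S T B l' r'" and "mor S T A l r = mor S T B l' r'"
  obtains \<theta> where "isomorphic_spans A l r B l' r' \<theta>"
proof -
  have "isomorphic_spans B l' r' (apex (mkspan B l' r')) (lleg (mkspan B l' r')) (rleg (mkspan B l' r')) (\<lambda>x. x)"
    by (auto simp: isomorphic_spans_def equivariant_def bij_betw_def)
  then have "mkspan B l' r' \<in> mor S T B l' r'"
    unfolding mor_def using mkspan_in_spans[OF B] by blast
  then have "mkspan B l' r' \<in> mor S T A l r"
    using assms(3) by simp
  then obtain \<theta> where "isomorphic_spans A l r B (restrict l' (pts B)) (restrict r' (pts B)) \<theta>"
    unfolding mor_def by auto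
  then have "isomorphic_spans A l r B l' r' \<theta>"
    by (subst isomorphic_spans_cong[of A _ l _ r B _ "restrict l' (pts B)" _ "restrict r' (pts B)"]) auto
  then show ?thesis by (rule that)
qed

text \<open>Any G-set in the role of the fibre product, not only the model \<open>pbk\<close>.
  Composites can then be computed with the most convenient apex, for instance an apex already at
  hand when one leg is an identity.\<close>

definition pullback ::
  "('a, nat) gset \<Rightarrow> (nat \<Rightarrow> nat) \<Rightarrow> ('a, nat) gset \<Rightarrow> (nat \<Rightarrow> nat) \<Rightarrow> ('a, nat) gset \<Rightarrow>
    (nat \<Rightarrow> nat) \<Rightarrow> (nat \<Rightarrow> nat) \<Rightarrow> bool" where
  "pullback A r B l P p q \<longleftrightarrow> finite_gset G P \<and> equivariant G P A p \<and> equivariant G P B q \<and>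
    bij_betw (\<lambda>z. (p z, q z)) (pts P) {(x, y). x \<in> pts A \<and> y \<in> pts B \<and> r x = l y}"

lemma pullbackI:
  assumes "finite_gset G P" "equivariant G P A p" "equivariant G P B q"
    "\<And>z. z \<in> pts P \<Longrightarrow> r (p z) = l (q z)"
    "\<And>z w. \<lbrakk>z \<in> pts P; w \<in> pts P; p z = p w; q z = q w\<rbrakk> \<Longrightarrow> z = w"
    "\<And>x y. \<lbrakk>x \<in> pts A; y \<in> pts B; r x = l y\<rbrakk> \<Longrightarrow> \<exists>z\<in>pts P. p z = x \<and> q z = y"
  shows "pullback A r B l P p q"
  unfolding pullback_def
proof (intro conjI bij_betwI')
  fix y assume "y \<in> {(x, y). x \<in> pts A \<and> y \<in> pts B \<and> r x = l y}"
  then show "\<exists>x\<in>pts P. y = (p x, q x)" using assms(6)[of "fst y" "snd y"] by force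
qed (use assms equivariant_pts[OF assms(2)] equivariant_pts[OF assms(3)] in auto)

lemma pullbackD:
  assumes "pullback A r B l P p q"
  shows "finite_gset G P" "equivariant G P A p" "equivariant G P B q"
    "\<And>z. z \<in> pts P \<Longrightarrow> r (p z) = l (q z)"
    "\<And>z w. \<lbrakk>z \<in> pts P; w \<in> pts P; p z = p w; q z = q w\<rbrakk> \<Longrightarrow> z = w"
    "\<And>x y. \<lbrakk>x \<in> pts A; y \<in> pts B; r x = l y\<rbrakk> \<Longrightarrow> \<exists>z\<in>pts P. p z = x \<and> q z = y"
proof -
  have b: "bij_betw (\<lambda>z. (p z, q z)) (pts P) {(x, y). x \<in> pts A \<and> y \<in> pts B \<and> r x = l y}"
    and "finite_gset G P" "equivariant G P A p" "equivariant G P B q"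
    using assms by (auto simp: pullback_def)
  then show "finite_gset G P" "equivariant G P A p" "equivariant G P B q" by blast+
  show "r (p z) = l (q z)" if "z \<in> pts P" for z
    using bij_betwE[OF b] that by auto
  show "z = w" if "z \<in> pts P" "w \<in> pts P" "p z = p w" "q z = q w" for z w
    using bij_betw_imp_inj_on[OF b] that by (auto simp: inj_on_def)
  show "\<exists>z\<in>pts P. p z = x \<and> q z = y" if "x \<in> pts A" "y \<in> pts B" "r x = l y" for x y
    using bij_betw_imp_surj_on[OF b] that by (auto simp: set_eq_iff image_iff) metis
qed

lemma pullback_pbk:
  assumes "finite_gset G A" "finite_gset G B" "equivariant G A T r" "equivariant G B T l"
  shows "pullback A r B l (pbk A B r l) pr1 pr2"
  by (rule pullbackI) (use assms in \<open>auto simp: finite_gset_pbk equivariant_pbk intro: pr_eqI bexI[of _ "pr x y" for x y]\<close>)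

lemma stab_pullback:
  assumes P: "pullback A r B l P p q" and z: "z \<in> pts P"
  shows "stab P z = stab A (p z) \<inter> stab B (q z)"
proof
  show "stab P z \<subseteq> stab A (p z) \<inter> stab B (q z)"
    using stab_mono[OF pullbackD(2)[OF P] z] stab_mono[OF pullbackD(3)[OF P] z] by blast
  show "stab A (p z) \<inter> stab B (q z) \<subseteq> stab P z"
  proof
    fix g assume "g \<in> stab A (p z) \<inter> stab B (q z)"
    then have g: "g \<in> carrier G" "act A g (p z) = p z" "act B g (q z) = q z" by (auto simp: stab_iff)
    have "act P g z = z"
      by (rule pullbackD(5)[OF P]) (use g z equivariant_act[OF pullbackD(2)[OF P]]
          equivariant_act[OF pullbackD(3)[OF P]] gs_act[OF pullbackD(1)[OF P]] in auto)
    then show "g \<in> stab P z" using g by (simp add: stab_iff)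
  qed
qed

text \<open>Base change is the restriction axiom: the stabilizer of a point of P is the intersection
  of the stabilizers of its projections, and the one in B lies below the stabilizer of the common
  image in T.\<close>

lemma admissible_pullback:
  assumes P: "pullback A r B l P p q" and r: "admissible A T r" and l: "equivariant G B T l"
    and B: "finite_gset G B"
  shows "admissible P B q"
  unfolding admissible_def
proof (intro conjI ballI)
  fix z assume z: "z \<in> pts P"
  have p: "p z \<in> pts A" and q: "q z \<in> pts B"
    using equivariant_pts[OF pullbackD(2)[OF P] z] equivariant_pts[OF pullbackD(3)[OF P] z] by auto
  have "(stab A (p z) \<inter> stab B (q z), stab B (q z)) \<in> \<O>"
    using O_restrict[OF adm_O[OF r p] subgroup_stab[OF B q]] stab_mono[OF l q] pullbackD(4)[OF P z] by simp
  then show "(stab P z, stab B (q z)) \<in> \<O>"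
    by (simp add: stab_pullback[OF P z])
qed (rule pullbackD(3)[OF P])

lemma span_data_pullback:
  assumes v: "span_data S T A l r" and w: "span_data T R B l' r'" and P: "pullback A r B l' P p q"
  shows "span_data S R P (\<lambda>z. l (p z)) (\<lambda>z. r' (q z))"
  unfolding span_data_def
  using pullbackD[OF P] equivariant_comp[OF pullbackD(2)[OF P] sd_l[OF v]]
    admissible_comp[OF admissible_pullback[OF P sd_adm[OF v] sd_l[OF w] sd_gset[OF w]] sd_adm[OF w]]
  by blast

section \<open>Composition of spans and the category axioms\<close>

lemma comp_span_simps:
  "pts (apex (comp_span w v)) = {(x, y). x \<in> pts (apex v) \<and> y \<in> pts (apex w) \<and> rleg v x = lleg w y}"
  "z \<in> pts (apex (comp_span w v)) \<Longrightarrow>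
    act (apex (comp_span w v)) g z = (act (apex v) g (fst z), act (apex w) g (snd z))"
  "z \<in> pts (apex (comp_span w v)) \<Longrightarrow> lleg (comp_span w v) z = lleg v (fst z)"
  "z \<in> pts (apex (comp_span w v)) \<Longrightarrow> rleg (comp_span w v) z = rleg w (snd z)"
  by (simp_all add: comp_span_def Let_def)

lemma isomorphic_comp_span:
  assumes P: "pullback A r B l' P p q" and \<alpha>: "isomorphic_spans A l r (apex v) (lleg v) (rleg v) \<alpha>"
    and \<beta>: "isomorphic_spans B l' r' (apex w) (lleg w) (rleg w) \<beta>"
  shows "isomorphic_spans P (\<lambda>z. l (p z)) (\<lambda>z. r' (q z)) (apex (comp_span w v))
    (lleg (comp_span w v)) (rleg (comp_span w v)) (\<lambda>z. (\<alpha> (p z), \<beta> (q z)))"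
proof -
  note a = isomorphic_spansD[OF \<alpha>] and b = isomorphic_spansD[OF \<beta>] and P' = pullbackD[OF P]
  have p: "p z \<in> pts A" and q: "q z \<in> pts B" if "z \<in> pts P" for z
    using equivariant_pts[OF P'(2) that] equivariant_pts[OF P'(3) that] by auto
  have in_c: "(\<alpha> (p z), \<beta> (q z)) \<in> pts (apex (comp_span w v))" if "z \<in> pts P" for z
    using a(3,5)[OF p[OF that]] b(3,4)[OF q[OF that]] P'(4)[OF that] by (simp add: comp_span_simps(1))
  have "bij_betw (\<lambda>z. (\<alpha> (p z), \<beta> (q z))) (pts P) (pts (apex (comp_span w v)))"
  proof (rule bij_betwI')
    fix z z' assume z: "z \<in> pts P" "z' \<in> pts P"
    show "((\<alpha> (p z), \<beta> (q z)) = (\<alpha> (p z'), \<beta> (q z'))) = (z = z')"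
      using inj_onD[OF bij_betw_imp_inj_on[OF a(2)], of "p z" "p z'"]
        inj_onD[OF bij_betw_imp_inj_on[OF b(2)], of "q z" "q z'"] p[OF z(1)] p[OF z(2)] q[OF z(1)] q[OF z(2)]
        P'(5)[OF z] by auto
  next
    fix y assume "y \<in> pts (apex (comp_span w v))"
    then obtain y1 y2 where y: "y = (y1, y2)" "y1 \<in> pts (apex v)" "y2 \<in> pts (apex w)" "rleg v y1 = lleg w y2"
      by (auto simp: comp_span_simps(1))
    then obtain x1 x2 where x: "x1 \<in> pts A" "x2 \<in> pts B" "y1 = \<alpha> x1" "y2 = \<beta> x2"
      using bij_betw_imp_surj_on[OF a(2)] bij_betw_imp_surj_on[OF b(2)] by blast
    then obtain z where "z \<in> pts P" "p z = x1" "q z = x2"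
      using P'(6)[of x1 x2] y(4) a(5) b(4) by auto
    then show "\<exists>z\<in>pts P. y = (\<alpha> (p z), \<beta> (q z))"
      using x y(1) by auto
  qed (rule in_c)
  then show ?thesis
    unfolding isomorphic_spans_def equivariant_def
    using in_c p q a(4,5) b(4,5) equivariant_act[OF a(1)] equivariant_act[OF b(1)]
      equivariant_act[OF P'(2)] equivariant_act[OF P'(3)]
    by (simp add: comp_span_simps(2-4))
qed

text \<open>Composition runs over all representatives of both classes, but their fibre products are
  all isomorphic to P as spans; a single pullback of a single pair of representatives therefore
  computes the composite.\<close>

lemma Comp_mor:
  assumes v: "span_data S T A l r" and w: "span_data T R B l' r'" and P: "pullback A r B l' P p q"
  shows "Comp (lindner G \<O>) S T R (mor T R B l' r') (mor S T A l r) =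
    mor S R P (\<lambda>z. l (p z)) (\<lambda>z. r' (q z))"
proof -
  let ?l = "\<lambda>z. l (p z)" and ?r = "\<lambda>z. r' (q z)"
  have iso: "span_iso G x (comp_span w' v') \<longleftrightarrow>
      (\<exists>\<theta>. isomorphic_spans P ?l ?r (apex x) (lleg x) (rleg x) \<theta>)"
    if x: "x \<in> spans G \<O> S R" and v': "v' \<in> mor S T A l r" and w': "w' \<in> mor T R B l' r'" for x v' w'
  proof -
    obtain \<alpha> \<beta> where ab: "isomorphic_spans A l r (apex v') (lleg v') (rleg v') \<alpha>"
      "isomorphic_spans B l' r' (apex w') (lleg w') (rleg w') \<beta>"
      using v' w' by (auto simp: mor_def)
    note c = isomorphic_comp_span[OF P this]
    have x': "finite_gset G (apex x)" using x by (simp add: spans_def)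
    have c': "isomorphic_spans (apex (comp_span w' v')) (lleg (comp_span w' v')) (rleg (comp_span w' v')) P ?l ?r
        (the_inv_into (pts P) (\<lambda>z. (\<alpha> (p z), \<beta> (q z))))"
      using isomorphic_spans_sym[OF c] gs_act[OF pullbackD(1)[OF P]] by blast
    have "span_iso G x (comp_span w' v') \<longleftrightarrow>
      (\<exists>\<theta>. isomorphic_spans (apex x) (lleg x) (rleg x) (apex (comp_span w' v'))
        (lleg (comp_span w' v')) (rleg (comp_span w' v')) \<theta>)"
      by (rule span_iso_iff) (simp add: gs_act[OF x'])
    also have "\<dots> \<longleftrightarrow> (\<exists>\<theta>. isomorphic_spans (apex x) (lleg x) (rleg x) P ?l ?r \<theta>)"
      using isomorphic_spans_trans[OF _ c] isomorphic_spans_trans[OF _ c'] by blast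
    also have "\<dots> \<longleftrightarrow> (\<exists>\<theta>. isomorphic_spans P ?l ?r (apex x) (lleg x) (rleg x) \<theta>)"
      by (rule isomorphic_spans_commute) (simp_all add: gs_act[OF x'] gs_act[OF pullbackD(1)[OF P]])
    finally show ?thesis .
  qed
  have "mkspan A l r \<in> mor S T A l r" "mkspan B l' r' \<in> mor T R B l' r'"
    unfolding mor_def using mkspan_in_spans[OF v] mkspan_in_spans[OF w]
    by (auto intro!: exI[of _ "\<lambda>x. x"] simp: isomorphic_spans_def equivariant_def bij_betw_def)
  then have "{x \<in> spans G \<O> S R. \<exists>u \<in> mor S T A l r. \<exists>v \<in> mor T R B l' r'. span_iso G x (comp_span v u)} =
      mor S R P ?l ?r"
    unfolding mor_def[of S R] using iso by blast
  then show ?thesis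
    by (simp add: lindner_def)
qed

lemma Comp_mor_pbk:
  assumes v: "span_data S T A l r" and w: "span_data T R B l' r'"
  shows "Comp (lindner G \<O>) S T R (mor T R B l' r') (mor S T A l r) =
      mor S R (pbk A B r l') (\<lambda>z. l (pr1 z)) (\<lambda>z. r' (pr2 z))"
    and "span_data S R (pbk A B r l') (\<lambda>z. l (pr1 z)) (\<lambda>z. r' (pr2 z))"
    and "pullback A r B l' (pbk A B r l') pr1 pr2"
proof -
  show P: "pullback A r B l' (pbk A B r l') pr1 pr2"
    using pullback_pbk sd_gset[OF v] sd_gset[OF w] sd_r[OF v] sd_l[OF w] .
  show "Comp (lindner G \<O>) S T R (mor T R B l' r') (mor S T A l r) =
      mor S R (pbk A B r l') (\<lambda>z. l (pr1 z)) (\<lambda>z. r' (pr2 z))"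
    by (rule Comp_mor[OF v w P])
  show "span_data S R (pbk A B r l') (\<lambda>z. l (pr1 z)) (\<lambda>z. r' (pr2 z))"
    by (rule span_data_pullback[OF v w P])
qed

lemma span_data_id: "finite_gset G S \<Longrightarrow> span_data S S S (\<lambda>x. x) (\<lambda>x. x)"
  by (simp add: span_data_def equivariant_id admissible_inj)

lemma Ident_mor:
  assumes S: "finite_gset G S"
  shows "Ident (lindner G \<O>) S = mor S S S (\<lambda>x. x) (\<lambda>x. x)"
proof -
  have "span_iso G w \<lparr>apex = S, lleg = (\<lambda>x\<in>pts S. x), rleg = (\<lambda>x\<in>pts S. x)\<rparr> \<longleftrightarrow>
      (\<exists>\<theta>. isomorphic_spans S (\<lambda>x. x) (\<lambda>x. x) (apex w) (lleg w) (rleg w) \<theta>)"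
    if "w \<in> spans G \<O> S S" for w
  proof -
    have w: "finite_gset G (apex w)" using that by (simp add: spans_def)
    have "span_iso G w \<lparr>apex = S, lleg = (\<lambda>x\<in>pts S. x), rleg = (\<lambda>x\<in>pts S. x)\<rparr> \<longleftrightarrow>
      (\<exists>\<theta>. isomorphic_spans (apex w) (lleg w) (rleg w) S (\<lambda>x\<in>pts S. x) (\<lambda>x\<in>pts S. x) \<theta>)"
      using span_iso_iff[of w "\<lparr>apex = S, lleg = (\<lambda>x\<in>pts S. x), rleg = (\<lambda>x\<in>pts S. x)\<rparr>"] gs_act[OF w] by simp
    also have "\<dots> \<longleftrightarrow> (\<exists>\<theta>. isomorphic_spans (apex w) (lleg w) (rleg w) S (\<lambda>x. x) (\<lambda>x. x) \<theta>)"
    proof -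
      have "isomorphic_spans (apex w) (lleg w) (rleg w) S (\<lambda>x\<in>pts S. x) (\<lambda>x\<in>pts S. x) =
          isomorphic_spans (apex w) (lleg w) (rleg w) S (\<lambda>x. x) (\<lambda>x. x)"
        by (intro ext isomorphic_spans_cong) auto
      then show ?thesis by simp
    qed
    also have "\<dots> \<longleftrightarrow> (\<exists>\<theta>. isomorphic_spans S (\<lambda>x. x) (\<lambda>x. x) (apex w) (lleg w) (rleg w) \<theta>)"
      by (rule isomorphic_spans_commute) (simp_all add: gs_act[OF w] gs_act[OF S])
    finally show ?thesis .
  qed
  then show ?thesis
    by (auto simp: lindner_def mor_def)
qed

lemma lindner_Obj [simp]: "X \<in> Obj (lindner G \<O>) \<longleftrightarrow> finite_gset G X"
  by (simp add: lindner_def)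

lemma category_lindner: "category (lindner G \<O>)"
proof (unfold_locales, goal_cases)
  case (1 X)
  then show ?case by (simp add: Ident_mor mor_in_Hom span_data_id)
next
  case (2 X Y Z f g)
  obtain A l r where A: "span_data X Y A l r" and f: "f = mor X Y A l r" by (rule Hom_mor[OF 2(4)])
  obtain B l' r' where B: "span_data Y Z B l' r'" and g: "g = mor Y Z B l' r'" by (rule Hom_mor[OF 2(5)])
  show ?case
    unfolding f g Comp_mor_pbk(1)[OF A B] by (rule mor_in_Hom[OF Comp_mor_pbk(2)[OF A B]])
next
  case (3 X Y f)
  then have Y: "finite_gset G Y" by simp
  obtain A l r where A: "span_data X Y A l r" and f: "f = mor X Y A l r" by (rule Hom_mor[OF 3(3)])
  have "pullback A r Y (\<lambda>x. x) A (\<lambda>x. x) r"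
    by (rule pullbackI) (use sd_gset[OF A] sd_r[OF A] in \<open>auto simp: equivariant_id\<close>)
  from Comp_mor[OF A span_data_id[OF Y] this] show ?case
    by (simp add: f Ident_mor[OF Y])
next
  case (4 X Y f)
  then have X: "finite_gset G X" by simp
  obtain A l r where A: "span_data X Y A l r" and f: "f = mor X Y A l r" by (rule Hom_mor[OF 4(3)])
  have "pullback X (\<lambda>x. x) A l A l (\<lambda>x. x)"
    by (rule pullbackI) (use sd_gset[OF A] sd_l[OF A] in \<open>auto simp: equivariant_id\<close>)
  from Comp_mor[OF span_data_id[OF X] A this] show ?case
    by (simp add: f Ident_mor[OF X])
next
  case (5 W X Y Z f g h)
  obtain A a a' where A: "span_data W X A a a'" and f: "f = mor W X A a a'" by (rule Hom_mor[OF 5(5)])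
  obtain B b b' where B: "span_data X Y B b b'" and g: "g = mor X Y B b b'" by (rule Hom_mor[OF 5(6)])
  obtain D d d' where D: "span_data Y Z D d d'" and h: "h = mor Y Z D d d'" by (rule Hom_mor[OF 5(7)])
  note AB = Comp_mor_pbk[OF A B] and BD = Comp_mor_pbk[OF B D]
  note Q = Comp_mor_pbk[OF AB(2) D]
  let ?Q = "pbk (pbk A B a' b) D (\<lambda>z. b' (pr2 z)) d"
  \<comment> \<open>Both bracketings are computed on the same apex: the fibre product of A x B with
    D is, after moving parentheses, also a pullback of A and B x D.\<close>
  have "pullback A a' (pbk B D b' d) (\<lambda>z. b (pr1 z)) ?Q (\<lambda>z. pr1 (pr1 z)) (\<lambda>z. pr (pr2 (pr1 z)) (pr2 z))"
  proof (rule pullbackI)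
    show "finite_gset G ?Q" by (rule pullbackD(1)[OF Q(3)])
    show "\<exists>z\<in>pts ?Q. pr1 (pr1 z) = x \<and> pr (pr2 (pr1 z)) (pr2 z) = y"
      if "x \<in> pts A" "y \<in> pts (pbk B D b' d)" "a' x = b (pr1 y)" for x y
      using that by (intro bexI[of _ "pr (pr x (pr1 y)) (pr2 y)"]) auto
  qed (auto simp: equivariant_def intro: pr_eqI)
  from Comp_mor[OF A BD(2) this] show ?case
    unfolding f g h AB(1) BD(1) Q(1) by simp
qed

section \<open>Full subcategories attached to subgroups; restrictions and transfers\<close>

lemma lindner_sub_simps [simp]:
  "X \<in> Obj (lindner_sub G \<O> H) \<longleftrightarrow> finite_gset G X \<and> (\<forall>x \<in> pts X. subconjugate G (stab X x) H)"
  "Hom (lindner_sub G \<O> H) = Hom (lindner G \<O>)"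
  "Comp (lindner_sub G \<O> H) = Comp (lindner G \<O>)"
  "Ident (lindner_sub G \<O> H) = Ident (lindner G \<O>)"
  by (simp_all add: lindner_sub_def)

lemma category_lindner_sub: "category (lindner_sub G \<O> H)"
  unfolding lindner_sub_def by (rule category_full_subcategory[OF category_lindner])

text \<open>Functors on the whole Lindner category and on the subcategory of a class can be treated
  together: everything is proved over \<open>lindner_sub G \<O> H\<close>, and H is specialized to
  the whole group or to \<open>rep c\<close>.\<close>

lemma lindner_sub_carrier: "lindner_sub G \<O> (carrier G) = lindner G \<O>"
proof -
  have "subconjugate G (stab X x) (carrier G)" for X :: "('a, nat) gset" and x
    unfolding subconjugate_def conjugate_set_eq by (intro bexI[of _ \<one>]) (auto simp: stab_iff)
  then show ?thesis
    by (simp add: lindner_sub_def full_subcategory_def) (simp add: lindner_def)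
qed

text \<open>Stabilizers can only shrink towards the source of an equivariant map. So the subcategory
  contains the apex of every span that starts or ends in it, and every product with one of its
  objects.\<close>

lemma Obj_equivariant:
  assumes "finite_gset G A" "equivariant G A S f" "S \<in> Obj (lindner_sub G \<O> H)"
  shows "A \<in> Obj (lindner_sub G \<O> H)"
  using assms subconjugate_mono[OF stab_mono[OF assms(2)]] equivariant_pts[OF assms(2)] by auto

definition resm :: "('a, nat) gset \<Rightarrow> ('a, nat) gset \<Rightarrow> (nat \<Rightarrow> nat) \<Rightarrow> 'a lindner_mor" where
  "resm T S f = mor T S S f (\<lambda>x. x)"

definition trm :: "('a, nat) gset \<Rightarrow> ('a, nat) gset \<Rightarrow> (nat \<Rightarrow> nat) \<Rightarrow> 'a lindner_mor" where
  "trm S T f = mor S T S (\<lambda>x. x) f"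

lemma span_data_res: "\<lbrakk>finite_gset G S; equivariant G S T f\<rbrakk> \<Longrightarrow> span_data T S S f (\<lambda>x. x)"
  by (simp add: span_data_def equivariant_id admissible_inj)

lemma span_data_tr: "\<lbrakk>finite_gset G S; admissible S T f\<rbrakk> \<Longrightarrow> span_data S T S (\<lambda>x. x) f"
  by (simp add: span_data_def equivariant_id)

lemma resm_Hom: "\<lbrakk>finite_gset G S; equivariant G S T f\<rbrakk> \<Longrightarrow> resm T S f \<in> Hom (lindner G \<O>) T S"
  unfolding resm_def by (intro mor_in_Hom span_data_res)

lemma trm_Hom: "\<lbrakk>finite_gset G S; admissible S T f\<rbrakk> \<Longrightarrow> trm S T f \<in> Hom (lindner G \<O>) S T"
  unfolding trm_def by (intro mor_in_Hom span_data_tr)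

text \<open>The pullback over the apex is along two identities and is the apex itself. Each morphism
  acts on a Mackey functor as a transfer after a restriction.\<close>

lemma mor_tr_res:
  assumes "span_data S T A l r"
  shows "mor S T A l r = Comp (lindner G \<O>) S A T (trm A T r) (resm S A l)"
proof -
  note A = sd_gset[OF assms] sd_l[OF assms] sd_adm[OF assms]
  have "pullback A (\<lambda>x. x) A (\<lambda>x. x) A (\<lambda>x. x) (\<lambda>x. x)"
    by (rule pullbackI) (auto simp: A equivariant_id)
  from Comp_mor[OF span_data_res[OF A(1,2)] span_data_tr[OF A(1,3)] this] show ?thesis
    by (simp add: resm_def trm_def)
qed

text \<open>Two spans into \<open>D\<close> are compared on the parts of their apices over \<open>X\<close> and over \<open>Y\<close>.\<close>

lemma binary_product_coprod:
  assumes c: "coprod_gset G X Y D i j" and D: "D \<in> Obj (lindner_sub G \<O> H)"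
  shows "is_binary_product (lindner_sub G \<O> H) X Y D (resm D X i) (resm D Y j)"
proof -
  note cD = coprodD[OF c]
  note sdX = span_data_res[OF cD(1,4)] and sdY = span_data_res[OF cD(2,5)]
  have comp_i: "Comp (lindner G \<O>) Z D X (resm D X i) (mor Z D W e h) = mor Z X P (\<lambda>x. e (p x)) q"
    if W: "span_data Z D W e h" and P: "pullback W h X i P p q" for Z W e h P p q
    unfolding resm_def using Comp_mor[OF W sdX P] .
  have comp_j: "Comp (lindner G \<O>) Z D Y (resm D Y j) (mor Z D W e h) = mor Z Y P (\<lambda>x. e (p x)) q"
    if W: "span_data Z D W e h" and P: "pullback W h Y j P p q" for Z W e h P p q
    unfolding resm_def using Comp_mor[OF W sdY P] .
  have ex: "\<exists>u. u \<in> Hom (lindner G \<O>) Z D \<and> Comp (lindner G \<O>) Z D X (resm D X i) u = f \<and>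
      Comp (lindner G \<O>) Z D Y (resm D Y j) u = g"
    if f: "f \<in> Hom (lindner G \<O>) Z X" and g: "g \<in> Hom (lindner G \<O>) Z Y" for Z f g
  proof -
    obtain U a a' where U: "span_data Z X U a a'" and f: "f = mor Z X U a a'" by (rule Hom_mor[OF f])
    obtain V b b' where V: "span_data Z Y V b b'" and g: "g = mor Z Y V b b'" by (rule Hom_mor[OF g])
    \<comment> \<open>The mediating span has as apex the disjoint union of the apices of f and g,
      with the tag 0 or 1 telling which legs to use.\<close>
    define e where "e z = (if pr1 z = 0 then a else b) (pr2 z)" for z
    define h where "h z = (if pr1 z = 0 then i (a' (pr2 z)) else j (b' (pr2 z)))" for z
    note UV = coprodD[OF coprod_sumg[OF sd_gset[OF U] sd_gset[OF V]]]
    note eU = equivariantD[OF sd_l[OF U]] equivariantD[OF sd_r[OF U]] and eV = equivariantD[OF sd_l[OF V]] equivariantD[OF sd_r[OF V]]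
    note ei = equivariantD[OF cD(4)] and ej = equivariantD[OF cD(5)]
    have "equivariant G (sumg U V) Z e"
      using eU eV by (auto simp: equivariant_def e_def)
    moreover have eh: "equivariant G (sumg U V) D h"
      unfolding equivariant_def
    proof (intro conjI ballI)
      fix z assume "z \<in> pts (sumg U V)"
      then show "h z \<in> pts D"
        using eU(3) eV(3) ei(1) ej(1) by (auto simp: h_def)
    next
      fix g z assume g: "g \<in> carrier G" and "z \<in> pts (sumg U V)"
      then consider "pr1 z = 0" "pr2 z \<in> pts U" | "pr1 z = 1" "pr2 z \<in> pts V"
        by auto
      then show "h (act (sumg U V) g z) = act D g (h z)"
        by cases (simp_all add: h_def g eU(3,4) eV(3,4) ei(2) ej(2))
    qed
    moreover have "(stab (sumg U V) z, stab D (h z)) \<in> \<O>" if z: "z \<in> pts (sumg U V)" for z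
    proof -
      consider x where "x \<in> pts U" "z = pr 0 x" | y where "y \<in> pts V" "z = pr 1 y"
        using z[unfolded UV(8)] by blast
      then show ?thesis
      proof cases
        case 1
        then show ?thesis
          using stab_inj[OF UV(4,6) _ sd_gset[OF U], of x] stab_inj[OF cD(4,6) eU(3) cD(1), of x]
            adm_O[OF sd_adm[OF U], of x] by (simp only: h_def pr_simps if_True refl)
      next
        case 2
        then show ?thesis
          using stab_inj[OF UV(5,7) _ sd_gset[OF V], of y] stab_inj[OF cD(5,7) eV(3) cD(2), of y]
            adm_O[OF sd_adm[OF V], of y] by (simp only: h_def pr_simps if_False one_neq_zero)
      qed
    qed
    ultimately have W: "span_data Z D (sumg U V) e h"
      by (simp add: span_data_def admissible_def UV(3))
    have "pullback (sumg U V) h X i U (pr 0) a'"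
    proof (rule pullbackI)
      fix z x assume z: "z \<in> pts (sumg U V)" "x \<in> pts X" "h z = i x"
      have "pr1 z = 0"
        using z cD(9) eV(3) by (auto simp: h_def split: if_splits)
      then have "a' (pr2 z) = x" "pr2 z \<in> pts U" "pr 0 (pr2 z) = z"
        using z eU(3) inj_onD[OF cD(6), of "a' (pr2 z)" x] by (auto simp: h_def intro: pr_eqI)
      then show "\<exists>u\<in>pts U. pr 0 u = z \<and> a' u = x" by blast
    qed (use UV(4) sd_gset[OF U] sd_r[OF U] in \<open>auto simp: h_def\<close>)
    from comp_i[OF W this] have "Comp (lindner G \<O>) Z D X (resm D X i) (mor Z D (sumg U V) e h) = f"
      by (simp add: f e_def)
    moreover have "pullback (sumg U V) h Y j V (pr 1) b'"
    proof (rule pullbackI)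
      fix z x assume z: "z \<in> pts (sumg U V)" "x \<in> pts Y" "h z = j x"
      have "pr1 z = 1"
        using z cD(9) eU(3) by (auto simp: h_def split: if_splits)
      then have "b' (pr2 z) = x" "pr2 z \<in> pts V" "pr 1 (pr2 z) = z"
        using z eV(3) inj_onD[OF cD(7), of "b' (pr2 z)" x] by (auto simp: h_def intro: pr_eqI)
      then show "\<exists>u\<in>pts V. pr 1 u = z \<and> b' u = x" by blast
    qed (use UV(5) sd_gset[OF V] sd_r[OF V] in \<open>auto simp: h_def\<close>)
    from comp_j[OF W this] have "Comp (lindner G \<O>) Z D Y (resm D Y j) (mor Z D (sumg U V) e h) = g"
      by (simp add: g e_def)
    ultimately show ?thesis
      using mor_in_Hom[OF W] by blast
  qed
  have un: "u = u'" if u: "u \<in> Hom (lindner G \<O>) Z D" and u': "u' \<in> Hom (lindner G \<O>) Z D"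
    and eqX: "Comp (lindner G \<O>) Z D X (resm D X i) u = Comp (lindner G \<O>) Z D X (resm D X i) u'"
    and eqY: "Comp (lindner G \<O>) Z D Y (resm D Y j) u = Comp (lindner G \<O>) Z D Y (resm D Y j) u'" for Z u u'
  proof -
    obtain W e h where W: "span_data Z D W e h" and u: "u = mor Z D W e h" by (rule Hom_mor[OF u])
    obtain W' e' h' where W': "span_data Z D W' e' h'" and u': "u' = mor Z D W' e' h'" by (rule Hom_mor[OF u'])
    note X1 = Comp_mor_pbk[OF W sdX] and X2 = Comp_mor_pbk[OF W' sdX]
    note Y1 = Comp_mor_pbk[OF W sdY] and Y2 = Comp_mor_pbk[OF W' sdY]
    obtain \<theta> where \<theta>: "isomorphic_spans (pbk W X h i) (\<lambda>z. e (pr1 z)) pr2 (pbk W' X h' i) (\<lambda>z. e' (pr1 z)) pr2 \<theta>"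
      using mor_eqD[OF X1(2) X2(2)] eqX unfolding u u' resm_def X1(1) X2(1) by blast
    obtain \<psi> where \<psi>: "isomorphic_spans (pbk W Y h j) (\<lambda>z. e (pr1 z)) pr2 (pbk W' Y h' j) (\<lambda>z. e' (pr1 z)) pr2 \<psi>"
      using mor_eqD[OF Y1(2) Y2(2)] eqY unfolding u u' resm_def Y1(1) Y2(1) by blast
    define i' where "i' = the_inv_into (pts X) i"
    define j' where "j' = the_inv_into (pts Y) j"
    have i': "i' (i x) = x" if "x \<in> pts X" for x
      using cD(6) that by (simp add: i'_def the_inv_into_f_f)
    have j': "j' (j y) = y" if "y \<in> pts Y" for y
      using cD(7) that by (simp add: j'_def the_inv_into_f_f)
    \<comment> \<open>A point w is paired with the unique point of X or Y over which it lies, the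
      pair is moved by \<open>\<theta>\<close> or \<open>\<psi>\<close>, and the second coordinate,
      which these preserve, is dropped again.\<close>
    define \<phi> where "\<phi> w = (if h w \<in> i ` pts X then pr1 (\<theta> (pr w (i' (h w)))) else pr1 (\<psi> (pr w (j' (h w)))))" for w
    note t = isomorphic_spansD[OF \<theta>] and s = isomorphic_spansD[OF \<psi>]
    have split: "(\<exists>x\<in>pts X. h w = i x) \<or> (\<exists>y\<in>pts Y. h w = j y)" if "w \<in> pts W" for w
      using equivariant_pts[OF sd_r[OF W] that] cD(8) by auto
    have ij: "i x \<noteq> j y" if "x \<in> pts X" "y \<in> pts Y" for x y
      using cD(9) that by blast
    have \<phi>X: "\<phi> w = pr1 (\<theta> (pr w x))" "pr w x \<in> pts (pbk W X h i)" "\<phi> w \<in> pts W'" "h' (\<phi> w) = i x"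
      "e' (\<phi> w) = e w" "\<theta> (pr w x) = pr (\<phi> w) x" if "w \<in> pts W" "x \<in> pts X" "h w = i x" for w x
    proof -
      show 1: "\<phi> w = pr1 (\<theta> (pr w x))" using that i' by (simp add: \<phi>_def)
      show 2: "pr w x \<in> pts (pbk W X h i)" using that by simp
      show 3: "\<theta> (pr w x) = pr (\<phi> w) x" by (rule pr_eqI) (use t(5)[OF 2] 1 in simp_all)
      show "\<phi> w \<in> pts W'" "h' (\<phi> w) = i x" using t(3)[OF 2] 3 by simp_all
      show "e' (\<phi> w) = e w" using t(4)[OF 2] 1 by simp
    qed
    have \<phi>Y: "\<phi> w = pr1 (\<psi> (pr w y))" "pr w y \<in> pts (pbk W Y h j)" "\<phi> w \<in> pts W'" "h' (\<phi> w) = j y"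
      "e' (\<phi> w) = e w" "\<psi> (pr w y) = pr (\<phi> w) y" if "w \<in> pts W" "y \<in> pts Y" "h w = j y" for w y
    proof -
      have "h w \<notin> i ` pts X" using that ij by (metis imageE)
      then show 1: "\<phi> w = pr1 (\<psi> (pr w y))" using that j' by (simp add: \<phi>_def)
      show 2: "pr w y \<in> pts (pbk W Y h j)" using that by simp
      show 3: "\<psi> (pr w y) = pr (\<phi> w) y" by (rule pr_eqI) (use s(5)[OF 2] 1 in simp_all)
      show "\<phi> w \<in> pts W'" "h' (\<phi> w) = j y" using s(3)[OF 2] 3 by simp_all
      show "e' (\<phi> w) = e w" using s(4)[OF 2] 1 by simp
    qed
    have \<phi>: "\<phi> w \<in> pts W'" "h' (\<phi> w) = h w" "e' (\<phi> w) = e w" if "w \<in> pts W" for w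
      using split[OF that] \<phi>X[OF that] \<phi>Y[OF that] by auto
    have "bij_betw \<phi> (pts W) (pts W')"
      unfolding bij_betw_def
    proof (intro conjI inj_onI)
      fix w v assume w: "w \<in> pts W" and v: "v \<in> pts W" and eq: "\<phi> w = \<phi> v"
      then have "h w = h v" using \<phi> by metis
      from split[OF w] show "w = v"
      proof (elim disjE bexE)
        fix x assume x: "x \<in> pts X" "h w = i x"
        then have "h v = i x" using \<open>h w = h v\<close> by simp
        then have "\<theta> (pr w x) = \<theta> (pr v x)" "pr w x \<in> pts (pbk W X h i)" "pr v x \<in> pts (pbk W X h i)"
          using \<phi>X(2,6)[OF w x] \<phi>X(2,6)[OF v x(1)] eq by simp_all
        then have "pr w x = pr v x"
          using inj_onD[OF bij_betw_imp_inj_on[OF t(2)]] by blast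
        then show "w = v" by simp
      next
        fix x assume x: "x \<in> pts Y" "h w = j x"
        then have "h v = j x" using \<open>h w = h v\<close> by simp
        then have "\<psi> (pr w x) = \<psi> (pr v x)" "pr w x \<in> pts (pbk W Y h j)" "pr v x \<in> pts (pbk W Y h j)"
          using \<phi>Y(2,6)[OF w x] \<phi>Y(2,6)[OF v x(1)] eq by simp_all
        then have "pr w x = pr v x"
          using inj_onD[OF bij_betw_imp_inj_on[OF s(2)]] by blast
        then show "w = v" by simp
      qed
    next
      show "\<phi> ` pts W = pts W'"
      proof
        show "pts W' \<subseteq> \<phi> ` pts W"
        proof
          fix w' assume w': "w' \<in> pts W'"
          then consider x where "x \<in> pts X" "h' w' = i x" | y where "y \<in> pts Y" "h' w' = j y"
            using equivariant_pts[OF sd_r[OF W'] w'] cD(8) by auto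
          then show "w' \<in> \<phi> ` pts W"
          proof cases
            case 1
            then have "pr w' x \<in> pts (pbk W' X h' i)" using w' by simp
            then obtain z where z: "z \<in> pts (pbk W X h i)" "\<theta> z = pr w' x"
              using bij_betw_imp_surj_on[OF t(2)] by (metis imageE)
            then have "\<phi> (pr1 z) = w'"
              using \<phi>X(1)[of "pr1 z" "pr2 z"] by simp
            then show ?thesis using z(1) by auto
          next
            case 2
            then have "pr w' y \<in> pts (pbk W' Y h' j)" using w' by simp
            then obtain z where z: "z \<in> pts (pbk W Y h j)" "\<psi> z = pr w' y"
              using bij_betw_imp_surj_on[OF s(2)] by (metis imageE)
            then have "\<phi> (pr1 z) = w'"
              using \<phi>Y(1)[of "pr1 z" "pr2 z"] by simp
            then show ?thesis using z(1) by auto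
          qed
        qed
      qed (use \<phi> in blast)
    qed
    moreover have "\<phi> (act W g w) = act W' g (\<phi> w)" if g: "g \<in> carrier G" and w: "w \<in> pts W" for g w
      using split[OF w]
    proof (elim disjE bexE)
      fix x assume x: "x \<in> pts X" "h w = i x"
      have gw: "act W g w \<in> pts W" "h (act W g w) = i (act X g x)" "act X g x \<in> pts X"
        using gs_act[OF sd_gset[OF W] g w] equivariant_act[OF sd_r[OF W] g w] equivariant_act[OF cD(4) g x(1)]
          gs_act[OF cD(1) g x(1)] x(2) by simp_all
      have "\<theta> (pr (act W g w) (act X g x)) = act (pbk W' X h' i) g (\<theta> (pr w x))"
        using equivariant_act[OF t(1) g \<phi>X(2)[OF w x]] w x by simp
      then show ?thesis
        using \<phi>X(6)[OF gw(1,3,2)] \<phi>X(3,4,6)[OF w x] x by simp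
    next
      fix x assume x: "x \<in> pts Y" "h w = j x"
      have gw: "act W g w \<in> pts W" "h (act W g w) = j (act Y g x)" "act Y g x \<in> pts Y"
        using gs_act[OF sd_gset[OF W] g w] equivariant_act[OF sd_r[OF W] g w] equivariant_act[OF cD(5) g x(1)]
          gs_act[OF cD(2) g x(1)] x(2) by simp_all
      have "\<psi> (pr (act W g w) (act Y g x)) = act (pbk W' Y h' j) g (\<psi> (pr w x))"
        using equivariant_act[OF s(1) g \<phi>Y(2)[OF w x]] w x by simp
      then show ?thesis
        using \<phi>Y(6)[OF gw(1,3,2)] \<phi>Y(3,4,6)[OF w x] x by simp
    qed
    ultimately have "isomorphic_spans W e h W' e' h' \<phi>"
      unfolding isomorphic_spans_def equivariant_def using \<phi> by simp
    then show ?thesis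
      unfolding u u' by (rule mor_eqI[OF W])
  qed
  have "X \<in> Obj (lindner_sub G \<O> H)" "Y \<in> Obj (lindner_sub G \<O> H)"
    using Obj_equivariant[OF cD(1,4) D] Obj_equivariant[OF cD(2,5) D] by auto
  then show ?thesis
    unfolding is_binary_product_def lindner_sub_simps(2,3)
    using D resm_Hom[OF cD(1,4)] resm_Hom[OF cD(2,5)] ex un by metis
qed

text \<open>A span into the empty set has an empty apex, and all spans with empty apex are
  isomorphic.\<close>

lemma is_terminal_emptyg: "is_terminal (lindner_sub G \<O> H) emptyg"
  unfolding is_terminal_def
proof (intro conjI ballI)
  show "emptyg \<in> Obj (lindner_sub G \<O> H)" by (simp add: finite_gset_emptyg)
  fix Z assume "Z \<in> Obj (lindner_sub G \<O> H)"
  have e: "span_data Z emptyg emptyg (\<lambda>x. x) (\<lambda>x. x)"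
    by (simp add: span_data_def admissible_def equivariant_def finite_gset_emptyg)
  show "\<exists>!f. f \<in> Hom (lindner_sub G \<O> H) Z emptyg"
  proof (rule ex1I[of _ "mor Z emptyg emptyg (\<lambda>x. x) (\<lambda>x. x)"])
    fix f assume f: "f \<in> Hom (lindner_sub G \<O> H) Z emptyg"
    obtain A l r where A: "span_data Z emptyg A l r" and f: "f = mor Z emptyg A l r"
      using Hom_mor f by (metis lindner_sub_simps(2))
    have "pts A = {}" using equivariant_pts[OF sd_r[OF A]] by auto
    then have "isomorphic_spans A l r emptyg (\<lambda>x. x) (\<lambda>x. x) (\<lambda>x. x)"
      by (simp add: isomorphic_spans_def equivariant_def bij_betw_def)
    then show "f = mor Z emptyg emptyg (\<lambda>x. x) (\<lambda>x. x)"
      unfolding f by (rule mor_eqI[OF A])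
  qed (simp add: mor_in_Hom[OF e])
qed

end

section \<open>Product preserving functors on the Lindner category\<close>

text \<open>The empty G-set counts as transitive; an orbit is always given together with one of its
  points.\<close>

definition transitive_gset :: "('a, 'b) monoid_scheme \<Rightarrow> ('a, 's) gset \<Rightarrow> bool" where
  "transitive_gset G T \<longleftrightarrow> (\<forall>x\<in>pts T. \<forall>y\<in>pts T. \<exists>g\<in>carrier G. act T g x = y)"

section \<open>Orbits and induction over finite G-sets\<close>

context transfer
begin

lemma invariant_orbit:
  assumes T: "finite_gset G T" and t: "t \<in> pts T"
  shows "invariant_subset G T ((\<lambda>g. act T g t) ` carrier G)"
    and "t \<in> (\<lambda>g. act T g t) ` carrier G"
    and "transitive_gset G (subg T ((\<lambda>g. act T g t) ` carrier G))"
proof -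
  show "invariant_subset G T ((\<lambda>g. act T g t) ` carrier G)"
    using T t by (auto simp: invariant_subset_def gs_mult[OF T, symmetric])
  show "t \<in> (\<lambda>g. act T g t) ` carrier G"
    using gs_one[OF T t] by (metis image_eqI one_closed)
  show "transitive_gset G (subg T ((\<lambda>g. act T g t) ` carrier G))"
    unfolding transitive_gset_def
  proof (intro ballI)
    fix x y assume "x \<in> pts (subg T ((\<lambda>g. act T g t) ` carrier G))" "y \<in> pts (subg T ((\<lambda>g. act T g t) ` carrier G))"
    then obtain g h where gh: "g \<in> carrier G" "h \<in> carrier G" "x = act T g t" "y = act T h t" by auto
    then have "act T (h \<otimes> inv g) x = y"
      using T t by (simp add: gs_mult gs_inv)
    then show "\<exists>g\<in>carrier G. act (subg T ((\<lambda>g. act T g t) ` carrier G)) g x = y"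
      using gh by (intro bexI[of _ "h \<otimes> inv g"]) auto
  qed
qed

lemma Obj_gset: "X \<in> Obj (lindner_sub G \<O> H) \<Longrightarrow> finite_gset G X"
  by simp

lemma Obj_subg:
  assumes T: "T \<in> Obj (lindner_sub G \<O> H)" and A: "invariant_subset G T A"
  shows "subg T A \<in> Obj (lindner_sub G \<O> H)"
  using Obj_equivariant[OF finite_gset_subg[OF Obj_gset[OF T] A] equivariant_subg[OF A] T] .

lemma finite_stab: "finite (stab T x)"
  by (rule finite_subset[OF _ fin]) (auto simp: stab_iff)

text \<open>An outer induction on a strict bound for the orders of stabilizers and an inner one on
  the number of points, which peels off orbits. In the orbit case the claim is available for
  arbitrary G-sets with smaller stabilizers, since the correction term of the action lives on a set
  that need not be an orbit.\<close>

lemma gset_induct [consumes 1, case_names empty union orbit]: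
  assumes X: "X \<in> Obj (lindner_sub G \<O> H)"
    and empty: "\<And>T. \<lbrakk>T \<in> Obj (lindner_sub G \<O> H); pts T = {}\<rbrakk> \<Longrightarrow> P T"
    and union: "\<And>T A. \<lbrakk>T \<in> Obj (lindner_sub G \<O> H); invariant_subset G T A; P (subg T A); P (subg T (pts T - A))\<rbrakk>
      \<Longrightarrow> P T"
    and orbit: "\<And>T t. \<lbrakk>T \<in> Obj (lindner_sub G \<O> H); transitive_gset G T; t \<in> pts T;
      \<And>R. \<lbrakk>R \<in> Obj (lindner_sub G \<O> H); \<And>z. z \<in> pts R \<Longrightarrow> card (stab R z) < card (stab T t)\<rbrakk> \<Longrightarrow> P R\<rbrakk> \<Longrightarrow> P T"
  shows "P X"
proof -
  have "P T" if "T \<in> Obj (lindner_sub G \<O> H)" "\<And>x. x \<in> pts T \<Longrightarrow> card (stab T x) < n" for T n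
    using that
  proof (induction n arbitrary: T)
    case 0
    then show ?case by (intro empty) auto
  next
    case (Suc n)
    note IH = Suc.IH
    from Suc.prems show ?case
    proof (induction "card (pts T)" arbitrary: T rule: less_induct)
      case less
      have T: "finite_gset G T" using less.prems(1) by simp
      show ?case
      proof (cases "pts T = {}")
        case True
        then show ?thesis using empty less.prems(1) by blast
      next
        case False
        then obtain t where t: "t \<in> pts T" by blast
        let ?A = "(\<lambda>g. act T g t) ` carrier G"
        note A = invariant_orbit[OF T t]
        have AT: "?A \<subseteq> pts T" using A(1) by (simp add: invariant_subset_def)
        show ?thesis
        proof (cases "?A = pts T")
          case True
          then have tr: "transitive_gset G T"
            using A(3) by (auto simp: transitive_gset_def)
          show ?thesis
          proof (rule orbit[OF less.prems(1) tr t])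
            fix R assume "R \<in> Obj (lindner_sub G \<O> H)"
              "\<And>z. z \<in> pts R \<Longrightarrow> card (stab R z) < card (stab T t)"
            then show "P R"
              using less.prems(2)[OF t] by (intro IH) force+
          qed
        next
          case False
          have fin: "finite (pts T)" by (rule gs_finite[OF T])
          have "card ?A < card (pts T)" using False AT fin by (intro psubset_card_mono) auto
          moreover have "card (pts T - ?A) < card (pts T)"
            using A(2) t fin by (intro psubset_card_mono) auto
          ultimately show ?thesis
            using less.prems AT
            by (intro union[OF less.prems(1) A(1)] less.hyps Obj_subg A(1) invariant_Diff[OF T A(1)]) auto
        qed
      qed
    qed
  qed
  moreover have "card (stab X x) < Suc (card (carrier G))" if "x \<in> pts X" for x
    using card_mono[OF fin, of "stab X x"] by (simp add: stab_iff subset_iff less_Suc_eq_le)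
  ultimately show ?thesis using X by blast
qed

lemma comp_res:
  assumes "finite_gset G U" "finite_gset G A" "equivariant G A U f" "equivariant G U S l"
  shows "Comp (lindner G \<O>) S U A (resm U A f) (resm S U l) = resm S A (\<lambda>x. l (f x))"
proof -
  have "pullback U (\<lambda>x. x) A f A f (\<lambda>x. x)"
    by (rule pullbackI) (use assms in \<open>auto simp: equivariant_id\<close>)
  from Comp_mor[OF span_data_res[OF assms(1,4)] span_data_res[OF assms(2,3)] this] show ?thesis
    by (simp add: resm_def)
qed

lemma comp_tr:
  assumes "finite_gset G U" "finite_gset G A" "admissible A U f" "admissible U T r"
  shows "Comp (lindner G \<O>) A U T (trm U T r) (trm A U f) = trm A T (\<lambda>x. r (f x))"
proof -
  have "pullback A f U (\<lambda>x. x) A (\<lambda>x. x) f"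
    by (rule pullbackI) (use assms adm_equivariant[OF assms(3)] in \<open>auto simp: equivariant_id equivariant_pts\<close>)
  from Comp_mor[OF span_data_tr[OF assms(2,3)] span_data_tr[OF assms(1,4)] this] show ?thesis
    by (simp add: trm_def)
qed

end

section \<open>Values of a product preserving functor\<close>

locale mackey = transfer G \<O> for G :: "('a, 'b) monoid_scheme" (structure) and \<O> +
  fixes H :: "'a set" and M :: "('a, 'v) mackey_obj"
  assumes F: "is_functor (lindner_sub G \<O> H) rat_vect M"
    and PP: "product_preserving (lindner_sub G \<O> H) rat_vect M"
begin

abbreviation "C \<equiv> lindner_sub G \<O> H"
abbreviation "V \<equiv> FObj M"

lemma ratmod_V: "X \<in> Obj C \<Longrightarrow> ratmod (V X)"
  by (rule fv_ratmod[OF F])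

lemma map_lm:
  assumes "X \<in> Obj C" "Y \<in> Obj C" "f \<in> Hom (lindner G \<O>) X Y"
  shows "FMap M X Y f \<in> linear_maps (V X) (V Y)"
  using fv_lm[OF F assms(1,2)] assms(3) by simp

lemma map_Comp:
  assumes "X \<in> Obj C" "Y \<in> Obj C" "Z \<in> Obj C" "f \<in> Hom (lindner G \<O>) X Y" "g \<in> Hom (lindner G \<O>) Y Z"
    "x \<in> carrier (V X)"
  shows "FMap M X Z (Comp (lindner G \<O>) X Y Z g f) x = FMap M Y Z g (FMap M X Y f x)"
  using fv_Comp[OF F assms(1,2,3)] assms(4-) by simp

lemma map_Ident: "\<lbrakk>X \<in> Obj C; x \<in> carrier (V X)\<rbrakk> \<Longrightarrow> FMap M X X (Ident (lindner G \<O>) X) x = x"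
  using fv_Ident[OF F] by simp

lemma map_res_lm:
  assumes "T \<in> Obj C" "finite_gset G S" "equivariant G S T f"
  shows "FMap M T S (resm T S f) \<in> linear_maps (V T) (V S)"
  using assms Obj_equivariant[OF assms(2,3,1)] by (intro map_lm resm_Hom)

lemma map_tr_lm:
  assumes "T \<in> Obj C" "finite_gset G S" "admissible S T f"
  shows "FMap M S T (trm S T f) \<in> linear_maps (V S) (V T)"
  using assms Obj_equivariant[OF assms(2) adm_equivariant[OF assms(3)] assms(1)] by (intro map_lm trm_Hom)

lemma map_span:
  assumes S: "S \<in> Obj C" and T: "T \<in> Obj C" and sd: "span_data S T A l r" and x: "x \<in> carrier (V S)"
  shows "FMap M S T (mor S T A l r) x = FMap M A T (trm A T r) (FMap M S A (resm S A l) x)"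
  unfolding mor_tr_res[OF sd]
  by (rule map_Comp[OF S _ T _ _ x])
    (use Obj_equivariant[OF sd_gset[OF sd] sd_l[OF sd] S] resm_Hom[OF sd_gset[OF sd] sd_l[OF sd]]
      trm_Hom[OF sd_gset[OF sd] sd_adm[OF sd]] in auto)

lemma V_empty:
  assumes "x \<in> carrier (V emptyg)"
  shows "x = \<zero>\<^bsub>V emptyg\<^esub>"
proof -
  have "is_terminal rat_vect (V emptyg)"
    using PP is_terminal_emptyg unfolding product_preserving_def by blast
  then show ?thesis using assms by (simp add: is_terminal_rat_vect)
qed

lemma emptyg_Obj: "emptyg \<in> Obj C"
  using is_terminal_emptyg[of H] by (simp add: is_terminal_def)

text \<open>The span factors through the value at the empty G-set, which is zero because the empty
  G-set is terminal.\<close>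

lemma map_empty:
  assumes S: "S \<in> Obj C" and T: "T \<in> Obj C" and sd: "span_data S T A l r" and "pts A = {}"
    and x: "x \<in> carrier (V S)"
  shows "FMap M S T (mor S T A l r) x = \<zero>\<^bsub>V T\<^esub>"
proof -
  have e: "span_data S T emptyg l r"
    by (simp add: span_data_def admissible_def equivariant_def finite_gset_emptyg)
  have "isomorphic_spans A l r emptyg l r (\<lambda>x. x)"
    using assms(4) by (simp add: isomorphic_spans_def equivariant_def bij_betw_def)
  then have "mor S T A l r = mor S T emptyg l r"
    by (rule mor_eqI[OF sd])
  moreover have "FMap M S emptyg (resm S emptyg l) x = \<zero>\<^bsub>V emptyg\<^esub>"
    by (rule V_empty) (rule lm_closed[OF map_res_lm[OF S sd_gset[OF e] sd_l[OF e]] x])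
  ultimately show ?thesis
    using map_span[OF S T e x] lm_zero[OF map_tr_lm[OF T sd_gset[OF e] sd_adm[OF e]] ratmod_V[OF emptyg_Obj] ratmod_V[OF T]]
    by simp
qed

text \<open>Product preservation makes a vector over D determined by its restrictions to X and Y,
  and both sides have the same ones: restricting a transfer gives the identity on the same part and
  zero on the other part, where the pullback is empty.\<close>

lemma coprod_sum:
  assumes c: "coprod_gset G X Y D i j" and D: "D \<in> Obj C" and x: "x \<in> carrier (V D)"
  shows "x = FMap M X D (trm X D i) (FMap M D X (resm D X i) x) \<oplus>\<^bsub>V D\<^esub>
    FMap M Y D (trm Y D j) (FMap M D Y (resm D Y j) x)"
proof -
  note cD = coprodD[OF c]
  have X: "X \<in> Obj C" and Y: "Y \<in> Obj C"
    using Obj_equivariant[OF cD(1,4) D] Obj_equivariant[OF cD(2,5) D] by auto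
  have ai: "admissible X D i" and aj: "admissible Y D j"
    using admissible_inj[OF cD(1,4,6)] admissible_inj[OF cD(2,5,7)] by auto
  note ri = map_res_lm[OF D cD(1,4)] and rj = map_res_lm[OF D cD(2,5)]
  note ti = map_tr_lm[OF D cD(1) ai] and tj = map_tr_lm[OF D cD(2) aj]
  have ii: "FMap M D X (resm D X i) (FMap M X D (trm X D i) y) = y" if y: "y \<in> carrier (V X)" for y
  proof -
    have "pullback X i X i X (\<lambda>x. x) (\<lambda>x. x)"
      by (rule pullbackI) (use cD(1,6) in \<open>auto simp: equivariant_id inj_on_def\<close>)
    from Comp_mor[OF span_data_tr[OF cD(1) ai] span_data_res[OF cD(1,4)] this]
    have "Comp (lindner G \<O>) X D X (resm D X i) (trm X D i) = Ident (lindner G \<O>) X"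
      by (simp add: resm_def trm_def Ident_mor[OF cD(1)])
    then show ?thesis
      using map_Comp[OF X D X trm_Hom[OF cD(1) ai] resm_Hom[OF cD(1,4)] y] map_Ident[OF X y] by simp
  qed
  have jj: "FMap M D Y (resm D Y j) (FMap M Y D (trm Y D j) y) = y" if y: "y \<in> carrier (V Y)" for y
  proof -
    have "pullback Y j Y j Y (\<lambda>x. x) (\<lambda>x. x)"
      by (rule pullbackI) (use cD(2,7) in \<open>auto simp: equivariant_id inj_on_def\<close>)
    from Comp_mor[OF span_data_tr[OF cD(2) aj] span_data_res[OF cD(2,5)] this]
    have "Comp (lindner G \<O>) Y D Y (resm D Y j) (trm Y D j) = Ident (lindner G \<O>) Y"
      by (simp add: resm_def trm_def Ident_mor[OF cD(2)])
    then show ?thesis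
      using map_Comp[OF Y D Y trm_Hom[OF cD(2) aj] resm_Hom[OF cD(2,5)] y] map_Ident[OF Y y] by simp
  qed
  have ji: "FMap M D Y (resm D Y j) (FMap M X D (trm X D i) y) = \<zero>\<^bsub>V Y\<^esub>" if y: "y \<in> carrier (V X)" for y
  proof -
    have P: "pullback X i Y j emptyg (\<lambda>x. x) (\<lambda>x. x)"
      by (rule pullbackI) (use cD(9) in \<open>auto simp: equivariant_def finite_gset_emptyg\<close>)
    note sds = span_data_tr[OF cD(1) ai] span_data_res[OF cD(2,5)]
    show ?thesis
      using map_Comp[OF X D Y trm_Hom[OF cD(1) ai] resm_Hom[OF cD(2,5)] y]
        map_empty[OF X Y span_data_pullback[OF sds P] _ y] Comp_mor[OF sds P]
      by (simp add: resm_def trm_def)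
  qed
  have ij: "FMap M D X (resm D X i) (FMap M Y D (trm Y D j) y) = \<zero>\<^bsub>V X\<^esub>" if y: "y \<in> carrier (V Y)" for y
  proof -
    have P: "pullback Y j X i emptyg (\<lambda>x. x) (\<lambda>x. x)"
      by (rule pullbackI) (use cD(9) in \<open>auto simp: equivariant_def finite_gset_emptyg\<close>)
    note sds = span_data_tr[OF cD(2) aj] span_data_res[OF cD(1,4)]
    show ?thesis
      using map_Comp[OF Y D X trm_Hom[OF cD(2) aj] resm_Hom[OF cD(1,4)] y]
        map_empty[OF Y X span_data_pullback[OF sds P] _ y] Comp_mor[OF sds P]
      by (simp add: resm_def trm_def)
  qed
  define y where "y = FMap M X D (trm X D i) (FMap M D X (resm D X i) x) \<oplus>\<^bsub>V D\<^esub>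
    FMap M Y D (trm Y D j) (FMap M D Y (resm D Y j) x)"
  note VD = ratmod_V[OF D] and VX = ratmod_V[OF X] and VY = ratmod_V[OF Y]
  have cl: "FMap M D X (resm D X i) x \<in> carrier (V X)" "FMap M D Y (resm D Y j) x \<in> carrier (V Y)"
    "FMap M X D (trm X D i) (FMap M D X (resm D X i) x) \<in> carrier (V D)"
    "FMap M Y D (trm Y D j) (FMap M D Y (resm D Y j) x) \<in> carrier (V D)"
    using lm_closed[OF ri x] lm_closed[OF rj x] lm_closed[OF ti] lm_closed[OF tj] by auto
  then have y: "y \<in> carrier (V D)" using VD by (simp add: y_def)
  have "FMap M D X (resm D X i) y = FMap M D X (resm D X i) x"
    using cl VX by (simp add: y_def lm_add[OF ri] ii ij)
  moreover have "FMap M D Y (resm D Y j) y = FMap M D Y (resm D Y j) x"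
    using cl VY by (simp add: y_def lm_add[OF rj] jj ji)
  moreover have "is_binary_product rat_vect (V X) (V Y) (V D) (FMap M D X (resm D X i)) (FMap M D Y (resm D Y j))"
    using PP binary_product_coprod[OF c D] unfolding product_preserving_def by blast
  then have inj: "\<forall>z \<in> carrier (V D). FMap M D X (resm D X i) z = \<zero>\<^bsub>V X\<^esub> \<and>
      FMap M D Y (resm D Y j) z = \<zero>\<^bsub>V Y\<^esub> \<longrightarrow> z = \<zero>\<^bsub>V D\<^esub>"
    unfolding is_binary_product_rat_vect[OF VX VY VD ri rj] by blast
  ultimately have "x \<oplus>\<^bsub>V D\<^esub> (-1) \<odot>\<^bsub>V D\<^esub> y = \<zero>\<^bsub>V D\<^esub>"
    using inj x y VD VX VY cl by (simp add: lm_add[OF ri] lm_add[OF rj] lm_smult[OF ri] lm_smult[OF rj] rm_neg)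
  then show ?thesis
    using rm_diff_eq_zero[OF VD x y] by (simp add: y_def)
qed

lemma span_data_subg:
  assumes sd: "span_data S T U l r" and A: "invariant_subset G U A"
  shows "span_data S T (subg U A) l r"
  using finite_gset_subg[OF sd_gset[OF sd] A] equivariant_comp[OF equivariant_subg[OF A] sd_l[OF sd]]
    admissible_comp[OF admissible_inj[OF _ equivariant_subg[OF A]] sd_adm[OF sd]]
  by (simp add: span_data_def)

text \<open>The sum of two spans is the disjoint union of their apices, and M turns it into
  addition. This follows by applying \<open>coprod_sum\<close> to the vector restricted to the apex
  U and transferring the result to T.\<close>

lemma map_split:
  assumes S: "S \<in> Obj C" and T: "T \<in> Obj C" and sd: "span_data S T U l r"
    and A: "invariant_subset G U A" and x: "x \<in> carrier (V S)"
  shows "FMap M S T (mor S T U l r) x = FMap M S T (mor S T (subg U A) l r) x \<oplus>\<^bsub>V T\<^esub>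
    FMap M S T (mor S T (subg U (pts U - A)) l r) x"
proof -
  note U = sd_gset[OF sd] sd_l[OF sd] sd_adm[OF sd]
  have UO: "U \<in> Obj C" by (rule Obj_equivariant[OF U(1,2) S])
  let ?x = "FMap M S U (resm S U l) x"
  have x': "?x \<in> carrier (V U)" by (rule lm_closed[OF map_res_lm[OF S U(1,2)] x])
  note tU = map_tr_lm[OF T U(1,3)]
  have part: "FMap M U T (trm U T r) (FMap M (subg U B) U (trm (subg U B) U (\<lambda>x. x))
      (FMap M U (subg U B) (resm U (subg U B) (\<lambda>x. x)) ?x)) = FMap M S T (mor S T (subg U B) l r) x"
    "FMap M (subg U B) U (trm (subg U B) U (\<lambda>x. x))
      (FMap M U (subg U B) (resm U (subg U B) (\<lambda>x. x)) ?x) \<in> carrier (V U)"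
    if B: "invariant_subset G U B" for B
  proof -
    note sB = finite_gset_subg[OF U(1) B] and eB = equivariant_subg[OF B]
    have aB: "admissible (subg U B) U (\<lambda>x. x)" by (rule admissible_inj[OF sB eB]) simp
    have BO: "subg U B \<in> Obj C" by (rule Obj_subg[OF UO B])
    have "FMap M U (subg U B) (resm U (subg U B) (\<lambda>x. x)) ?x = FMap M S (subg U B) (resm S (subg U B) l) x"
      using map_Comp[OF S UO BO resm_Hom[OF U(1,2)] resm_Hom[OF sB eB] x] comp_res[OF U(1) sB eB U(2)] by simp
    moreover have xB: "FMap M S (subg U B) (resm S (subg U B) l) x \<in> carrier (V (subg U B))"
      using lm_closed[OF map_res_lm[OF S sB equivariant_comp[OF eB U(2)]] x] by simp
    moreover note map_Comp[OF BO UO T trm_Hom[OF sB aB] trm_Hom[OF U(1,3)] xB] comp_tr[OF U(1) sB aB U(3)]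
      map_span[OF S T span_data_subg[OF sd B] x]
    ultimately show "FMap M U T (trm U T r) (FMap M (subg U B) U (trm (subg U B) U (\<lambda>x. x))
      (FMap M U (subg U B) (resm U (subg U B) (\<lambda>x. x)) ?x)) = FMap M S T (mor S T (subg U B) l r) x"
      by simp
    show "FMap M (subg U B) U (trm (subg U B) U (\<lambda>x. x))
      (FMap M U (subg U B) (resm U (subg U B) (\<lambda>x. x)) ?x) \<in> carrier (V U)"
      using lm_closed[OF map_tr_lm[OF UO sB aB] lm_closed[OF map_res_lm[OF UO sB eB] x']] .
  qed
  show ?thesis
    using arg_cong[OF coprod_sum[OF coprod_subset[OF U(1) A] UO x'], of "FMap M U T (trm U T r)"]
      part[OF A] part[OF invariant_Diff[OF U(1) A]]
    by (simp add: lm_add[OF tU] map_span[OF S T sd x])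
qed

lemma map_union:
  assumes T: "T \<in> Obj C" and A: "invariant_subset G T A" and x: "x \<in> carrier (V T)"
  defines "U \<equiv> subg T A" and "W \<equiv> subg T (pts T - A)"
  shows "x = FMap M U T (trm U T (\<lambda>x. x)) (FMap M T U (resm T U (\<lambda>x. x)) x) \<oplus>\<^bsub>V T\<^esub>
      FMap M W T (trm W T (\<lambda>x. x)) (FMap M T W (resm T W (\<lambda>x. x)) x)"
    and "resm T U (\<lambda>x. x) \<in> Hom (lindner G \<O>) T U" "trm U T (\<lambda>x. x) \<in> Hom (lindner G \<O>) U T"
    and "resm T W (\<lambda>x. x) \<in> Hom (lindner G \<O>) T W" "trm W T (\<lambda>x. x) \<in> Hom (lindner G \<O>) W T"
    and "U \<in> Obj C" "W \<in> Obj C"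
proof -
  have T': "finite_gset G T" using T by simp
  show "x = FMap M U T (trm U T (\<lambda>x. x)) (FMap M T U (resm T U (\<lambda>x. x)) x) \<oplus>\<^bsub>V T\<^esub>
      FMap M W T (trm W T (\<lambda>x. x)) (FMap M T W (resm T W (\<lambda>x. x)) x)"
    unfolding U_def W_def by (rule coprod_sum[OF coprod_subset[OF T' A] T x])
  note A' = A invariant_Diff[OF T' A]
  note g = finite_gset_subg[OF T' A'(1)] finite_gset_subg[OF T' A'(2)]
  note e = equivariant_subg[OF A'(1)] equivariant_subg[OF A'(2)]
  have "admissible U T (\<lambda>x. x)" "admissible W T (\<lambda>x. x)"
    unfolding U_def W_def by (rule admissible_inj[OF g(1) e(1)] admissible_inj[OF g(2) e(2)], simp)+
  then show "resm T U (\<lambda>x. x) \<in> Hom (lindner G \<O>) T U" "trm U T (\<lambda>x. x) \<in> Hom (lindner G \<O>) U T"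
    "resm T W (\<lambda>x. x) \<in> Hom (lindner G \<O>) T W" "trm W T (\<lambda>x. x) \<in> Hom (lindner G \<O>) W T"
    using g e by (auto simp: U_def W_def intro!: resm_Hom trm_Hom)
  show "U \<in> Obj C" "W \<in> Obj C"
    using Obj_subg[OF T] A' unfolding U_def W_def by blast+
qed

text \<open>No stabilizer shrinks along p, so W consists of copies of the orbit T, each mapped
  isomorphically by p. Each copy contributes the identity and contains exactly one point over
  t.\<close>

lemma map_covering:
  assumes T: "T \<in> Obj C" and tr: "transitive_gset G T" and t: "t \<in> pts T" and x: "x \<in> carrier (V T)"
    and sd: "span_data T T W p p" and st: "\<And>w. w \<in> pts W \<Longrightarrow> stab W w = stab T (p w)"
  shows "FMap M T T (mor T T W p p) x = of_nat (card {w \<in> pts W. p w = t}) \<odot>\<^bsub>V T\<^esub> x"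
  using sd st
proof (induction "card (pts W)" arbitrary: W rule: less_induct)
  case less
  note sd = less.prems(1)
  note W = sd_gset[OF sd] and p = sd_l[OF sd]
  have T': "finite_gset G T" using T by simp
  show ?case
  proof (cases "pts W = {}")
    case True
    then show ?thesis
      using map_empty[OF T T sd True x] ratmod_V[OF T] x by simp
  next
    case False
    then obtain v where v: "v \<in> pts W" by blast
    then obtain g where g: "g \<in> carrier G" "act T g (p v) = t"
      using tr t equivariant_pts[OF p v] unfolding transitive_gset_def by blast
    \<comment> \<open>The point v is moved within its orbit to lie over t, so that removing the
      orbit removes exactly one point of the fibre.\<close>
    define w where "w = act W g v"
    have w: "w \<in> pts W" "p w = t"
      using g v gs_act[OF W] equivariant_act[OF p g(1) v] by (simp_all add: w_def)
    let ?A = "(\<lambda>g. act W g w) ` carrier G"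
    note A = invariant_orbit[OF W w(1)]
    have AW: "?A \<subseteq> pts W" using A(1) by (simp add: invariant_subset_def)
    have fin: "finite (pts W)" by (rule gs_finite[OF W])
    have pA: "p (act W h w) = act T h t" if "h \<in> carrier G" for h
      using equivariant_act[OF p that w(1)] w(2) by simp
    \<comment> \<open>Two points of the orbit with the same image differ by an element of Stab t,
      and this is the stabilizer of w by hypothesis.\<close>
    have inj: "inj_on p ?A"
    proof (rule inj_onI)
      fix y z assume "y \<in> ?A" "z \<in> ?A" and eq: "p y = p z"
      then obtain h k where hk: "h \<in> carrier G" "k \<in> carrier G" "y = act W h w" "z = act W k w" by auto
      then have "act T (inv k \<otimes> h) t = t"
        using eq pA T' t by (simp add: gs_mult gs_inv)
      then have "inv k \<otimes> h \<in> stab W w"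
        using less.prems(2)[OF w(1)] w(2) hk by (simp add: stab_iff)
      then have "act W k (act W (inv k \<otimes> h) w) = act W k w"
        by (simp add: stab_iff)
      then show "y = z"
        using hk W w(1) by (simp add: gs_mult[OF W, symmetric] m_assoc[symmetric])
    qed
    have surj: "p ` ?A = pts T"
    proof
      show "p ` ?A \<subseteq> pts T" using AW equivariant_pts[OF p] by blast
      show "pts T \<subseteq> p ` ?A"
      proof
        fix y assume "y \<in> pts T"
        then obtain h where "h \<in> carrier G" "act T h t = y"
          using tr t unfolding transitive_gset_def by blast
        then show "y \<in> p ` ?A" using pA by force
      qed
    qed
    have "isomorphic_spans (subg W ?A) p p T (\<lambda>x. x) (\<lambda>x. x) p"
      unfolding isomorphic_spans_def bij_betw_def
      using inj surj equivariant_comp[OF equivariant_subg[OF A(1)] p] by simp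
    from mor_eqI[OF span_data_subg[OF sd A(1)] this]
    have "FMap M T T (mor T T (subg W ?A) p p) x = x"
      using map_Ident[OF T x] by (simp add: Ident_mor[OF T'])
    moreover have "FMap M T T (mor T T (subg W (pts W - ?A)) p p) x =
        of_nat (card {w \<in> pts (subg W (pts W - ?A)). p w = t}) \<odot>\<^bsub>V T\<^esub> x"
    proof (rule less.hyps)
      show "card (pts (subg W (pts W - ?A))) < card (pts W)"
        using fin A(2) w(1) by (intro psubset_card_mono) auto
      show "span_data T T (subg W (pts W - ?A)) p p"
        by (rule span_data_subg[OF sd invariant_Diff[OF W A(1)]])
    qed (use less.prems(2) in auto)
    moreover have "card {w \<in> pts W. p w = t} = Suc (card {w \<in> pts (subg W (pts W - ?A)). p w = t})"
    proof -
      have "{y \<in> pts W. p y = t} = insert w {w \<in> pts (subg W (pts W - ?A)). p w = t}"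
        using w A(2) inj_onD[OF inj, of _ w] by auto
      then show ?thesis
        using fin A(2) by simp
    qed
    ultimately show ?thesis
      using map_split[OF T T sd A(1) x] rm_smult_nat[OF ratmod_V[OF T] x] by simp
  qed
qed

end

section \<open>Marks and inseparability classes\<close>

definition fixpts :: "('a, 'b) monoid_scheme \<Rightarrow> ('a, nat) gset \<Rightarrow> 'a set \<Rightarrow> nat set" where
  "fixpts G Z K = {z \<in> pts Z. K \<subseteq> stabilizer G (act Z) z}"

text \<open>The entry of the table of marks: the order of the fixed point set of K on Z, known from
  the Burnside ring.\<close>

definition mark :: "('a, 'b) monoid_scheme \<Rightarrow> ('a, nat) gset \<Rightarrow> 'a set \<Rightarrow> nat" where
  "mark G Z K = card (fixpts G Z K)"

definition natg :: "('s \<Rightarrow> nat) \<Rightarrow> ('a, 's) gset \<Rightarrow> ('a, nat) gset" where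
  "natg e A = \<lparr>pts = e ` pts A, act = (\<lambda>g. \<lambda>z\<in>e ` pts A. e (act A g (the_inv_into (pts A) e z)))\<rparr>"

text \<open>A product with this set is a disjoint union of n copies, which multiplies marks by
  n.\<close>

definition trivg :: "nat \<Rightarrow> ('a, nat) gset" where
  "trivg n = \<lparr>pts = {..<n}, act = (\<lambda>g. \<lambda>x\<in>{..<n}. x)\<rparr>"

lemma trivg_simps [simp]: "pts (trivg n) = {..<n}" "x < n \<Longrightarrow> act (trivg n) g x = x"
  by (simp_all add: trivg_def)

section \<open>Conjugation, coset spaces and marks of sums and multiples\<close>

context group
begin

lemma conj_one: "K \<subseteq> carrier G \<Longrightarrow> conjugate_set G \<one> K = K"
  by (force simp: conjugate_set_eq subset_iff)

lemma conj_mult: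
  assumes "g \<in> carrier G" "h \<in> carrier G" "K \<subseteq> carrier G"
  shows "conjugate_set G g (conjugate_set G h K) = conjugate_set G (g \<otimes> h) K"
  using assms by (auto simp: conjugate_set_eq image_image subset_iff inv_mult_group m_assoc intro!: image_cong)

lemma conj_inv:
  assumes "g \<in> carrier G" "K \<subseteq> carrier G"
  shows "conjugate_set G (inv g) (conjugate_set G g K) = K" "conjugate_set G g (conjugate_set G (inv g) K) = K"
  using assms by (simp_all add: conj_mult conj_one)

lemma conj_mono: "K \<subseteq> L \<Longrightarrow> conjugate_set G g K \<subseteq> conjugate_set G g L"
  by (auto simp: conjugate_set_eq)

lemma conj_closed: "g \<in> carrier G \<Longrightarrow> K \<subseteq> carrier G \<Longrightarrow> conjugate_set G g K \<subseteq> carrier G"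
  by (auto simp: conjugate_set_eq)

lemma conj_carrier: "g \<in> carrier G \<Longrightarrow> conjugate_set G g (carrier G) = carrier G"
  using conj_closed[of g "carrier G"] conj_mono[OF conj_closed[of "inv g" "carrier G"], of g] conj_inv(2)[of g "carrier G"]
  by (intro subset_antisym) auto

lemma card_conj:
  assumes "g \<in> carrier G" "K \<subseteq> carrier G"
  shows "card (conjugate_set G g K) = card K"
  unfolding conjugate_set_eq
proof (rule card_image, rule inj_onI)
  fix x y assume "x \<in> K" "y \<in> K" "g \<otimes> x \<otimes> inv g = g \<otimes> y \<otimes> inv g"
  then show "x = y" using assms by (simp add: subset_iff)
qed

lemma subgroup_conj:
  assumes g: "g \<in> carrier G" and K: "subgroup K G"
  shows "subgroup (conjugate_set G g K) G"
proof (rule subgroupI)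
  have Kc: "K \<subseteq> carrier G" using subgroup.subset[OF K] .
  show "conjugate_set G g K \<subseteq> carrier G" by (rule conj_closed[OF g Kc])
  show "conjugate_set G g K \<noteq> {}" using subgroup.one_closed[OF K] by (auto simp: conjugate_set_eq)
  show "inv a \<in> conjugate_set G g K" if a: "a \<in> conjugate_set G g K" for a
  proof -
    obtain k where k: "k \<in> K" "a = g \<otimes> k \<otimes> inv g" using a by (auto simp: conjugate_set_eq)
    then have "inv a = g \<otimes> inv k \<otimes> inv g"
      using g Kc by (simp add: subset_iff inv_mult_group m_assoc)
    then show ?thesis using k subgroup.m_inv_closed[OF K] by (auto simp: conjugate_set_eq)
  qed
  show "a \<otimes> b \<in> conjugate_set G g K" if ab: "a \<in> conjugate_set G g K" "b \<in> conjugate_set G g K" for a b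
  proof -
    obtain k l where k: "k \<in> K" "a = g \<otimes> k \<otimes> inv g" "l \<in> K" "b = g \<otimes> l \<otimes> inv g"
      using ab by (auto simp: conjugate_set_eq)
    then have kl: "k \<in> carrier G" "l \<in> carrier G" using Kc by auto
    have "inv g \<otimes> (g \<otimes> (l \<otimes> inv g)) = l \<otimes> inv g"
      using g kl by (simp add: m_assoc[symmetric])
    then have "a \<otimes> b = g \<otimes> (k \<otimes> l) \<otimes> inv g"
      using g kl k by (simp add: m_assoc)
    then show ?thesis using k subgroup.m_closed[OF K] by (auto simp: conjugate_set_eq)
  qed
qed

lemma lcos_act: "\<lbrakk>g \<in> carrier G; h \<in> carrier G; subgroup L G\<rbrakk> \<Longrightarrow> g <# (h <# L) = (g \<otimes> h) <# L"
  by (simp add: lcos_m_assoc subgroup.subset)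

lemma lcos_eq_self:
  assumes L: "subgroup L G" and g: "g \<in> carrier G"
  shows "g <# L = L \<longleftrightarrow> g \<in> L"
proof
  assume "g <# L = L"
  then show "g \<in> L" using lcos_self[OF g L] by simp
next
  assume gL: "g \<in> L"
  show "g <# L = L"
  proof
    show "g <# L \<subseteq> L" using gL subgroup.m_closed[OF L] by (auto simp: l_coset_def)
    show "L \<subseteq> g <# L"
    proof
      fix x assume x: "x \<in> L"
      then have "inv g \<otimes> x \<in> L" "g \<otimes> (inv g \<otimes> x) = x"
        using gL g subgroup.m_closed[OF L] subgroup.m_inv_closed[OF L] subgroup.mem_carrier[OF L]
        by (simp_all add: m_assoc[symmetric])
      then show "x \<in> g <# L" unfolding l_coset_def by force
    qed
  qed
qed

lemma coset_gset:
  assumes L: "subgroup L G" and fin: "finite (carrier G)"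
  shows "finite_gset G (coset_gset G L)" "L \<in> pts (coset_gset G L)" "stab (coset_gset G L) L = L"
    "\<And>x. x \<in> pts (coset_gset G L) \<Longrightarrow> \<exists>g\<in>carrier G. x = act (coset_gset G L) g L"
proof -
  have pts: "pts (coset_gset G L) = (\<lambda>g. g <# L) ` carrier G"
    by (auto simp: coset_gset_def LCOSETS_def)
  have act: "act (coset_gset G L) g (h <# L) = (g \<otimes> h) <# L" if "g \<in> carrier G" "h \<in> carrier G" for g h
    using that lcos_act[OF that L] by (auto simp: coset_gset_def LCOSETS_def)
  have one: "\<one> <# L = L"
    using subgroup.one_closed[OF L] by (simp add: lcos_eq_self[OF L])
  show "L \<in> pts (coset_gset G L)"
    unfolding pts using one by (metis image_eqI one_closed)
  have actL: "act (coset_gset G L) g L = g <# L" if "g \<in> carrier G" for g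
    using act[OF that one_closed] that one by simp
  then show "stab (coset_gset G L) L = L"
    using lcos_eq_self[OF L] subgroup.mem_carrier[OF L] by (auto simp: stab_iff)
  show "\<exists>g\<in>carrier G. x = act (coset_gset G L) g L" if "x \<in> pts (coset_gset G L)" for x
    using that actL unfolding pts by auto
  show "finite_gset G (coset_gset G L)"
  proof (rule finite_gsetI)
    show "finite (pts (coset_gset G L))" unfolding pts using fin by simp
    show "act (coset_gset G L) g \<in> extensional (pts (coset_gset G L))" for g
      by (simp add: coset_gset_def)
  qed (auto simp: pts act m_assoc)
qed

text \<open>The orbit-stabilizer correspondence, needed because the vanishing condition on class
  Mackey functors speaks of coset spaces whereas the induction produces abstract orbits.\<close>

lemma transitive_coset_gset:
  assumes T: "finite_gset G T" and tr: "transitive_gset G T" and t: "t \<in> pts T"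
    and fin: "finite (carrier G)"
  shows "gset_iso G T (coset_gset G (stab T t))"
proof -
  let ?L = "stab T t"
  have L: "subgroup ?L G" by (rule subgroup_stab[OF T t])
  obtain s where s: "\<And>x. x \<in> pts T \<Longrightarrow> s x \<in> carrier G \<and> act T (s x) t = x"
    using tr t unfolding transitive_gset_def by metis
  define f where "f x = s x <# ?L" for x
  \<comment> \<open>Two cosets of the stabilizer agree exactly when their representatives move t to
    the same point. This gives equivariance and injectivity of f, and independence of the chosen
    elements \<open>s x\<close>.\<close>
  have cos: "g <# ?L = h <# ?L \<longleftrightarrow> act T g t = act T h t" if "g \<in> carrier G" "h \<in> carrier G" for g h
  proof -
    have "\<one> <# ?L = ?L"
      using subgroup.one_closed[OF L] by (simp add: lcos_eq_self[OF L])
    then have 1: "inv h <# (h <# ?L) = ?L"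
      using that by (simp add: lcos_act[OF _ _ L])
    have 2: "inv h <# (g <# ?L) = (inv h \<otimes> g) <# ?L" "h <# ((inv h \<otimes> g) <# ?L) = g <# ?L"
      using that by (simp_all add: lcos_act[OF _ _ L] m_assoc[symmetric])
    have "g <# ?L = h <# ?L \<longleftrightarrow> (inv h \<otimes> g) <# ?L = ?L"
      using 1 2 by metis
    also have "\<dots> \<longleftrightarrow> act T (inv h \<otimes> g) t = t"
      using that by (simp add: lcos_eq_self[OF L] stab_iff)
    also have "\<dots> \<longleftrightarrow> act T g t = act T h t"
      using that T t by (metis gs_act gs_inv gs_mult inv_closed)
    finally show ?thesis .
  qed
  have pts: "pts (coset_gset G ?L) = (\<lambda>g. g <# ?L) ` carrier G"
    by (auto simp: coset_gset_def LCOSETS_def)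
  have act: "act (coset_gset G ?L) g (h <# ?L) = (g \<otimes> h) <# ?L" if "g \<in> carrier G" "h \<in> carrier G" for g h
    using that lcos_act[OF that L] by (auto simp: coset_gset_def LCOSETS_def)
  have "restrict f (pts T) \<in> gmaps G T (coset_gset G ?L)"
  proof -
    have "f (act T g x) = act (coset_gset G ?L) g (f x)" if "g \<in> carrier G" "x \<in> pts T" for g x
      using that s[OF that(2)] s[OF gs_act[OF T that]] T t
      by (simp add: f_def act cos gs_mult)
    then show ?thesis
      using s T by (auto simp: gmaps_def pts f_def)
  qed
  moreover have "bij_betw (restrict f (pts T)) (pts T) (pts (coset_gset G ?L))"
  proof (rule bij_betwI')
    show "(restrict f (pts T) x = restrict f (pts T) y) = (x = y)" if "x \<in> pts T" "y \<in> pts T" for x y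
      using that s[OF that(1)] s[OF that(2)] by (simp add: f_def cos)
    show "restrict f (pts T) x \<in> pts (coset_gset G ?L)" if "x \<in> pts T" for x
      using that s by (simp add: f_def pts)
    show "\<exists>x\<in>pts T. y = restrict f (pts T) x" if y: "y \<in> pts (coset_gset G ?L)" for y
    proof -
      obtain g where g: "g \<in> carrier G" "y = g <# ?L" using y unfolding pts by blast
      then show ?thesis
        using s[OF gs_act[OF T g(1) t]] T t by (intro bexI[of _ "act T g t"]) (auto simp: f_def cos)
    qed
  qed
  ultimately show ?thesis unfolding gset_iso_def by blast
qed

lemma natg:
  assumes A: "finite_gset G A" and e: "inj_on e (pts A)"
  shows "finite_gset G (natg e A)" "x \<in> pts A \<Longrightarrow> stab (natg e A) (e x) = stab A x"
    "\<lbrakk>g \<in> carrier G; x \<in> pts A\<rbrakk> \<Longrightarrow> act (natg e A) g (e x) = e (act A g x)"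
proof -
  have act: "act (natg e A) g (e x) = e (act A g x)" if "x \<in> pts A" for g x
    using that e by (simp add: natg_def the_inv_into_f_f)
  show "finite_gset G (natg e A)"
  proof (rule finite_gsetI)
    show "finite (pts (natg e A))" using gs_finite[OF A] by (simp add: natg_def)
    show "act (natg e A) g \<in> extensional (pts (natg e A))" for g by (simp add: natg_def)
    have pts: "pts (natg e A) = e ` pts A" by (simp add: natg_def)
    show "g \<in> carrier G \<Longrightarrow> x \<in> pts (natg e A) \<Longrightarrow> act (natg e A) g x \<in> pts (natg e A)" for g x
      unfolding pts using act gs_act[OF A] by auto
    show "x \<in> pts (natg e A) \<Longrightarrow> act (natg e A) \<one> x = x" for x
      unfolding pts using act gs_one[OF A] by auto
    show "\<lbrakk>g \<in> carrier G; h \<in> carrier G; x \<in> pts (natg e A)\<rbrakk>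
      \<Longrightarrow> act (natg e A) (g \<otimes> h) x = act (natg e A) g (act (natg e A) h x)" for g h x
      unfolding pts using act gs_mult[OF A] gs_act[OF A] by auto
  qed
  show "act (natg e A) g (e x) = e (act A g x)" if "g \<in> carrier G" "x \<in> pts A"
    using act that by simp
  show "stab (natg e A) (e x) = stab A x" if x: "x \<in> pts A"
    using act[OF x] x gs_act[OF A _ x] inj_onD[OF e] by (auto simp: stab_iff)
qed

lemma mark_sumg:
  assumes A: "finite_gset G A" and B: "finite_gset G B"
  shows "mark G (sumg A B) K = mark G A K + mark G B K"
proof -
  note c = coprodD[OF coprod_sumg[OF A B]]
  have "fixpts G (sumg A B) K = pr 0 ` fixpts G A K \<union> pr 1 ` fixpts G B K"
    using stab_inj[OF c(4,6) _ A] stab_inj[OF c(5,7) _ B] unfolding fixpts_def c(8) by auto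
  moreover have "pr 0 ` fixpts G A K \<inter> pr 1 ` fixpts G B K = {}"
    by auto
  ultimately show ?thesis
    unfolding mark_def using gs_finite[OF A] gs_finite[OF B]
    by (simp add: card_Un_disjoint fixpts_def card_image inj_on_def)
qed

lemma finite_gset_trivg: "finite_gset G (trivg n)"
  by (rule finite_gsetI) (auto simp: trivg_def)

lemma stab_trivg: "x < n \<Longrightarrow> stab (trivg n) x = carrier G"
  by (auto simp: stab_iff)

lemma stab_ten_trivg:
  "z \<in> pts (ten A (trivg n)) \<Longrightarrow> stab (ten A (trivg n)) z = stab A (pr1 z)"
  by (subst stab_ten) (auto simp: stab_trivg stab_iff)

lemma mark_ten_trivg:
  assumes A: "finite_gset G A"
  shows "mark G (ten A (trivg n)) K = mark G A K * n"
proof -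
  have "fixpts G (ten A (trivg n)) K = (\<lambda>(x, y). pr x y) ` (fixpts G A K \<times> {..<n})"
    using stab_ten_trivg[of _ A n] by (fastforce simp: fixpts_def image_iff intro: pr_eqI)
  moreover have "inj_on (\<lambda>(x, y). pr x y) (fixpts G A K \<times> {..<n})"
    by (auto simp: inj_on_def)
  ultimately show ?thesis
    by (simp add: mark_def card_image card_cartesian_product)
qed

end

section \<open>The closure H_O, inseparability classes and a separating G-set\<close>

context transfer
begin

text \<open>Equivalently, the map from Z to a point is a morphism of Fin_O. These are the sets whose
  projections T x Z -> T carry transfers.\<close>

definition adm_gset :: "('a, nat) gset \<Rightarrow> bool" where
  "adm_gset Z \<longleftrightarrow> finite_gset G Z \<and> (\<forall>z\<in>pts Z. (stab Z z, carrier G) \<in> \<O>)"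

lemma adm_gset_finite: "adm_gset Z \<Longrightarrow> finite_gset G Z"
  by (simp add: adm_gset_def)

lemma adm_gset_stab: "\<lbrakk>adm_gset Z; z \<in> pts Z\<rbrakk> \<Longrightarrow> stab Z z \<in> Sub_O G \<O>"
  using O_subgroup by (auto simp: adm_gset_def Sub_O_def)

text \<open>Restrict K -> G along L to get an arrow from the intersection to L, then compose with L
  -> G.\<close>

lemma Sub_O_Int: "\<lbrakk>K \<in> Sub_O G \<O>; L \<in> Sub_O G \<O>\<rbrakk> \<Longrightarrow> K \<inter> L \<in> Sub_O G \<O>"
proof -
  assume KL: "K \<in> Sub_O G \<O>" "L \<in> Sub_O G \<O>"
  then have "(K \<inter> L, L) \<in> \<O>" "(L, carrier G) \<in> \<O>"
    using O_restrict[of K "carrier G" L] by (auto simp: Sub_O_def subgroup.subset)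
  then have "(K \<inter> L, carrier G) \<in> \<O>" by (rule O_trans)
  then show "K \<inter> L \<in> Sub_O G \<O>" using O_subgroup by (auto simp: Sub_O_def)
qed

lemma carrier_Sub_O: "carrier G \<in> Sub_O G \<O>"
  using O_refl[OF subgroup_self] subgroup_self by (simp add: Sub_O_def)

lemma Sub_O_conj: "\<lbrakk>K \<in> Sub_O G \<O>; g \<in> carrier G\<rbrakk> \<Longrightarrow> conjugate_set G g K \<in> Sub_O G \<O>"
  unfolding Sub_O_def using O_conj[of K "carrier G" g] conj_carrier subgroup_conj by auto

lemma Sub_O_subset: "K \<in> Sub_O G \<O> \<Longrightarrow> K \<subseteq> carrier G"
  by (simp add: Sub_O_def subgroup.subset)

text \<open>Because \<open>Sub_O\<close> is closed under intersections, a member of least order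
  above J is already contained in every other member above J.\<close>

lemma H_O:
  assumes J: "J \<subseteq> carrier G"
  shows H_O_Sub: "H_O G \<O> J \<in> Sub_O G \<O>" and H_O_incl: "J \<subseteq> H_O G \<O> J"
    and H_O_least: "\<lbrakk>K \<in> Sub_O G \<O>; J \<subseteq> K\<rbrakk> \<Longrightarrow> H_O G \<O> J \<subseteq> K"
proof -
  let ?P = "\<lambda>H. H \<in> Sub_O G \<O> \<and> J \<subseteq> H"
  obtain K0 where K0: "?P K0" and min: "\<And>K. ?P K \<Longrightarrow> card K0 \<le> card K"
    using ex_has_least_nat[of ?P "carrier G" card] carrier_Sub_O J by blast
  have K0fin: "finite K0" using Sub_O_subset K0 fin finite_subset by blast
  have least: "K0 \<subseteq> K" if "?P K" for K
  proof -
    have "card K0 \<le> card (K0 \<inter> K)" using K0 that Sub_O_Int by (intro min) auto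
    then have "K0 \<inter> K = K0" by (intro card_seteq[OF K0fin]) auto
    then show ?thesis by blast
  qed
  have "H_O G \<O> J = K0"
    unfolding H_O_def using K0 least by (intro the_equality) blast+
  then show "H_O G \<O> J \<in> Sub_O G \<O>" "J \<subseteq> H_O G \<O> J"
    "\<lbrakk>K \<in> Sub_O G \<O>; J \<subseteq> K\<rbrakk> \<Longrightarrow> H_O G \<O> J \<subseteq> K"
    using K0 least by auto
qed

lemma H_O_carrier: "J \<subseteq> carrier G \<Longrightarrow> H_O G \<O> J \<subseteq> carrier G"
  using Sub_O_subset[OF H_O_Sub] .

lemma H_O_finite: "J \<subseteq> carrier G \<Longrightarrow> finite (H_O G \<O> J)"
  using H_O_carrier fin finite_subset by blast

lemma H_O_self: "K \<in> Sub_O G \<O> \<Longrightarrow> H_O G \<O> K = K"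
  using H_O_incl[of K] H_O_least[of K K] Sub_O_subset by blast

lemma H_O_mono:
  assumes "J \<subseteq> K" "K \<subseteq> carrier G"
  shows "H_O G \<O> J \<subseteq> H_O G \<O> K"
  by (rule H_O_least[OF _ H_O_Sub]) (use assms H_O_incl[OF assms(2)] in auto)

lemma H_O_conj_le:
  assumes "J \<subseteq> carrier G" "g \<in> carrier G"
  shows "H_O G \<O> (conjugate_set G g J) \<subseteq> conjugate_set G g (H_O G \<O> J)"
  using assms H_O_Sub H_O_incl by (intro H_O_least Sub_O_conj conj_mono conj_closed) auto

lemma H_O_conj:
  assumes J: "J \<subseteq> carrier G" and g: "g \<in> carrier G"
  shows "H_O G \<O> (conjugate_set G g J) = conjugate_set G g (H_O G \<O> J)"
proof
  let ?J = "conjugate_set G g J"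
  have "H_O G \<O> (conjugate_set G (inv g) ?J) \<subseteq> conjugate_set G (inv g) (H_O G \<O> ?J)"
    by (rule H_O_conj_le) (use J g conj_closed in auto)
  then have "conjugate_set G g (H_O G \<O> J) \<subseteq> conjugate_set G g (conjugate_set G (inv g) (H_O G \<O> ?J))"
    using J g by (intro conj_mono) (simp add: conj_inv)
  then show "conjugate_set G g (H_O G \<O> J) \<subseteq> H_O G \<O> ?J"
    using J g by (simp add: conj_inv H_O_carrier conj_closed)
qed (rule H_O_conj_le[OF J g])

text \<open>The stabilizers of Z belong to \<open>Sub_O\<close>, so they contain J exactly when they
  contain its closure.\<close>

lemma mark_H_O:
  assumes Z: "adm_gset Z" and J: "J \<subseteq> carrier G"
  shows "mark G Z (H_O G \<O> J) = mark G Z J"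
proof -
  have "J \<subseteq> stab Z z \<longleftrightarrow> H_O G \<O> J \<subseteq> stab Z z" if "z \<in> pts Z" for z
    using H_O_least[OF J adm_gset_stab[OF Z that]] H_O_incl[OF J] by blast
  then have "fixpts G Z (H_O G \<O> J) = fixpts G Z J"
    by (auto simp: fixpts_def)
  then show ?thesis by (simp add: mark_def)
qed

lemma mark_conj:
  assumes Z: "finite_gset G Z" and K: "K \<subseteq> carrier G" and g: "g \<in> carrier G"
  shows "mark G Z (conjugate_set G g K) = mark G Z K"
proof -
  have "bij_betw (act Z g) (fixpts G Z K) (fixpts G Z (conjugate_set G g K))"
  proof (rule bij_betw_byWitness[where f' = "act Z (inv g)"])
    show "act Z g ` fixpts G Z K \<subseteq> fixpts G Z (conjugate_set G g K)"
    proof (rule image_subsetI)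
      fix z assume "z \<in> fixpts G Z K"
      then show "act Z g z \<in> fixpts G Z (conjugate_set G g K)"
        using Z g conj_mono[of K "stab Z z" g] by (simp add: fixpts_def stab_act)
    qed
    show "act Z (inv g) ` fixpts G Z (conjugate_set G g K) \<subseteq> fixpts G Z K"
    proof (rule image_subsetI)
      fix z assume "z \<in> fixpts G Z (conjugate_set G g K)"
      then show "act Z (inv g) z \<in> fixpts G Z K"
        using Z g conj_mono[of "conjugate_set G g K" "stab Z z" "inv g"] conj_inv[OF g K]
        by (simp add: fixpts_def stab_act)
    qed
  qed (use Z g in \<open>auto simp: fixpts_def gs_inv\<close>)
  then show ?thesis
    unfolding mark_def by (rule bij_betw_same_card[symmetric])
qed

lemma inseparable_iff:
  "(J, K) \<in> inseparable G \<O> \<longleftrightarrow> subgroup J G \<and> subgroup K G \<and>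
    (\<exists>g\<in>carrier G. conjugate_set G g (H_O G \<O> J) = H_O G \<O> K)"
  by (simp add: inseparable_def)

lemma equiv_inseparable: "equiv {H. subgroup H G} (inseparable G \<O>)"
proof (rule equivI)
  show "inseparable G \<O> \<subseteq> {H. subgroup H G} \<times> {H. subgroup H G}"
    by (auto simp: inseparable_def)
  show "refl_on {H. subgroup H G} (inseparable G \<O>)"
    using conj_one[OF H_O_carrier[OF subgroup.subset]]
    by (auto simp only: refl_on_def inseparable_iff mem_Collect_eq intro!: bexI[of _ \<one>] one_closed)
  show "sym (inseparable G \<O>)"
  proof (rule symI)
    fix J K assume "(J, K) \<in> inseparable G \<O>"
    then obtain g where g: "subgroup J G" "subgroup K G" "g \<in> carrier G" "conjugate_set G g (H_O G \<O> J) = H_O G \<O> K"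
      by (auto simp: inseparable_def)
    then have "conjugate_set G (inv g) (H_O G \<O> K) = H_O G \<O> J"
      using conj_inv(1)[OF g(3) H_O_carrier[OF subgroup.subset[OF g(1)]]] by simp
    then show "(K, J) \<in> inseparable G \<O>" using g by (auto simp: inseparable_def)
  qed
  show "trans (inseparable G \<O>)"
  proof (rule transI)
    fix J K L assume "(J, K) \<in> inseparable G \<O>" "(K, L) \<in> inseparable G \<O>"
    then obtain g h where g: "subgroup J G" "subgroup L G" "g \<in> carrier G" "h \<in> carrier G"
      "conjugate_set G g (H_O G \<O> J) = H_O G \<O> K" "conjugate_set G h (H_O G \<O> K) = H_O G \<O> L"
      by (auto simp: inseparable_def)
    then have "conjugate_set G (h \<otimes> g) (H_O G \<O> J) = H_O G \<O> L"
      using conj_mult[OF g(4,3) H_O_carrier[OF subgroup.subset[OF g(1)]]] by simp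
    then show "(J, L) \<in> inseparable G \<O>" using g by (auto simp: inseparable_def intro!: bexI[of _ "h \<otimes> g"])
  qed
qed

abbreviation "cl K \<equiv> insep_class G \<O> K"
abbreviation "iclasses \<equiv> insep_classes G \<O>"

lemma cl_in_classes: "subgroup K G \<Longrightarrow> cl K \<in> iclasses"
  by (auto simp: insep_class_def insep_classes_def intro: quotientI)

lemma in_cl: "J \<in> cl K \<longleftrightarrow> (K, J) \<in> inseparable G \<O>"
  by (auto simp: insep_class_def)

lemma cl_eq_iff: "\<lbrakk>subgroup J G; subgroup K G\<rbrakk> \<Longrightarrow> cl J = cl K \<longleftrightarrow> (J, K) \<in> inseparable G \<O>"
  unfolding insep_class_def by (rule eq_equiv_class_iff[OF equiv_inseparable]) auto

lemma finite_classes: "finite iclasses"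
proof -
  have "iclasses = cl ` {K. subgroup K G}"
    by (auto simp: insep_classes_def quotient_def insep_class_def)
  moreover have "finite {K. subgroup K G}"
    by (rule finite_subset[of _ "Pow (carrier G)"]) (auto simp: fin subgroup.mem_carrier)
  ultimately show ?thesis by simp
qed

text \<open>Passing from \<open>K\<close> to \<open>K \<inter> Stab z\<close> properly shrinks \<open>H_O\<close> unless \<open>z\<close> is fixed by \<open>K\<close>.\<close>

lemma cl_neq:
  assumes Z: "adm_gset Z" and z: "z \<in> pts Z" and K: "subgroup K G" and J: "subgroup J G"
    and "J \<subseteq> K" "J \<subseteq> stab Z z" "\<not> K \<subseteq> stab Z z"
  shows "cl J \<noteq> cl K"
proof
  note Kc = subgroup.subset[OF K] and Jc = subgroup.subset[OF J]
  have "H_O G \<O> J \<subseteq> H_O G \<O> K" by (rule H_O_mono[OF assms(5) Kc])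
  moreover have "H_O G \<O> J \<subseteq> stab Z z" by (rule H_O_least[OF Jc adm_gset_stab[OF Z z] assms(6)])
  moreover have "\<not> H_O G \<O> K \<subseteq> stab Z z" using H_O_incl[OF Kc] assms(7) by blast
  ultimately have "H_O G \<O> J \<subset> H_O G \<O> K" by blast
  \<comment> \<open>Orders are compared rather than subgroups, because the class remembers H_O only
    up to conjugation.\<close>
  then have "card (H_O G \<O> J) < card (H_O G \<O> K)" by (rule psubset_card_mono[OF H_O_finite[OF Kc]])
  moreover assume "cl J = cl K"
  then obtain g where "g \<in> carrier G" "conjugate_set G g (H_O G \<O> J) = H_O G \<O> K"
    using cl_eq_iff[OF J K] by (auto simp: inseparable_def)
  then have "card (H_O G \<O> J) = card (H_O G \<O> K)"
    using card_conj[OF _ H_O_carrier[OF Jc]] by metis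
  ultimately show False by simp
qed

text \<open>The orbit G/L copied to the natural numbers. Its stabilizers are the conjugates of L,
  which lie in \<open>Sub_O\<close> by the conjugation axiom.\<close>

lemma obtain_orbit:
  assumes L: "L \<in> Sub_O G \<O>"
  obtains Y y where "adm_gset Y" "y \<in> pts Y" "stab Y y = L"
    "\<And>z. z \<in> pts Y \<Longrightarrow> \<exists>g\<in>carrier G. stab Y z = conjugate_set G g L"
proof -
  have Ls: "subgroup L G" using L by (simp add: Sub_O_def)
  let ?C = "coset_gset G L"
  note C = coset_gset[OF Ls fin]
  obtain e :: "'a set \<Rightarrow> nat" where e: "inj_on e (pts ?C)"
    using finite_imp_inj_to_nat_seg[OF gs_finite[OF C(1)]] by blast
  note N = natg[OF C(1) e]
  have st: "\<exists>g\<in>carrier G. stab (natg e ?C) z = conjugate_set G g L" if z: "z \<in> pts (natg e ?C)" for z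
  proof -
    obtain x where x: "x \<in> pts ?C" "z = e x" using z by (auto simp: natg_def)
    then obtain g where "g \<in> carrier G" "x = act ?C g L" using C(4) by blast
    then show ?thesis using N(2)[OF x(1)] x stab_act[OF C(1) _ C(2)] C(3) by metis
  qed
  show ?thesis
  proof
    show "adm_gset (natg e ?C)"
      unfolding adm_gset_def
    proof (intro conjI ballI)
      fix z assume "z \<in> pts (natg e ?C)"
      then obtain g where "g \<in> carrier G" "stab (natg e ?C) z = conjugate_set G g L" using st by blast
      then show "(stab (natg e ?C) z, carrier G) \<in> \<O>"
        using Sub_O_conj[OF L] by (simp add: Sub_O_def)
    qed (rule N(1))
    show "e L \<in> pts (natg e ?C)" using C(2) by (simp add: natg_def)
    show "stab (natg e ?C) (e L) = L" using N(2)[OF C(2)] C(3) by simp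
  qed (rule st)
qed

text \<open>
  Adding \<open>B\<close> copies of an orbit, with \<open>B\<close> larger than every mark of \<open>X\<close>, keeps both
  marks readable as remainder and quotient modulo \<open>B\<close>.
\<close>

lemma obtain_separating:
  assumes "finite A" "A \<subseteq> Sub_O G \<O>"
  shows "\<exists>X. adm_gset X \<and> (\<forall>K K'. mark G X K = mark G X K' \<longrightarrow>
    (\<forall>L\<in>A. \<exists>Y y. adm_gset Y \<and> y \<in> pts Y \<and> stab Y y = L \<and>
      (\<forall>z\<in>pts Y. \<exists>g\<in>carrier G. stab Y z = conjugate_set G g L) \<and> mark G Y K = mark G Y K'))"
  using assms
proof (induction A)
  case empty
  have "adm_gset emptyg" by (simp add: adm_gset_def finite_gset_emptyg)
  then show ?case by blast
next
  case (insert L A)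
  then obtain X where X: "adm_gset X" "\<And>K K'. mark G X K = mark G X K' \<Longrightarrow>
    (\<forall>L\<in>A. \<exists>Y y. adm_gset Y \<and> y \<in> pts Y \<and> stab Y y = L \<and>
      (\<forall>z\<in>pts Y. \<exists>g\<in>carrier G. stab Y z = conjugate_set G g L) \<and> mark G Y K = mark G Y K')"
    by auto
  obtain Y y where Y: "adm_gset Y" "y \<in> pts Y" "stab Y y = L"
    "\<And>z. z \<in> pts Y \<Longrightarrow> \<exists>g\<in>carrier G. stab Y z = conjugate_set G g L"
    using obtain_orbit[of L] insert.prems by blast
  define B where "B = Suc (card (pts X))"
  define W where "W = sumg X (ten Y (trivg B))"
  note Xf = adm_gset_finite[OF X(1)] and Yf = adm_gset_finite[OF Y(1)]
  note Bf = finite_gset_ten[OF Yf finite_gset_trivg[of B]]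
  note c = coprodD[OF coprod_sumg[OF Xf Bf]]
  have "(stab W z, carrier G) \<in> \<O>" if z: "z \<in> pts W" for z
  proof -
    consider x where "x \<in> pts X" "z = pr 0 x" | x where "x \<in> pts (ten Y (trivg B))" "z = pr 1 x"
      using z unfolding W_def c(8) by blast
    then show ?thesis
    proof cases
      case 1
      then show ?thesis
        using stab_inj[OF c(4,6) _ Xf] X(1) by (simp add: W_def adm_gset_def del: sumg_simps)
    next
      case 2
      then show ?thesis
        using stab_inj[OF c(5,7) _ Bf, of x] stab_ten_trivg[of x Y B] Y(1) by (simp add: W_def adm_gset_def)
    qed
  qed
  then have W: "adm_gset W" using c(3) by (simp add: adm_gset_def W_def)
  have mark: "mark G W K = mark G X K + mark G Y K * B" for K
    unfolding W_def by (simp add: mark_sumg[OF Xf Bf] mark_ten_trivg[OF Yf])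
  have small: "mark G X K < B" for K
    unfolding mark_def B_def using gs_finite[OF Xf] by (simp add: less_Suc_eq_le card_mono fixpts_def)
  have sep: "mark G X K = mark G X K' \<and> mark G Y K = mark G Y K'" if "mark G W K = mark G W K'" for K K'
  proof
    have eq: "mark G X K + mark G Y K * B = mark G X K' + mark G Y K' * B"
      using that by (simp add: mark)
    then have "(mark G X K + mark G Y K * B) mod B = (mark G X K' + mark G Y K' * B) mod B" by simp
    then show "mark G X K = mark G X K'" using small by simp
    with eq have "mark G Y K * B = mark G Y K' * B" by simp
    moreover have "B > 0" by (simp add: B_def)
    ultimately show "mark G Y K = mark G Y K'" by simp
  qed
  show ?case
  proof (rule exI[of _ W], intro conjI W allI impI ballI)
    fix K K' L' assume eq: "mark G W K = mark G W K'" and "L' \<in> insert L A"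
    then consider "L' = L" | "L' \<in> A" by blast
    then show "\<exists>Y y. adm_gset Y \<and> y \<in> pts Y \<and> stab Y y = L' \<and>
      (\<forall>z\<in>pts Y. \<exists>g\<in>carrier G. stab Y z = conjugate_set G g L') \<and> mark G Y K = mark G Y K'"
    proof cases
      case 1
      then show ?thesis using Y sep[OF eq] by blast
    next
      case 2
      then show ?thesis using X(2)[of K K'] sep[OF eq] by blast
    qed
  qed
qed

text \<open>L fixes the base point of G/L, so the common mark is positive; hence K fixes some point,
  whose stabilizer is a conjugate of L.\<close>

lemma subconjugate_mark:
  assumes Y: "finite_gset G Y" and y: "y \<in> pts Y" "stab Y y = L"
    and cj: "\<forall>z\<in>pts Y. \<exists>g\<in>carrier G. stab Y z = conjugate_set G g L"
    and eq: "mark G Y L = mark G Y K" and K: "K \<subseteq> carrier G" and L: "L \<subseteq> carrier G"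
  shows "\<exists>g\<in>carrier G. K \<subseteq> conjugate_set G g L"
proof -
  have "y \<in> fixpts G Y L" using y by (simp add: fixpts_def)
  then have "mark G Y L > 0"
    unfolding mark_def using gs_finite[OF Y] by (auto simp: card_gt_0_iff fixpts_def)
  then have "fixpts G Y K \<noteq> {}" using eq by (auto simp: mark_def)
  then obtain z where z: "z \<in> pts Y" "K \<subseteq> stab Y z" by (auto simp: fixpts_def)
  then obtain g where "g \<in> carrier G" "stab Y z = conjugate_set G g L" using cj by blast
  then show ?thesis using z(2) by auto
qed

text \<open>Equal marks on X imply equal marks on both G/K and G/L, so each of K and L is
  subconjugate to the other. Comparing orders turns the inclusion of one in a conjugate of the other
  into an equality.\<close>

lemma obtain_separating_gset:
  obtains X where "adm_gset X" "\<And>K L. \<lbrakk>K \<in> Sub_O G \<O>; L \<in> Sub_O G \<O>; mark G X K = mark G X L\<rbrakk>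
    \<Longrightarrow> \<exists>g\<in>carrier G. conjugate_set G g K = L"
proof -
  have "finite (Sub_O G \<O>)"
    by (rule finite_subset[of _ "Pow (carrier G)"]) (use fin Sub_O_subset in auto)
  then obtain X where X: "adm_gset X" "\<And>K K'. mark G X K = mark G X K' \<Longrightarrow>
    (\<forall>L\<in>Sub_O G \<O>. \<exists>Y y. adm_gset Y \<and> y \<in> pts Y \<and> stab Y y = L \<and>
      (\<forall>z\<in>pts Y. \<exists>g\<in>carrier G. stab Y z = conjugate_set G g L) \<and> mark G Y K = mark G Y K')"
    using obtain_separating[of "Sub_O G \<O>"] by auto
  show ?thesis
  proof (rule that[OF X(1)])
    fix K L assume KL: "K \<in> Sub_O G \<O>" "L \<in> Sub_O G \<O>" and eq: "mark G X K = mark G X L"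
    note KLc = Sub_O_subset[OF KL(1)] Sub_O_subset[OF KL(2)]
    have "\<exists>g\<in>carrier G. L \<subseteq> conjugate_set G g K"
    proof -
      obtain Y y where Y: "adm_gset Y" "y \<in> pts Y" "stab Y y = K"
        "\<forall>z\<in>pts Y. \<exists>g\<in>carrier G. stab Y z = conjugate_set G g K" "mark G Y K = mark G Y L"
        using bspec[OF X(2)[OF eq] KL(1)] by auto
      from subconjugate_mark[OF adm_gset_finite[OF Y(1)] Y(2-5) KLc(2,1)] show ?thesis .
    qed
    then obtain g where g: "g \<in> carrier G" "L \<subseteq> conjugate_set G g K" by blast
    have "\<exists>h\<in>carrier G. K \<subseteq> conjugate_set G h L"
    proof -
      obtain Y y where Y: "adm_gset Y" "y \<in> pts Y" "stab Y y = L"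
        "\<forall>z\<in>pts Y. \<exists>g\<in>carrier G. stab Y z = conjugate_set G g L" "mark G Y L = mark G Y K"
        using bspec[OF X(2)[OF eq[symmetric]] KL(2)] by auto
      from subconjugate_mark[OF adm_gset_finite[OF Y(1)] Y(2-5) KLc] show ?thesis .
    qed
    then obtain h where h: "h \<in> carrier G" "K \<subseteq> conjugate_set G h L" by blast
    have finK: "finite (conjugate_set G g K)" "finite (conjugate_set G h L)"
      using finite_subset[OF conj_closed[OF g(1) KLc(1)] fin] finite_subset[OF conj_closed[OF h(1) KLc(2)] fin] .
    have "card K \<le> card L"
      using card_mono[OF finK(2) h(2)] card_conj[OF h(1) KLc(2)] by simp
    then have "L = conjugate_set G g K"
      using card_conj[OF g(1) KLc(1)] by (intro card_seteq[OF finK(1) g(2)]) simp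
    then show "\<exists>g\<in>carrier G. conjugate_set G g K = L" using g(1) by blast
  qed
qed

end

section \<open>Induction and restriction along \<open>T \<times> Y \<rightarrow> T\<close>\<close>

text \<open>The product of \<open>l\<close> with the identity of the second factor.\<close>

definition tmap :: "(nat \<Rightarrow> nat) \<Rightarrow> nat \<Rightarrow> nat" where
  "tmap l z = pr (l (pr1 z)) (pr2 z)"

lemma tmap_simps [simp]: "pr1 (tmap l z) = l (pr1 z)" "pr2 (tmap l z) = pr2 z"
  by (simp_all add: tmap_def)

context transfer
begin

lemma equivariant_tmap: "equivariant G A S l \<Longrightarrow> equivariant G (ten A Y) (ten S Y) (tmap l)"
  by (auto simp: equivariant_def tmap_def)

text \<open>The stabilizer of (a,y) is Stab a cut down to the stabilizer of (r a, y), so the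
  restriction axiom applies to the arrow from Stab a to Stab (r a).\<close>

lemma admissible_tmap:
  assumes A: "finite_gset G A" and T: "finite_gset G T" and Y: "finite_gset G Y" and r: "admissible A T r"
  shows "admissible (ten A Y) (ten T Y) (tmap r)"
  unfolding admissible_def
proof (intro conjI ballI)
  fix z assume z: "z \<in> pts (ten A Y)"
  then have z': "pr1 z \<in> pts A" "pr2 z \<in> pts Y" by simp_all
  have rz: "r (pr1 z) \<in> pts T" by (rule equivariant_pts[OF adm_equivariant[OF r] z'(1)])
  let ?L = "stab T (r (pr1 z)) \<inter> stab Y (pr2 z)"
  have "(stab A (pr1 z) \<inter> ?L, ?L) \<in> \<O>"
    using subgroups_Inter_pair[OF subgroup_stab[OF T rz] subgroup_stab[OF Y z'(2)]]
    by (intro O_restrict[OF adm_O[OF r z'(1)]]) auto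
  moreover have "stab A (pr1 z) \<inter> ?L = stab (ten A Y) z"
    using stab_mono[OF adm_equivariant[OF r] z'(1)] by (auto simp only: stab_ten[OF z])
  moreover have "tmap r z \<in> pts (ten T Y)" using rz z' by simp
  ultimately show "(stab (ten A Y) z, stab (ten T Y) (tmap r z)) \<in> \<O>"
    by (simp add: stab_ten del: ten_simps)
qed (rule equivariant_tmap[OF adm_equivariant[OF r]])

lemma span_data_ten:
  assumes "span_data S T A l r" "finite_gset G T" "finite_gset G Y"
  shows "span_data (ten S Y) (ten T Y) (ten A Y) (tmap l) (tmap r)"
  using finite_gset_ten[OF sd_gset[OF assms(1)] assms(3)] equivariant_tmap[OF sd_l[OF assms(1)]]
    admissible_tmap[OF sd_gset[OF assms(1)] assms(2,3) sd_adm[OF assms(1)]]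
  by (simp add: span_data_def)

text \<open>The functor - x Y on morphisms. A morphism is a class of spans, so a representative has
  to be picked; \<open>tenm_mor\<close> shows that every representative gives the same
  result.\<close>

definition tenm :: "('a, nat) gset \<Rightarrow> ('a, nat) gset \<Rightarrow> ('a, nat) gset \<Rightarrow> 'a lindner_mor \<Rightarrow> 'a lindner_mor" where
  "tenm Y S T f = (SOME h. \<exists>A l r. span_data S T A l r \<and> f = mor S T A l r \<and>
    h = mor (ten S Y) (ten T Y) (ten A Y) (tmap l) (tmap r))"

lemma isomorphic_spans_ten:
  assumes "isomorphic_spans A l r B l' r' \<theta>"
  shows "isomorphic_spans (ten A Y) (tmap l) (tmap r) (ten B Y) (tmap l') (tmap r') (tmap \<theta>)"
proof -
  note D = isomorphic_spansD[OF assms]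
  have "bij_betw (tmap \<theta>) (pts (ten A Y)) (pts (ten B Y))"
    unfolding bij_betw_def
  proof (intro conjI inj_onI)
    fix z w assume "z \<in> pts (ten A Y)" "w \<in> pts (ten A Y)" "tmap \<theta> z = tmap \<theta> w"
    then show "z = w"
      using inj_onD[OF bij_betw_imp_inj_on[OF D(2)], of "pr1 z" "pr1 w"]
      by (auto simp: tmap_def intro: pr_eqI)
  next
    show "tmap \<theta> ` pts (ten A Y) = pts (ten B Y)"
    proof
      show "pts (ten B Y) \<subseteq> tmap \<theta> ` pts (ten A Y)"
      proof
        fix z assume z: "z \<in> pts (ten B Y)"
        then obtain x where x: "x \<in> pts A" "pr1 z = \<theta> x"
          using bij_betw_imp_surj_on[OF D(2)] by auto
        then have "z = tmap \<theta> (pr x (pr2 z))" by (simp add: tmap_def flip: x(2))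
        moreover have "pr x (pr2 z) \<in> pts (ten A Y)" using x z by simp
        ultimately show "z \<in> tmap \<theta> ` pts (ten A Y)" by blast
      qed
    qed (use D(3) in auto)
  qed
  then show ?thesis
    using D equivariant_tmap[OF D(1)] by (auto simp: isomorphic_spans_def tmap_def)
qed

lemma tenm_mor:
  assumes sd: "span_data S T A l r" and T: "finite_gset G T" and Y: "finite_gset G Y"
  shows "tenm Y S T (mor S T A l r) = mor (ten S Y) (ten T Y) (ten A Y) (tmap l) (tmap r)"
proof -
  have "h = mor (ten S Y) (ten T Y) (ten A Y) (tmap l) (tmap r)"
    if hyp: "\<exists>B l' r'. span_data S T B l' r' \<and> mor S T A l r = mor S T B l' r' \<and>
      h = mor (ten S Y) (ten T Y) (ten B Y) (tmap l') (tmap r')" for h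
  proof -
    obtain B l' r' where B: "span_data S T B l' r'" "mor S T A l r = mor S T B l' r'"
      "h = mor (ten S Y) (ten T Y) (ten B Y) (tmap l') (tmap r')" using hyp by blast
    obtain \<theta> where "isomorphic_spans A l r B l' r' \<theta>" using mor_eqD[OF sd B(1,2)] .
    from mor_eqI[OF span_data_ten[OF sd T Y] isomorphic_spans_ten[OF this]] show ?thesis
      using B(3) by simp
  qed
  moreover have "\<exists>h B l' r'. span_data S T B l' r' \<and> mor S T A l r = mor S T B l' r' \<and>
      h = mor (ten S Y) (ten T Y) (ten B Y) (tmap l') (tmap r')" using sd by blast
  ultimately show ?thesis
    unfolding tenm_def by (rule someI2_ex[rotated])
qed

lemma pullback_ten:
  assumes P: "pullback A r B l P p q" and Y: "finite_gset G Y"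
  shows "pullback (ten A Y) (tmap r) (ten B Y) (tmap l) (ten P Y) (tmap p) (tmap q)"
proof (rule pullbackI)
  note D = pullbackD[OF P]
  show "finite_gset G (ten P Y)" by (rule finite_gset_ten[OF D(1) Y])
  show "equivariant G (ten P Y) (ten A Y) (tmap p)" "equivariant G (ten P Y) (ten B Y) (tmap q)"
    by (rule equivariant_tmap[OF D(2)], rule equivariant_tmap[OF D(3)])
  show "tmap r (tmap p z) = tmap l (tmap q z)" if "z \<in> pts (ten P Y)" for z
    using D(4)[of "pr1 z"] that by (simp add: tmap_def)
  show "z = w" if "z \<in> pts (ten P Y)" "w \<in> pts (ten P Y)" "tmap p z = tmap p w" "tmap q z = tmap q w" for z w
    using D(5)[of "pr1 z" "pr1 w"] that by (auto simp: tmap_def intro: pr_eqI)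
  show "\<exists>z\<in>pts (ten P Y). tmap p z = x \<and> tmap q z = y"
    if xy: "x \<in> pts (ten A Y)" "y \<in> pts (ten B Y)" "tmap r x = tmap l y" for x y
  proof -
    have eq: "r (pr1 x) = l (pr1 y)" "pr2 x = pr2 y" using xy(3) by (simp_all add: tmap_def)
    then obtain z where z: "z \<in> pts P" "p z = pr1 x" "q z = pr1 y" using D(6)[of "pr1 x" "pr1 y"] xy by auto
    have "tmap p (pr z (pr2 x)) = x" by (rule pr_eqI) (use z in simp_all)
    moreover have "tmap q (pr z (pr2 x)) = y" by (rule pr_eqI) (use z eq in simp_all)
    ultimately show ?thesis using z(1) xy(1) by (intro bexI[of _ "pr z (pr2 x)"]) auto
  qed
qed

definition ten_functor ::
  "('a, nat) gset \<Rightarrow> ('a lindner_obj, 'a lindner_mor, 'a lindner_obj, 'a lindner_mor) cfunctor" where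
  "ten_functor Y = \<lparr>FObj = (\<lambda>T. ten T Y), FMap = tenm Y\<rparr>"

lemma ten_functor_simps [simp]: "FObj (ten_functor Y) T = ten T Y" "FMap (ten_functor Y) = tenm Y"
  by (simp_all add: ten_functor_def)

lemma ten_Obj:
  assumes Y: "finite_gset G Y" and sub: "\<And>y. y \<in> pts Y \<Longrightarrow> subconjugate G (stab Y y) H" and T: "finite_gset G T"
  shows "ten T Y \<in> Obj (lindner_sub G \<O> H)"
  by (rule Obj_equivariant[OF finite_gset_ten[OF T Y] equivariant_ten(2)]) (use Y sub in simp)

text \<open>Multiplying with Y preserves pullbacks, hence composition. The values lie in the
  subcategory of H for every T because the stabilizer of (t,y) is contained in that of y.\<close>

lemma is_functor_ten:
  assumes Y: "finite_gset G Y" and sub: "\<And>y. y \<in> pts Y \<Longrightarrow> subconjugate G (stab Y y) H"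
  shows "is_functor (lindner G \<O>) (lindner_sub G \<O> H) (ten_functor Y)"
  unfolding is_functor_def ten_functor_simps
proof (intro conjI ballI)
  show "ten X Y \<in> Obj (lindner_sub G \<O> H)" if "X \<in> Obj (lindner G \<O>)" for X
    using ten_Obj[OF Y sub] that by simp
next
  fix S T f assume "S \<in> Obj (lindner G \<O>)" "T \<in> Obj (lindner G \<O>)" and f: "f \<in> Hom (lindner G \<O>) S T"
  then have T: "finite_gset G T" by simp
  obtain A l r where A: "span_data S T A l r" and f: "f = mor S T A l r" by (rule Hom_mor[OF f])
  show "tenm Y S T f \<in> Hom (lindner_sub G \<O> H) (ten S Y) (ten T Y)"
    unfolding f tenm_mor[OF A T Y] using mor_in_Hom[OF span_data_ten[OF A T Y]] by simp
next
  fix T assume "T \<in> Obj (lindner G \<O>)"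
  then have T: "finite_gset G T" by simp
  have "mor (ten T Y) (ten T Y) (ten T Y) (tmap (\<lambda>x. x)) (tmap (\<lambda>x. x)) =
    mor (ten T Y) (ten T Y) (ten T Y) (\<lambda>x. x) (\<lambda>x. x)"
    by (rule mor_cong) (simp_all add: tmap_def)
  then show "tenm Y T T (Ident (lindner G \<O>) T) = Ident (lindner_sub G \<O> H) (ten T Y)"
    by (simp add: Ident_mor[OF T] tenm_mor[OF span_data_id[OF T] T Y] Ident_mor[OF finite_gset_ten[OF T Y]])
next
  fix S T R f g
  assume "S \<in> Obj (lindner G \<O>)" "T \<in> Obj (lindner G \<O>)" "R \<in> Obj (lindner G \<O>)"
    and f: "f \<in> Hom (lindner G \<O>) S T" and g: "g \<in> Hom (lindner G \<O>) T R"
  then have T: "finite_gset G T" and R: "finite_gset G R" by simp_all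
  obtain A l r where A: "span_data S T A l r" and f: "f = mor S T A l r" by (rule Hom_mor[OF f])
  obtain B l' r' where B: "span_data T R B l' r'" and g: "g = mor T R B l' r'" by (rule Hom_mor[OF g])
  note P = Comp_mor_pbk[OF A B]
  have "mor (ten S Y) (ten R Y) (ten (pbk A B r l') Y) (tmap (\<lambda>z. l (pr1 z))) (tmap (\<lambda>z. r' (pr2 z))) =
     mor (ten S Y) (ten R Y) (ten (pbk A B r l') Y) (\<lambda>z. tmap l (tmap pr1 z)) (\<lambda>z. tmap r' (tmap pr2 z))"
    by (rule mor_cong) (simp_all add: tmap_def)
  then show "tenm Y S R (Comp (lindner G \<O>) S T R g f) =
      Comp (lindner_sub G \<O> H) (ten S Y) (ten T Y) (ten R Y) (tenm Y T R g) (tenm Y S T f)"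
    using Comp_mor[OF span_data_ten[OF A T Y] span_data_ten[OF B R Y] pullback_ten[OF P(3) Y]]
    by (simp add: f g P(1) tenm_mor[OF A T Y] tenm_mor[OF B R Y] tenm_mor[OF P(2) R Y])
qed

text \<open>Products distribute over disjoint unions; this is why precomposing with - x Y keeps a
  functor product preserving.\<close>

lemma coprod_ten:
  assumes c: "coprod_gset G A B D i j" and Y: "finite_gset G Y"
  shows "coprod_gset G (ten A Y) (ten B Y) (ten D Y) (tmap i) (tmap j)"
proof -
  note cD = coprodD[OF c]
  have "pts (ten D Y) = tmap i ` pts (ten A Y) \<union> tmap j ` pts (ten B Y)"
  proof
    show "tmap i ` pts (ten A Y) \<union> tmap j ` pts (ten B Y) \<subseteq> pts (ten D Y)"
      using equivariant_pts[OF cD(4)] equivariant_pts[OF cD(5)] by auto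
    show "pts (ten D Y) \<subseteq> tmap i ` pts (ten A Y) \<union> tmap j ` pts (ten B Y)"
    proof
      fix z assume z: "z \<in> pts (ten D Y)"
      then consider x where "x \<in> pts A" "pr1 z = i x" | x where "x \<in> pts B" "pr1 z = j x"
        using cD(8) by auto
      then show "z \<in> tmap i ` pts (ten A Y) \<union> tmap j ` pts (ten B Y)"
      proof cases
        case 1
        then have "z = tmap i (pr x (pr2 z))" by (simp add: tmap_def flip: 1(2))
        then show ?thesis using 1 z by (intro UnI1 image_eqI[where x = "pr x (pr2 z)"]) auto
      next
        case 2
        then have "z = tmap j (pr x (pr2 z))" by (simp add: tmap_def flip: 2(2))
        then show ?thesis using 2 z by (intro UnI2 image_eqI[where x = "pr x (pr2 z)"]) auto
      qed
    qed
  qed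
  moreover have "tmap i ` pts (ten A Y) \<inter> tmap j ` pts (ten B Y) = {}"
  proof -
    have "i x \<noteq> j y" if "x \<in> pts A" "y \<in> pts B" for x y using cD(9) that by blast
    then show ?thesis by (auto simp: tmap_def)
  qed
  moreover have "inj_on (tmap i) (pts (ten A Y))" "inj_on (tmap j) (pts (ten B Y))"
    using cD(6,7) by (auto simp: tmap_def inj_on_def intro: pr_eqI)
  ultimately show ?thesis
    using finite_gset_ten[OF _ Y] cD(1-3) equivariant_tmap[OF cD(4)] equivariant_tmap[OF cD(5)]
    by (simp add: coprod_gset_def)
qed

lemma tenm_res:
  assumes "finite_gset G S" "equivariant G S T f" "finite_gset G Y"
  shows "tenm Y T S (resm T S f) = resm (ten T Y) (ten S Y) (tmap f)"
  unfolding resm_def tenm_mor[OF span_data_res[OF assms(1,2)] assms(1,3)]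
  by (rule mor_cong) (simp_all add: tmap_def)

text \<open>The stabilizer of (t,z) arises by restricting the arrow Stab z -> G to Stab t.\<close>

lemma admissible_pr1:
  assumes Z: "adm_gset Z" and T: "finite_gset G T"
  shows "admissible (ten T Z) T pr1"
  unfolding admissible_def
proof (intro conjI ballI)
  fix z assume z: "z \<in> pts (ten T Z)"
  then have z': "pr1 z \<in> pts T" "pr2 z \<in> pts Z" by simp_all
  have "(stab Z (pr2 z) \<inter> stab T (pr1 z), stab T (pr1 z)) \<in> \<O>"
    using Z z' subgroup_stab[OF T z'(1)] by (intro O_restrict[of _ "carrier G"]) (auto simp: adm_gset_def stab_iff)
  then show "(stab (ten T Z) z, stab T (pr1 z)) \<in> \<O>"
    by (simp add: stab_ten[OF z] Int_commute)
qed (rule equivariant_ten(1))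

section \<open>Natural maps attached to the projection T x Z -> T\<close>

definition aop :: "('a, nat) gset \<Rightarrow> ('a, nat) gset \<Rightarrow> 'a lindner_mor" where
  "aop Z T = mor T T (ten T Z) pr1 pr1"

definition resY :: "('a, nat) gset \<Rightarrow> ('a, nat) gset \<Rightarrow> 'a lindner_mor" where
  "resY Y T = resm T (ten T Y) pr1"

definition trY :: "('a, nat) gset \<Rightarrow> ('a, nat) gset \<Rightarrow> 'a lindner_mor" where
  "trY Y T = trm (ten T Y) T pr1"

lemma span_data_aop:
  assumes "adm_gset Z" "finite_gset G T"
  shows "span_data T T (ten T Z) pr1 pr1"
  using admissible_pr1[OF assms] finite_gset_ten[OF assms(2) adm_gset_finite[OF assms(1)]] equivariant_ten(1)
  by (simp add: span_data_def)

lemma aop_Hom: "\<lbrakk>adm_gset Z; finite_gset G T\<rbrakk> \<Longrightarrow> aop Z T \<in> Hom (lindner G \<O>) T T"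
  unfolding aop_def by (intro mor_in_Hom span_data_aop)

lemma resY_Hom: "\<lbrakk>finite_gset G Y; finite_gset G T\<rbrakk> \<Longrightarrow> resY Y T \<in> Hom (lindner G \<O>) T (ten T Y)"
  unfolding resY_def by (intro resm_Hom finite_gset_ten equivariant_ten(1))

lemma trY_Hom: "\<lbrakk>adm_gset Y; finite_gset G T\<rbrakk> \<Longrightarrow> trY Y T \<in> Hom (lindner G \<O>) (ten T Y) T"
  unfolding trY_def by (intro trm_Hom[OF finite_gset_ten[OF _ adm_gset_finite]] admissible_pr1)

lemma aop_tr_res:
  assumes "adm_gset Z" "finite_gset G T"
  shows "aop Z T = Comp (lindner G \<O>) T (ten T Z) T (trY Z T) (resY Z T)"
  unfolding aop_def trY_def resY_def by (rule mor_tr_res[OF span_data_aop[OF assms]])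

text \<open>Both composites have apex A x Y: on the left one pulls back along an identity, on the
  right A x Y is the pullback of A with T x Y over T.\<close>

lemma resY_natural:
  assumes S: "finite_gset G S" and T: "finite_gset G T" and Y: "finite_gset G Y" and f: "f \<in> Hom (lindner G \<O>) S T"
  shows "Comp (lindner G \<O>) S (ten S Y) (ten T Y) (tenm Y S T f) (resY Y S) =
    Comp (lindner G \<O>) S T (ten T Y) (resY Y T) f"
proof -
  obtain A l r where A: "span_data S T A l r" and f: "f = mor S T A l r" by (rule Hom_mor[OF f])
  note AY = finite_gset_ten[OF sd_gset[OF A] Y]
  note sS = span_data_res[OF finite_gset_ten[OF S Y] equivariant_ten(1)]
    and sT = span_data_res[OF finite_gset_ten[OF T Y] equivariant_ten(1)]
  have "pullback (ten S Y) (\<lambda>x. x) (ten A Y) (tmap l) (ten A Y) (tmap l) (\<lambda>x. x)"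
    by (rule pullbackI) (use AY equivariant_tmap[OF sd_l[OF A]] in \<open>auto simp: equivariant_id simp del: ten_simps\<close>)
  moreover have "pullback A r (ten T Y) pr1 (ten A Y) pr1 (tmap r)"
  proof (rule pullbackI)
    show "\<exists>z\<in>pts (ten A Y). pr1 z = x \<and> tmap r z = y" if "x \<in> pts A" "y \<in> pts (ten T Y)" "r x = pr1 y" for x y
      using that by (intro bexI[of _ "pr x (pr2 y)"]) (auto simp: tmap_def)
    show "z = w" if "pr1 z = pr1 w" "tmap r z = tmap r w" for z w
      using that by (auto simp: tmap_def intro: pr_eqI)
  qed (use AY equivariant_ten(1) equivariant_tmap[OF sd_r[OF A]] in \<open>auto simp: tmap_def\<close>)
  ultimately show ?thesis
    using Comp_mor[OF sS span_data_ten[OF A T Y]] Comp_mor[OF A sT]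
    by (simp add: f resY_def resm_def tenm_mor[OF A T Y])
qed

text \<open>The apex is A x Y on both sides, this time as the pullback of S x Y with A over S.
  Restriction and transfer are thus transformations between the identity and - x Y in both
  directions.\<close>

lemma trY_natural:
  assumes S: "finite_gset G S" and T: "finite_gset G T" and Y: "adm_gset Y" and f: "f \<in> Hom (lindner G \<O>) S T"
  shows "Comp (lindner G \<O>) (ten S Y) (ten T Y) T (trY Y T) (tenm Y S T f) =
    Comp (lindner G \<O>) (ten S Y) S T f (trY Y S)"
proof -
  obtain A l r where A: "span_data S T A l r" and f: "f = mor S T A l r" by (rule Hom_mor[OF f])
  note Yf = adm_gset_finite[OF Y]
  note AY = finite_gset_ten[OF sd_gset[OF A] Yf]
  note sS = span_data_tr[OF finite_gset_ten[OF S Yf] admissible_pr1[OF Y S]]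
    and sT = span_data_tr[OF finite_gset_ten[OF T Yf] admissible_pr1[OF Y T]]
  have "pullback (ten A Y) (tmap r) (ten T Y) (\<lambda>x. x) (ten A Y) (\<lambda>x. x) (tmap r)"
    by (rule pullbackI) (use AY equivariant_tmap[OF sd_r[OF A]] in \<open>auto simp: equivariant_id simp del: ten_simps\<close>)
  moreover have "pullback (ten S Y) pr1 A l (ten A Y) (tmap l) pr1"
  proof (rule pullbackI)
    show "\<exists>z\<in>pts (ten A Y). tmap l z = x \<and> pr1 z = y" if "x \<in> pts (ten S Y)" "y \<in> pts A" "pr1 x = l y" for x y
    proof -
      have "tmap l (pr y (pr2 x)) = x" by (rule pr_eqI) (use that in simp_all)
      then show ?thesis using that by (intro bexI[of _ "pr y (pr2 x)"]) auto
    qed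
    show "z = w" if "tmap l z = tmap l w" "pr1 z = pr1 w" for z w
      using that by (auto simp: tmap_def intro: pr_eqI)
  qed (use AY equivariant_ten(1) equivariant_tmap[OF sd_l[OF A]] in \<open>auto simp: tmap_def\<close>)
  ultimately show ?thesis
    using Comp_mor[OF span_data_ten[OF A T Yf] sT] Comp_mor[OF sS A]
    by (simp add: f trY_def trm_def tenm_mor[OF A T Yf])
qed

lemma aop_natural:
  assumes S: "finite_gset G S" and T: "finite_gset G T" and Z: "adm_gset Z" and f: "f \<in> Hom (lindner G \<O>) S T"
  shows "Comp (lindner G \<O>) S T T (aop Z T) f = Comp (lindner G \<O>) S S T f (aop Z S)"
proof -
  interpret L: category "lindner G \<O>" by (rule category_lindner)
  note Zf = adm_gset_finite[OF Z]
  \<comment> \<open>The instance of \<open>is_functor_ten\<close> for the whole group, where the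
    condition on stabilizers always holds.\<close>
  have tf: "tenm Z S T f \<in> Hom (lindner G \<O>) (ten S Z) (ten T Z)"
    using is_functor_map[OF is_functor_ten[OF Zf, of "carrier G"], of S T f] S T f
    unfolding lindner_sub_carrier[symmetric]
    by (simp add: subconjugate_def conjugate_set_eq) (metis (no_types, lifting) image_subsetI inv_closed m_closed one_closed stab_iff)
  note o = S T finite_gset_ten[OF S Zf] finite_gset_ten[OF T Zf]
  note h = resY_Hom[OF Zf S] resY_Hom[OF Zf T] trY_Hom[OF Z S] trY_Hom[OF Z T] f tf
  have "Comp (lindner G \<O>) S T T (aop Z T) f =
      Comp (lindner G \<O>) S (ten T Z) T (trY Z T) (Comp (lindner G \<O>) S T (ten T Z) (resY Z T) f)"
    unfolding aop_tr_res[OF Z T] by (rule L.Comp_assoc[symmetric]) (use o h in auto)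
  also have "\<dots> = Comp (lindner G \<O>) S (ten T Z) T (trY Z T)
      (Comp (lindner G \<O>) S (ten S Z) (ten T Z) (tenm Z S T f) (resY Z S))"
    by (simp add: resY_natural[OF S T Zf f])
  also have "\<dots> = Comp (lindner G \<O>) S (ten S Z) T
      (Comp (lindner G \<O>) (ten S Z) (ten T Z) T (trY Z T) (tenm Z S T f)) (resY Z S)"
    by (rule L.Comp_assoc) (use o h in auto)
  also have "\<dots> = Comp (lindner G \<O>) S (ten S Z) T
      (Comp (lindner G \<O>) (ten S Z) S T f (trY Z S)) (resY Z S)"
    by (simp add: trY_natural[OF S T Z f])
  also have "\<dots> = Comp (lindner G \<O>) S S T f (aop Z S)"
    unfolding aop_tr_res[OF Z S] by (rule L.Comp_assoc[symmetric]) (use o h in auto)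
  finally show ?thesis .
qed

text \<open>Exchanging the last two coordinates identifies (T x Z) x Y with (T x Y) x Z over T x Y.
  Later it lets the action on an extended functor at T be read off at T x Y.\<close>

lemma tenm_aop:
  assumes T: "finite_gset G T" and Z: "adm_gset Z" and Y: "finite_gset G Y"
  shows "tenm Y T T (aop Z T) = aop Z (ten T Y)"
proof -
  note Zf = adm_gset_finite[OF Z]
  define s where "s z = pr (pr (pr1 (pr1 z)) (pr2 z)) (pr2 (pr1 z))" for z
  have ss: "s (s z) = z" for z by (simp add: s_def)
  have bij: "bij_betw s (pts (ten (ten T Z) Y)) (pts (ten (ten T Y) Z))"
    by (rule bij_betw_byWitness[where f' = s]) (auto simp: ss, auto simp: s_def)
  have "isomorphic_spans (ten (ten T Z) Y) (tmap pr1) (tmap pr1) (ten (ten T Y) Z) pr1 pr1 s"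
    unfolding isomorphic_spans_def using bij by (auto simp: equivariant_def s_def tmap_def)
  from mor_eqI[OF span_data_ten[OF span_data_aop[OF Z T] T Y] this] show ?thesis
    unfolding aop_def tenm_mor[OF span_data_aop[OF Z T] T Y] .
qed

end

section \<open>The action of admissible \<open>G\<close>-sets on a Mackey functor\<close>

context transfer
begin

definition Cls :: "('a, nat) gset \<Rightarrow> 'a set set set" where
  "Cls T = {cl J | J t. subgroup J G \<and> t \<in> pts T \<and> J \<subseteq> stab T t}"

lemma Cls_subset: "Cls T \<subseteq> iclasses"
  by (auto simp: Cls_def cl_in_classes)

lemma finite_Cls: "finite (Cls T)"
  using finite_subset[OF Cls_subset finite_classes] .

lemma Cls_equivariant: "equivariant G A T f \<Longrightarrow> Cls A \<subseteq> Cls T"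
proof
  fix c assume f: "equivariant G A T f" and "c \<in> Cls A"
  then obtain J x where "subgroup J G" "x \<in> pts A" "J \<subseteq> stab A x" "c = cl J" by (auto simp: Cls_def)
  with stab_mono[OF f, of x] equivariant_pts[OF f, of x] show "c \<in> Cls T"
    unfolding Cls_def by blast
qed

lemma cl_stab_Cls: "\<lbrakk>finite_gset G T; t \<in> pts T\<rbrakk> \<Longrightarrow> cl (stab T t) \<in> Cls T"
  unfolding Cls_def using subgroup_stab[of T t] by auto

lemma cl_conj:
  assumes K: "subgroup K G" and g: "g \<in> carrier G"
  shows "cl (conjugate_set G g K) = cl K"
proof -
  have "(K, conjugate_set G g K) \<in> inseparable G \<O>"
    using H_O_conj[OF subgroup.subset[OF K] g] K g subgroup_conj[OF g K] by (auto simp: inseparable_iff)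
  then show ?thesis using cl_eq_iff[OF K subgroup_conj[OF g K]] by simp
qed

end

section \<open>The action on an orbit: mark plus correction term\<close>

context mackey
begin

lemma aop_nat: "adm_gset Z \<Longrightarrow> nat_trans C rat_vect M M (\<lambda>T. FMap M T T (aop Z T))"
proof (rule nat_rat_vectI)
  assume Z: "adm_gset Z"
  show lm: "FMap M X X (aop Z X) \<in> linear_maps (V X) (V X)" if "X \<in> Obj C" for X
    using that aop_Hom[OF Z] by (intro map_lm) simp_all
  fix S T f x assume S: "S \<in> Obj C" and T: "T \<in> Obj C" and f: "f \<in> Hom C S T" and x: "x \<in> carrier (V S)"
  have f': "f \<in> Hom (lindner G \<O>) S T" using f by simp
  show "FMap M T T (aop Z T) (FMap M S T f x) = FMap M S T f (FMap M S S (aop Z S) x)"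
    using map_Comp[OF S T T f' aop_Hom[OF Z Obj_gset[OF T]] x] map_Comp[OF S S T aop_Hom[OF Z Obj_gset[OF S]] f' x]
      aop_natural[OF Obj_gset[OF S] Obj_gset[OF T] Z f'] by simp
qed

text \<open>T x Z is cut into the part W where the projection to T keeps stabilizers, which acts by
  a scalar through \<open>map_covering\<close>, and the rest R. On R stabilizers shrink, and by
  \<open>cl_neq\<close> no subgroup of them has the class of Stab t.\<close>

lemma map_aop_orbit:
  assumes T: "T \<in> Obj C" and tr: "transitive_gset G T" and t: "t \<in> pts T" and Z: "adm_gset Z"
  obtains R where "R \<in> Obj C" "resm T R pr1 \<in> Hom (lindner G \<O>) T R" "trm R T pr1 \<in> Hom (lindner G \<O>) R T"
    "\<And>x. x \<in> carrier (V T) \<Longrightarrow> FMap M T T (aop Z T) x = of_nat (mark G Z (stab T t)) \<odot>\<^bsub>V T\<^esub> x \<oplus>\<^bsub>V T\<^esub>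
      FMap M R T (trm R T pr1) (FMap M T R (resm T R pr1) x)"
    "\<And>z. z \<in> pts R \<Longrightarrow> card (stab R z) < card (stab T t)"
    "Cls R \<subseteq> Cls T - {cl (stab T t)}"
proof -
  have Tf: "finite_gset G T" and Zf: "finite_gset G Z" using T adm_gset_finite[OF Z] by auto
  let ?U = "ten T Z"
  note Uf = finite_gset_ten[OF Tf Zf]
  \<comment> \<open>The points (s,z) with z fixed by Stab s. Conjugating the inclusion of
    stabilizers shows that the set is invariant.\<close>
  define W where "W = {z \<in> pts ?U. stab T (pr1 z) \<subseteq> stab Z (pr2 z)}"
  have Wi: "invariant_subset G ?U W"
    unfolding invariant_subset_def
  proof (intro conjI ballI)
    fix g z assume g: "g \<in> carrier G" and z: "z \<in> W"
    then show "act ?U g z \<in> W"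
      using conj_mono[of "stab T (pr1 z)" "stab Z (pr2 z)" g] stab_act[OF Tf g, of "pr1 z"] stab_act[OF Zf g, of "pr2 z"]
      by (simp add: W_def gs_act[OF Tf] gs_act[OF Zf])
  qed (auto simp: W_def)
  note Ri = invariant_Diff[OF Uf Wi]
  define R where "R = subg ?U (pts ?U - W)"
  note sd = span_data_aop[OF Z Tf]
  note sdW = span_data_subg[OF sd Wi] and sdR = span_data_subg[OF sd Ri, folded R_def]
  have RO: "R \<in> Obj C" by (rule Obj_equivariant[OF sd_gset[OF sdR] sd_l[OF sdR] T])
  have R: "pr1 z \<in> pts T" "pr2 z \<in> pts Z" "\<not> stab T (pr1 z) \<subseteq> stab Z (pr2 z)"
    "stab R z = stab T (pr1 z) \<inter> stab Z (pr2 z)" if "z \<in> pts R" for z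
    using that stab_ten[of z T Z] by (auto simp: R_def W_def)
  have conj: "\<exists>g\<in>carrier G. stab T s = conjugate_set G g (stab T t)" if s: "s \<in> pts T" for s
  proof -
    obtain g where "g \<in> carrier G" "act T g t = s" using tr t s unfolding transitive_gset_def by blast
    then show ?thesis using stab_act[OF Tf _ t] by metis
  qed
  have ts: "stab T s \<subseteq> carrier G" for s by (auto simp: stab_iff)
  show ?thesis
  proof (rule that[OF RO])
    show "resm T R pr1 \<in> Hom (lindner G \<O>) T R" "trm R T pr1 \<in> Hom (lindner G \<O>) R T"
      using resm_Hom[OF sd_gset[OF sdR] sd_l[OF sdR]] trm_Hom[OF sd_gset[OF sdR] sd_adm[OF sdR]] by auto
    show "card (stab R z) < card (stab T t)" if z: "z \<in> pts R" for z
    proof -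
      obtain g where "g \<in> carrier G" "stab T (pr1 z) = conjugate_set G g (stab T t)" using conj R(1)[OF z] by blast
      then have "card (stab T (pr1 z)) = card (stab T t)" using card_conj[OF _ ts] by metis
      moreover have "stab R z \<subset> stab T (pr1 z)" using R(3,4)[OF z] by blast
      ultimately show ?thesis using psubset_card_mono[OF finite_stab] by metis
    qed
    show "Cls R \<subseteq> Cls T - {cl (stab T t)}"
    proof
      fix c assume c: "c \<in> Cls R"
      then obtain J z where J: "subgroup J G" "z \<in> pts R" "J \<subseteq> stab R z" "c = cl J" by (auto simp: Cls_def)
      note z = R[OF J(2)]
      obtain g where g: "g \<in> carrier G" "stab T (pr1 z) = conjugate_set G g (stab T t)" using conj z(1) by blast
      have "cl (stab T (pr1 z)) = cl (stab T t)"
        using cl_conj[OF subgroup_stab[OF Tf t] g(1)] g(2) by simp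
      moreover have "cl J \<noteq> cl (stab T (pr1 z))"
        using cl_neq[OF Z z(2) subgroup_stab[OF Tf z(1)] J(1)] J(3) z(3,4) by blast
      ultimately show "c \<in> Cls T - {cl (stab T t)}"
        using J(4) c Cls_equivariant[OF sd_l[OF sdR]] by auto
    qed
    fix x assume x: "x \<in> carrier (V T)"
    have "FMap M T T (mor T T (subg ?U W) pr1 pr1) x =
        of_nat (card {z \<in> pts (subg ?U W). pr1 z = t}) \<odot>\<^bsub>V T\<^esub> x"
    proof (rule map_covering[OF T tr t x sdW])
      fix z assume "z \<in> pts (subg ?U W)"
      then have "z \<in> W" by simp
      then show "stab (subg ?U W) z = stab T (pr1 z)"
        using stab_ten[of z T Z] by (auto simp: W_def)
    qed
    \<comment> \<open>The fibre of W over t consists of the pairs (t,z) with z fixed by Stab t, so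
      the number of sheets is the mark.\<close>
    moreover have "{z \<in> pts (subg ?U W). pr1 z = t} = pr t ` fixpts G Z (stab T t)"
    proof
      show "{z \<in> pts (subg ?U W). pr1 z = t} \<subseteq> pr t ` fixpts G Z (stab T t)"
      proof
        fix z assume "z \<in> {z \<in> pts (subg ?U W). pr1 z = t}"
        then have "pr2 z \<in> fixpts G Z (stab T t)" "z = pr t (pr2 z)"
          by (auto simp: W_def fixpts_def)
        then show "z \<in> pr t ` fixpts G Z (stab T t)" by blast
      qed
      show "pr t ` fixpts G Z (stab T t) \<subseteq> {z \<in> pts (subg ?U W). pr1 z = t}"
        using t by (auto simp: W_def fixpts_def)
    qed
    then have "card {z \<in> pts (subg ?U W). pr1 z = t} = mark G Z (stab T t)"
      by (simp add: mark_def card_image inj_on_def)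
    ultimately show "FMap M T T (aop Z T) x = of_nat (mark G Z (stab T t)) \<odot>\<^bsub>V T\<^esub> x \<oplus>\<^bsub>V T\<^esub>
      FMap M R T (trm R T pr1) (FMap M T R (resm T R pr1) x)"
      unfolding aop_def map_split[OF T T sd Wi x] R_def[symmetric] map_span[OF T T sdR x] by simp
  qed
qed

lemma V_pts_empty:
  assumes T: "T \<in> Obj C" and "pts T = {}" and x: "x \<in> carrier (V T)"
  shows "x = \<zero>\<^bsub>V T\<^esub>"
  using map_empty[OF T T span_data_id[OF Obj_gset[OF T]] assms(2) x] map_Ident[OF T x]
  by (simp add: Ident_mor[OF Obj_gset[OF T]])

end

section \<open>Eigenspaces of a separating \<open>G\<close>-set\<close>

locale split = transfer G \<O> for G :: "('a, 'b) monoid_scheme" (structure) and \<O> +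
  fixes rep :: "'a set set \<Rightarrow> 'a set" and X :: "('a, nat) gset"
  assumes rep: "c \<in> iclasses \<Longrightarrow> rep c \<in> c \<and> (rep c, carrier G) \<in> \<O>"
    and X: "adm_gset X"
    and sep: "\<lbrakk>K \<in> Sub_O G \<O>; L \<in> Sub_O G \<O>; mark G X K = mark G X L\<rbrakk>
      \<Longrightarrow> \<exists>g\<in>carrier G. conjugate_set G g K = L"
begin

text \<open>The eigenvalue attached to a class; by \<open>mark_cl\<close> it is the mark of X at
  every subgroup in the class.\<close>

definition lam :: "'a set set \<Rightarrow> rat" where "lam c = of_nat (mark G X (rep c))"

lemma rep_Sub: "c \<in> iclasses \<Longrightarrow> rep c \<in> Sub_O G \<O>"
  using rep O_subgroup by (auto simp: Sub_O_def)

lemma rep_subgroup: "c \<in> iclasses \<Longrightarrow> subgroup (rep c) G"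
  using rep_Sub by (simp add: Sub_O_def)

lemma cl_rep:
  assumes c: "c \<in> iclasses"
  shows "cl (rep c) = c"
proof -
  obtain K where K: "subgroup K G" "c = cl K"
    using c by (auto simp: insep_classes_def insep_class_def elim!: quotientE)
  then have "(K, rep c) \<in> inseparable G \<O>" using rep[OF c] by (simp add: in_cl)
  then show ?thesis using cl_eq_iff[OF K(1) rep_subgroup[OF c]] K(2) by simp
qed

lemma cl_eqD:
  assumes K: "subgroup K G" and c: "c \<in> iclasses" and eq: "cl K = c"
  shows "\<exists>g\<in>carrier G. conjugate_set G g (H_O G \<O> K) = rep c"
  using cl_eq_iff[OF K rep_subgroup[OF c]] cl_rep[OF c] eq H_O_self[OF rep_Sub[OF c]]
  by (auto simp: inseparable_iff)

lemma mark_cl: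
  assumes Z: "adm_gset Z" and K: "subgroup K G"
  shows "mark G Z K = mark G Z (rep (cl K))"
proof -
  note Kc = subgroup.subset[OF K]
  obtain g where "g \<in> carrier G" "conjugate_set G g (H_O G \<O> K) = rep (cl K)"
    using cl_eqD[OF K cl_in_classes[OF K] refl] by blast
  then show ?thesis
    using mark_conj[OF adm_gset_finite[OF Z] H_O_carrier[OF Kc]] mark_H_O[OF Z Kc] by metis
qed

lemma inj_lam: "inj_on lam iclasses"
proof (rule inj_onI)
  fix c d assume c: "c \<in> iclasses" and d: "d \<in> iclasses" and "lam c = lam d"
  then have "mark G X (rep c) = mark G X (rep d)" by (simp add: lam_def)
  then obtain g where g: "g \<in> carrier G" "conjugate_set G g (rep c) = rep d"
    using sep[OF rep_Sub[OF c] rep_Sub[OF d]] by blast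
  then show "c = d"
    using cl_conj[OF rep_subgroup[OF c] g(1)] cl_rep[OF c] cl_rep[OF d] by simp
qed

lemma subconjugate_rep:
  assumes K: "subgroup K G" and "c \<in> iclasses" "cl K = c"
  shows "subconjugate G K (rep c)"
proof -
  obtain g where "g \<in> carrier G" "conjugate_set G g (H_O G \<O> K) = rep c" using cl_eqD[OF assms] by blast
  then show ?thesis
    using conj_mono[OF H_O_incl[OF subgroup.subset[OF K]], of g] by (auto simp: subconjugate_def)
qed

text \<open>H_O(K) contains H_O(J), which has the order of \<open>rep c\<close>, and a conjugate of
  H_O(K) fits into \<open>rep c\<close>; so that conjugate is all of \<open>rep c\<close>.
  Consequently, in the subcategory of c, a stabilizer with a subgroup in c is itself in c.\<close>

lemma cl_between:
  assumes K: "subgroup K G" and J: "subgroup J G" "J \<subseteq> K" and c: "c \<in> iclasses" "cl J = c"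
    and sub: "subconjugate G K (rep c)"
  shows "cl K = c"
proof -
  note Kc = subgroup.subset[OF K] and Jc = subgroup.subset[OF J(1)]
  obtain g where g: "g \<in> carrier G" "conjugate_set G g (H_O G \<O> J) = rep c" using cl_eqD[OF J(1) c] by blast
  obtain h where h: "h \<in> carrier G" "conjugate_set G h K \<subseteq> rep c" using sub by (auto simp: subconjugate_def)
  have "conjugate_set G h (H_O G \<O> K) \<subseteq> rep c"
    using H_O_least[OF conj_closed[OF h(1) Kc] rep_Sub[OF c(1)] h(2)] H_O_conj[OF Kc h(1)] by simp
  moreover have "card (conjugate_set G h (H_O G \<O> K)) \<ge> card (rep c)"
    using card_mono[OF H_O_finite[OF Kc] H_O_mono[OF J(2) Kc]] card_conj[OF h(1) H_O_carrier[OF Kc]]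
      card_conj[OF g(1) H_O_carrier[OF Jc]] g(2) by simp
  moreover have "finite (rep c)" using finite_subset[OF Sub_O_subset[OF rep_Sub[OF c(1)]] fin] .
  ultimately have "conjugate_set G h (H_O G \<O> K) = rep c"
    by (intro card_seteq) auto
  then have "(K, rep c) \<in> inseparable G \<O>"
    using K rep_subgroup[OF c(1)] h(1) H_O_self[OF rep_Sub[OF c(1)]] by (auto simp: inseparable_iff)
  then show ?thesis
    using cl_eq_iff[OF K rep_subgroup[OF c(1)]] cl_rep[OF c(1)] by simp
qed

end

locale split_mackey = split G \<O> rep X + mackey G \<O> H M
  for G :: "('a, 'b) monoid_scheme" (structure) and \<O> and rep X H and M :: "('a, 'v) mackey_obj"
begin

abbreviation "A T \<equiv> FMap M T T (aop X T)"

lemma A_lm: "T \<in> Obj C \<Longrightarrow> A T \<in> linear_maps (V T) (V T)"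
  using nv_lm[OF aop_nat[OF X]] .

lemma A_map:
  assumes "S \<in> Obj C" "T \<in> Obj C" "f \<in> Hom (lindner G \<O>) S T" "x \<in> carrier (V S)"
  shows "A T (FMap M S T f x) = FMap M S T f (A S x)"
  using nv_nat[OF aop_nat[OF X] assms(1,2)] assms(3,4) by simp

lemma map_eigen:
  assumes "S \<in> Obj C" "T \<in> Obj C" "f \<in> Hom (lindner G \<O>) S T" "x \<in> eigenspace (V S) (A S) l"
  shows "FMap M S T f x \<in> eigenspace (V T) (A T) l"
  by (rule map_in_eigenspace[OF map_lm[OF assms(1-3)] assms(4)]) (rule A_map[OF assms(1-3)])

text \<open>On an orbit the class is missing from R as well, so the correction term vanishes by
  induction. Then x is scaled both by \<open>lam c\<close> and by the mark of Stab t, which belongs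
  to a different class.\<close>

lemma eigen_zero:
  assumes T: "T \<in> Obj C" and c: "c \<in> iclasses" "c \<notin> Cls T" and x: "x \<in> eigenspace (V T) (A T) (lam c)"
  shows "x = \<zero>\<^bsub>V T\<^esub>"
proof -
  have "\<forall>x\<in>eigenspace (V T) (A T) (lam c). c \<notin> Cls T \<longrightarrow> x = \<zero>\<^bsub>V T\<^esub>"
    using T
  proof (induction rule: gset_induct)
    case (empty T)
    then show ?case using V_pts_empty by (auto dest: eigenspaceD)
  next
    case (union T B)
    show ?case
    proof (intro ballI impI)
      fix x assume x: "x \<in> eigenspace (V T) (A T) (lam c)" and cT: "c \<notin> Cls T"
      note u = map_union[OF union(1,2) eigenspaceD[OF x, THEN conjunct1]]
      have "c \<notin> Cls (subg T B)" "c \<notin> Cls (subg T (pts T - B))"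
        using cT Cls_equivariant[OF equivariant_subg[OF union(2)]]
          Cls_equivariant[OF equivariant_subg[OF invariant_Diff[OF Obj_gset[OF union(1)] union(2)]]] by auto
      then show "x = \<zero>\<^bsub>V T\<^esub>"
        using u(1) union(3,4) map_eigen[OF union(1) u(6,2) x] map_eigen[OF union(1) u(7,4) x]
          lm_zero[OF map_lm[OF u(6) union(1) u(3)]] lm_zero[OF map_lm[OF u(7) union(1) u(5)]] ratmod_V
          union(1) u(6,7) by simp
    qed
  next
    case (orbit T t)
    note Tf = Obj_gset[OF orbit(1)]
    obtain R where R: "R \<in> Obj C" "resm T R pr1 \<in> Hom (lindner G \<O>) T R" "trm R T pr1 \<in> Hom (lindner G \<O>) R T"
      "\<And>x. x \<in> carrier (V T) \<Longrightarrow> A T x = of_nat (mark G X (stab T t)) \<odot>\<^bsub>V T\<^esub> x \<oplus>\<^bsub>V T\<^esub>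
        FMap M R T (trm R T pr1) (FMap M T R (resm T R pr1) x)"
      "\<And>z. z \<in> pts R \<Longrightarrow> card (stab R z) < card (stab T t)" "Cls R \<subseteq> Cls T - {cl (stab T t)}"
      using map_aop_orbit[OF orbit(1-3) X] by metis
    note IH = orbit(4)[OF R(1,5)]
    have K: "subgroup (stab T t) G" by (rule subgroup_stab[OF Tf orbit(3)])
    show ?case
    proof (intro ballI impI)
      fix x assume x: "x \<in> eigenspace (V T) (A T) (lam c)" and cT: "c \<notin> Cls T"
      have xc: "x \<in> carrier (V T)" using x by (auto dest: eigenspaceD)
      have "FMap M T R (resm T R pr1) x = \<zero>\<^bsub>V R\<^esub>"
        using IH map_eigen[OF orbit(1) R(1,2) x] cT R(6) by blast
      then have "A T x = of_nat (mark G X (stab T t)) \<odot>\<^bsub>V T\<^esub> x"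
        using R(4)[OF xc] lm_zero[OF map_lm[OF R(1) orbit(1) R(3)] ratmod_V[OF R(1)] ratmod_V[OF orbit(1)]]
          ratmod_V[OF orbit(1)] xc by simp
      then have "lam c \<odot>\<^bsub>V T\<^esub> x = lam (cl (stab T t)) \<odot>\<^bsub>V T\<^esub> x"
        using x mark_cl[OF X K] by (simp add: eigenspace_def lam_def)
      moreover have "lam c \<noteq> lam (cl (stab T t))"
        using inj_onD[OF inj_lam _ c(1) cl_in_classes[OF K]] cT cl_stab_Cls[OF Tf orbit(3)] by auto
      ultimately show "x = \<zero>\<^bsub>V T\<^esub>"
        by (rule rm_smult_cancel[OF ratmod_V[OF orbit(1)] xc])
    qed
  qed
  then show ?thesis using x c(2) by blast
qed

text \<open>On an orbit with class d the vector \<open>A x - lam d x\<close> is transferred from R,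
  hence by induction a sum of eigenvectors for classes of R. Since d is not among these,
  \<open>eigen_sum_step\<close> can divide.\<close>

lemma eigen_sum_Cls:
  assumes T: "T \<in> Obj C" and x: "x \<in> carrier (V T)"
  shows "eigen_sum (V T) (A T) (Cls T) lam x"
proof -
  have "\<forall>x\<in>carrier (V T). eigen_sum (V T) (A T) (Cls T) lam x"
    using T
  proof (induction rule: gset_induct)
    case (empty T)
    then have "Cls T = {}" by (auto simp: Cls_def)
    then show ?case
      using V_pts_empty[OF empty] ratmod_V[OF empty(1)] by (auto simp: eigen_sum_def rm_finsum_empty)
  next
    case (union T B)
    show ?case
    proof
      fix x assume x: "x \<in> carrier (V T)"
      note u = map_union[OF union(1,2) x]
      have part: "eigen_sum (V T) (A T) (Cls T) lam (FMap M U T g (FMap M T U f x))"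
        if U: "U \<in> Obj C" "f \<in> Hom (lindner G \<O>) T U" "g \<in> Hom (lindner G \<O>) U T"
          and IH: "\<forall>x\<in>carrier (V U). eigen_sum (V U) (A U) (Cls U) lam x" and "Cls U \<subseteq> Cls T" for U f g
      proof (rule eigen_sum_mono[OF ratmod_V[OF union(1)] A_lm[OF union(1)] finite_Cls that(5)])
        show "eigen_sum (V T) (A T) (Cls U) lam (FMap M U T g (FMap M T U f x))"
          by (rule eigen_sum_map[OF ratmod_V[OF U(1)] ratmod_V[OF union(1)] map_lm[OF U(1) union(1) U(3)] finite_Cls])
            (use A_map[OF U(1) union(1) U(3)] IH lm_closed[OF map_lm[OF union(1) U(1,2)] x] in auto)
      qed
      have "eigen_sum (V T) (A T) (Cls T) lam
          (FMap M (subg T B) T (trm (subg T B) T (\<lambda>x. x)) (FMap M T (subg T B) (resm T (subg T B) (\<lambda>x. x)) x))"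
        by (rule part[OF u(6,2,3) union(3) Cls_equivariant[OF equivariant_subg[OF union(2)]]])
      moreover have "eigen_sum (V T) (A T) (Cls T) lam
          (FMap M (subg T (pts T - B)) T (trm (subg T (pts T - B)) T (\<lambda>x. x))
            (FMap M T (subg T (pts T - B)) (resm T (subg T (pts T - B)) (\<lambda>x. x)) x))"
        by (rule part[OF u(7,4,5) union(4)
            Cls_equivariant[OF equivariant_subg[OF invariant_Diff[OF Obj_gset[OF union(1)] union(2)]]]])
      ultimately show "eigen_sum (V T) (A T) (Cls T) lam x"
        by (subst u(1)) (rule eigen_sum_add[OF ratmod_V[OF union(1)] A_lm[OF union(1)]])
    qed
  next
    case (orbit T t)
    note Tf = Obj_gset[OF orbit(1)]
    obtain R where R: "R \<in> Obj C" "resm T R pr1 \<in> Hom (lindner G \<O>) T R" "trm R T pr1 \<in> Hom (lindner G \<O>) R T"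
      "\<And>x. x \<in> carrier (V T) \<Longrightarrow> A T x = of_nat (mark G X (stab T t)) \<odot>\<^bsub>V T\<^esub> x \<oplus>\<^bsub>V T\<^esub>
        FMap M R T (trm R T pr1) (FMap M T R (resm T R pr1) x)"
      "\<And>z. z \<in> pts R \<Longrightarrow> card (stab R z) < card (stab T t)" "Cls R \<subseteq> Cls T - {cl (stab T t)}"
      using map_aop_orbit[OF orbit(1-3) X] by metis
    note IH = orbit(4)[OF R(1,5)]
    have K: "subgroup (stab T t) G" by (rule subgroup_stab[OF Tf orbit(3)])
    let ?d = "cl (stab T t)"
    have dT: "?d \<in> Cls T" by (rule cl_stab_Cls[OF Tf orbit(3)])
    note VT = ratmod_V[OF orbit(1)]
    show ?case
    proof
      fix x assume x: "x \<in> carrier (V T)"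
      let ?y = "FMap M R T (trm R T pr1) (FMap M T R (resm T R pr1) x)"
      have "eigen_sum (V T) (A T) (Cls R) lam ?y"
        by (rule eigen_sum_map[OF ratmod_V[OF R(1)] VT map_lm[OF R(1) orbit(1) R(3)] finite_Cls])
          (use A_map[OF R(1) orbit(1) R(3)] IH lm_closed[OF map_lm[OF orbit(1) R(1,2)] x] in auto)
      then have y: "eigen_sum (V T) (A T) (Cls T - {?d}) lam ?y"
        by (rule eigen_sum_mono[OF VT A_lm[OF orbit(1)] _ R(6), rotated]) (simp add: finite_Cls)
      have "eigen_sum (V T) (A T) (insert ?d (Cls T - {?d})) lam x"
      proof (rule eigen_sum_step[OF VT A_lm[OF orbit(1)] _ _ _ x _ y])
        show "lam ?d \<notin> lam ` (Cls T - {?d})"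
          using inj_onD[OF inj_lam] Cls_subset[of T] dT by blast
        show "A T x = lam ?d \<odot>\<^bsub>V T\<^esub> x \<oplus>\<^bsub>V T\<^esub> ?y"
          using R(4)[OF x] mark_cl[OF X K] by (simp add: lam_def)
      qed (simp_all add: finite_Cls)
      then show "eigen_sum (V T) (A T) (Cls T) lam x"
        using dT by (simp add: insert_absorb)
    qed
  qed
  then show ?thesis using x by blast
qed

lemma eigen_decomposition_V:
  assumes T: "T \<in> Obj C"
  shows "eigen_decomposition (V T) (A T) iclasses lam"
  by (rule eigen_decomposition.intro) (use ratmod_V[OF T] A_lm[OF T] finite_classes inj_lam
      eigen_sum_mono[OF ratmod_V[OF T] A_lm[OF T] finite_classes Cls_subset eigen_sum_Cls[OF T]] in auto)

text \<open>
  On an orbit of another class an eigenvector is a multiple of a transfer of an eigenvector from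
  smaller orbits.
\<close>

lemma eigen_generated:
  assumes T: "T \<in> Obj C" and c: "c \<in> iclasses" and x: "x \<in> eigenspace (V T) (A T) (lam c)"
    and zero: "\<And>T. T \<in> Obj C \<Longrightarrow> Q T \<zero>\<^bsub>V T\<^esub>"
    and add: "\<And>T x y. \<lbrakk>T \<in> Obj C; x \<in> carrier (V T); y \<in> carrier (V T); Q T x; Q T y\<rbrakk> \<Longrightarrow> Q T (x \<oplus>\<^bsub>V T\<^esub> y)"
    and smult: "\<And>T x r. \<lbrakk>T \<in> Obj C; x \<in> carrier (V T); Q T x\<rbrakk> \<Longrightarrow> Q T (r \<odot>\<^bsub>V T\<^esub> x)"
    and map: "\<And>S T f x. \<lbrakk>S \<in> Obj C; T \<in> Obj C; f \<in> Hom (lindner G \<O>) S T; x \<in> carrier (V S); Q S x\<rbrakk>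
      \<Longrightarrow> Q T (FMap M S T f x)"
    and base: "\<And>S x. \<lbrakk>S \<in> Obj C; S \<in> Obj (lindner_sub G \<O> (rep c)); x \<in> eigenspace (V S) (A S) (lam c)\<rbrakk> \<Longrightarrow> Q S x"
  shows "Q T x"
proof -
  have "\<forall>x\<in>eigenspace (V T) (A T) (lam c). Q T x"
    using T
  proof (induction rule: gset_induct)
    case (empty T)
    then show ?case using V_pts_empty[OF empty] zero[OF empty(1)] by (metis eigenspaceD)
  next
    case (union T B)
    show ?case
    proof
      fix x assume x: "x \<in> eigenspace (V T) (A T) (lam c)"
      note u = map_union[OF union(1,2) eigenspaceD[OF x, THEN conjunct1]]
      note e = map_eigen[OF union(1) u(6,2) x] map_eigen[OF union(1) u(7,4) x]
      note e' = eigenspaceD[OF e(1), THEN conjunct1] eigenspaceD[OF e(2), THEN conjunct1]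
      show "Q T x"
        by (subst u(1), rule add[OF union(1)])
          (use lm_closed[OF map_lm[OF u(6) union(1) u(3)] e'(1)] lm_closed[OF map_lm[OF u(7) union(1) u(5)] e'(2)]
            map[OF u(6) union(1) u(3) e'(1)] map[OF u(7) union(1) u(5) e'(2)] union(3,4) e in auto)
    qed
  next
    case (orbit T t)
    note Tf = Obj_gset[OF orbit(1)]
    obtain R where R: "R \<in> Obj C" "resm T R pr1 \<in> Hom (lindner G \<O>) T R" "trm R T pr1 \<in> Hom (lindner G \<O>) R T"
      "\<And>x. x \<in> carrier (V T) \<Longrightarrow> A T x = of_nat (mark G X (stab T t)) \<odot>\<^bsub>V T\<^esub> x \<oplus>\<^bsub>V T\<^esub>
        FMap M R T (trm R T pr1) (FMap M T R (resm T R pr1) x)"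
      "\<And>z. z \<in> pts R \<Longrightarrow> card (stab R z) < card (stab T t)" "Cls R \<subseteq> Cls T - {cl (stab T t)}"
      using map_aop_orbit[OF orbit(1-3) X] by metis
    note IH = orbit(4)[OF R(1,5)]
    have K: "subgroup (stab T t) G" by (rule subgroup_stab[OF Tf orbit(3)])
    let ?d = "cl (stab T t)"
    note VT = ratmod_V[OF orbit(1)]
    show ?case
    proof
      fix x assume x: "x \<in> eigenspace (V T) (A T) (lam c)"
      have xc: "x \<in> carrier (V T)" using x by (auto dest: eigenspaceD)
      show "Q T x"
      proof (cases "?d = c")
        case True
        \<comment> \<open>All stabilizers of the orbit are conjugate and of class c, so T is an
          object of the subcategory of c and \<open>base\<close> applies.\<close>
        have "subconjugate G (stab T s) (rep c)" if s: "s \<in> pts T" for s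
        proof -
          obtain g where g: "g \<in> carrier G" "act T g t = s"
            using orbit(2,3) s unfolding transitive_gset_def by blast
          have "cl (stab T s) = c"
            using cl_conj[OF K g(1)] stab_act[OF Tf g(1) orbit(3)] g(2) True by simp
          then show ?thesis by (rule subconjugate_rep[OF subgroup_stab[OF Tf s] c])
        qed
        then show ?thesis using base[OF orbit(1) _ x] Tf by simp
      next
        case False
        let ?y = "FMap M R T (trm R T pr1) (FMap M T R (resm T R pr1) x)"
        have ex: "FMap M T R (resm T R pr1) x \<in> eigenspace (V R) (A R) (lam c)"
          by (rule map_eigen[OF orbit(1) R(1,2) x])
        then have exc: "FMap M T R (resm T R pr1) x \<in> carrier (V R)" by (auto dest: eigenspaceD)
        have y: "?y \<in> carrier (V T)" by (rule lm_closed[OF map_lm[OF R(1) orbit(1) R(3)] exc])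
        have Qy: "Q T ?y" using map[OF R(1) orbit(1) R(3) exc] IH ex by blast
        have neq: "lam c - lam ?d \<noteq> 0"
          using inj_onD[OF inj_lam _ c cl_in_classes[OF K]] False by auto
        have "lam ?d \<odot>\<^bsub>V T\<^esub> x \<oplus>\<^bsub>V T\<^esub> ?y = lam c \<odot>\<^bsub>V T\<^esub> x"
          using R(4)[OF xc] mark_cl[OF X K] x by (simp add: lam_def eigenspace_def)
        also have "\<dots> = lam ?d \<odot>\<^bsub>V T\<^esub> x \<oplus>\<^bsub>V T\<^esub> (lam c - lam ?d) \<odot>\<^bsub>V T\<^esub> x"
          using rm_add_smult[OF VT xc, of "lam ?d" "lam c - lam ?d"] by simp
        finally have eq: "lam ?d \<odot>\<^bsub>V T\<^esub> x \<oplus>\<^bsub>V T\<^esub> ?y =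
            lam ?d \<odot>\<^bsub>V T\<^esub> x \<oplus>\<^bsub>V T\<^esub> (lam c - lam ?d) \<odot>\<^bsub>V T\<^esub> x" .
        have "?y = (lam c - lam ?d) \<odot>\<^bsub>V T\<^esub> x"
          by (rule rm_left_cancel[OF VT _ y _ eq]) (use VT xc in simp_all)
        then have "x = (1 / (lam c - lam ?d)) \<odot>\<^bsub>V T\<^esub> ?y"
          using neq VT xc by simp
        then show ?thesis using smult[OF orbit(1) y Qy] by metis
      qed
    qed
  qed
  then show ?thesis using x by blast
qed

end

section \<open>Mackey functors concentrated in one class\<close>

locale class_mackey = split_mackey G \<O> rep X "rep c" M
  for G :: "('a, 'b) monoid_scheme" (structure) and \<O> and rep X c and M :: "('a, 'v) mackey_obj" +
  assumes c: "c \<in> iclasses"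
    and vanish: "\<lbrakk>subgroup K G; subconjugate G K (rep c); K \<notin> c; T \<in> Obj (lindner_sub G \<O> (rep c));
      gset_iso G T (coset_gset G K)\<rbrakk> \<Longrightarrow> carrier (FObj M T) = {\<zero>\<^bsub>FObj M T\<^esub>}"
begin

lemma in_c_iff: "subgroup K G \<Longrightarrow> K \<in> c \<longleftrightarrow> cl K = c"
  using in_cl[of K "rep c"] cl_rep[OF c] cl_eq_iff[OF rep_subgroup[OF c], of K] by auto

lemma orbit_zero:
  assumes T: "T \<in> Obj C" and tr: "transitive_gset G T" and t: "t \<in> pts T" and ne: "cl (stab T t) \<noteq> c"
  shows "carrier (V T) = {\<zero>\<^bsub>V T\<^esub>}"
  using vanish[OF subgroup_stab[OF Obj_gset[OF T] t] _ _ T transitive_coset_gset[OF Obj_gset[OF T] tr t fin]]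
    T t ne in_c_iff[OF subgroup_stab[OF Obj_gset[OF T] t]] by simp

text \<open>If c does not occur in \<open>Cls T\<close>, no stabilizer in T has class c, so the
  functor vanishes on every orbit of T and, by additivity, on T.\<close>

lemma V_zero:
  assumes T: "T \<in> Obj C" and "c \<notin> Cls T" and x: "x \<in> carrier (V T)"
  shows "x = \<zero>\<^bsub>V T\<^esub>"
proof -
  have "c \<notin> Cls T \<longrightarrow> (\<forall>x\<in>carrier (V T). x = \<zero>\<^bsub>V T\<^esub>)"
    using T
  proof (induction rule: gset_induct)
    case (empty T)
    then show ?case using V_pts_empty by blast
  next
    case (union T B)
    show ?case
    proof (intro ballI impI)
      fix x assume x: "x \<in> carrier (V T)" and cT: "c \<notin> Cls T"
      note u = map_union[OF union(1,2) x]
      have "c \<notin> Cls (subg T B)" "c \<notin> Cls (subg T (pts T - B))"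
        using cT Cls_equivariant[OF equivariant_subg[OF union(2)]]
          Cls_equivariant[OF equivariant_subg[OF invariant_Diff[OF Obj_gset[OF union(1)] union(2)]]] by auto
      then show "x = \<zero>\<^bsub>V T\<^esub>"
        using u(1) union(3,4) lm_closed[OF map_lm[OF union(1) u(6,2)] x] lm_closed[OF map_lm[OF union(1) u(7,4)] x]
          lm_zero[OF map_lm[OF u(6) union(1) u(3)]] lm_zero[OF map_lm[OF u(7) union(1) u(5)]] ratmod_V
          union(1) u(6,7) by simp
    qed
  next
    case (orbit T t)
    then show ?case
      using orbit_zero[OF orbit(1-3)] cl_stab_Cls[OF Obj_gset[OF orbit(1)] orbit(3)] by auto
  qed
  then show ?thesis using assms by blast
qed

text \<open>Only orbits of class c carry nonzero values. On such an orbit the mark is that of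
  \<open>rep c\<close>, and the correction term runs through a set R with c not in
  \<open>Cls R\<close>, where the functor is zero. With Z = X this yields the eigenvalue, with Z = Y
  the scalar to divide by.\<close>

lemma aop_scalar:
  assumes Z: "adm_gset Z" and T: "T \<in> Obj C" and x: "x \<in> carrier (V T)"
  shows "FMap M T T (aop Z T) x = of_nat (mark G Z (rep c)) \<odot>\<^bsub>V T\<^esub> x"
proof -
  let ?m = "of_nat (mark G Z (rep c)) :: rat"
  have lm: "FMap M T T (aop Z T) \<in> linear_maps (V T) (V T)" if "T \<in> Obj C" for T
    using nv_lm[OF aop_nat[OF Z] that] .
  have nat: "FMap M T T (aop Z T) (FMap M S T f x) = FMap M S T f (FMap M S S (aop Z S) x)"
    if "S \<in> Obj C" "T \<in> Obj C" "f \<in> Hom (lindner G \<O>) S T" "x \<in> carrier (V S)" for S T f x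
    using nv_nat[OF aop_nat[OF Z] that(1,2)] that(3,4) by simp
  have "\<forall>x\<in>carrier (V T). FMap M T T (aop Z T) x = ?m \<odot>\<^bsub>V T\<^esub> x"
    using T
  proof (induction rule: gset_induct)
    case (empty T)
    then show ?case
      using V_pts_empty[OF empty] lm_closed[OF lm[OF empty(1)]] ratmod_V[OF empty(1)] by (metis rm_smult)
  next
    case (union T B)
    show ?case
    proof
      fix x assume x: "x \<in> carrier (V T)"
      note u = map_union[OF union(1,2) x]
      note r = lm_closed[OF map_lm[OF union(1) u(6,2)] x] lm_closed[OF map_lm[OF union(1) u(7,4)] x]
      note l = map_lm[OF u(6) union(1) u(3)] map_lm[OF u(7) union(1) u(5)]
      let ?a = "FMap M (subg T B) T (trm (subg T B) T (\<lambda>x. x)) (FMap M T (subg T B) (resm T (subg T B) (\<lambda>x. x)) x)"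
      let ?b = "FMap M (subg T (pts T - B)) T (trm (subg T (pts T - B)) T (\<lambda>x. x))
            (FMap M T (subg T (pts T - B)) (resm T (subg T (pts T - B)) (\<lambda>x. x)) x)"
      have ab: "?a \<in> carrier (V T)" "?b \<in> carrier (V T)"
        using lm_closed[OF l(1) r(1)] lm_closed[OF l(2) r(2)] by auto
      have "FMap M T T (aop Z T) ?a = ?m \<odot>\<^bsub>V T\<^esub> ?a"
        using nat[OF u(6) union(1) u(3) r(1)] bspec[OF union(3) r(1)] lm_smult[OF l(1) r(1)] by simp
      moreover have "FMap M T T (aop Z T) ?b = ?m \<odot>\<^bsub>V T\<^esub> ?b"
        using nat[OF u(7) union(1) u(5) r(2)] bspec[OF union(4) r(2)] lm_smult[OF l(2) r(2)] by simp
      ultimately have "FMap M T T (aop Z T) (?a \<oplus>\<^bsub>V T\<^esub> ?b) = ?m \<odot>\<^bsub>V T\<^esub> (?a \<oplus>\<^bsub>V T\<^esub> ?b)"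
        using ab ratmod_V[OF union(1)] by (simp add: lm_add[OF lm[OF union(1)]] rm_smult_add)
      then show "FMap M T T (aop Z T) x = ?m \<odot>\<^bsub>V T\<^esub> x"
        using u(1) by simp
    qed
  next
    case (orbit T t)
    note Tf = Obj_gset[OF orbit(1)] and VT = ratmod_V[OF orbit(1)]
    have K: "subgroup (stab T t) G" by (rule subgroup_stab[OF Tf orbit(3)])
    show ?case
    proof
      fix x assume x: "x \<in> carrier (V T)"
      show "FMap M T T (aop Z T) x = ?m \<odot>\<^bsub>V T\<^esub> x"
      proof (cases "cl (stab T t) = c")
        case False
        then have "carrier (V T) = {\<zero>\<^bsub>V T\<^esub>}" by (rule orbit_zero[OF orbit(1-3)])
        then show ?thesis using lm_closed[OF lm[OF orbit(1)] x] rm_smult[OF VT x] by auto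
      next
        case True
        obtain R where R: "R \<in> Obj C" "resm T R pr1 \<in> Hom (lindner G \<O>) T R" "trm R T pr1 \<in> Hom (lindner G \<O>) R T"
          "\<And>x. x \<in> carrier (V T) \<Longrightarrow> FMap M T T (aop Z T) x = of_nat (mark G Z (stab T t)) \<odot>\<^bsub>V T\<^esub> x \<oplus>\<^bsub>V T\<^esub>
            FMap M R T (trm R T pr1) (FMap M T R (resm T R pr1) x)"
          "Cls R \<subseteq> Cls T - {cl (stab T t)}"
          using map_aop_orbit[OF orbit(1-3) Z] by metis
        have "FMap M T R (resm T R pr1) x = \<zero>\<^bsub>V R\<^esub>"
          using V_zero[OF R(1) _ lm_closed[OF map_lm[OF orbit(1) R(1,2)] x]] R(5) True by blast
        then show ?thesis
          using R(4)[OF x] mark_cl[OF Z K] True VT x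
            lm_zero[OF map_lm[OF R(1) orbit(1) R(3)] ratmod_V[OF R(1)] VT] by simp
      qed
    qed
  qed
  then show ?thesis using x by blast
qed

end

section \<open>The splitting functor\<close>

lemma O_Mackey_simps:
  "M \<in> Obj (O_Mackey G \<O>) \<longleftrightarrow> is_functor (lindner G \<O>) rat_vect M \<and>
    extensional_functor (lindner G \<O>) M \<and> product_preserving (lindner G \<O>) rat_vect M"
  "\<alpha> \<in> Hom (O_Mackey G \<O>) M M' \<longleftrightarrow>
    \<alpha> \<in> extensional (Obj (lindner G \<O>)) \<and> nat_trans (lindner G \<O>) rat_vect M M' \<alpha>"
  "Ident (O_Mackey G \<O>) M = (\<lambda>X\<in>Obj (lindner G \<O>). \<lambda>x\<in>carrier (FObj M X). x)"
  "Comp (O_Mackey G \<O>) M M' M'' \<beta> \<alpha> =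
    (\<lambda>X\<in>Obj (lindner G \<O>). compose (carrier (FObj M X)) (\<beta> X) (\<alpha> X))"
  by (auto simp: O_Mackey_def)

lemma class_Mackey_simps:
  "N \<in> Obj (class_Mackey G \<O> H) \<longleftrightarrow> is_functor (lindner_sub G \<O> H) rat_vect N \<and>
    extensional_functor (lindner_sub G \<O> H) N \<and> product_preserving (lindner_sub G \<O> H) rat_vect N \<and>
    (\<forall>K. subgroup K G \<and> subconjugate G K H \<and> K \<notin> insep_class G \<O> H \<longrightarrow>
        (\<forall>X \<in> Obj (lindner_sub G \<O> H). gset_iso G X (coset_gset G K) \<longrightarrow>
          carrier (FObj N X) = {\<zero>\<^bsub>FObj N X\<^esub>}))"
  "\<alpha> \<in> Hom (class_Mackey G \<O> H) N N' \<longleftrightarrow>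
    \<alpha> \<in> extensional (Obj (lindner_sub G \<O> H)) \<and> nat_trans (lindner_sub G \<O> H) rat_vect N N' \<alpha>"
  "Ident (class_Mackey G \<O> H) N = (\<lambda>X\<in>Obj (lindner_sub G \<O> H). \<lambda>x\<in>carrier (FObj N X). x)"
  "Comp (class_Mackey G \<O> H) N N' N'' \<beta> \<alpha> =
    (\<lambda>X\<in>Obj (lindner_sub G \<O> H). compose (carrier (FObj N X)) (\<beta> X) (\<alpha> X))"
  by (auto simp: class_Mackey_def)

lemma category_O_Mackey: "category (O_Mackey G \<O>)"
  unfolding O_Mackey_def by (intro category_full_subcategory category_functor_category category_rat_vect)

lemma category_class_Mackey: "category (class_Mackey G \<O> H)"
  unfolding class_Mackey_def by (intro category_full_subcategory category_functor_category category_rat_vect)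

lemma product_category_simps:
  "X \<in> Obj (product_category I C) \<longleftrightarrow> X \<in> (\<Pi>\<^sub>E i\<in>I. Obj (C i))"
  "f \<in> Hom (product_category I C) X Y \<longleftrightarrow> f \<in> (\<Pi>\<^sub>E i\<in>I. Hom (C i) (X i) (Y i))"
  "Ident (product_category I C) X = (\<lambda>i\<in>I. Ident (C i) (X i))"
  "Comp (product_category I C) X Y Z g f = (\<lambda>i\<in>I. Comp (C i) (X i) (Y i) (Z i) (g i) (f i))"
  by (simp_all add: product_category_def)

context transfer
begin

lemma restrict_functor:
  assumes "is_functor (lindner G \<O>) D F"
  shows "is_functor (lindner_sub G \<O> H) D F"
  using assms unfolding is_functor_def by auto

lemma restrict_nat_trans:
  assumes "nat_trans (lindner G \<O>) D F K \<alpha>"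
  shows "nat_trans (lindner_sub G \<O> H) D F K \<alpha>"
  using assms unfolding nat_trans_def by auto

text \<open>Reduces product preservation to the empty G-set and to disjoint unions with their
  restrictions, which are products of any two objects.\<close>

lemma product_preserving_standard:
  assumes F: "is_functor (lindner_sub G \<O> H) rat_vect F"
    and t: "is_terminal rat_vect (FObj F emptyg)"
    and p: "\<And>A B D i j. \<lbrakk>coprod_gset G A B D i j; A \<in> Obj (lindner_sub G \<O> H); B \<in> Obj (lindner_sub G \<O> H);
        D \<in> Obj (lindner_sub G \<O> H)\<rbrakk> \<Longrightarrow>
      is_binary_product rat_vect (FObj F A) (FObj F B) (FObj F D) (FMap F D A (resm D A i)) (FMap F D B (resm D B j))"
  shows "product_preserving (lindner_sub G \<O> H) rat_vect F"
proof (rule product_preservingI[OF category_lindner_sub category_rat_vect F])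
  show "\<exists>P. is_terminal (lindner_sub G \<O> H) P \<and> is_terminal rat_vect (FObj F P)"
    using is_terminal_emptyg t by blast
  fix A B assume A: "A \<in> Obj (lindner_sub G \<O> H)" and B: "B \<in> Obj (lindner_sub G \<O> H)"
  note c = coprod_sumg[OF Obj_gset[OF A] Obj_gset[OF B]]
  note cD = coprodD[OF c]
  have "subconjugate G (stab (sumg A B) z) H" if z: "z \<in> pts (sumg A B)" for z
  proof -
    consider x where "x \<in> pts A" "z = pr 0 x" | x where "x \<in> pts B" "z = pr 1 x"
      using z[unfolded cD(8)] by blast
    then show ?thesis
      using stab_inj[OF cD(4,6) _ cD(1)] stab_inj[OF cD(5,7) _ cD(2)] A B by cases auto
  qed
  then have D: "sumg A B \<in> Obj (lindner_sub G \<O> H)" using cD(3) by auto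
  show "\<exists>P p q. is_binary_product (lindner_sub G \<O> H) A B P p q \<and>
      is_binary_product rat_vect (FObj F A) (FObj F B) (FObj F P) (FMap F P A p) (FMap F P B q)"
    using binary_product_coprod[OF c D] p[OF c A B D] by blast
qed

lemma mackeyD:
  assumes "M \<in> Obj (O_Mackey G \<O>)"
  shows "is_functor (lindner G \<O>) rat_vect M" "product_preserving (lindner G \<O>) rat_vect M"
  using assms by (simp_all add: O_Mackey_simps)

end

section \<open>The splitting functor on objects and morphisms\<close>

context split
begin

abbreviation "L \<equiv> lindner G \<O>"
abbreviation "Lc c \<equiv> lindner_sub G \<O> (rep c)"
abbreviation "aM M T \<equiv> FMap M T T (aop X T)"
abbreviation "eig M c T \<equiv> eigenspace (FObj M T) (aM M T) (lam c)"

lemma split_mackey_O_Mackey: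
  assumes "M \<in> Obj (O_Mackey G \<O>)"
  shows "split_mackey G \<O> rep X (carrier G) M"
  by unfold_locales (use mackeyD[OF assms] in \<open>simp_all add: lindner_sub_carrier\<close>)

lemma class_mackey_class_Mackey:
  assumes c: "c \<in> iclasses" and "N \<in> Obj (class_Mackey G \<O> (rep c))"
  shows "class_mackey G \<O> rep X c N"
  by unfold_locales (use assms cl_rep[OF c] in \<open>auto simp: class_Mackey_simps\<close>)

lemma aM_nat:
  assumes "M \<in> Obj (O_Mackey G \<O>)" and Z: "adm_gset Z"
  shows "nat_trans L rat_vect M M (\<lambda>T. FMap M T T (aop Z T))"
proof -
  interpret split_mackey G \<O> rep X "carrier G" M by (rule split_mackey_O_Mackey[OF assms(1)])
  show ?thesis using aop_nat[OF Z] by (simp only: lindner_sub_carrier)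
qed

lemma eigen_endo_c:
  assumes M: "M \<in> Obj (O_Mackey G \<O>)"
  shows "eigen_endo (Lc c) M (aM M)"
  by (rule eigen_endo.intro[OF category_lindner_sub restrict_functor[OF mackeyD(1)[OF M]]
      restrict_nat_trans[OF aM_nat[OF M X]]])

definition SF :: "('a, 'v) mackey_obj \<Rightarrow> 'a set set \<Rightarrow> ('a, 'v) mackey_obj" where
  "SF M = (\<lambda>c\<in>iclasses. eigen_functor (Lc c) M (aM M) (lam c))"

lemma gset_iso_coset:
  assumes T: "finite_gset G T" and K: "subgroup K G" and iso: "gset_iso G T (coset_gset G K)" and x: "x \<in> pts T"
  shows "\<exists>g\<in>carrier G. stab T x = conjugate_set G g K"
proof -
  note CK = coset_gset[OF K fin]
  obtain f where f: "f \<in> gmaps G T (coset_gset G K)" "bij_betw f (pts T) (pts (coset_gset G K))"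
    using iso by (auto simp: gset_iso_def)
  have e: "equivariant G T (coset_gset G K) f"
    using f(1) by (auto simp: gmaps_def equivariant_def)
  obtain g where "g \<in> carrier G" "f x = act (coset_gset G K) g K"
    using CK(4)[OF equivariant_pts[OF e x]] by blast
  then show ?thesis
    using stab_inj[OF e bij_betw_imp_inj_on[OF f(2)] x T] stab_act[OF CK(1) _ CK(2)] CK(3) by metis
qed

text \<open>Product preservation is inherited by eigenspaces. For the vanishing condition, an orbit
  of the subcategory whose stabilizer is not in c has no subgroup of a stabilizer in c either, so
  its eigenspace is zero by \<open>eigen_zero\<close>.\<close>

lemma eigen_functor_class:
  assumes M: "M \<in> Obj (O_Mackey G \<O>)" and c: "c \<in> iclasses"
  shows "eigen_functor (Lc c) M (aM M) (lam c) \<in> Obj (class_Mackey G \<O> (rep c))"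
proof -
  interpret M: split_mackey G \<O> rep X "carrier G" M by (rule split_mackey_O_Mackey[OF M])
  interpret E: eigen_endo "Lc c" M "aM M" by (rule eigen_endo_c[OF M])
  have LO: "T \<in> Obj (lindner_sub G \<O> (carrier G))" if "T \<in> Obj (Lc c)" for T
    using that unfolding lindner_sub_carrier by simp
  have "product_preserving (Lc c) rat_vect (eigen_functor (Lc c) M (aM M) (lam c))"
  proof (rule product_preserving_standard[OF E.is_functor_eigen])
    have "is_terminal rat_vect (FObj M emptyg)"
      using mackeyD(2)[OF M] is_terminal_emptyg[of "carrier G"]
      unfolding product_preserving_def lindner_sub_carrier by blast
    then show "is_terminal rat_vect (FObj (eigen_functor (Lc c) M (aM M) (lam c)) emptyg)"
      by (intro E.eigen_preserves_terminal) (simp add: finite_gset_emptyg)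
  next
    fix A B D i j assume co: "coprod_gset G A B D i j" and A: "A \<in> Obj (Lc c)" and B: "B \<in> Obj (Lc c)" and D: "D \<in> Obj (Lc c)"
    note cD = coprodD[OF co]
    have "is_binary_product rat_vect (FObj M A) (FObj M B) (FObj M D) (FMap M D A (resm D A i)) (FMap M D B (resm D B j))"
      using mackeyD(2)[OF M] binary_product_coprod[OF co LO[OF D]]
      unfolding product_preserving_def lindner_sub_carrier by blast
    then show "is_binary_product rat_vect (FObj (eigen_functor (Lc c) M (aM M) (lam c)) A)
        (FObj (eigen_functor (Lc c) M (aM M) (lam c)) B) (FObj (eigen_functor (Lc c) M (aM M) (lam c)) D)
        (FMap (eigen_functor (Lc c) M (aM M) (lam c)) D A (resm D A i))
        (FMap (eigen_functor (Lc c) M (aM M) (lam c)) D B (resm D B j))"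
      using resm_Hom[OF cD(1,4)] resm_Hom[OF cD(2,5)] by (intro E.eigen_preserves_product A B D) simp_all
  qed
  moreover have "carrier (FObj (eigen_functor (Lc c) M (aM M) (lam c)) T) =
      {\<zero>\<^bsub>FObj (eigen_functor (Lc c) M (aM M) (lam c)) T\<^esub>}"
    if K: "subgroup K G" "K \<notin> cl (rep c)" and T: "T \<in> Obj (Lc c)" and iso: "gset_iso G T (coset_gset G K)" for K T
  proof -
    \<comment> \<open>A subgroup of class c in a stabilizer would force that stabilizer, a conjugate
      of K, into c by \<open>cl_between\<close>.\<close>
    have "c \<notin> Cls T"
    proof
      assume "c \<in> Cls T"
      then obtain J t where J: "subgroup J G" "t \<in> pts T" "J \<subseteq> stab T t" "c = cl J" by (auto simp: Cls_def)
      have "cl (stab T t) = c"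
        using cl_between[OF subgroup_stab[OF Obj_gset[OF T] J(2)] J(1,3) c] J T by simp
      moreover obtain g where "g \<in> carrier G" "stab T t = conjugate_set G g K"
        using gset_iso_coset[OF Obj_gset[OF T] K(1) iso J(2)] by blast
      ultimately have "cl K = cl (rep c)"
        using cl_conj[OF K(1)] cl_rep[OF c] by simp
      then show False
        using K cl_eq_iff[OF rep_subgroup[OF c] K(1)] in_cl by auto
    qed
    then have "x = \<zero>\<^bsub>FObj M T\<^esub>" if "x \<in> eig M c T" for x
      using M.eigen_zero[OF LO[OF T] c _ that] by blast
    then show ?thesis
      using T zero_in_eigenspace[OF M.ratmod_V[OF LO[OF T]] M.A_lm[OF LO[OF T]]] by auto
  qed
  ultimately show ?thesis
    using E.is_functor_eigen extensional_eigen_functor unfolding class_Mackey_simps by blast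
qed

lemma SF_Obj:
  assumes M: "M \<in> Obj (O_Mackey G \<O>)"
  shows "SF M \<in> Obj (product_category iclasses (\<lambda>c. class_Mackey G \<O> (rep c)))"
  unfolding product_category_simps SF_def using eigen_functor_class[OF M] by simp

definition SFmap :: "('a, 'v) mackey_obj \<Rightarrow> ('a, 'v) mackey_obj \<Rightarrow> ('a, 'v) mackey_mor \<Rightarrow>
    'a set set \<Rightarrow> ('a, 'v) mackey_mor" where
  "SFmap M M' \<alpha> = (\<lambda>c\<in>iclasses. \<lambda>T\<in>Obj (Lc c). restrict (\<alpha> T) (eig M c T))"

text \<open>The operator is itself the value at a morphism of the Lindner category, so every natural
  transformation commutes with it.\<close>

lemma nat_eig:
  assumes M: "M \<in> Obj (O_Mackey G \<O>)" and \<alpha>: "nat_trans L rat_vect M M' \<alpha>" and T: "T \<in> Obj L"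
    and x: "x \<in> eig M c T"
  shows "\<alpha> T x \<in> eig M' c T"
  by (rule map_in_eigenspace[OF nv_lm[OF \<alpha> T] x])
    (use nv_nat[OF \<alpha> T T] aop_Hom[OF X] T in simp)

lemma SFmap_Hom:
  assumes M: "M \<in> Obj (O_Mackey G \<O>)" and M': "M' \<in> Obj (O_Mackey G \<O>)"
    and \<alpha>: "\<alpha> \<in> Hom (O_Mackey G \<O>) M M'"
  shows "SFmap M M' \<alpha> \<in> Hom (product_category iclasses (\<lambda>c. class_Mackey G \<O> (rep c))) (SF M) (SF M')"
proof -
  have nt: "nat_trans L rat_vect M M' \<alpha>" using \<alpha> by (simp add: O_Mackey_simps)
  have "nat_trans (Lc c) rat_vect (eigen_functor (Lc c) M (aM M) (lam c)) (eigen_functor (Lc c) M' (aM M') (lam c))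
      (\<lambda>T. restrict (\<alpha> T) (eig M c T))" for c
  proof (rule nat_rat_vectI)
    interpret E: eigen_endo "Lc c" M "aM M" by (rule eigen_endo_c[OF M])
    fix T assume T: "T \<in> Obj (Lc c)"
    then have TL: "T \<in> Obj L" by simp
    note lm = nv_lm[OF nt TL]
    let ?E = "(FObj M T)\<lparr>carrier := eig M c T\<rparr>"
    have "restrict (\<alpha> T) (carrier ?E) \<in> linear_maps ?E (FObj (eigen_functor (Lc c) M' (aM M') (lam c)) T)"
      using T nat_eig[OF M nt TL] fv_ratmod[OF E.is_functor_eigen T]
      by (intro linear_mapsI) (simp_all add: lm_add[OF lm] lm_smult[OF lm] eigenspaceD)
    then show "restrict (\<alpha> T) (eig M c T) \<in> linear_maps (FObj (eigen_functor (Lc c) M (aM M) (lam c)) T)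
        (FObj (eigen_functor (Lc c) M' (aM M') (lam c)) T)"
      using T by simp
  next
    interpret E: eigen_endo "Lc c" M "aM M" by (rule eigen_endo_c[OF M])
    fix S T f x assume ST: "S \<in> Obj (Lc c)" "T \<in> Obj (Lc c)" and f: "f \<in> Hom (Lc c) S T"
      and x: "x \<in> carrier (FObj (eigen_functor (Lc c) M (aM M) (lam c)) S)"
    then have x': "x \<in> eig M c S" and xc: "x \<in> carrier (FObj M S)" by (auto dest: eigenspaceD)
    have SL: "S \<in> Obj L" "T \<in> Obj L" "f \<in> Hom L S T" using ST f by auto
    show "restrict (\<alpha> T) (eig M c T) (FMap (eigen_functor (Lc c) M (aM M) (lam c)) S T f x) =
        FMap (eigen_functor (Lc c) M' (aM M') (lam c)) S T f (restrict (\<alpha> S) (eig M c S) x)"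
      using ST f x' E.map_eigenspace[OF ST f x'] nat_eig[OF M nt SL(1) x'] nv_nat[OF nt SL xc] by simp
  qed
  then show ?thesis
    unfolding product_category_simps SFmap_def SF_def by (auto simp: class_Mackey_simps)
qed

definition split_functor ::
  "(('a, 'v) mackey_obj, ('a, 'v) mackey_mor, 'a set set \<Rightarrow> ('a, 'v) mackey_obj, 'a set set \<Rightarrow> ('a, 'v) mackey_mor) cfunctor"
  where "split_functor = \<lparr>FObj = SF, FMap = SFmap\<rparr>"

lemma is_functor_split:
  "is_functor (O_Mackey G \<O>) (product_category iclasses (\<lambda>c. class_Mackey G \<O> (rep c))) split_functor"
  unfolding is_functor_def
proof (intro conjI ballI)
  fix M :: "('a, 'v) mackey_obj" assume M: "M \<in> Obj (O_Mackey G \<O>)"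
  have [simp]: "carrier (FObj M T) \<inter> eig M c T = eig M c T" for c T
    by (auto dest: eigenspaceD)
  show "FMap split_functor M M (Ident (O_Mackey G \<O>) M) =
      Ident (product_category iclasses (\<lambda>c. class_Mackey G \<O> (rep c))) (FObj split_functor M)"
    by (auto simp: split_functor_def SFmap_def SF_def product_category_simps class_Mackey_simps O_Mackey_simps
        intro!: restrict_ext dest: eigenspaceD)
next
  fix M1 M2 M3 :: "('a, 'v) mackey_obj" and \<alpha> \<beta>
  assume M: "M1 \<in> Obj (O_Mackey G \<O>)" "M2 \<in> Obj (O_Mackey G \<O>)" "M3 \<in> Obj (O_Mackey G \<O>)"
    and \<alpha>: "\<alpha> \<in> Hom (O_Mackey G \<O>) M1 M2" and "\<beta> \<in> Hom (O_Mackey G \<O>) M2 M3"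
  then have nt: "nat_trans L rat_vect M1 M2 \<alpha>" by (simp add: O_Mackey_simps)
  have [simp]: "carrier (FObj M1 T) \<inter> eig M1 c T = eig M1 c T" for c T
    by (auto dest: eigenspaceD)
  show "FMap split_functor M1 M3 (Comp (O_Mackey G \<O>) M1 M2 M3 \<beta> \<alpha>) =
      Comp (product_category iclasses (\<lambda>c. class_Mackey G \<O> (rep c))) (FObj split_functor M1)
        (FObj split_functor M2) (FObj split_functor M3) (FMap split_functor M2 M3 \<beta>) (FMap split_functor M1 M2 \<alpha>)"
    using nat_eig[OF M(1) nt]
    by (auto simp: split_functor_def SFmap_def SF_def product_category_simps class_Mackey_simps O_Mackey_simps
        compose_def intro!: restrict_ext dest: eigenspaceD)
qed (simp_all add: split_functor_def SF_Obj SFmap_Hom)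

text \<open>Transformations that agree on the subcategory of c agree on the whole eigenspace of c,
  as this is generated from there under the maps of M; and the eigenspaces together span every
  value.\<close>

lemma SFmap_inj:
  assumes M: "M \<in> Obj (O_Mackey G \<O>)" and M': "M' \<in> Obj (O_Mackey G \<O>)"
  shows "inj_on (SFmap M M') (Hom (O_Mackey G \<O>) M M')"
proof (rule inj_onI)
  interpret M: split_mackey G \<O> rep X "carrier G" M by (rule split_mackey_O_Mackey[OF M])
  fix \<alpha> \<beta> assume a: "\<alpha> \<in> Hom (O_Mackey G \<O>) M M'" and b: "\<beta> \<in> Hom (O_Mackey G \<O>) M M'"
    and eq: "SFmap M M' \<alpha> = SFmap M M' \<beta>"
  have na: "nat_trans L rat_vect M M' \<alpha>" and nb: "nat_trans L rat_vect M M' \<beta>"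
    and ext: "\<alpha> \<in> extensional (Obj L)" "\<beta> \<in> extensional (Obj L)"
    using a b by (auto simp: O_Mackey_simps)
  note rM' = fv_ratmod[OF mackeyD(1)[OF M']] and rM = fv_ratmod[OF mackeyD(1)[OF M]]
  have LC: "lindner_sub G \<O> (carrier G) = L" by (rule lindner_sub_carrier)
  have base: "\<alpha> T x = \<beta> T x" if "c \<in> iclasses" "T \<in> Obj (Lc c)" "x \<in> eig M c T" for c T x
  proof -
    have "SFmap M M' \<alpha> c T x = SFmap M M' \<beta> c T x" by (simp add: eq)
    then show ?thesis using that by (simp add: SFmap_def)
  qed
  \<comment> \<open>The set where the two transformations agree contains zero and is closed under
    addition, scalars and all maps of M, as \<open>eigen_generated\<close> demands.\<close>
  have eig: "\<alpha> T x = \<beta> T x" if c: "c \<in> iclasses" and T: "T \<in> Obj (lindner_sub G \<O> (carrier G))" and x: "x \<in> eig M c T" for c T x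
  proof (rule M.eigen_generated[OF T c x, of "\<lambda>T x. \<alpha> T x = \<beta> T x"])
    fix T assume "T \<in> Obj (lindner_sub G \<O> (carrier G))"
    then have T: "T \<in> Obj L" by (simp only: LC)
    note lms = nv_lm[OF na T] nv_lm[OF nb T]
    show "\<alpha> T \<zero>\<^bsub>FObj M T\<^esub> = \<beta> T \<zero>\<^bsub>FObj M T\<^esub>"
      using lm_zero[OF lms(1) rM[OF T] rM'[OF T]] lm_zero[OF lms(2) rM[OF T] rM'[OF T]] by simp
    show "\<alpha> T (x \<oplus>\<^bsub>FObj M T\<^esub> y) = \<beta> T (x \<oplus>\<^bsub>FObj M T\<^esub> y)"
      if "x \<in> carrier (FObj M T)" "y \<in> carrier (FObj M T)" "\<alpha> T x = \<beta> T x" "\<alpha> T y = \<beta> T y" for x y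
      using that by (simp add: lm_add[OF lms(1)] lm_add[OF lms(2)])
    show "\<alpha> T (r \<odot>\<^bsub>FObj M T\<^esub> x) = \<beta> T (r \<odot>\<^bsub>FObj M T\<^esub> x)"
      if "x \<in> carrier (FObj M T)" "\<alpha> T x = \<beta> T x" for x r
      using that by (simp add: lm_smult[OF lms(1)] lm_smult[OF lms(2)])
  next
    fix S T f x assume "S \<in> Obj (lindner_sub G \<O> (carrier G))" "T \<in> Obj (lindner_sub G \<O> (carrier G))"
      and f: "f \<in> Hom L S T" and x: "x \<in> carrier (FObj M S)" and e: "\<alpha> S x = \<beta> S x"
    then have ST: "S \<in> Obj L" "T \<in> Obj L" by (simp_all only: LC)
    show "\<alpha> T (FMap M S T f x) = \<beta> T (FMap M S T f x)"
      using nv_nat[OF na ST f x] nv_nat[OF nb ST f x] e by simp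
  qed (use base[OF c] in blast)
  show "\<alpha> = \<beta>"
  proof (rule extensionalityI[OF ext])
    fix T assume T: "T \<in> Obj L"
    then have T': "T \<in> Obj (lindner_sub G \<O> (carrier G))" by (simp only: LC)
    interpret D: eigen_decomposition "FObj M T" "aM M T" iclasses lam by (rule M.eigen_decomposition_V[OF T'])
    show "\<alpha> T = \<beta> T"
    proof (rule extensionalityI[OF lm_ext[OF nv_lm[OF na T]] lm_ext[OF nv_lm[OF nb T]]])
      fix x assume x: "x \<in> carrier (FObj M T)"
      note pc = D.eproj_carrier[OF x]
      have "\<alpha> T x = (\<Oplus>\<^bsub>FObj M' T\<^esub>c\<in>iclasses. \<alpha> T (D.eproj x c))"
        using lm_finsum[OF nv_lm[OF na T] rM[OF T] rM'[OF T] finite_classes pc] D.eproj_sum[OF x] by simp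
      also have "\<dots> = (\<Oplus>\<^bsub>FObj M' T\<^esub>c\<in>iclasses. \<beta> T (D.eproj x c))"
        using eig[OF _ T' D.eproj_in[OF x]] pc lm_closed[OF nv_lm[OF nb T]] by (intro rm_finsum_cong[OF rM'[OF T]]) auto
      also have "\<dots> = \<beta> T x"
        using lm_finsum[OF nv_lm[OF nb T] rM[OF T] rM'[OF T] finite_classes pc] D.eproj_sum[OF x] by simp
      finally show "\<alpha> T x = \<beta> T x" .
    qed
  qed
qed

text \<open>\<open>Y c\<close> is a copy of the orbit \<open>G / rep c\<close>.\<close>

lemma obtain_orbits:
  obtains Y where "\<And>c. c \<in> iclasses \<Longrightarrow> adm_gset (Y c)"
    "\<And>c. c \<in> iclasses \<Longrightarrow> mark G (Y c) (rep c) > 0"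
    "\<And>c y. \<lbrakk>c \<in> iclasses; y \<in> pts (Y c)\<rbrakk> \<Longrightarrow> subconjugate G (stab (Y c) y) (rep c)"
proof -
  have "\<exists>Y. adm_gset Y \<and> mark G Y (rep c) > 0 \<and> (\<forall>y\<in>pts Y. subconjugate G (stab Y y) (rep c))"
    if c: "c \<in> iclasses" for c
  proof -
    obtain Y y where Y: "adm_gset Y" "y \<in> pts Y" "stab Y y = rep c"
      "\<And>z. z \<in> pts Y \<Longrightarrow> \<exists>g\<in>carrier G. stab Y z = conjugate_set G g (rep c)"
      using obtain_orbit[OF rep_Sub[OF c]] by blast
    have "y \<in> fixpts G Y (rep c)" using Y(2,3) by (simp add: fixpts_def)
    then have "mark G Y (rep c) > 0"
      unfolding mark_def using gs_finite[OF adm_gset_finite[OF Y(1)]] by (auto simp: card_gt_0_iff fixpts_def)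
    moreover have "subconjugate G (stab Y z) (rep c)" if z: "z \<in> pts Y" for z
    proof -
      obtain g where g: "g \<in> carrier G" "stab Y z = conjugate_set G g (rep c)" using Y(4)[OF z] by blast
      then have "conjugate_set G (inv g) (stab Y z) = rep c"
        using conj_inv(1)[OF g(1) Sub_O_subset[OF rep_Sub[OF c]]] by simp
      then show ?thesis using g(1) unfolding subconjugate_def by (intro bexI[of _ "inv g"]) auto
    qed
    ultimately show ?thesis using Y(1) by blast
  qed
  then show ?thesis using that by metis
qed

text \<open>
  A compatible family \<open>\<beta>\<close> on the subcategories extends by restricting to \<open>T \<times> Y c\<close>, applying \<open>\<beta> c\<close>,
  transferring back and dividing by the scalar through which \<open>Y c\<close> acts.
\<close>

lemma SFmap_surj:
  assumes M: "M \<in> Obj (O_Mackey G \<O>)" and M': "M' \<in> Obj (O_Mackey G \<O>)"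
    and \<beta>: "\<beta> \<in> Hom (product_category iclasses (\<lambda>c. class_Mackey G \<O> (rep c))) (SF M) (SF M')"
  shows "\<exists>\<alpha>\<in>Hom (O_Mackey G \<O>) M M'. SFmap M M' \<alpha> = \<beta>"
proof -
  interpret M: split_mackey G \<O> rep X "carrier G" M by (rule split_mackey_O_Mackey[OF M])
  interpret M': split_mackey G \<O> rep X "carrier G" M' by (rule split_mackey_O_Mackey[OF M'])
  have LC: "lindner_sub G \<O> (carrier G) = L" by (rule lindner_sub_carrier)
  note F = mackeyD(1)[OF M] and F' = mackeyD(1)[OF M']
  note rM' = fv_ratmod[OF F'] and rM = fv_ratmod[OF F]
  note mapM = fv_lm[OF F] and mapM' = fv_lm[OF F']
  obtain Y where Y: "\<And>c. c \<in> iclasses \<Longrightarrow> adm_gset (Y c)"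
    "\<And>c. c \<in> iclasses \<Longrightarrow> mark G (Y c) (rep c) > 0"
    "\<And>c y. \<lbrakk>c \<in> iclasses; y \<in> pts (Y c)\<rbrakk> \<Longrightarrow> subconjugate G (stab (Y c) y) (rep c)"
    by (rule obtain_orbits) blast
  note Yf = adm_gset_finite[OF Y(1)]
  define n where "n c = (of_nat (mark G (Y c) (rep c)) :: rat)" for c
  have n: "n c \<noteq> 0" if "c \<in> iclasses" for c using Y(2)[OF that] by (simp add: n_def)
  have \<beta>c: "nat_trans (Lc c) rat_vect (eigen_functor (Lc c) M (aM M) (lam c))
      (eigen_functor (Lc c) M' (aM M') (lam c)) (\<beta> c)" "\<beta> c \<in> extensional (Obj (Lc c))" if "c \<in> iclasses" for c
    using \<beta> that by (auto simp: product_category_simps SF_def class_Mackey_simps dest!: PiE_mem)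
  have tO: "ten T (Y c) \<in> Obj (Lc c)" "ten T (Y c) \<in> Obj L" if "c \<in> iclasses" "T \<in> Obj L" for T c
    using ten_Obj[OF Yf[OF that(1)] Y(3)[OF that(1)]] that(2) by auto
  have \<beta>_lm: "\<beta> c T \<in> linear_maps ((FObj M T)\<lparr>carrier := eig M c T\<rparr>) ((FObj M' T)\<lparr>carrier := eig M' c T\<rparr>)"
    if "c \<in> iclasses" "T \<in> Obj (Lc c)" for c T
    using nv_lm[OF \<beta>c(1)[OF that(1)] that(2)] that by simp
  have \<beta>_eig: "\<beta> c T x \<in> eig M' c T" if "c \<in> iclasses" "T \<in> Obj (Lc c)" "x \<in> eig M c T" for c T x
    using lm_closed[OF \<beta>_lm[OF that(1,2)], of x] that(3) by simp
  have \<beta>_nat: "\<beta> c T (FMap M S T f x) = FMap M' S T f (\<beta> c S x)"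
    if c: "c \<in> iclasses" and S: "S \<in> Obj (Lc c)" and T: "T \<in> Obj (Lc c)" and f: "f \<in> Hom L S T" and x: "x \<in> eig M c S" for c S T f x
  proof -
    have f': "f \<in> Hom (Lc c) S T" using f by simp
    show ?thesis
      using nv_nat[OF \<beta>c(1)[OF c] S T f'] S T f' x \<beta>_eig[OF c S x] by simp
  qed
  have res: "resY (Y c) T \<in> Hom L T (ten T (Y c))" and tr: "trY (Y c) T \<in> Hom L (ten T (Y c)) T"
    if "c \<in> iclasses" "T \<in> Obj L" for c T
    using resY_Hom[OF Yf[OF that(1)]] trY_Hom[OF Y(1)[OF that(1)]] that(2) by auto
  have mapE: "FMap M S T f x \<in> eig M c T" if "S \<in> Obj L" "T \<in> Obj L" "f \<in> Hom L S T" "x \<in> eig M c S" for S T f x c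
    using M.map_eigen[of S T f x "lam c", unfolded LC] that by blast
  have mapE': "FMap M' S T f x \<in> eig M' c T" if "S \<in> Obj L" "T \<in> Obj L" "f \<in> Hom L S T" "x \<in> eig M' c S" for S T f x c
    using M'.map_eigen[of S T f x "lam c", unfolded LC] that by blast
  define \<gamma> where "\<gamma> c T x = (1 / n c) \<odot>\<^bsub>FObj M' T\<^esub>
    FMap M' (ten T (Y c)) T (trY (Y c) T) (\<beta> c (ten T (Y c)) (FMap M T (ten T (Y c)) (resY (Y c) T) x))" for c T x
  have b_in: "\<beta> c (ten T (Y c)) (FMap M T (ten T (Y c)) (resY (Y c) T) x) \<in> eig M' c (ten T (Y c))"
    if "c \<in> iclasses" "T \<in> Obj L" "x \<in> eig M c T" for c T x
    using \<beta>_eig[OF that(1) tO(1)[OF that(1,2)] mapE[OF that(2) tO(2)[OF that(1,2)] res[OF that(1,2)] that(3)]] .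
  have tr_in: "FMap M' (ten T (Y c)) T (trY (Y c) T) (\<beta> c (ten T (Y c)) (FMap M T (ten T (Y c)) (resY (Y c) T) x)) \<in> carrier (FObj M' T)"
    if "c \<in> iclasses" "T \<in> Obj L" "x \<in> eig M c T" for c T x
    using mapE'[OF tO(2)[OF that(1,2)] that(2) tr[OF that(1,2)] b_in[OF that]] by (auto dest: eigenspaceD)
  have \<gamma>_in: "\<gamma> c T x \<in> carrier (FObj M' T)" if "c \<in> iclasses" "T \<in> Obj L" "x \<in> eig M c T" for c T x
    unfolding \<gamma>_def using tr_in[OF that] rM'[OF that(2)] by simp
  have \<gamma>_add: "\<gamma> c T (x \<oplus>\<^bsub>FObj M T\<^esub> y) = \<gamma> c T x \<oplus>\<^bsub>FObj M' T\<^esub> \<gamma> c T y"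
    if c: "c \<in> iclasses" and T: "T \<in> Obj L" and x: "x \<in> eig M c T" and y: "y \<in> eig M c T" for c T x y
  proof -
    note r = mapM[OF T tO(2)[OF c T] res[OF c T]] and t = mapM'[OF tO(2)[OF c T] T tr[OF c T]]
    note rx = mapE[OF T tO(2)[OF c T] res[OF c T] x] and ry = mapE[OF T tO(2)[OF c T] res[OF c T] y]
    show ?thesis
      using lm_add[OF \<beta>_lm[OF c tO(1)[OF c T]]] rx ry eigenspaceD[OF x] eigenspaceD[OF y]
        eigenspaceD[OF b_in[OF c T x]] eigenspaceD[OF b_in[OF c T y]] tr_in[OF c T x] tr_in[OF c T y] rM'[OF T]
      by (simp add: \<gamma>_def lm_add[OF r] lm_add[OF t] rm_smult_add)
  qed
  have \<gamma>_smult: "\<gamma> c T (d \<odot>\<^bsub>FObj M T\<^esub> x) = d \<odot>\<^bsub>FObj M' T\<^esub> \<gamma> c T x"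
    if c: "c \<in> iclasses" and T: "T \<in> Obj L" and x: "x \<in> eig M c T" for c T x d
  proof -
    note r = mapM[OF T tO(2)[OF c T] res[OF c T]] and t = mapM'[OF tO(2)[OF c T] T tr[OF c T]]
    note rx = mapE[OF T tO(2)[OF c T] res[OF c T] x]
    show ?thesis
      using lm_smult[OF \<beta>_lm[OF c tO(1)[OF c T]]] rx eigenspaceD[OF x]
        eigenspaceD[OF b_in[OF c T x]] tr_in[OF c T x] rM'[OF T]
      by (simp add: \<gamma>_def lm_smult[OF r] lm_smult[OF t])
  qed
  \<comment> \<open>Each of the three ingredients is natural: restriction and transfer as maps
    between the identity and - x Y, and \<open>\<beta> c\<close> on the subcategory to which S x Y
    and T x Y belong.\<close>
  have \<gamma>_nat: "\<gamma> c T (FMap M S T f x) = FMap M' S T f (\<gamma> c S x)"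
    if c: "c \<in> iclasses" and S: "S \<in> Obj L" and T: "T \<in> Obj L" and f: "f \<in> Hom L S T" and x: "x \<in> eig M c S" for c S T f x
  proof -
    have Sf: "finite_gset G S" and Tf: "finite_gset G T" using S T by auto
    note xc = eigenspaceD[OF x, THEN conjunct1]
    have tf: "tenm (Y c) S T f \<in> Hom L (ten S (Y c)) (ten T (Y c))"
      using is_functor_map[OF is_functor_ten[OF Yf[OF c] Y(3)[OF c]] S T f] by simp
    note rx = mapE[OF S tO(2)[OF c S] res[OF c S] x]
    note bx = b_in[OF c S x, THEN eigenspaceD, THEN conjunct1]
    have "FMap M T (ten T (Y c)) (resY (Y c) T) (FMap M S T f x) =
        FMap M (ten S (Y c)) (ten T (Y c)) (tenm (Y c) S T f) (FMap M S (ten S (Y c)) (resY (Y c) S) x)"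
      using fv_Comp[OF F S T tO(2)[OF c T] f res[OF c T] xc] fv_Comp[OF F S tO(2)[OF c S] tO(2)[OF c T] res[OF c S] tf xc]
        resY_natural[OF Sf Tf Yf[OF c] f] by simp
    then have "\<beta> c (ten T (Y c)) (FMap M T (ten T (Y c)) (resY (Y c) T) (FMap M S T f x)) =
        FMap M' (ten S (Y c)) (ten T (Y c)) (tenm (Y c) S T f)
          (\<beta> c (ten S (Y c)) (FMap M S (ten S (Y c)) (resY (Y c) S) x))"
      using \<beta>_nat[OF c tO(1)[OF c S] tO(1)[OF c T] tf rx] by simp
    moreover have "FMap M' (ten T (Y c)) T (trY (Y c) T) (FMap M' (ten S (Y c)) (ten T (Y c)) (tenm (Y c) S T f)
          (\<beta> c (ten S (Y c)) (FMap M S (ten S (Y c)) (resY (Y c) S) x))) =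
        FMap M' S T f (FMap M' (ten S (Y c)) S (trY (Y c) S) (\<beta> c (ten S (Y c)) (FMap M S (ten S (Y c)) (resY (Y c) S) x)))"
      using fv_Comp[OF F' tO(2)[OF c S] tO(2)[OF c T] T tf tr[OF c T] bx]
        fv_Comp[OF F' tO(2)[OF c S] S T tr[OF c S] f bx] trY_natural[OF Sf Tf Y(1)[OF c] f] by simp
    ultimately show ?thesis
      unfolding \<gamma>_def using tr_in[OF c S x] by (simp add: lm_smult[OF mapM'[OF S T f]])
  qed
  \<comment> \<open>Over the subcategory \<open>\<beta> c\<close> commutes with the restriction to T
    x Y. What remains is transfer after restriction, the action of \<open>Y c\<close>, which is the
    scalar \<open>n c\<close> on the eigenfunctor of M'.\<close>
  have \<gamma>_eig: "\<gamma> c T x = \<beta> c T x" if c: "c \<in> iclasses" and T: "T \<in> Obj (Lc c)" and x: "x \<in> eig M c T" for c T x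
  proof -
    have TL: "T \<in> Obj L" and Tf: "finite_gset G T" using T by auto
    interpret E: class_mackey G \<O> rep X c "eigen_functor (Lc c) M' (aM M') (lam c)"
      by (rule class_mackey_class_Mackey[OF c eigen_functor_class[OF M' c]])
    note bx = \<beta>_eig[OF c T x] and bxc = eigenspaceD[OF \<beta>_eig[OF c T x], THEN conjunct1]
    have "\<beta> c (ten T (Y c)) (FMap M T (ten T (Y c)) (resY (Y c) T) x) = FMap M' T (ten T (Y c)) (resY (Y c) T) (\<beta> c T x)"
      using \<beta>_nat[OF c T tO(1)[OF c TL] res[OF c TL] x] .
    then have "\<gamma> c T x = (1 / n c) \<odot>\<^bsub>FObj M' T\<^esub> FMap M' T T (aop (Y c) T) (\<beta> c T x)"
      using fv_Comp[OF F' TL tO(2)[OF c TL] TL res[OF c TL] tr[OF c TL] bxc] aop_tr_res[OF Y(1)[OF c] Tf]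
      by (simp add: \<gamma>_def)
    also have "FMap M' T T (aop (Y c) T) (\<beta> c T x) = n c \<odot>\<^bsub>FObj M' T\<^esub> \<beta> c T x"
      using E.aop_scalar[OF Y(1)[OF c] T, of "\<beta> c T x"] T aop_Hom[OF Y(1)[OF c] Tf] bx by (simp add: n_def)
    finally show ?thesis
      using n[OF c] rM'[OF TL] bxc by simp
  qed
  have dec: "eigen_decomposition (FObj M T) (aM M T) iclasses lam" if "T \<in> Obj L" for T
    using M.eigen_decomposition_V[of T, unfolded LC] that by blast
  define ep where "ep T = eigen_decomposition.eproj (FObj M T) (aM M T) iclasses lam" for T
  have ep_in: "ep T x c \<in> eig M c T" if "T \<in> Obj L" "x \<in> carrier (FObj M T)" "c \<in> iclasses" for T x c
    unfolding ep_def using eigen_decomposition.eproj_in[OF dec[OF that(1)] that(2,3)] .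
  \<comment> \<open>The extended maps live on single eigenspaces; they are assembled by decomposing
    x into its eigencomponents.\<close>
  define \<alpha> where "\<alpha> = (\<lambda>T\<in>Obj L. \<lambda>x\<in>carrier (FObj M T). \<Oplus>\<^bsub>FObj M' T\<^esub>c\<in>iclasses. \<gamma> c T (ep T x c))"
  have g_in: "(\<lambda>c. \<gamma> c T (ep T x c)) \<in> iclasses \<rightarrow> carrier (FObj M' T)" if "T \<in> Obj L" "x \<in> carrier (FObj M T)" for T x
    using \<gamma>_in[OF _ that(1) ep_in[OF that]] by auto
  have "nat_trans L rat_vect M M' \<alpha>"
  proof (rule nat_rat_vectI)
    fix T assume T: "T \<in> Obj L"
    have "restrict (\<lambda>x. \<Oplus>\<^bsub>FObj M' T\<^esub>c\<in>iclasses. \<gamma> c T (ep T x c)) (carrier (FObj M T)) \<in> linear_maps (FObj M T) (FObj M' T)"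
    proof (rule linear_mapsI)
      show "(\<Oplus>\<^bsub>FObj M' T\<^esub>c\<in>iclasses. \<gamma> c T (ep T x c)) \<in> carrier (FObj M' T)" if "x \<in> carrier (FObj M T)" for x
        by (rule rm_finsum_closed[OF rM'[OF T] g_in[OF T that]])
      show "(\<Oplus>\<^bsub>FObj M' T\<^esub>c\<in>iclasses. \<gamma> c T (ep T (x \<oplus>\<^bsub>FObj M T\<^esub> y) c)) =
          (\<Oplus>\<^bsub>FObj M' T\<^esub>c\<in>iclasses. \<gamma> c T (ep T x c)) \<oplus>\<^bsub>FObj M' T\<^esub> (\<Oplus>\<^bsub>FObj M' T\<^esub>c\<in>iclasses. \<gamma> c T (ep T y c))"
        if xy: "x \<in> carrier (FObj M T)" "y \<in> carrier (FObj M T)" for x y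
      proof -
        have "\<gamma> c T (ep T (x \<oplus>\<^bsub>FObj M T\<^esub> y) c) = \<gamma> c T (ep T x c) \<oplus>\<^bsub>FObj M' T\<^esub> \<gamma> c T (ep T y c)" if c: "c \<in> iclasses" for c
          using eigen_decomposition.eproj_add[OF dec[OF T] xy c] \<gamma>_add[OF c T ep_in[OF T xy(1) c] ep_in[OF T xy(2) c]]
          by (simp add: ep_def)
        then have "(\<Oplus>\<^bsub>FObj M' T\<^esub>c\<in>iclasses. \<gamma> c T (ep T (x \<oplus>\<^bsub>FObj M T\<^esub> y) c)) =
            (\<Oplus>\<^bsub>FObj M' T\<^esub>c\<in>iclasses. \<gamma> c T (ep T x c) \<oplus>\<^bsub>FObj M' T\<^esub> \<gamma> c T (ep T y c))"
          using g_in[OF T xy(1)] g_in[OF T xy(2)] rM'[OF T]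
          by (intro rm_finsum_cong[OF rM'[OF T]]) (auto simp: Pi_iff)
        also have "\<dots> = (\<Oplus>\<^bsub>FObj M' T\<^esub>c\<in>iclasses. \<gamma> c T (ep T x c)) \<oplus>\<^bsub>FObj M' T\<^esub> (\<Oplus>\<^bsub>FObj M' T\<^esub>c\<in>iclasses. \<gamma> c T (ep T y c))"
          by (rule rm_finsum_add[OF rM'[OF T] g_in[OF T xy(1)] g_in[OF T xy(2)]])
        finally show ?thesis .
      qed
      show "(\<Oplus>\<^bsub>FObj M' T\<^esub>c\<in>iclasses. \<gamma> c T (ep T (d \<odot>\<^bsub>FObj M T\<^esub> x) c)) =
          d \<odot>\<^bsub>FObj M' T\<^esub> (\<Oplus>\<^bsub>FObj M' T\<^esub>c\<in>iclasses. \<gamma> c T (ep T x c))"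
        if x: "x \<in> carrier (FObj M T)" for x d
      proof -
        have "\<gamma> c T (ep T (d \<odot>\<^bsub>FObj M T\<^esub> x) c) = d \<odot>\<^bsub>FObj M' T\<^esub> \<gamma> c T (ep T x c)" if c: "c \<in> iclasses" for c
          using eigen_decomposition.eproj_smult[OF dec[OF T] x c] \<gamma>_smult[OF c T ep_in[OF T x c]]
          by (simp add: ep_def)
        then have "(\<Oplus>\<^bsub>FObj M' T\<^esub>c\<in>iclasses. \<gamma> c T (ep T (d \<odot>\<^bsub>FObj M T\<^esub> x) c)) =
            (\<Oplus>\<^bsub>FObj M' T\<^esub>c\<in>iclasses. d \<odot>\<^bsub>FObj M' T\<^esub> \<gamma> c T (ep T x c))"
          using g_in[OF T x] rM'[OF T] by (intro rm_finsum_cong[OF rM'[OF T]]) (auto simp: Pi_iff)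
        then show ?thesis
          using rm_finsum_smult[OF rM'[OF T] finite_classes g_in[OF T x]] by simp
      qed
    qed (rule rM[OF T])
    then show "\<alpha> T \<in> linear_maps (FObj M T) (FObj M' T)"
      using T by (simp add: \<alpha>_def)
  next
    fix S T f x assume S: "S \<in> Obj L" and T: "T \<in> Obj L" and f: "f \<in> Hom L S T" and x: "x \<in> carrier (FObj M S)"
    have fx: "FMap M S T f x \<in> carrier (FObj M T)" by (rule lm_closed[OF mapM[OF S T f] x])
    have "ep T (FMap M S T f x) c = FMap M S T f (ep S x c)" if c: "c \<in> iclasses" for c
      unfolding ep_def
      by (rule eproj_map[OF dec[OF S] dec[OF T] mapM[OF S T f] _ x c])
        (use nv_nat[OF aM_nat[OF M X] S T f] in simp)
    then have "\<gamma> c T (ep T (FMap M S T f x) c) = FMap M' S T f (\<gamma> c S (ep S x c))" if c: "c \<in> iclasses" for c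
      using \<gamma>_nat[OF c S T f ep_in[OF S x c]] c by simp
    then have "(\<Oplus>\<^bsub>FObj M' T\<^esub>c\<in>iclasses. \<gamma> c T (ep T (FMap M S T f x) c)) =
        (\<Oplus>\<^bsub>FObj M' T\<^esub>c\<in>iclasses. FMap M' S T f (\<gamma> c S (ep S x c)))"
      using g_in[OF S x] lm_closed[OF mapM'[OF S T f]] by (intro rm_finsum_cong[OF rM'[OF T]]) auto
    also have "\<dots> = FMap M' S T f (\<Oplus>\<^bsub>FObj M' S\<^esub>c\<in>iclasses. \<gamma> c S (ep S x c))"
      using lm_finsum[OF mapM'[OF S T f] rM'[OF S] rM'[OF T] finite_classes g_in[OF S x]] by simp
    finally show "\<alpha> T (FMap M S T f x) = FMap M' S T f (\<alpha> S x)"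
      using S T x fx by (simp add: \<alpha>_def)
  qed
  moreover have "SFmap M M' \<alpha> = \<beta>"
  proof (rule PiE_ext)
    show "\<beta> \<in> (\<Pi>\<^sub>E c\<in>iclasses. extensional (Obj (Lc c)))"
      using \<beta> \<beta>c(2) by (auto simp: product_category_simps PiE_def)
    show "SFmap M M' \<alpha> \<in> (\<Pi>\<^sub>E c\<in>iclasses. extensional (Obj (Lc c)))"
      by (auto simp: SFmap_def)
    fix c assume c: "c \<in> iclasses"
    show "SFmap M M' \<alpha> c = \<beta> c"
    proof (rule extensionalityI[OF _ \<beta>c(2)[OF c]])
      show "SFmap M M' \<alpha> c \<in> extensional (Obj (Lc c))" using c by (simp add: SFmap_def)
      fix T assume T: "T \<in> Obj (Lc c)"
      then have TL: "T \<in> Obj L" by simp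
      have "restrict (\<alpha> T) (eig M c T) = \<beta> c T"
      proof (rule extensionalityI[OF restrict_extensional])
        show "\<beta> c T \<in> extensional (eig M c T)" using lm_ext[OF \<beta>_lm[OF c T]] by simp
        fix x assume x: "x \<in> eig M c T"
        note xc = eigenspaceD[OF x, THEN conjunct1]
        \<comment> \<open>An eigenvector for c has no other components, and \<open>\<gamma>\<close>
          sends zero to zero by homogeneity with the factor 0.\<close>
        have "\<gamma> d T (ep T x d) = (if d = c then \<gamma> c T x else \<zero>\<^bsub>FObj M' T\<^esub>)" if d: "d \<in> iclasses" for d
        proof (cases "d = c")
          case False
          have "ep T x d = \<zero>\<^bsub>FObj M T\<^esub>"
            using eigen_decomposition.eproj_eigen[OF dec[OF TL] x c d] False by (simp add: ep_def)
          then show ?thesis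
            using \<gamma>_smult[OF d TL ep_in[OF TL xc d], of 0] \<gamma>_in[OF d TL ep_in[OF TL xc d]] rM[OF TL] rM'[OF TL] False by simp
        qed (use eigen_decomposition.eproj_eigen[OF dec[OF TL] x c d] in \<open>simp add: ep_def\<close>)
        then have "(\<Oplus>\<^bsub>FObj M' T\<^esub>d\<in>iclasses. \<gamma> d T (ep T x d)) = (\<Oplus>\<^bsub>FObj M' T\<^esub>d\<in>iclasses. if d = c then \<gamma> c T x else \<zero>\<^bsub>FObj M' T\<^esub>)"
          using \<gamma>_in[OF c TL x] rM'[OF TL] by (intro rm_finsum_cong[OF rM'[OF TL]]) auto
        also have "\<dots> = \<gamma> c T x"
          by (rule rm_finsum_single[OF rM'[OF TL] finite_classes c \<gamma>_in[OF c TL x]])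
        finally show "restrict (\<alpha> T) (eig M c T) x = \<beta> c T x"
          using x xc TL \<gamma>_eig[OF c T x] by (simp add: \<alpha>_def)
      qed
      then show "SFmap M M' \<alpha> c T = \<beta> c T" using c T by (simp add: SFmap_def)
    qed
  qed
  moreover have "\<alpha> \<in> extensional (Obj L)" by (simp add: \<alpha>_def)
  ultimately show ?thesis by (auto simp: O_Mackey_simps)
qed

end

lemma is_functor_comp:
  assumes F: "is_functor C D F" and K: "is_functor D E K"
  shows "is_functor C E (comp_functor K F)"
  unfolding is_functor_def comp_functor_def
  using is_functorD[OF F] is_functorD[OF K] by simp

context split
begin

text \<open>
  The extension of \<open>N\<close> to all finite \<open>G\<close>-sets takes \<open>T\<close> to the image of the idempotent
  \<open>(1 / n) res \<circ> tr\<close> on \<open>N (T \<times> Y)\<close>, where \<open>n\<close> is the scalar through which \<open>Y\<close> acts.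
\<close>

definition resTr :: "('a, nat) gset \<Rightarrow> ('a, nat) gset \<Rightarrow> 'a lindner_mor" where
  "resTr Y T = Comp L (ten T Y) T (ten T Y) (resY Y T) (trY Y T)"

definition ext_endo :: "('a, 'v) mackey_obj \<Rightarrow> ('a, nat) gset \<Rightarrow> 'a lindner_obj \<Rightarrow> 'v \<Rightarrow> 'v" where
  "ext_endo N Y T = FMap N (ten T Y) (ten T Y) (resTr Y T)"

text \<open>The image of the idempotent is written as the n-eigenspace of \<open>resTr\<close>, so
  that the facts on eigenspaces of natural endomorphisms give functoriality and product
  preservation.\<close>

definition ext_functor :: "('a, 'v) mackey_obj \<Rightarrow> ('a, nat) gset \<Rightarrow> rat \<Rightarrow> ('a, 'v) mackey_obj" where
  "ext_functor N Y n = eigen_functor L (comp_functor N (ten_functor Y)) (ext_endo N Y) n"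

end

section \<open>Extension of a class Mackey functor to all finite G-sets\<close>

locale extension = class_mackey G \<O> rep X c N
  for G :: "('a, 'b) monoid_scheme" (structure) and \<O> and rep X c and N :: "('a, 'v) mackey_obj" +
  fixes Y :: "('a, nat) gset"
  assumes Y: "adm_gset Y" and Y_pos: "mark G Y (rep c) > 0"
    and Y_sub: "y \<in> pts Y \<Longrightarrow> subconjugate G (stab Y y) (rep c)"
begin

definition n :: rat where "n = of_nat (mark G Y (rep c))"

lemma n_nonzero: "n \<noteq> 0"
  using Y_pos by (simp add: n_def)

lemma Yf: "finite_gset G Y"
  by (rule adm_gset_finite[OF Y])

lemma ten_C: "T \<in> Obj L \<Longrightarrow> ten T Y \<in> Obj C"
  using ten_Obj[OF Yf Y_sub] by simp

lemma ten_L: "T \<in> Obj L \<Longrightarrow> ten T Y \<in> Obj L"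
  using ten_C by simp

lemma L_category: "category L"
  by (rule category_lindner)

lemma homs:
  assumes "T \<in> Obj L"
  shows "resY Y T \<in> Hom L T (ten T Y)" "trY Y T \<in> Hom L (ten T Y) T" "resTr Y T \<in> Hom L (ten T Y) (ten T Y)"
proof -
  show r: "resY Y T \<in> Hom L T (ten T Y)" and t: "trY Y T \<in> Hom L (ten T Y) T"
    using assms resY_Hom[OF Yf] trY_Hom[OF Y] by simp_all
  show "resTr Y T \<in> Hom L (ten T Y) (ten T Y)"
    unfolding resTr_def using category.Comp_in_Hom[OF L_category ten_L[OF assms] assms ten_L[OF assms] t r] .
qed

lemma tenm_Hom: "\<lbrakk>S \<in> Obj L; T \<in> Obj L; f \<in> Hom L S T\<rbrakk> \<Longrightarrow> tenm Y S T f \<in> Hom L (ten S Y) (ten T Y)"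
  using is_functor_map[OF is_functor_ten[OF Yf Y_sub], of S T f] by simp

text \<open>Naturality of \<open>resTr\<close>, by moving the morphism first past the transfer and
  then past the restriction.\<close>

lemma tenm_resTr:
  assumes S: "S \<in> Obj L" and T: "T \<in> Obj L" and f: "f \<in> Hom L S T"
  shows "Comp L (ten S Y) (ten T Y) (ten T Y) (resTr Y T) (tenm Y S T f) =
    Comp L (ten S Y) (ten S Y) (ten T Y) (tenm Y S T f) (resTr Y S)"
proof -
  interpret K: category L by (rule L_category)
  have Sf: "finite_gset G S" and Tf: "finite_gset G T" using S T by auto
  note o = S T ten_L[OF S] ten_L[OF T] and h = homs[OF S] homs[OF T] tenm_Hom[OF S T f] f
  have "Comp L (ten S Y) (ten T Y) (ten T Y) (resTr Y T) (tenm Y S T f) =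
      Comp L (ten S Y) T (ten T Y) (resY Y T) (Comp L (ten S Y) (ten T Y) T (trY Y T) (tenm Y S T f))"
    unfolding resTr_def by (rule K.Comp_assoc[symmetric]) (rule o h)+
  also have "\<dots> = Comp L (ten S Y) T (ten T Y) (resY Y T) (Comp L (ten S Y) S T f (trY Y S))"
    by (simp add: trY_natural[OF Sf Tf Y f])
  also have "\<dots> = Comp L (ten S Y) S (ten T Y) (Comp L S T (ten T Y) (resY Y T) f) (trY Y S)"
    by (rule K.Comp_assoc) (rule o h)+
  also have "\<dots> = Comp L (ten S Y) S (ten T Y) (Comp L S (ten S Y) (ten T Y) (tenm Y S T f) (resY Y S)) (trY Y S)"
    by (simp add: resY_natural[OF Sf Tf Yf f])
  also have "\<dots> = Comp L (ten S Y) (ten S Y) (ten T Y) (tenm Y S T f) (resTr Y S)"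
    unfolding resTr_def by (rule K.Comp_assoc[symmetric]) (rule o h)+
  finally show ?thesis .
qed

abbreviation "\<Phi> \<equiv> comp_functor N (ten_functor Y)"

lemma \<Phi>_simps [simp]:
  "FObj \<Phi> T = FObj N (ten T Y)" "FMap \<Phi> S T f = FMap N (ten S Y) (ten T Y) (tenm Y S T f)"
  by (simp_all add: comp_functor_def)

lemma eigen_endo_\<Phi>: "eigen_endo L \<Phi> (ext_endo N Y)"
proof (rule eigen_endo.intro[OF L_category])
  show "is_functor L rat_vect \<Phi>"
    by (rule is_functor_comp[OF is_functor_ten[OF Yf Y_sub] F])
  show "nat_trans L rat_vect \<Phi> \<Phi> (ext_endo N Y)"
  proof (rule nat_rat_vectI)
    show "ext_endo N Y T \<in> linear_maps (FObj \<Phi> T) (FObj \<Phi> T)" if T: "T \<in> Obj L" for T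
      using map_lm[OF ten_C[OF T] ten_C[OF T] homs(3)[OF T]] by (simp add: ext_endo_def)
    fix S T f x assume S: "S \<in> Obj L" and T: "T \<in> Obj L" and f: "f \<in> Hom L S T" and "x \<in> carrier (FObj \<Phi> S)"
    then have x: "x \<in> carrier (V (ten S Y))" by simp
    note tf = tenm_Hom[OF S T f]
    show "ext_endo N Y T (FMap \<Phi> S T f x) = FMap \<Phi> S T f (ext_endo N Y S x)"
      using map_Comp[OF ten_C[OF S] ten_C[OF T] ten_C[OF T] tf homs(3)[OF T] x]
        map_Comp[OF ten_C[OF S] ten_C[OF S] ten_C[OF T] homs(3)[OF S] tf x] tenm_resTr[OF S T f]
      by (simp add: ext_endo_def)
  qed
qed

lemma ext_functor_props:
  shows "is_functor L rat_vect (ext_functor N Y n)" "extensional_functor L (ext_functor N Y n)"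
    and "is_terminal rat_vect (FObj (ext_functor N Y n) emptyg)"
    and "\<And>A B D i j. \<lbrakk>coprod_gset G A B D i j; A \<in> Obj L; B \<in> Obj L; D \<in> Obj L\<rbrakk> \<Longrightarrow>
      is_binary_product rat_vect (FObj (ext_functor N Y n) A) (FObj (ext_functor N Y n) B) (FObj (ext_functor N Y n) D)
        (FMap (ext_functor N Y n) D A (resm D A i)) (FMap (ext_functor N Y n) D B (resm D B j))"
proof -
  interpret E: eigen_endo L \<Phi> "ext_endo N Y" by (rule eigen_endo_\<Phi>)
  show "is_functor L rat_vect (ext_functor N Y n)" "extensional_functor L (ext_functor N Y n)"
    unfolding ext_functor_def by (rule E.is_functor_eigen, rule extensional_eigen_functor)
  have e: "(emptyg :: ('a, nat) gset) \<in> Obj L" by (simp add: finite_gset_emptyg)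
  have "pts (ten (emptyg :: ('a, nat) gset) Y) = {}" by auto
  then have "is_terminal rat_vect (FObj \<Phi> emptyg)"
    using V_pts_empty[OF ten_C[OF e]] ratmod_V[OF ten_C[OF e]] by (auto simp: is_terminal_rat_vect)
  then show "is_terminal rat_vect (FObj (ext_functor N Y n) emptyg)"
    unfolding ext_functor_def by (rule E.eigen_preserves_terminal[OF e])
  fix A B D i j assume c: "coprod_gset G A B D i j" and A: "A \<in> Obj L" and B: "B \<in> Obj L" and D: "D \<in> Obj L"
  note cD = coprodD[OF c]
  have "is_binary_product C (ten A Y) (ten B Y) (ten D Y) (resm (ten D Y) (ten A Y) (tmap i)) (resm (ten D Y) (ten B Y) (tmap j))"
    by (rule binary_product_coprod[OF coprod_ten[OF c Yf] ten_C[OF D]])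
  then have "is_binary_product rat_vect (FObj \<Phi> A) (FObj \<Phi> B) (FObj \<Phi> D) (FMap \<Phi> D A (resm D A i)) (FMap \<Phi> D B (resm D B j))"
    using PP unfolding product_preserving_def
    by (simp add: tenm_res[OF cD(1,4) Yf] tenm_res[OF cD(2,5) Yf])
  then show "is_binary_product rat_vect (FObj (ext_functor N Y n) A) (FObj (ext_functor N Y n) B) (FObj (ext_functor N Y n) D)
        (FMap (ext_functor N Y n) D A (resm D A i)) (FMap (ext_functor N Y n) D B (resm D B j))"
    unfolding ext_functor_def
    by (rule E.eigen_preserves_product[OF A B D resm_Hom[OF cD(1,4)] resm_Hom[OF cD(2,5)]])
qed

lemma ext_carrier:
  assumes "T \<in> Obj L"
  shows "x \<in> carrier (FObj (ext_functor N Y n) T) \<longleftrightarrow> x \<in> carrier (V (ten T Y)) \<and>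
    FMap N (ten T Y) (ten T Y) (resTr Y T) x = n \<odot>\<^bsub>V (ten T Y)\<^esub> x"
  using assms by (simp add: ext_functor_def eigenspace_def ext_endo_def)

lemma ext_simps:
  assumes "T \<in> Obj L"
  shows "add (FObj (ext_functor N Y n) T) = add (V (ten T Y))" "zero (FObj (ext_functor N Y n) T) = zero (V (ten T Y))"
    "smult (FObj (ext_functor N Y n) T) = smult (V (ten T Y))"
  using assms by (simp_all add: ext_functor_def)

lemma ext_map:
  assumes "S \<in> Obj L" "T \<in> Obj L" "f \<in> Hom L S T" "x \<in> carrier (FObj (ext_functor N Y n) S)"
  shows "FMap (ext_functor N Y n) S T f x = FMap N (ten S Y) (ten T Y) (tenm Y S T f) x"
  using assms by (simp add: ext_functor_def)

text \<open>By \<open>tenm_aop\<close> X acts on the extension at T as it acts on N at T x Y, an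
  object of the subcategory, where it is the scalar \<open>lam c\<close>. Extensions for different
  classes are thus told apart by X.\<close>

lemma ext_aop:
  assumes T: "T \<in> Obj L" and x: "x \<in> carrier (FObj (ext_functor N Y n) T)"
  shows "FMap (ext_functor N Y n) T T (aop X T) x = lam c \<odot>\<^bsub>V (ten T Y)\<^esub> x"
proof -
  have Tf: "finite_gset G T" using T by simp
  have "x \<in> carrier (V (ten T Y))" using x ext_carrier[OF T] by blast
  then show ?thesis
    using ext_map[OF T T aop_Hom[OF X Tf] x] aop_scalar[OF X ten_C[OF T]] tenm_aop[OF Tf X Yf]
    by (simp add: lam_def)
qed

text \<open>The transfer along T x Y -> T. Over the subcategory it compares the extension with N
  itself.\<close>

definition counit :: "'a lindner_obj \<Rightarrow> 'v \<Rightarrow> 'v" where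
  "counit T = FMap N (ten T Y) T (trY Y T)"

text \<open>Over the subcategory transfer after restriction is the scalar n, while on the extension
  restriction after transfer is n by construction. So the transfer is bijective there, with inverse
  the restriction divided by n.\<close>

lemma counit:
  assumes T: "T \<in> Obj C"
  shows counit_lm: "counit T \<in> linear_maps (V (ten T Y)) (V T)"
    and counit_inj: "\<lbrakk>x \<in> carrier (FObj (ext_functor N Y n) T); counit T x = \<zero>\<^bsub>V T\<^esub>\<rbrakk> \<Longrightarrow> x = \<zero>\<^bsub>V (ten T Y)\<^esub>"
    and counit_surj: "y \<in> carrier (V T) \<Longrightarrow> \<exists>x\<in>carrier (FObj (ext_functor N Y n) T). counit T x = y"
proof -
  have TL: "T \<in> Obj L" and Tf: "finite_gset G T" using T by auto
  note tC = ten_C[OF TL] and h = homs[OF TL]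
  note r = map_lm[OF T tC h(1)]
  show t: "counit T \<in> linear_maps (V (ten T Y)) (V T)"
    unfolding counit_def by (rule map_lm[OF tC T h(2)])
  show "x = \<zero>\<^bsub>V (ten T Y)\<^esub>" if x: "x \<in> carrier (FObj (ext_functor N Y n) T)" and 0: "counit T x = \<zero>\<^bsub>V T\<^esub>"
  proof (rule rm_smult_cancel[OF ratmod_V[OF tC] _ _ n_nonzero])
    have xc: "x \<in> carrier (V (ten T Y))" "FMap N (ten T Y) (ten T Y) (resTr Y T) x = n \<odot>\<^bsub>V (ten T Y)\<^esub> x"
      using x ext_carrier[OF TL] by auto
    show "x \<in> carrier (V (ten T Y))" by (rule xc(1))
    have "n \<odot>\<^bsub>V (ten T Y)\<^esub> x = FMap N T (ten T Y) (resY Y T) (counit T x)"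
      using map_Comp[OF tC T tC h(2,1) xc(1)] xc(2) by (simp add: resTr_def counit_def)
    then show "n \<odot>\<^bsub>V (ten T Y)\<^esub> x = 0 \<odot>\<^bsub>V (ten T Y)\<^esub> x"
      using 0 lm_zero[OF r ratmod_V[OF T] ratmod_V[OF tC]] ratmod_V[OF tC] xc(1) by simp
  qed
  show "\<exists>x\<in>carrier (FObj (ext_functor N Y n) T). counit T x = y" if y: "y \<in> carrier (V T)"
  proof -
    let ?r = "FMap N T (ten T Y) (resY Y T) y"
    have rc: "?r \<in> carrier (V (ten T Y))" by (rule lm_closed[OF r y])
    have tr: "counit T ?r = n \<odot>\<^bsub>V T\<^esub> y"
      using map_Comp[OF T tC T h(1,2) y] aop_tr_res[OF Y Tf] aop_scalar[OF Y T y] by (simp add: counit_def n_def)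
    have "FMap N (ten T Y) (ten T Y) (resTr Y T) ?r = n \<odot>\<^bsub>V (ten T Y)\<^esub> ?r"
      using map_Comp[OF tC T tC h(2,1) rc] tr lm_smult[OF r y] by (simp add: resTr_def counit_def)
    then have "(1 / n) \<odot>\<^bsub>V (ten T Y)\<^esub> ?r \<in> carrier (FObj (ext_functor N Y n) T)"
      unfolding ext_carrier[OF TL] using ratmod_V[OF tC] rc lm_smult[OF map_lm[OF tC tC h(3)] rc] by simp
    moreover have "counit T ((1 / n) \<odot>\<^bsub>V (ten T Y)\<^esub> ?r) = y"
      using lm_smult[OF t rc] tr ratmod_V[OF T] y n_nonzero by simp
    ultimately show ?thesis by blast
  qed
qed

lemma counit_natural:
  assumes S: "S \<in> Obj C" and T: "T \<in> Obj C" and f: "f \<in> Hom L S T" and x: "x \<in> carrier (V (ten S Y))"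
  shows "counit T (FMap N (ten S Y) (ten T Y) (tenm Y S T f) x) = FMap N S T f (counit S x)"
proof -
  have SL: "S \<in> Obj L" "finite_gset G S" and TL: "T \<in> Obj L" "finite_gset G T" using S T by auto
  show ?thesis
    using map_Comp[OF ten_C[OF SL(1)] ten_C[OF TL(1)] T tenm_Hom[OF SL(1) TL(1) f] homs(2)[OF TL(1)] x]
      map_Comp[OF ten_C[OF SL(1)] S T homs(2)[OF SL(1)] f x] trY_natural[OF SL(2) TL(2) Y f]
    by (simp add: counit_def)
qed

end

section \<open>Essential surjectivity and the equivalence\<close>

context split
begin

text \<open>M is the direct sum of the extensions of the N c. As X acts on the summand of c by
  \<open>lam c\<close> and these scalars differ, the eigenspace of c is precisely that summand, and
  over the subcategory of c the transfer identifies it with N c.\<close>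

lemma SF_ess_surj:
  assumes N: "N \<in> Obj (product_category iclasses (\<lambda>c. class_Mackey G \<O> (rep c) :: ('a, 'v) mackey_cat))"
  shows "\<exists>M\<in>Obj (O_Mackey G \<O>). \<exists>f.
    iso_in (product_category iclasses (\<lambda>c. class_Mackey G \<O> (rep c))) (SF M) N f"
proof -
  obtain Y where Y: "\<And>c. c \<in> iclasses \<Longrightarrow> adm_gset (Y c)"
    "\<And>c. c \<in> iclasses \<Longrightarrow> mark G (Y c) (rep c) > 0"
    "\<And>c y. \<lbrakk>c \<in> iclasses; y \<in> pts (Y c)\<rbrakk> \<Longrightarrow> subconjugate G (stab (Y c) y) (rep c)"
    by (rule obtain_orbits) blast
  have Nc: "N c \<in> Obj (class_Mackey G \<O> (rep c))" if "c \<in> iclasses" for c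
    using N that by (auto simp: product_category_simps)
  have ext: "extension G \<O> rep X c (N c) (Y c)" if c: "c \<in> iclasses" for c
    by (rule extension.intro[OF class_mackey_class_Mackey[OF c Nc[OF c]]]) (unfold_locales, use Y[OF c] in auto)
  \<comment> \<open>The scalar is spelled out because the defining equation of the locale constant
    \<open>n\<close> is available only for actual classes; \<open>E_def'\<close> converts.\<close>
  define E where "E c = ext_functor (N c) (Y c) (of_nat (mark G (Y c) (rep c)))" for c
  have E_def': "E c = ext_functor (N c) (Y c) (extension.n G rep c (Y c))" if c: "c \<in> iclasses" for c
    unfolding E_def extension.n_def[OF ext[OF c]] ..
  have E_props: "is_functor L rat_vect (E c)" "extensional_functor L (E c)"
    "is_terminal rat_vect (FObj (E c) emptyg)"
    "\<And>A B D i j. \<lbrakk>coprod_gset G A B D i j; A \<in> Obj L; B \<in> Obj L; D \<in> Obj L\<rbrakk> \<Longrightarrow>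
      is_binary_product rat_vect (FObj (E c) A) (FObj (E c) B) (FObj (E c) D)
        (FMap (E c) D A (resm D A i)) (FMap (E c) D B (resm D B j))" if c: "c \<in> iclasses" for c
    unfolding E_def'[OF c] by (rule extension.ext_functor_props[OF ext[OF c]]; assumption)+
  \<comment> \<open>For every T an encoding of families of vectors inside the universe, so that the
    direct sum is again an object.\<close>
  have "\<exists>j :: ('a set set \<Rightarrow> 'v) \<Rightarrow> 'v. inj_on j (\<Pi>\<^sub>E c\<in>iclasses. carrier (FObj (E c) T))" if "T \<in> Obj L" for T
    by (rule inj_on_PiE_ratmod[OF finite_classes]) (rule fv_ratmod[OF E_props(1) that])
  then obtain j :: "'a lindner_obj \<Rightarrow> ('a set set \<Rightarrow> 'v) \<Rightarrow> 'v"
    where j: "\<And>T. T \<in> Obj L \<Longrightarrow> inj_on (j T) (\<Pi>\<^sub>E c\<in>iclasses. carrier (FObj (E c) T))"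
    by metis
  interpret S: functor_sum L iclasses E j
    by (rule functor_sum.intro[OF category_lindner E_props(1) j])
  define M where "M = dsum_functor L iclasses E j"
  have MF: "is_functor L rat_vect M" unfolding M_def by (rule S.is_functor_dsum)
  have "product_preserving L rat_vect M"
  proof (rule product_preserving_standard[of "carrier G" M, unfolded lindner_sub_carrier])
    show "is_functor L rat_vect M" by (rule MF)
    show "is_terminal rat_vect (FObj M emptyg)"
      unfolding M_def by (rule S.dsum_preserves_terminal[OF _ E_props(3)]) (simp add: finite_gset_emptyg)
    fix A B D i j' assume c: "coprod_gset G A B D i j'" and A: "A \<in> Obj L" and B: "B \<in> Obj L" and D: "D \<in> Obj L"
    note cD = coprodD[OF c]
    show "is_binary_product rat_vect (FObj M A) (FObj M B) (FObj M D) (FMap M D A (resm D A i)) (FMap M D B (resm D B j'))"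
      unfolding M_def
      by (rule S.dsum_preserves_product[OF A B D resm_Hom[OF cD(1,4)] resm_Hom[OF cD(2,5)] E_props(4)[OF _ c A B D]])
  qed
  then have M: "M \<in> Obj (O_Mackey G \<O>)"
    using MF extensional_dsum_functor by (simp add: O_Mackey_simps M_def)
  interpret MM: split_mackey G \<O> rep X "carrier G" M by (rule split_mackey_O_Mackey[OF M])
  define k where "k T = dcomp iclasses (\<lambda>c. FObj (E c) T) (j T)" for T
  have MD: "FObj M T = dsum iclasses (\<lambda>c. FObj (E c) T) (j T)" if "T \<in> Obj L" for T
    unfolding M_def using that by simp
  have kc: "k T x c \<in> carrier (FObj (E c) T)" if "T \<in> Obj L" "x \<in> carrier (FObj M T)" "c \<in> iclasses" for T x c
    using direct_sum.k_carrier[OF S.direct_sum_at[OF that(1)]] that MD[OF that(1)] by (simp add: k_def)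
  have kmap: "k T (FMap M S T f x) c = FMap (E c) S T f (k S x c)"
    if "S \<in> Obj L" "T \<in> Obj L" "f \<in> Hom L S T" "x \<in> carrier (FObj M S)" "c \<in> iclasses" for S T f x c
    using S.comp_map[OF that[unfolded M_def]] by (simp add: k_def M_def)
  have keq: "x = y" if "T \<in> Obj L" "x \<in> carrier (FObj M T)" "y \<in> carrier (FObj M T)"
    "\<And>c. c \<in> iclasses \<Longrightarrow> k T x c = k T y c" for T x y
    using S.eqI[OF that(1), of x y] that(2-4) by (simp add: k_def M_def)
  have ksimps: "k T (x \<oplus>\<^bsub>FObj M T\<^esub> y) c = k T x c \<oplus>\<^bsub>FObj (E c) T\<^esub> k T y c"
    "k T (r \<odot>\<^bsub>FObj M T\<^esub> x) c = r \<odot>\<^bsub>FObj (E c) T\<^esub> k T x c" "k T \<zero>\<^bsub>FObj M T\<^esub> c = \<zero>\<^bsub>FObj (E c) T\<^esub>"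
    if "T \<in> Obj L" "x \<in> carrier (FObj M T)" "y \<in> carrier (FObj M T)" "c \<in> iclasses" for T x y c r
    using direct_sum.k_simps[OF S.direct_sum_at[OF that(1)] that(4)] that(2,3) unfolding MD[OF that(1)] k_def by auto
  have "iso_in (class_Mackey G \<O> (rep c)) (SF M c) (N c)
      (restrict (\<lambda>T. \<lambda>z\<in>eig M c T. FMap (N c) (ten T (Y c)) T (trY (Y c) T) (k T z c)) (Obj (Lc c)))"
    if c: "c \<in> iclasses" for c
  proof -
    interpret X: extension G \<O> rep X c "N c" "Y c" by (rule ext[OF c])
    let ?E = "ext_functor (N c) (Y c) X.n" and ?F = "eigen_functor (Lc c) M (aM M) (lam c)"
    let ?\<delta> = "\<lambda>T. \<lambda>z\<in>eig M c T. FMap (N c) (ten T (Y c)) T (trY (Y c) T) (k T z c)"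
    have Ec: "E c = ?E" by (rule E_def'[OF c])
    interpret EE: eigen_endo "Lc c" M "aM M" by (rule eigen_endo_c[OF M])
    \<comment> \<open>The operator of X on the sum acts on each component by the scalar of that
      component's class.\<close>
    have aM_k: "k T (aM M T z) d = lam d \<odot>\<^bsub>FObj (E d) T\<^esub> k T z d"
      if T: "T \<in> Obj L" and z: "z \<in> carrier (FObj M T)" and d: "d \<in> iclasses" for T z d
    proof -
      interpret D: extension G \<O> rep X d "N d" "Y d" by (rule ext[OF d])
      have "aop X T \<in> Hom L T T" using aop_Hom[OF X] T by simp
      then show ?thesis
        using kmap[OF T T _ z d] D.ext_aop[OF T, of "k T z d"] kc[OF T z d] D.ext_simps(3)[OF T] E_def'[OF d] by simp
    qed
    \<comment> \<open>An eigenvector for c has its component at d scaled both by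
      \<open>lam c\<close> and by \<open>lam d\<close>, hence zero.\<close>
    have k0: "k T z d = \<zero>\<^bsub>FObj (E d) T\<^esub>" if T: "T \<in> Obj L" and z: "z \<in> eig M c T" and d: "d \<in> iclasses" "d \<noteq> c" for T z d
    proof -
      have zc: "z \<in> carrier (FObj M T)" "aM M T z = lam c \<odot>\<^bsub>FObj M T\<^esub> z" using z by (auto dest: eigenspaceD)
      have "lam d \<odot>\<^bsub>FObj (E d) T\<^esub> k T z d = lam c \<odot>\<^bsub>FObj (E d) T\<^esub> k T z d"
        using aM_k[OF T zc(1) d(1)] zc(2) ksimps(2)[OF T zc(1) zc(1) d(1)] by simp
      moreover have "lam d \<noteq> lam c" using inj_onD[OF inj_lam _ d(1) c] d(2) by blast
      ultimately show ?thesis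
        by (rule rm_smult_cancel[OF fv_ratmod[OF E_props(1)[OF d(1)] T] kc[OF T zc(1) d(1)]])
    qed
    have kE: "k T z c \<in> carrier (FObj ?E T)" "k T z c \<in> carrier (X.V (ten T (Y c)))"
      if "T \<in> Obj L" "z \<in> eig M c T" for T z
      using kc[OF that(1) _ c, of z] eigenspaceD[OF that(2)] X.ext_carrier[OF that(1)] Ec by auto
    have eiff: "z \<in> carrier (FObj ?F T) \<longleftrightarrow> z \<in> eig M c T" if "T \<in> Obj (Lc c)" for T z
      using that by simp
    have F: "is_functor (Lc c) rat_vect ?F" by (rule EE.is_functor_eigen)
    have lm: "?\<delta> T \<in> linear_maps (FObj ?F T) (X.V T)" if T: "T \<in> Obj (Lc c)" for T
    proof -
      have TL: "T \<in> Obj L" using T by simp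
      note cl = X.counit_lm[OF T, unfolded X.counit_def]
      have "restrict (\<lambda>z. FMap (N c) (ten T (Y c)) T (trY (Y c) T) (k T z c)) (carrier (FObj ?F T))
          \<in> linear_maps (FObj ?F T) (X.V T)"
      proof (rule linear_mapsI)
        fix z w assume zw: "z \<in> carrier (FObj ?F T)" "w \<in> carrier (FObj ?F T)"
        then have zw': "z \<in> eig M c T" "w \<in> eig M c T" using T by simp_all
        then have "z \<in> carrier (FObj M T)" "w \<in> carrier (FObj M T)" by (auto dest: eigenspaceD)
        then show "FMap (N c) (ten T (Y c)) T (trY (Y c) T) (k T (z \<oplus>\<^bsub>FObj ?F T\<^esub> w) c) =
            FMap (N c) (ten T (Y c)) T (trY (Y c) T) (k T z c) \<oplus>\<^bsub>X.V T\<^esub> FMap (N c) (ten T (Y c)) T (trY (Y c) T) (k T w c)"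
          using ksimps(1)[OF TL _ _ c, of z w] T X.ext_simps(1)[OF TL] Ec lm_add[OF cl kE(2)[OF TL zw'(1)] kE(2)[OF TL zw'(2)]]
          by simp
      next
        fix z r assume z: "z \<in> carrier (FObj ?F T)"
        then have z': "z \<in> eig M c T" using T by simp
        then have "z \<in> carrier (FObj M T)" by (auto dest: eigenspaceD)
        then show "FMap (N c) (ten T (Y c)) T (trY (Y c) T) (k T (r \<odot>\<^bsub>FObj ?F T\<^esub> z) c) =
            r \<odot>\<^bsub>X.V T\<^esub> FMap (N c) (ten T (Y c)) T (trY (Y c) T) (k T z c)"
          using ksimps(2)[OF TL _ _ c, of z z r] T X.ext_simps(3)[OF TL] Ec lm_smult[OF cl kE(2)[OF TL z']] by simp
      next
        show "FMap (N c) (ten T (Y c)) T (trY (Y c) T) (k T z c) \<in> carrier (X.V T)" if "z \<in> carrier (FObj ?F T)" for z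
          using lm_closed[OF cl kE(2)[OF TL]] that T by simp
      qed (rule fv_ratmod[OF F T])
      then show ?thesis using T by simp
    qed
    have nat: "nat_trans (Lc c) rat_vect ?F (N c) ?\<delta>"
    proof (rule nat_rat_vectI)
      fix S T f z assume S: "S \<in> Obj (Lc c)" and T: "T \<in> Obj (Lc c)" and f: "f \<in> Hom (Lc c) S T"
        and z: "z \<in> carrier (FObj ?F S)"
      then have z': "z \<in> eig M c S" and SL: "S \<in> Obj L" and TL: "T \<in> Obj L" and f': "f \<in> Hom L S T" by simp_all
      have zc: "z \<in> carrier (FObj M S)" using z' by (auto dest: eigenspaceD)
      have "k T (FMap M S T f z) c = FMap (N c) (ten S (Y c)) (ten T (Y c)) (tenm (Y c) S T f) (k S z c)"
        using kmap[OF SL TL f' zc c] X.ext_map[OF SL TL f' kE(1)[OF SL z']] Ec by simp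
      then show "?\<delta> T (FMap ?F S T f z) = FMap (N c) S T f (?\<delta> S z)"
        using S T f z' EE.map_eigenspace[OF S T f z'] X.counit_natural[OF S T f' kE(2)[OF SL z']]
        by (simp add: X.counit_def)
    qed (rule lm)
    have "iso_in rat_vect (FObj ?F T) (X.V T) (?\<delta> T)" if T: "T \<in> Obj (Lc c)" for T
    proof (rule iso_in_rat_vect[OF fv_ratmod[OF F T] X.ratmod_V[OF T] lm[OF T]])
      have TL: "T \<in> Obj L" using T by simp
      note rM = fv_ratmod[OF MF TL] and lmT = lm[OF T] and rF = fv_ratmod[OF F T]
      have \<delta>: "?\<delta> T z = X.counit T (k T z c)" if "z \<in> eig M c T" for z
        using that by (simp add: X.counit_def)
      \<comment> \<open>The component at c vanishes because the transfer is injective on the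
        extension, the remaining ones by \<open>k0\<close>.\<close>
      have ker: "z = \<zero>\<^bsub>FObj M T\<^esub>" if z: "z \<in> eig M c T" and 0: "?\<delta> T z = \<zero>\<^bsub>X.V T\<^esub>" for z
      proof (rule keq[OF TL])
        show "z \<in> carrier (FObj M T)" using z by (auto dest: eigenspaceD)
        show "\<zero>\<^bsub>FObj M T\<^esub> \<in> carrier (FObj M T)" using rM by simp
        fix d assume d: "d \<in> iclasses"
        have zero: "k T \<zero>\<^bsub>FObj M T\<^esub> d = \<zero>\<^bsub>FObj (E d) T\<^esub>"
          using ksimps(3)[OF TL rm_zero[OF rM] rm_zero[OF rM] d] .
        show "k T z d = k T \<zero>\<^bsub>FObj M T\<^esub> d"
        proof (cases "d = c")
          case True
          then show ?thesis
            using X.counit_inj[OF T kE(1)[OF TL z]] 0 \<delta>[OF z] zero Ec X.ext_simps(2)[OF TL] by simp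
        qed (use k0[OF TL z d] zero in simp)
      qed
      have inj: "inj_on (?\<delta> T) (carrier (FObj ?F T))"
      proof (rule inj_onI)
        fix z w assume z: "z \<in> carrier (FObj ?F T)" and w: "w \<in> carrier (FObj ?F T)" and eq: "?\<delta> T z = ?\<delta> T w"
        show "z = w"
        proof (rule rm_diff_eq_zero[OF rF z w])
          let ?u = "z \<oplus>\<^bsub>FObj ?F T\<^esub> (-1) \<odot>\<^bsub>FObj ?F T\<^esub> w"
          have u: "?u \<in> carrier (FObj ?F T)" using rF z w by simp
          have "?\<delta> T ?u = \<zero>\<^bsub>X.V T\<^esub>"
            using lm_add[OF lmT z rm_smult[OF rF w]] lm_smult[OF lmT w] eq rm_neg[OF X.ratmod_V[OF T] lm_closed[OF lmT w]]
            by metis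
          then have "?u = \<zero>\<^bsub>FObj M T\<^esub>" using ker[of ?u] u eiff[OF T] by blast
          then show "?u = \<zero>\<^bsub>FObj ?F T\<^esub>" using T by simp
        qed
      qed
      have surj: "\<exists>z\<in>carrier (FObj ?F T). ?\<delta> T z = y" if y: "y \<in> carrier (X.V T)" for y
      proof -
        obtain x where x: "x \<in> carrier (FObj ?E T)" "X.counit T x = y" using X.counit_surj[OF T y] by blast
        \<comment> \<open>The family concentrated in c; its encoding is an eigenvector for
          \<open>lam c\<close> that the comparison map sends to y.\<close>
        define s where "s d = (if d = c then x else \<zero>\<^bsub>FObj (E d) T\<^esub>)" for d
        have s: "s d \<in> carrier (FObj (E d) T)" if "d \<in> iclasses" for d
          using x(1) Ec fv_ratmod[OF E_props(1)[OF that] TL] by (simp add: s_def)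
        define z where "z = j T (restrict s iclasses)"
        have z: "z \<in> carrier (FObj M T)"
          unfolding z_def MD[OF TL] by (rule direct_sum.j_carrier[OF S.direct_sum_at[OF TL] s])
        have kz: "k T z d = s d" if "d \<in> iclasses" for d
          unfolding z_def k_def using direct_sum.k_restrict[OF S.direct_sum_at[OF TL], of s d] s that by blast
        have "aM M T z = lam c \<odot>\<^bsub>FObj M T\<^esub> z"
        proof (rule keq[OF TL])
          show "aM M T z \<in> carrier (FObj M T)" using lm_closed[OF nv_lm[OF aM_nat[OF M X] TL] z] .
          show "lam c \<odot>\<^bsub>FObj M T\<^esub> z \<in> carrier (FObj M T)" using rM z by simp
          fix d assume d: "d \<in> iclasses"
          show "k T (aM M T z) d = k T (lam c \<odot>\<^bsub>FObj M T\<^esub> z) d"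
            using aM_k[OF TL z d] ksimps(2)[OF TL z z d, of "lam c"] kz[OF d] fv_ratmod[OF E_props(1)[OF d] TL]
            by (cases "d = c") (simp_all add: s_def)
        qed
        then have ze: "z \<in> eig M c T" using z by (simp add: eigenspace_def)
        have "?\<delta> T z = y" using \<delta>[OF ze] kz[OF c] x(2) by (simp add: s_def)
        then show ?thesis using ze eiff[OF T] by blast
      qed
      show "bij_betw (?\<delta> T) (carrier (FObj ?F T)) (carrier (X.V T))"
        unfolding bij_betw_def using inj surj lm_closed[OF lmT] by blast
    qed
    from iso_in_functor_category[OF category_rat_vect F X.F nat this] show ?thesis
      using c unfolding SF_def by (simp add: iso_in_def class_Mackey_def del: functor_category_simps)
  qed
  then have "iso_in (product_category iclasses (\<lambda>c. class_Mackey G \<O> (rep c))) (SF M) N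
      (\<lambda>c\<in>iclasses. \<lambda>T\<in>Obj (Lc c). \<lambda>z\<in>eig M c T. FMap (N c) (ten T (Y c)) T (trY (Y c) T) (k T z c))"
    by (rule iso_in_product_category)
  then show ?thesis by (intro bexI[OF _ M] exI)
qed

lemma equivalent:
  "equivalent_categories (O_Mackey G \<O> :: ('a, 'v) mackey_cat)
    (product_category iclasses (\<lambda>c. class_Mackey G \<O> (rep c) :: ('a, 'v) mackey_cat))"
proof (rule equivalent_categoriesI[OF category_O_Mackey category_product_category[OF category_class_Mackey] is_functor_split])
  fix M M' :: "('a, 'v) mackey_obj" assume M: "M \<in> Obj (O_Mackey G \<O>)" and M': "M' \<in> Obj (O_Mackey G \<O>)"
  show "bij_betw (FMap split_functor M M') (Hom (O_Mackey G \<O>) M M')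
      (Hom (product_category iclasses (\<lambda>c. class_Mackey G \<O> (rep c))) (FObj split_functor M) (FObj split_functor M'))"
    unfolding bij_betw_def split_functor_def cfunctor.simps
    using SFmap_inj[OF M M'] SFmap_Hom[OF M M'] SFmap_surj[OF M M'] by blast
next
  fix N :: "'a set set \<Rightarrow> ('a, 'v) mackey_obj"
  assume "N \<in> Obj (product_category iclasses (\<lambda>c. class_Mackey G \<O> (rep c)))"
  then show "\<exists>M\<in>Obj (O_Mackey G \<O>). \<exists>f. iso_in (product_category iclasses (\<lambda>c. class_Mackey G \<O> (rep c)))
      (FObj split_functor M) N f"
    using SF_ess_surj by (simp add: split_functor_def)
qed

end

theorem theorem6p5:
  fixes G :: "('a, 'b) monoid_scheme"
    and \<O> :: "('a set \<times> 'a set) set"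
    and rep :: "'a set set \<Rightarrow> 'a set"
  assumes "group G" and "finite (carrier G)"
    and "transfer_system G \<O>"
    and "\<And>c. c \<in> insep_classes G \<O> \<Longrightarrow> rep c \<in> c \<and> (rep c, carrier G) \<in> \<O>"
  shows "equivalent_categories
    (O_Mackey G \<O> :: ('a, 'v) mackey_cat)
    (product_category (insep_classes G \<O>)
      (\<lambda>c. class_Mackey G \<O> (rep c) :: ('a, 'v) mackey_cat))"
proof -
  interpret transfer G \<O>
    using assms(1-3) by (simp add: transfer_def transfer_axioms_def)
  \<comment> \<open>Any separating set will do; it serves to construct the splitting functor and
    leaves no trace in the two categories compared.\<close>
  obtain X where X: "adm_gset X" "\<And>K L. \<lbrakk>K \<in> Sub_O G \<O>; L \<in> Sub_O G \<O>; mark G X K = mark G X L\<rbrakk>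
    \<Longrightarrow> \<exists>g\<in>carrier G. conjugate_set G g K = L"
    by (rule obtain_separating_gset) blast
  interpret split G \<O> rep X
    by unfold_locales (use assms(4) X in blast)+
  show ?thesis by (rule equivalent)
qed

end
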